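(* Assume that the constant term of $\chi(x,y)$ is nonzero. If $\chi(x,y)$ is sufficiently general within its Newton polygon $P$, then the genus of the Riemann surface $S$ associated to $\chi(x,y)=0$ is the integer $$\begin{aligned}\gamma=\ &n_1\mu_1\Big(\frac{n_1m_1-1}{2}\Big)+n_2\mu_2\Big(n_1m_1+\frac{n_2m_2-1}{2}\Big)+\cdots\\ &+n_\varepsilon\mu_\varepsilon\Big(n_1m_1+\cdots+n_{\varepsilon-1}m_{\varepsilon-1}+\frac{n_\varepsilon m_\varepsilon-1}{2}\Big)-\frac{n_1(m_1+1)}{2}-\cdots-\frac{n_\varepsilon(m_\varepsilon+1)}{2}+1,\end{aligned}$$ and $S$ can be identified with the smooth projective curve in $X_P$ defined by $\chi(x,y)=0$.
   Context: $\chi(x,y)$ is a polynomial with complex coefficients, monic of degree $n$ in $y$ and irreducible over $\mathbb{C}$. Its Newton polygon $P\subset\mathbb{R}^2$ is the convex hull of the exponent vectors of its nonzero terms; $P$ is assumed two-dimensional. Since the constant term is nonzero, the segment from the origin to $(0,n)$ is an edge of $P$. The first quadrant edges of $P$ are the edges not lying on the coordinate axes; they are numbered $1,\dots,\varepsilon$ from top to bottom, the first starting at $(0,n)$ and the $\varepsilon$th ending on the $x$-axis. The outer normal of the $i$th edge is written $(1,\frac{m_i}{\mu_i})$ with $m_i,\mu_i\in\mathbb{Z}$, $\mu_i>0$, $\gcd(m_i,\mu_i)=1$, and $n_i+1$ is the number of lattice points on the $i$th edge. $X_P$ is the projective toric surface over $\mathbb{C}$ determined by $P$, with its ample divisor $D_P$;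 the global sections of $\mathcal{O}_{X_P}(D_P)$ are identified with the span of the monomials $x^ay^m$, $(a,m)\in P\cap\mathbb{Z}^2$, and the curve in $X_P$ defined by $\chi(x,y)=0$ is the zero locus of the section corresponding to $\chi$. "Sufficiently general within its Newton polygon $P$" means: $P$ being fixed, the coefficient vector of $\chi$ lies in a suitable nonempty Zariski open subset of the space of polynomials $\sum_{(a,m)\in P\cap\mathbb{Z}^2}c_{a,m}x^ay^m$ that are monic of degree $n$ in $y$. The Riemann surface $S$ associated to $\chi(x,y)=0$ is the compact Riemann surface of the function field $\mathbb{C}(x)[y]/\langle\chi(x,y)\rangle$. *)

theory Defs
  imports
    "HOL-Algebra.Subrings"
    "HOL-Library.Function_Algebras"
    "HOL-Computational_Algebra.Computational_Algebra"
    "HOL-Analysis.Analysis"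
begin

section \<open>Newton polygons\<close>

text \<open>
  A polynomial in \<open>x\<close> and \<open>y\<close> is an element of \<open>complex poly poly\<close>: the outer variable is
  \<open>y\<close>, the inner one is \<open>x\<close>.  The exponent vector \<open>(a, m)\<close> stands for the monomial
  \<open>x^a y^m\<close>.
\<close>

definition coeff_vec :: "complex poly poly \<Rightarrow> nat \<times> nat \<Rightarrow> complex" where
  "coeff_vec chi = (\<lambda>(a, m). Polynomial.coeff (Polynomial.coeff chi m) a)"

definition real_pt :: "nat \<times> nat \<Rightarrow> real \<times> real" where
  "real_pt = (\<lambda>(a, m). (real a, real m))"

definition newton_polygon :: "complex poly poly \<Rightarrow> (real \<times> real) set" where
  "newton_polygon chi = convex hull (real_pt ` {e. coeff_vec chi e \<noteq> 0})"

text \<open>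
  Newton polygons of polynomials lie in the closed first quadrant, so all their lattice points
  have natural number coordinates.
\<close>

definition lattice_points :: "(real \<times> real) set \<Rightarrow> (nat \<times> nat) set" where
  "lattice_points F = {e. real_pt e \<in> F}"

definition first_quadrant_edges :: "(real \<times> real) set \<Rightarrow> (real \<times> real) set set" where
  "first_quadrant_edges P =
     {F. F edge_of P \<and> \<not> F \<subseteq> {p. fst p = 0} \<and> \<not> F \<subseteq> {p. snd p = 0}}"

definition monic_in_y :: "nat \<Rightarrow> complex poly poly \<Rightarrow> bool" where
  "monic_in_y n chi \<longleftrightarrow> Polynomial.degree chi = n \<and> lead_coeff chi = 1"

text \<open>\<open>k i\<close> plays the role of \<open>n_i\<close>: the \<open>i\<close>th edge has \<open>k i + 1\<close> lattice points.\<close>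

definition gamma_number ::
    "nat \<Rightarrow> (nat \<Rightarrow> nat) \<Rightarrow> (nat \<Rightarrow> int) \<Rightarrow> (nat \<Rightarrow> int) \<Rightarrow> real" where
  "gamma_number \<epsilon> k m \<mu> =
     (\<Sum>i = 1..\<epsilon>. real (k i) * of_int (\<mu> i) *
         ((\<Sum>j = 1..<i. real (k j) * of_int (m j)) + (real (k i) * of_int (m i) - 1) / 2))
     - (\<Sum>i = 1..\<epsilon>. real (k i) * (of_int (m i) + 1) / 2) + 1"


section \<open>Polynomial functions and dimension\<close>

text \<open>Polynomial functions on a complex coordinate space; since the complex numbers are infinite
  these are the same as polynomials (in finitely many of the coordinates).\<close>

inductive poly_fun :: "(('i \<Rightarrow> complex) \<Rightarrow> complex) \<Rightarrow> bool" where
  const: "poly_fun (\<lambda>z. c)"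
| coord: "poly_fun (\<lambda>z. z i)"
| add: "poly_fun f \<Longrightarrow> poly_fun g \<Longrightarrow> poly_fun (\<lambda>z. f z + g z)"
| mult: "poly_fun f \<Longrightarrow> poly_fun g \<Longrightarrow> poly_fun (\<lambda>z. f z * g z)"

definition homogeneous_poly_fun :: "(('i \<Rightarrow> complex) \<Rightarrow> complex) \<Rightarrow> bool" where
  "homogeneous_poly_fun f \<longleftrightarrow>
     poly_fun f \<and> (\<exists>d::nat. \<forall>c z. f (\<lambda>i. c * z i) = c ^ d * f z)"

interpretation cfun: vector_space "\<lambda>(c::complex) (v::'i \<Rightarrow> complex). (\<lambda>i. c * v i)"
  by unfold_locales (auto simp: plus_fun_def algebra_simps)

definition has_cdim :: "('i \<Rightarrow> complex) set \<Rightarrow> nat \<Rightarrow> bool" where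
  "has_cdim V d \<longleftrightarrow>
     (\<exists>B. finite B \<and> card B = d \<and> cfun.independent B \<and> cfun.span B = V)"

text \<open>The affine space of polynomials that are monic of degree \<open>n\<close> in \<open>y\<close> and supported in
  \<open>P\<close>, and its Zariski open subsets (complements of common zero sets of polynomials in the
  coefficients).\<close>

definition monic_polys_in :: "nat \<Rightarrow> (real \<times> real) set \<Rightarrow> complex poly poly set" where
  "monic_polys_in n P =
     {chi. monic_in_y n chi \<and> (\<forall>e. coeff_vec chi e \<noteq> 0 \<longrightarrow> e \<in> lattice_points P)}"

definition zariski_open_in :: "complex poly poly set \<Rightarrow> complex poly poly set \<Rightarrow> bool" where
  "zariski_open_in V U \<longleftrightarrow>
     (\<exists>F. (\<forall>f\<in>F. poly_fun f) \<and> U = {chi\<in>V. \<exists>f\<in>F. f (coeff_vec chi) \<noteq> 0})"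


section \<open>Complex atlases, holomorphic 1-forms and genus\<close>

text \<open>A chart is a pair \<open>(U, \<phi>)\<close>; only the values of \<open>\<phi>\<close> on \<open>U\<close> matter.\<close>

type_synonym 'a chart = "'a set \<times> ('a \<Rightarrow> complex)"

text \<open>
  A holomorphic 1-form \<open>\<omega>\<close> is written \<open>h d\<phi>\<close> on each chart \<open>(U, \<phi>)\<close>, with
  \<open>h p = \<omega> ((U, \<phi>), p)\<close> holomorphic in the coordinate \<open>\<phi>\<close>.  The last condition is the
  transformation rule \<open>h d\<phi> = (h d\<phi>/d\<psi>) d\<psi>\<close>; the first one normalizes the values
  at meaningless arguments, so that equal forms are equal functions.
\<close>

definition holomorphic_forms :: "'a chart set \<Rightarrow> ('a chart \<times> 'a \<Rightarrow> complex) set" where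
  "holomorphic_forms \<A> =
     {\<omega>. (\<forall>c p. \<not> (c \<in> \<A> \<and> p \<in> fst c) \<longrightarrow> \<omega> (c, p) = 0) \<and>
         (\<forall>(U, \<phi>)\<in>\<A>. (\<lambda>w. \<omega> ((U, \<phi>), inv_into U \<phi> w)) holomorphic_on \<phi> ` U) \<and>
         (\<forall>(U, \<phi>)\<in>\<A>. \<forall>(V, \<psi>)\<in>\<A>. \<forall>p\<in>U \<inter> V.
            \<omega> ((V, \<psi>), p) =
            \<omega> ((U, \<phi>), p) * deriv (\<lambda>w. \<phi> (inv_into V \<psi> w)) (\<psi> p))}"

text \<open>The genus of a compact Riemann surface is the dimension of its space of holomorphic
  1-forms.\<close>

definition has_genus :: "'a chart set \<Rightarrow> nat \<Rightarrow> bool" where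
  "has_genus \<A> g \<longleftrightarrow> has_cdim (holomorphic_forms \<A>) g"


section \<open>The compact Riemann surface of a function field\<close>

definition poly_ring :: "'a::comm_ring_1 poly ring" where
  "poly_ring = \<lparr>carrier = UNIV, monoid.mult = (*), one = 1, zero = 0, add = (+)\<rparr>"

text \<open>The function field \<open>\<complex>(x)[y]/\<langle>chi\<rangle>\<close>; its elements are cosets.\<close>

type_synonym ff_elem = "complex poly fract poly set"

definition ff_class :: "complex poly poly \<Rightarrow> complex poly fract poly \<Rightarrow> ff_elem" where
  "ff_class chi q = (PIdl\<^bsub>poly_ring\<^esub> (fract_poly chi)) +>\<^bsub>poly_ring\<^esub> q"

definition function_field :: "complex poly poly \<Rightarrow> ff_elem ring" where
  "function_field chi = poly_ring Quot (PIdl\<^bsub>poly_ring\<^esub> (fract_poly chi))"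

definition ff_const :: "complex poly poly \<Rightarrow> complex \<Rightarrow> ff_elem" where
  "ff_const chi c = ff_class chi [:to_fract [:c:]:]"

definition ff_x :: "complex poly poly \<Rightarrow> ff_elem" where
  "ff_x chi = ff_class chi [:to_fract [:0, 1:]:]"

definition ff_y :: "complex poly poly \<Rightarrow> ff_elem" where
  "ff_y chi = ff_class chi [:0, 1:]"

text \<open>
  The points of the Riemann surface are the places of the function field over the complex
  numbers, represented by their valuation rings.
\<close>

type_synonym place = "ff_elem set"

definition places :: "complex poly poly \<Rightarrow> place set" where
  "places chi =
     {\<O>. subring \<O> (function_field chi) \<and> range (ff_const chi) \<subseteq> \<O> \<and>
         \<O> \<noteq> carrier (function_field chi) \<and>
         (\<forall>f \<in> carrier (function_field chi) - {\<zero>\<^bsub>function_field chi\<^esub>}.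
            f \<in> \<O> \<or> inv\<^bsub>function_field chi\<^esub> f \<in> \<O>)}"

definition place_ideal :: "complex poly poly \<Rightarrow> place \<Rightarrow> ff_elem set" where
  "place_ideal chi \<O> =
     {f \<in> \<O>. f = \<zero>\<^bsub>function_field chi\<^esub> \<or> inv\<^bsub>function_field chi\<^esub> f \<notin> \<O>}"

text \<open>The value of \<open>f \<in> \<O>\<close> at the place, in the residue field \<open>\<complex>\<close>.  Elements \<open>f \<notin> \<O>\<close>
  have a pole at the place; the value is then meaningless.\<close>

definition place_value :: "complex poly poly \<Rightarrow> ff_elem \<Rightarrow> place \<Rightarrow> complex" where
  "place_value chi f \<O> =
     (THE c. f \<ominus>\<^bsub>function_field chi\<^esub> ff_const chi c \<in> place_ideal chi \<O>)"

text \<open>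
  The coarsest topology for which every element of the function field is a continuous map to the
  Riemann sphere (neighbourhoods of infinity are covered by passing from \<open>f\<close> to \<open>1/f\<close>).
\<close>

definition rs_topology :: "complex poly poly \<Rightarrow> place topology" where
  "rs_topology chi = topology_generated_by
     {{\<O> \<in> places chi. f \<in> \<O> \<and> place_value chi f \<O> \<in> W} | f W.
        f \<in> carrier (function_field chi) \<and> open W}"

text \<open>The complex structure for which the elements of the function field are meromorphic: the
  charts are the elements of the function field that map an open set homeomorphically onto an open
  subset of \<open>\<complex>\<close>.  Around each place every local uniformizer gives such a chart.\<close>

definition rs_charts :: "complex poly poly \<Rightarrow> place chart set" where
  "rs_charts chi =
     {(U, place_value chi f) | U f.
        f \<in> carrier (function_field chi) \<and> openin (rs_topology chi) U \<and> (\<forall>\<O>\<in>U. f \<in> \<O>) \<and>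
        open (place_value chi f ` U) \<and>
        homeomorphic_map (subtopology (rs_topology chi) U)
          (top_of_set (place_value chi f ` U)) (place_value chi f)}"


section \<open>The projective toric surface of a polygon\<close>

text \<open>A point of projective space with homogeneous coordinates \<open>z\<close> is the punctured line
  through \<open>z\<close>.\<close>

definition proj_point :: "('i \<Rightarrow> complex) \<Rightarrow> ('i \<Rightarrow> complex) set" where
  "proj_point z = {\<lambda>i. c * z i | c. c \<noteq> 0}"

definition torus_point :: "(real \<times> real) set \<Rightarrow> complex \<Rightarrow> complex \<Rightarrow> nat \<times> nat \<Rightarrow> complex" where
  "torus_point P s t =
     (\<lambda>(a, m). if (a, m) \<in> lattice_points P then s ^ a * t ^ m else 0)"

text \<open>The homogeneous elements of the ideal of the image of the torus.\<close>

definition toric_ideal :: "(real \<times> real) set \<Rightarrow> ((nat \<times> nat \<Rightarrow> complex) \<Rightarrow> complex) set" where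
  "toric_ideal P =
     {f. homogeneous_poly_fun f \<and>
         (\<forall>s t. s \<noteq> 0 \<longrightarrow> t \<noteq> 0 \<longrightarrow> f (torus_point P s t) = 0)}"

text \<open>
  Every two-dimensional lattice polygon is very ample, so the toric surface of \<open>P\<close> is the Zariski
  closure of the image of the torus in the projective space whose homogeneous coordinates are
  indexed by the lattice points of \<open>P\<close>.  The coordinate with index \<open>(a, m)\<close> is the global
  section of \<open>O(D_P)\<close> corresponding to \<open>x^a y^m\<close>, where \<open>D_P\<close> is the hyperplane
  divisor.
\<close>

definition toric_surface :: "(real \<times> real) set \<Rightarrow> (nat \<times> nat \<Rightarrow> complex) set set" where
  "toric_surface P =
     {proj_point z | z. z \<noteq> (\<lambda>_. 0) \<and> (\<forall>e. e \<notin> lattice_points P \<longrightarrow> z e = 0) \<and>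
        (\<forall>f\<in>toric_ideal P. f z = 0)}"

definition toric_section ::
    "(real \<times> real) set \<Rightarrow> complex poly poly \<Rightarrow> (nat \<times> nat \<Rightarrow> complex) \<Rightarrow> complex" where
  "toric_section P chi z = (\<Sum>e\<in>lattice_points P. coeff_vec chi e * z e)"

definition toric_curve ::
    "(real \<times> real) set \<Rightarrow> complex poly poly \<Rightarrow> (nat \<times> nat \<Rightarrow> complex) set set" where
  "toric_curve P chi = {L \<in> toric_surface P. \<forall>z\<in>L. toric_section P chi z = 0}"

text \<open>
  Zariski tangent space, at a nonzero vector \<open>z\<close>, of the affine cone over the zero scheme of the
  section: the vectors annihilated by the differentials at \<open>z\<close> of all equations.  Its dimension
  exceeds that of the Zariski tangent space of the zero scheme at the point \<open>[z]\<close> by one, so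
  the curve is smooth at \<open>[z]\<close> if and only if the dimension is two.
\<close>

definition cone_tangent_space ::
    "(real \<times> real) set \<Rightarrow> complex poly poly \<Rightarrow> (nat \<times> nat \<Rightarrow> complex) \<Rightarrow>
     (nat \<times> nat \<Rightarrow> complex) set" where
  "cone_tangent_space P chi z =
     {w. (\<forall>e. e \<notin> lattice_points P \<longrightarrow> w e = 0) \<and>
         (\<forall>f\<in>toric_ideal P. deriv (\<lambda>t. f (\<lambda>e. z e + t * w e)) 0 = 0) \<and>
         toric_section P chi w = 0}"

definition smooth_toric_curve :: "(real \<times> real) set \<Rightarrow> complex poly poly \<Rightarrow> bool" where
  "smooth_toric_curve P chi \<longleftrightarrow>
     (\<forall>L\<in>toric_curve P chi. \<forall>z\<in>L. has_cdim (cone_tangent_space P chi z) 2)"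


section \<open>Holomorphic embeddings into projective space\<close>

text \<open>The quotient of two homogeneous coordinates at a point where the second is nonzero.\<close>

definition coord_ratio :: "'i \<Rightarrow> 'i \<Rightarrow> ('i \<Rightarrow> complex) set \<Rightarrow> complex" where
  "coord_ratio i j L = (THE r. \<forall>z\<in>L. z i = r * z j)"

text \<open>
  Near each point \<open>p\<close> some homogeneous coordinate \<open>j\<close> does not vanish, all quotients by it are
  holomorphic, and one of the quotients is a local coordinate at \<open>p\<close>.  On a compact surface such
  an injective map is a biholomorphism onto its image, a submanifold of projective space.
\<close>

definition holomorphic_embedding ::
    "'a set \<Rightarrow> 'a chart set \<Rightarrow> ('a \<Rightarrow> ('i \<Rightarrow> complex) set) \<Rightarrow> bool" where
  "holomorphic_embedding S \<A> \<Phi> \<longleftrightarrow> inj_on \<Phi> S \<and>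
     (\<forall>p\<in>S. \<exists>(U, \<phi>)\<in>\<A>. \<exists>j. p \<in> U \<and>
        (\<forall>q\<in>U. \<forall>z\<in>\<Phi> q. z j \<noteq> 0) \<and>
        (\<forall>i. (\<lambda>w. coord_ratio i j (\<Phi> (inv_into U \<phi> w))) holomorphic_on \<phi> ` U) \<and>
        (\<exists>i. deriv (\<lambda>w. coord_ratio i j (\<Phi> (inv_into U \<phi> w))) (\<phi> p) \<noteq> 0))"

text \<open>
  The Riemann surface is identified with the curve by a biholomorphism compatible with the functions
  \<open>x\<close> and \<open>y\<close>: a point where both are finite and nonzero goes to the point of the torus with
  these coordinates.  This determines the map at all but finitely many points.
\<close>

definition identifies_with_curve ::
    "(real \<times> real) set \<Rightarrow> complex poly poly \<Rightarrow>
     (place \<Rightarrow> (nat \<times> nat \<Rightarrow> complex) set) \<Rightarrow> bool" where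
  "identifies_with_curve P chi \<Phi> \<longleftrightarrow>
     holomorphic_embedding (places chi) (rs_charts chi) \<Phi> \<and>
     \<Phi> ` places chi = toric_curve P chi \<and>
     (\<forall>\<O>\<in>places chi. ff_x chi \<in> \<O> \<longrightarrow> ff_y chi \<in> \<O> \<longrightarrow>
        place_value chi (ff_x chi) \<O> \<noteq> 0 \<longrightarrow> place_value chi (ff_y chi) \<O> \<noteq> 0 \<longrightarrow>
        \<Phi> \<O> = proj_point (torus_point P (place_value chi (ff_x chi) \<O>) (place_value chi (ff_y chi) \<O>)))"

end

theory Submission imports Defs "HOL-Algebra.Algebraic_Closure_Type" "HOL-Complex_Analysis.Complex_Analysis"
begin

text \<open>
  Monomial changes of coordinates at the vertices of the lattice polygon give unimodular charts in which
  a nondegenerate \<open>chi\<close> defines a smooth curve transversal to the boundary; its points are exactly the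
  places of the function field, which identifies the Riemann surface with the curve in the toric surface.
  For an interior lattice point \<open>(a + 1, b + 1)\<close> the form \<open>x^a y^b dx / chi_y\<close> is holomorphic on all charts.
  Conversely, the traces to the \<open>x\<close>-line of a holomorphic form times powers of \<open>y\<close> are rational with
  controlled growth, so Lagrange interpolation makes it a polynomial multiple of \<open>dx / chi_y\<close>, and the
  behaviour at the boundary confines its support to interior points. These are counted row by row. Nondegeneracy is
  generic because the coefficient vectors with a bad point are parametrized by tori of too small dimension.
\<close>

text \<open>A chart is attached to an edge rather than to a single vertex: the coordinate V along
  the edge is invertible, the transversal coordinate U may vanish. The charts thus cover the torus
  and the open boundary orbits but no torus-fixed point. Nothing is lost, since the vertex
  coefficients of chi are nonzero and the curve misses the fixed points; and the surface may well be
  singular there.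

  Neither places nor points of the surface come with coordinates. One combinatorial device,
  \<open>closed_face\<close>, locates both: the monomials of least valuation at a place, and the
  nonvanishing homogeneous coordinates of a point, are closed under integral affine relations, and a
  closed set with two elements carries a chart.

  Expansions of the branches at infinity are avoided as well. The growth of the traces is read off
  from supporting lines of the polygon, because on chi = 0 a truncation of chi equals minus the
  complementary truncation, and one of the two is always easy to bound.\<close>

hide_const (open) Polynomial_Divisibility.poly_ring Divisibility.irreducible Divisibility.prime Polynomials.degree Polynomials.lead_coeff

notation holomorphic_on (infixl "hol'_on" 50)
notation has_field_derivative (infix "hfd" 50)
notation tendsto (infixr "--->" 55)
abbreviation (input) LIMSEQ (infixr "---->" 60) where "f ----> l \<equiv> f \<longlonglongrightarrow> l"
lemmas hfd_transform = has_field_derivative_transform_within_open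
lemmas alg = algebra_simps

type_synonym mon = "nat \<times> nat"
abbreviation (input) "pv \<equiv> place_value"
abbreviation (input) "RC \<equiv> rs_charts"
abbreviation (input) "HF chi \<equiv> holomorphic_forms (rs_charts chi)"
abbreviation (input) "ix g \<equiv> int (fst g)"
abbreviation (input) "iy g \<equiv> int (snd g)"
abbreviation (input) "mn s t g \<equiv> s ^ fst g * t ^ snd g"

section \<open>Local analysis: implicit functions and orders of zeros\<close>

text \<open>The map (u,v) -> (u, G(u,v)) has an invertible derivative where Gv is nonzero, so the
  real inverse function theorem yields f. Differentiating G(u, f u) = 0 shows that the real
  derivative of f is multiplication by -Gu/Gv, hence f is holomorphic. The radius \<open>ep\<close>
  records that f accounts for all zeros near p0.\<close>

lemma implicit_function_complex:
fixes G Gu Gv :: "complex \<times> complex => complex"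
assumes S: "open S" "p0 : S" and G0: "G p0 = 0"
 and der: "!!p. p : S ==> (G has_derivative (%h. Gu p*fst h+Gv p * snd h)) (at p)"
 and cont: "continuous_on S Gu" "continuous_on S Gv" and nz: "!!p. p : S ==> Gv p ~= 0"
obtains r f ep where "r > 0" "f hol_on ball (fst p0) r" "f (fst p0) = snd p0"
 "!!u. u : ball (fst p0) r ==> (u,f u) : S & G (u,f u) = 0"
 "ep > 0" "!!q. dist q p0 < ep ==> G q = 0 ==> fst q : ball (fst p0) r & snd q = f (fst q)"
proof -
define F where "F = (%p. (fst p,G p))"
define L where "L = (%p (h::complex\<times>complex). (fst h,Gu p*fst h+Gv p * snd h))"
have bl: "bounded_linear (L p)" for p unfolding L_def by(intro bounded_linear_Pair bounded_linear_add bounded_linear_fst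
   bounded_linear_const_mult bounded_linear_snd bounded_linear_compose[OF bounded_linear_mult_right])
define F' where "F' = (%p. Blinfun (L p))"
have F'L: "blinfun_apply (F' p) = L p" for p unfolding F'_def using bl bounded_linear_Blinfun_apply by blast
define I where "I = (%h::complex\<times>complex. (fst h,(snd h-Gu p0*fst h)/Gv p0))"
have blI: "bounded_linear I" unfolding I_def divide_inverse by(intro bounded_linear_Pair bounded_linear_sub bounded_linear_fst
   bounded_linear_compose[OF bounded_linear_mult_left] bounded_linear_snd
   bounded_linear_compose[OF bounded_linear_mult_right])
have inv: "Blinfun I o\<^sub>L F' p0 = id_blinfun"
 by(rule blinfun_eqI) (simp add: F'L bounded_linear_Blinfun_apply[OF blI], simp add: I_def L_def nz S(2))
have derF: "(F has_derivative blinfun_apply (F' p)) (at p)" if "p : S" for p unfolding F_def F'L L_def by(intro derivative_intros der that)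
have contF': "continuous_on S F'" by(rule continuous_on_blinfun_componentwise)
  (auto simp: F'L L_def intro!: continuous_intros cont)
obtain U' V g g' where U: "open U'" "U' <= S" "p0 : U'" "open V" "F p0 : V" "homeomorphism U' V F g"
 and dg: "!!y. y : V ==> (g has_derivative (g' y)) (at y)" by(rule inverse_function_theorem[OF S(1) derF contF' S(2) inv]) (assumption | rule that)+
have Fg: "F (g y) = y" "g y : U'" if "y : V" for y using U(6) that by(auto simp: homeomorphism_def)
have gF: "g (F q) = q" if "q : U'" for q using U(6) that by(auto simp: homeomorphism_def)
define f where "f = (%u. snd (g (u,0)))"
have F0: "F p0 = (fst p0,0)" by(simp add: F_def G0)
obtain d where d: "d > 0" "ball (F p0) d <= V" using U(4,5) openE by blast
have inV: "(u,0) : V" if "u : ball (fst p0) d" for u using d(2) that by(auto simp: F0 dist_Pair_Pair subset_eq)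
have gu: "g (u,0) = (u,f u)" "G (u,f u) = 0" "(u,f u) : S" if "u : ball (fst p0) d" for u
proof -
 have "F (g (u,0)) = (u,0)" using Fg(1)[OF inV[OF that]] .
 thus g: "g (u,0) = (u,f u)" unfolding F_def f_def by(auto simp: prod_eq_iff)
 show "G (u,f u) = 0" using \<open>F (g (u, 0)) = (u, 0)\<close> unfolding g by(simp add: F_def)
 show "(u,f u) : S" using Fg(2)[OF inV[OF that]] U(2) unfolding g by blast
qed
have deriv: "EX D. (f hfd D) (at u)" if u: "u : ball (fst p0) d" for u
proof -
 define D where "D = (%h. snd (g' (u,0) (h,0)))"
 have "((%u. g (u,0)) has_derivative (%h. g' (u,0) (h,0))) (at u)" by(rule has_derivative_compose[of "%u. (u,0)" "%h. (h,0)" u UNIV g "g' (u,0)"])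
   (auto intro!: derivative_eq_intros dg[OF inV[OF u]])
 hence D: "(f has_derivative D) (at u)" unfolding f_def D_def by(rule has_derivative_snd)
 have "((%u. (u,f u)) has_derivative (%h. (h,D h))) (at u)" by(intro derivative_intros D)
 hence "((%u. G (u,f u)) has_derivative (%h. Gu (u,f u)*h+Gv (u,f u)*D h)) (at u)"
  using has_derivative_compose[where f="%u. (u,f u)" and f'="%h. (h,D h)" and g=G and s=UNIV and x=u,
    OF _ der[OF gu(3)[OF u]]] by simp
 moreover have "((%u. G (u,f u)) has_derivative (%h. 0)) (at u)" by(rule has_derivative_transform_within_open[of "%_. 0" _ _ _ "ball (fst p0) d"])
   (use u gu(2) in auto)
 ultimately have "(%h. Gu (u,f u)*h+Gv (u,f u)*D h) = (%h. 0)" by(rule has_derivative_unique)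
 hence "Gv (u,f u)*D h = - Gu (u,f u)*h" for h by(simp add: fun_eq_iff eq_neg_iff_add_eq_0 add.commute)
 hence "D = (%h. (- Gu (u,f u)/Gv (u,f u))*h)" using nz[OF gu(3)[OF u]] by(auto simp: fun_eq_iff field_simps)
 thus ?thesis using D unfolding has_field_derivative_def by metis
qed
obtain e where e: "e > 0" "ball p0 e <= U'" using U(1,3) openE by blast
show ?thesis
proof(rule that)
 show "d > 0" by(rule d)
 show "f hol_on ball (fst p0) d" using deriv by(auto simp: holomorphic_on_open)
 show "f (fst p0) = snd p0" using gF[OF U(3)] unfolding F0 f_def by simp
 show "(u,f u) : S & G (u,f u) = 0" if "u : ball (fst p0) d" for u using gu that by blast
 show "min e d > 0" using e d by simp
 show "fst q : ball (fst p0) d & snd q = f (fst q)" if q: "dist q p0 < min e d" "G q = 0" for q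
 proof
  have "dist (fst q) (fst p0) <= dist q p0" by(rule dist_fst_le)
  thus "fst q : ball (fst p0) d" using q by(simp add: dist_commute)
  have "q : U'" using e q by(auto simp: dist_commute subset_eq)
  hence "g (F q) = q" by(rule gF)
  thus "snd q = f (fst q)" unfolding F_def f_def q(2) by simp
 qed
qed
qed

lemma holomorphic_order:
assumes "f hol_on ball 0 r" "r > 0" "EX w:ball 0 r. f w ~= 0"
shows "EX k g R. R > 0 & R <= r & g hol_on ball 0 R & (ALL w:ball 0 R. f w = w ^ k*g w & g w ~= 0)"
proof -
note z = zorder_exist_zero[OF assms(1) open_ball connected_ball _ assms(3)]
have "0 : ball (0::complex) r" using assms(2) by simp
from conjunct2[OF z[OF this]] obtain R where R: "R > 0" "cball 0 R <= ball (0::complex) r"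
 "zor_poly f 0 hol_on cball 0 R"
 "ALL w:cball 0 R. f w = zor_poly f 0 w*(w-0)^nat (zorder f 0) & zor_poly f 0 w ~= 0" by(elim exE conjE)
have "of_real R : cball (0::complex) R" using R(1) by simp
hence "of_real R : ball (0::complex) r" using R(2) by(rule subsetD[rotated])
hence "R <= r" using R(1) by simp
moreover have "zor_poly f 0 hol_on ball 0 R" by(rule holomorphic_on_subset[OF R(3)]) auto
ultimately show ?thesis using R(1,4) by(intro exI[of _ "nat (zorder f 0)"] exI[of _ "zor_poly f 0"] exI[of _ R]) (auto simp: mult.commute)
qed

section \<open>The function field as a quotient ring and inside a field type\<close>

lemma cring_poly_ring: "cring (poly_ring :: 'a::comm_ring_1 poly ring)"
proof(rule cringI)
show "abelian_group (poly_ring :: 'a poly ring)"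
proof(rule abelian_groupI)
 fix x :: "'a poly"
 show "EX y:carrier poly_ring. y \<oplus>\<^bsub>poly_ring\<^esub> x = \<zero>\<^bsub>poly_ring\<^esub>"
  by(intro bexI[of _ "-x"]) (auto simp: poly_ring_def)
qed (auto simp: poly_ring_def)
show "comm_monoid (poly_ring :: 'a poly ring)" by unfold_locales (auto simp: poly_ring_def ac_simps)
qed (auto simp: poly_ring_def alg)

locale ff_context =
fixes chi :: "complex poly poly" and n :: nat
assumes irr: "irreducible chi" and monic: "monic_in_y n chi"
 and const: "coeff_vec chi (0,0) ~= 0"
begin

definition J where "J = PIdl\<^bsub>poly_ring\<^esub> (fract_poly chi)"

lemma J_eq: "J = {r. fract_poly chi dvd r}"
by(auto simp: J_def cgenideal_def poly_ring_def dvd_def mult.commute)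

lemma ideal_J: "ideal J poly_ring"
unfolding J_def by(rule cring.cgenideal_ideal[OF cring_poly_ring]) (simp add: poly_ring_def)

lemma ff_class_eq: "ff_class chi q = {r. fract_poly chi dvd r-q}"
proof -
have "ff_class chi q = {h+q | h. fract_poly chi dvd h}" unfolding ff_class_def J_def[symmetric] J_eq a_r_coset_def r_coset_def
 by(auto simp: poly_ring_def)
also have "... = {r. fract_poly chi dvd r-q}" by(force intro: exI[of _ "_-q"])
finally show ?thesis .
qed

lemma ff_class_eq_iff: "ff_class chi q = ff_class chi r \<longleftrightarrow> fract_poly chi dvd q-r"
proof
assume "ff_class chi q = ff_class chi r"
moreover have "q : ff_class chi q" unfolding ff_class_eq by simp
ultimately show "fract_poly chi dvd q-r" unfolding ff_class_eq by simp
next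
assume A: "fract_poly chi dvd q-r"
have "fract_poly chi dvd x-q \<longleftrightarrow> fract_poly chi dvd x-r" for x using dvd_add_right_iff[OF A, of "x-q"] by(simp add: alg)
thus "ff_class chi q = ff_class chi r" unfolding ff_class_eq by simp
qed

lemma ff_eq: "function_field chi = poly_ring Quot J"
by(simp add: function_field_def J_def)

lemma cring_ff: "cring (function_field chi)"
unfolding ff_eq by(rule ideal.quotient_is_cring[OF ideal_J cring_poly_ring])

lemma carrier_ff: "carrier (function_field chi) = range (ff_class chi)"
unfolding ff_eq FactRing_def A_RCOSETS_def RCOSETS_def ff_class_def J_def a_r_coset_def by(auto simp: poly_ring_def)

lemma ff_add: "ff_class chi q \<oplus>\<^bsub>function_field chi\<^esub> ff_class chi r = ff_class chi (q+r)"
unfolding ff_eq ff_class_def J_def[symmetric] using ideal.a_rcos_sum[OF ideal_J, of q r] by(simp add: poly_ring_def FactRing_def)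

lemma ff_mult: "ff_class chi q \<otimes>\<^bsub>function_field chi\<^esub> ff_class chi r = ff_class chi (q*r)"
unfolding ff_eq ff_class_def J_def[symmetric] FactRing_def using ideal.rcoset_mult_add[OF ideal_J, of q r] by(simp add: poly_ring_def)

lemma ff_one: "\<one>\<^bsub>function_field chi\<^esub> = ff_class chi 1"
unfolding ff_eq ff_class_def J_def[symmetric] FactRing_def by(simp add: poly_ring_def)

text \<open>A root of chi in an algebraic closure of C(x). Evaluation at it, \<open>iota\<close>,
  has the multiples of chi as kernel and so realizes the quotient ring inside a field.\<close>

definition eta :: "complex poly fract alg_closure" where
"eta = (SOME z. poly (map_poly to_ac (fract_poly chi)) z = 0)"

definition iota :: "complex poly fract poly => complex poly fract alg_closure" where
"iota q = poly (map_poly to_ac q) eta"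

lemma degree_chi: "degree chi = n" "lead_coeff chi = 1"
using monic by(auto simp: monic_in_y_def)

lemma chi_nonzero: "chi ~= 0" using irr by auto

lemma n_pos: "n > 0"
proof(rule ccontr)
assume "~ n > 0"
hence "degree chi = 0" using degree_chi by simp
hence "chi = 1" using degree_chi by(metis degree_eq_zeroE lead_coeff_pCons(2) one_pCons)
thus False using irr by simp
qed

text \<open>Gauss's lemma: an irreducible polynomial of positive degree in y is primitive and stays
  irreducible over C(x).\<close>

lemma irr_fract: "irreducible (fract_poly chi)" "Polynomial.content chi = 1"
using nonconst_poly_irreducible_iff[of chi] irr degree_chi n_pos by auto

lemma map_poly_ac_add: "map_poly to_ac (p+q) = map_poly to_ac p+map_poly to_ac q"
by(rule poly_eqI) (simp add: coeff_map_poly)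

lemma map_poly_ac_mult: "map_poly to_ac (p*q) = map_poly to_ac p*map_poly to_ac q"
by(rule poly_eqI) (simp add: coeff_map_poly coeff_mult to_ac_sum)

lemma iota_add: "iota (p+q) = iota p+iota q"
by(simp add: iota_def map_poly_ac_add)

lemma iota_mult: "iota (p*q) = iota p*iota q"
by(simp add: iota_def map_poly_ac_mult)

lemma iota_one: "iota 1 = 1" by(simp add: iota_def)

lemma iota_zero: "iota 0 = 0" by(simp add: iota_def)

lemma iota_minus: "iota (- p) = - iota p"
using iota_add[of p "- p"] by(simp add: iota_zero eq_neg_iff_add_eq_0 add.commute)

lemma iota_diff: "iota (p-q) = iota p-iota q"
using iota_add[of p "- q"] by(simp add: iota_minus)

lemma iota_chi: "iota (fract_poly chi) = 0"
proof -
have "degree (map_poly to_ac (fract_poly chi)) = n" by(subst degree_map_poly) (auto simp: degree_map_poly degree_chi)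
hence "EX z. poly (map_poly to_ac (fract_poly chi)) z = 0" using alg_closed_imp_poly_has_root[of "map_poly to_ac (fract_poly chi)"] n_pos by metis
thus ?thesis unfolding iota_def eta_def by(rule someI_ex)
qed

text \<open>A nonzero element of least degree in the ideal generated by chi and q divides both. By
  irreducibility it is a unit or an associate of chi, and the latter would make chi divide
  q.\<close>

lemma coprime_bezout:
assumes "~ fract_poly chi dvd q"
shows "EX a b. a*fract_poly chi+b*q = 1"
proof -
define I where "I = {a*fract_poly chi+b*q | a b. True}"
have mult: "c*x : I" if "x : I" for c x
proof -
 from that obtain a b where "x = a*fract_poly chi+b*q" unfolding I_def by blast
 hence "c*x = (c*a)*fract_poly chi+(c*b)*q" by(simp add: alg)
 thus ?thesis unfolding I_def by blast
qed
have diff: "x-y : I" if xy: "x : I" "y : I" for x y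
proof -
 from xy obtain a b a' b' where "x = a*fract_poly chi+b*q" "y = a'*fract_poly chi+b'*q" unfolding I_def by blast
 hence "x-y = (a-a')*fract_poly chi+(b-b')*q" by(simp add: alg)
 thus ?thesis unfolding I_def by blast
qed
have "fract_poly chi = 1*fract_poly chi+0*q" "q = 0*fract_poly chi+1*q" by simp_all
hence mem: "fract_poly chi : I" "q : I" unfolding I_def by blast+
have "fract_poly chi : I & fract_poly chi ~= 0" using mem(1) chi_nonzero by simp
from ex_has_least_nat[of "%g. g : I & g ~= 0", OF this, of degree]
obtain g where g: "g : I" "g ~= 0" and min: "!!h. h : I ==> h ~= 0 ==> degree g <= degree h" by blast
have dvd: "g dvd h" if "h : I" for h
proof -
 have "h mod g : I" using diff[OF that mult[OF g(1), of "h div g"]] by(simp add: minus_div_mult_eq_mod)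
 moreover have "degree (h mod g) < degree g | h mod g = 0" using degree_mod_less[OF g(2), of h] by auto
 ultimately have "h mod g = 0" using min[of "h mod g"] by linarith
 thus ?thesis by(rule mod_0_imp_dvd)
qed
obtain h where h: "fract_poly chi = g*h" using dvd[OF mem(1)] by blast
have "is_unit g"
proof(rule ccontr)
 assume "~ is_unit g"
 hence "is_unit h" using Factorial_Ring.irreducibleD[OF irr_fract(1) h] by blast
 hence "fract_poly chi dvd g" using h by(metis dvd_mult_unit_iff dvd_refl mult.commute)
 thus False using assms dvd[OF mem(2)] dvd_trans by blast
qed
then obtain u where "1 = g*u" by blast
hence "1 : I" using mult[OF g(1), of u] by(simp add: mult.commute)
thus ?thesis unfolding I_def by auto
qed

lemma iota_eq_0_iff: "iota q = 0 \<longleftrightarrow> fract_poly chi dvd q"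
proof
assume A: "iota q = 0"
show "fract_poly chi dvd q"
proof(rule ccontr)
 assume "~ ?thesis"
 then obtain a b where ab: "a*fract_poly chi+b*q = 1" using coprime_bezout by blast
 have "iota (a*fract_poly chi+b*q) = 0" by(simp add: iota_add iota_mult iota_chi A)
 thus False using ab iota_one by simp
qed
next
assume "fract_poly chi dvd q"
thus "iota q = 0" by(auto simp: iota_mult iota_chi elim!: dvdE)
qed

definition theta :: "ff_elem => complex poly fract alg_closure" where
"theta f = iota (SOME q. ff_class chi q = f)"

lemma theta_class: "theta (ff_class chi q) = iota q"
proof -
have "ff_class chi (SOME r. ff_class chi r = ff_class chi q) = ff_class chi q" by(rule someI) simp
hence "iota ((SOME r. ff_class chi r = ff_class chi q)-q) = 0" by(simp only: ff_class_eq_iff iota_eq_0_iff)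
thus ?thesis by(simp add: theta_def iota_diff)
qed

definition ev0 :: "complex poly poly => complex poly fract alg_closure" where
"ev0 A = iota (fract_poly A)"

lemma ev0_eq_0_iff: "ev0 A = 0 \<longleftrightarrow> chi dvd A"
unfolding ev0_def iota_eq_0_iff using fract_poly_dvdD[of chi A] irr_fract(2) fract_poly_dvd by blast

lemma iota_inverse_ex:
assumes "iota q ~= 0" shows "EX r. iota r = inverse (iota q)"
proof -
from assms obtain a b where ab: "a*fract_poly chi+b*q = 1" using coprime_bezout iota_eq_0_iff by blast
have "iota (a*fract_poly chi+b*q) = iota b*iota q" by(simp add: iota_add iota_mult iota_chi)
hence "iota b*iota q = 1" using ab iota_one by simp
thus ?thesis using inverse_unique[of "iota q" "iota b"] by(auto simp: mult.commute)
qed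

text \<open>Denominators can be taken in C[x]: building q up coefficient by coefficient, only
  elements of C(x) are ever inverted.\<close>

lemma iota_quotient: "EX A d. d ~= 0 & iota q = ev0 A/ev0 [:d:]"
proof(induction q)
case 0 show ?case by(intro exI[of _ 0] exI[of _ 1]) (simp add: iota_zero ev0_def)
next
case (pCons c q)
then obtain A d where A: "d ~= 0" "iota q = ev0 A/ev0 [:d:]" by blast
obtain a b where c: "c = Fract a b" "b ~= 0" by(cases c) auto
have nz: "ev0 [:e:] ~= 0" if "e ~= 0" for e unfolding ev0_eq_0_iff using that degree_chi n_pos
 by(metis dvd_imp_degree_le degree_pCons_0 leD pCons_eq_0_iff)
have m: "ev0 (P*Q) = ev0 P*ev0 Q" "ev0 (P+Q) = ev0 P+ev0 Q" for P Q by(simp_all add: ev0_def iota_mult iota_add)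
have "pCons c q = [:c:] + [:0,1:]*q" by simp
moreover have "iota [:c:] = ev0 [:a:]/ev0 [:b:]"
proof -
 have "c*to_fract b = to_fract a" using c by(simp add: to_fract_def eq_fract)
 hence "[:c:]*fract_poly [:b:] = fract_poly [:a:]" by(simp add: map_poly_pCons mult.commute)
 hence "iota [:c:]*ev0 [:b:] = ev0 [:a:]" unfolding ev0_def by(metis iota_mult)
 thus ?thesis using nz[OF c(2)] by(simp add: field_simps)
qed
moreover have "iota [:0,1:] = ev0 [:0,1:]" by(simp add: ev0_def map_poly_pCons)
ultimately have "iota (pCons c q) = ev0 [:a:]/ev0 [:b:]+ev0 [:0,1:]*(ev0 A/ev0 [:d:])" using A by(simp only: iota_add iota_mult)
also have "... = ev0 ([:a:] * [:d:] + [:b:] * [:0,1:]*A)/ev0 ([:b:] * [:d:])" using nz[OF c(2)] nz[OF A(1)] by(simp only: m) (simp add: field_simps)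
also have "[:b:] * [:d:] = [:b*d:]" by simp
finally show ?case using A(1) c(2) by(metis no_zero_divisors)
qed

lemma range_iota: "range iota = {ev0 A/ev0 B | A B. True}"
proof -
have "ev0 A/ev0 B : range iota" for A B
proof(cases "ev0 B = 0")
 case True thus ?thesis using iota_zero by(metis div_by_0 rangeI)
next
 case False
 then obtain r where "iota r = inverse (ev0 B)" using iota_inverse_ex unfolding ev0_def by blast
 thus ?thesis by(metis ev0_def iota_mult divide_inverse rangeI)
qed
thus ?thesis using iota_quotient by fastforce
qed

end

text \<open>The function field is modelled inside a field type, where type-class arithmetic is available:
  \<open>th\<close> identifies it with the field of fractions of the values of \<open>ev\<close>.\<close>

locale curve = ff_context +
fixes ev :: "complex poly poly => 'l::field" and th :: "ff_elem => 'l"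
assumes ev_add: "ev (A+B) = ev A+ev B" and ev_mult: "ev (A*B) = ev A*ev B"
 and ev_eq_0_iff: "ev A = 0 \<longleftrightarrow> chi dvd A" and ev_one: "ev 1 = 1"
 and ev_quot: "EX A d. d ~= 0 & ev B/ev C = ev A/ev [:d:]"
 and th_bij: "bij_betw th (carrier (function_field chi)) {ev A/ev B | A B. True}"
 and th_add: "f : carrier (function_field chi) ==> g : carrier (function_field chi) ==>
   th (f \<oplus>\<^bsub>function_field chi\<^esub> g) = th f+th g"
 and th_mult: "f : carrier (function_field chi) ==> g : carrier (function_field chi) ==>
   th (f \<otimes>\<^bsub>function_field chi\<^esub> g) = th f*th g"
 and th_one: "th \<one>\<^bsub>function_field chi\<^esub> = 1"
 and th_const: "th (ff_const chi c) = ev [:[:c:]:]"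
 and th_x: "th (ff_x chi) = ev [:[:0,1:]:]" and th_y: "th (ff_y chi) = ev [:0,1:]"

theorem (in ff_context) curve_model: "curve chi n ev0 theta"
proof unfold_locales
fix A B C :: "complex poly poly"
show "ev0 (A+B) = ev0 A+ev0 B" "ev0 (A*B) = ev0 A*ev0 B" by(simp_all add: ev0_def iota_add iota_mult)
show "ev0 A = 0 \<longleftrightarrow> chi dvd A" by(rule ev0_eq_0_iff)
show "ev0 1 = 1" by(simp add: ev0_def iota_one)
have "ev0 B/ev0 C : range iota" unfolding range_iota by blast
thus "EX A d. d ~= 0 & ev0 B/ev0 C = ev0 A/ev0 [:d:]" using iota_quotient by auto
show "bij_betw theta (carrier (function_field chi)) {ev0 A/ev0 B | A B. True}" unfolding range_iota[symmetric] carrier_ff bij_betw_def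
 by(auto simp: inj_on_def theta_class image_iff ff_class_eq_iff iota_eq_0_iff[symmetric] iota_diff)
show "theta (ff_const chi c) = ev0 [:[:c:]:]" for c by(simp add: ff_const_def theta_class ev0_def map_poly_pCons)
show "theta (ff_x chi) = ev0 [:[:0,1:]:]" by(simp add: ff_x_def theta_class ev0_def map_poly_pCons)
show "theta (ff_y chi) = ev0 [:0,1:]" by(simp add: ff_y_def theta_class ev0_def map_poly_pCons)
qed (auto simp: carrier_ff ff_add ff_mult ff_one theta_class iota_add iota_mult iota_one)

context curve begin

abbreviation FF where "FF \<equiv> function_field chi"

definition cst :: "complex => 'l" where "cst c = ev [:[:c:]:]"
definition Xc :: 'l where "Xc = ev [:[:0,1:]:]"
definition Yc :: 'l where "Yc = ev [:0,1:]"
definition K :: "'l set" where "K = {ev A/ev B | A B. True}"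

interpretation FF: cring FF by(rule cring_ff)

lemma ev_zero: "ev 0 = 0" by(simp add: ev_eq_0_iff)
lemma ev_minus: "ev (- A) = - ev A"
using ev_add[of A "- A"] by(simp add: ev_zero eq_neg_iff_add_eq_0 add.commute)
lemma ev_diff: "ev (A-B) = ev A-ev B"
using ev_add[of A "- B"] by(simp add: ev_minus)
lemma ev_power: "ev (A ^ k) = ev A ^ k"
by(induction k) (simp_all add: ev_one ev_mult)
lemma ev_sum: "ev (SUM i:S. f i) = (SUM i:S. ev (f i))"
by(induction S rule: infinite_finite_induct) (simp_all add: ev_zero ev_add)

lemma cst_add: "cst (a+b) = cst a+cst b"
unfolding cst_def ev_add[symmetric] by simp
lemma cst_mult: "cst (a*b) = cst a*cst b"
unfolding cst_def ev_mult[symmetric] by simp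
lemma cst_0 [simp]: "cst 0 = 0" unfolding cst_def by(simp add: ev_zero)
lemma cst_1 [simp]: "cst 1 = 1" unfolding cst_def using ev_one by(simp add: one_pCons)
lemma cst_minus: "cst (- a) = - cst a"
unfolding cst_def ev_minus[symmetric] by simp
lemma cst_diff: "cst (a-b) = cst a-cst b"
unfolding cst_def ev_diff[symmetric] by simp
lemma ev_deg0: assumes "d ~= 0" shows "ev [:d:] ~= 0"
unfolding ev_eq_0_iff using assms degree_chi n_pos by(metis dvd_imp_degree_le degree_pCons_0 leD pCons_eq_0_iff)
lemma cst_eq_0 [simp]: "cst a = 0 \<longleftrightarrow> a = 0"
using ev_deg0[of "[:a:]"] by(cases "a = 0") (auto simp: cst_def ev_zero)
lemma cst_inverse: "cst (inverse a) = inverse (cst a)"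
proof(cases "a = 0")
case False
hence "cst (inverse a)*cst a = 1" unfolding cst_mult[symmetric] by simp
thus ?thesis using inverse_unique[of "cst a" "cst (inverse a)"] by(simp add: mult.commute)
qed simp
lemma cst_sum: "cst (SUM i:S. f i) = (SUM i:S. cst (f i))"
by(induction S rule: infinite_finite_induct) (simp_all add: cst_add)

lemma K_I: "ev A/ev B : K" unfolding K_def by blast
lemma K_ev: "ev A : K" using K_I[of A 1] by(simp add: ev_one)
lemma K_mult: assumes "a : K" "b : K" shows "a*b : K"
proof -
obtain A B C D where "a = ev A/ev B" "b = ev C/ev D" using assms unfolding K_def by blast
hence "a*b = ev (A*C)/ev (B*D)" by(simp add: ev_mult)
thus ?thesis unfolding K_def by blast
qed
lemma K_add: assumes "a : K" "b : K" shows "a+b : K"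
proof -
obtain A B C D where AB: "a = ev A/ev B" "b = ev C/ev D" using assms unfolding K_def by blast
show ?thesis
proof(cases "ev B = 0 | ev D = 0")
 case True thus ?thesis using AB assms by auto
next
 case False
 hence "a+b = ev (A*D+C*B)/ev (B*D)" using AB by(simp add: ev_mult ev_add field_simps)
 thus ?thesis unfolding K_def by blast
qed
qed
lemma K_inverse: assumes "a : K" shows "inverse a : K"
proof -
obtain A B where "a = ev A/ev B" using assms unfolding K_def by blast
hence "inverse a = ev B/ev A" by simp
thus ?thesis unfolding K_def by blast
qed
lemma K_cst: "cst c : K" unfolding cst_def by(rule K_ev)
lemma K_Xc: "Xc : K" and K_Yc: "Yc : K" unfolding Xc_def Yc_def by(rule K_ev)+
lemma K_divide: "a : K ==> b : K ==> a/b : K"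
using K_mult[of a "inverse b"] K_inverse by(simp add: divide_inverse)
lemma K_power: "a : K ==> a ^ k : K"
by(induction k) (use K_cst[of 1] in \<open>auto intro: K_mult\<close>)
lemma K_powi: "a : K ==> a powi k : K"
by(cases k rule: int_cases2) (auto simp: power_int_minus intro: K_power K_inverse)

lemma K_quot: assumes "f : K" obtains A d where "d ~= 0" "f = ev A/ev [:d:]"
using assms ev_quot unfolding K_def by blast

lemma Xc_nonzero: "Xc ~= 0" unfolding Xc_def by(rule ev_deg0) simp
lemma Yc_nonzero: "Yc ~= 0"
proof
assume "Yc = 0"
hence "chi dvd [:0,1:]" by(simp add: Yc_def ev_eq_0_iff)
then obtain q where q: "[:0,1:] = chi*q" by blast
have qz: "q ~= 0" using q by auto
have "degree ([:0,1:] :: complex poly poly) = degree chi+degree q" unfolding q using qz chi_nonzero by(simp add: degree_mult_eq)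
hence "degree chi = 1" "degree q = 0" using n_pos degree_chi by auto
then obtain c where c: "q = [:c:]" by(metis degree_eq_zeroE)
have "Polynomial.coeff [:0,1:] 0 = Polynomial.coeff chi 0*c" unfolding q c by simp
hence "Polynomial.coeff chi 0 = 0" using qz c by auto
thus False using const by(simp add: coeff_vec_def)
qed

subsection \<open>Valuation rings\<close>

text \<open>The definition of \<open>places\<close> transported along \<open>th\<close>: valuation
  rings become subsets of a field, where inverses and differences need no carrier
  conditions.\<close>

definition vring :: "'l set => bool" where
"vring W \<longleftrightarrow> W <= K & W ~= K & range cst <= W &
  (ALL a:W. ALL b:W. a+b : W & a*b : W) & (ALL f:K. f ~= 0 --> f : W | inverse f : W)"

definition vmax :: "'l set => 'l set" where "vmax W = {f : W. f = 0 | inverse f ~: W}"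
definition pval :: "'l => 'l set => complex" where "pval f W = (THE c. f-cst c : vmax W)"
definition place_of :: "'l set => place" where "place_of W = {f : carrier FF. th f : W}"

lemma th_image: "th ` carrier FF = K" and th_inj: "inj_on th (carrier FF)"
using th_bij by(auto simp: K_def bij_betw_def)

lemma th_in_K: "f : carrier FF ==> th f : K" using th_image by blast

lemma th_zero: "th \<zero>\<^bsub>FF\<^esub> = 0"
proof -
have "th \<zero>\<^bsub>FF\<^esub>+0 = th \<zero>\<^bsub>FF\<^esub>+th \<zero>\<^bsub>FF\<^esub>"
 using th_add[of "\<zero>\<^bsub>FF\<^esub>" "\<zero>\<^bsub>FF\<^esub>"] by(simp only: FF.zero_closed FF.l_zero add_0_right simp_thms)
thus ?thesis by(metis add_left_cancel)
qed

lemma th_eq_0: "f : carrier FF ==> th f = 0 \<longleftrightarrow> f = \<zero>\<^bsub>FF\<^esub>"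
using th_zero th_inj by(metis FF.zero_closed inj_onD)

lemma th_uminus: assumes "f : carrier FF" shows "th (\<ominus>\<^bsub>FF\<^esub> f) = - th f"
using th_add[OF FF.a_inv_closed[OF assms] assms] FF.l_neg[OF assms] th_zero by(simp add: eq_neg_iff_add_eq_0)

lemma th_diff: "f : carrier FF ==> g : carrier FF ==> th (f \<ominus>\<^bsub>FF\<^esub> g) = th f-th g"
by(simp add: a_minus_def th_add th_uminus)

lemma th_inv:
assumes f: "f : carrier FF" "f ~= \<zero>\<^bsub>FF\<^esub>"
shows "inv\<^bsub>FF\<^esub> f : carrier FF" "th (inv\<^bsub>FF\<^esub> f) = inverse (th f)"
proof -
have nz: "th f ~= 0" using th_eq_0 f by blast
have "inverse (th f) : K" using K_inverse th_in_K f by blast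
then obtain g where g: "g : carrier FF" "th g = inverse (th f)" using th_image by(metis imageE)
have "th (f \<otimes>\<^bsub>FF\<^esub> g) = th \<one>\<^bsub>FF\<^esub>" using f g nz by(simp add: th_mult th_one)
hence "f \<otimes>\<^bsub>FF\<^esub> g = \<one>\<^bsub>FF\<^esub>" using th_inj f g by(meson FF.m_closed FF.one_closed inj_onD)
hence "inv\<^bsub>FF\<^esub> f = g" using FF.comm_inv_char f g by blast
thus "inv\<^bsub>FF\<^esub> f : carrier FF" "th (inv\<^bsub>FF\<^esub> f) = inverse (th f)" using g by auto
qed

lemma ff_const_carrier: "ff_const chi c : carrier FF" by(simp add: ff_const_def carrier_ff)
lemma ff_xy_carrier: "ff_x chi : carrier FF" "ff_y chi : carrier FF" by(simp_all add: ff_x_def ff_y_def carrier_ff)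

lemma th_mem_iff: assumes "O' <= carrier FF" "f : carrier FF" shows "th f : th ` O' \<longleftrightarrow> f : O'"
using assms th_inj by(meson inj_on_image_mem_iff)

lemma places_carrier: "O' : places chi ==> O' <= carrier FF"
unfolding places_def using subringE(1) by blast

lemma vring_image: assumes "O' : places chi" shows "vring (th ` O')"
proof -
have sub: "O' <= carrier FF" by(rule places_carrier[OF assms])
have sr: "subring O' FF" and ct: "range (ff_const chi) <= O'" and ne: "O' ~= carrier FF"
 and val: "!!f. f : carrier FF ==> f ~= \<zero>\<^bsub>FF\<^esub> ==> f : O' | inv\<^bsub>FF\<^esub> f : O'" using assms unfolding places_def by auto
have "th ` O' <= K" using sub th_in_K by blast
moreover have "th ` O' ~= K" using ne sub th_inj th_image by(metis inj_on_image_eq_iff order_refl)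
moreover have "range cst <= th ` O'" using ct by(auto simp: cst_def th_const[symmetric])
moreover have "a+b : th ` O' & a*b : th ` O'" if ab: "a : th ` O'" "b : th ` O'" for a b
proof -
 obtain f g where "f : O'" "g : O'" "a = th f" "b = th g" using ab by blast
 moreover from this have "f \<oplus>\<^bsub>FF\<^esub> g : O'" "f \<otimes>\<^bsub>FF\<^esub> g : O'" by(auto intro: subringE(6,7)[OF sr])
 moreover have "th (f \<oplus>\<^bsub>FF\<^esub> g) = a+b" "th (f \<otimes>\<^bsub>FF\<^esub> g) = a*b"
  using calculation sub by(auto intro!: th_add th_mult)
 ultimately show ?thesis by(metis imageI)
qed
moreover have "a : th ` O' | inverse a : th ` O'" if a: "a : K" "a ~= 0" for a
proof -
 obtain f where f: "f : carrier FF" "a = th f" using a th_image by blast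
 hence "f ~= \<zero>\<^bsub>FF\<^esub>" using a th_zero by auto
 thus ?thesis using val[of f] th_inv[of f] f by(metis imageI)
qed
ultimately show ?thesis unfolding vring_def by blast
qed

lemma place_of_image: "O' : places chi ==> place_of (th ` O') = O'"
unfolding place_of_def using th_mem_iff[OF places_carrier] places_carrier by auto

lemma image_place_of: "W <= K ==> th ` place_of W = W"
unfolding place_of_def th_image[symmetric] by auto

lemma vringD:
assumes "vring W"
shows "W <= K" "W ~= K" "cst c : W" "a : W ==> b : W ==> a+b : W"
 "a : W ==> b : W ==> a*b : W" "f : K ==> f ~: W ==> inverse f : W"
proof -
note W = assms[unfolded vring_def]
show "W <= K" "W ~= K" "cst c : W" using W by auto
show "a : W ==> b : W ==> a+b : W" "a : W ==> b : W ==> a*b : W" using W by auto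
have "f ~= 0" if "f ~: W" using W that cst_0 by(metis rangeI subsetD)
thus "f : K ==> f ~: W ==> inverse f : W" using W by auto
qed

lemma vring_minus: assumes "vring W" "a : W" shows "- a : W"
using vringD(5)[OF assms(1) vringD(3)[OF assms(1), of "-1"] assms(2)] by(simp add: cst_minus)

lemma vring_0_1: assumes "vring W" shows "0 : W" "1 : W"
using vringD(3)[OF assms, of 0] vringD(3)[OF assms, of 1] by auto

lemma place_of_places: assumes W: "vring W" shows "place_of W : places chi"
proof -
have cl: "place_of W <= carrier FF" unfolding place_of_def by auto
have im: "th ` place_of W = W" by(rule image_place_of[OF vringD(1)[OF W]])
have "subring (place_of W) FF"
proof(rule FF.subringI)
 show "\<one>\<^bsub>FF\<^esub> : place_of W" using vring_0_1[OF W] unfolding place_of_def by(simp add: th_one)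
 show "\<ominus>\<^bsub>FF\<^esub> h : place_of W" if "h : place_of W" for h using that vring_minus[OF W] by(simp add: place_of_def th_uminus)
 show "f \<otimes>\<^bsub>FF\<^esub> h : place_of W" "f \<oplus>\<^bsub>FF\<^esub> h : place_of W"
  if "f : place_of W" "h : place_of W" for f h using that vringD(4,5)[OF W] by(simp_all add: place_of_def th_add th_mult)
qed (rule cl)
moreover have "range (ff_const chi) <= place_of W" using vringD(3)[OF W] ff_const_carrier th_const unfolding place_of_def cst_def by auto
moreover have "place_of W ~= carrier FF" using im th_image vringD(2)[OF W] by metis
moreover have "f : place_of W | inv\<^bsub>FF\<^esub> f : place_of W"
 if f: "f : carrier FF" "f ~= \<zero>\<^bsub>FF\<^esub>" for f using th_inv[OF f] f vringD(6)[OF W th_in_K[OF f(1)]] unfolding place_of_def by auto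
ultimately show ?thesis unfolding places_def by auto
qed

lemma place_ideal_iff:
assumes O: "O' : places chi" and f: "f : carrier FF"
shows "f : place_ideal chi O' \<longleftrightarrow> th f : vmax (th ` O')"
proof(cases "f = \<zero>\<^bsub>FF\<^esub>")
case True
thus ?thesis unfolding place_ideal_def vmax_def using th_mem_iff[OF places_carrier[OF O] f] th_zero by auto
next
case False
have "inv\<^bsub>FF\<^esub> f : O' \<longleftrightarrow> inverse (th f) : th ` O'"
 using th_mem_iff[OF places_carrier[OF O]] th_inv[OF f False] by metis
thus ?thesis unfolding place_ideal_def vmax_def using th_mem_iff[OF places_carrier[OF O] f] th_eq_0[OF f] False by auto
qed

lemma place_value_eq:
assumes "O' : places chi" "f : carrier FF"
shows "pv chi f O' = pval (th f) (th ` O')"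
proof -
have "th (f \<ominus>\<^bsub>FF\<^esub> ff_const chi c) = th f-cst c" for c using assms ff_const_carrier by(simp add: th_diff th_const cst_def)
hence "f \<ominus>\<^bsub>FF\<^esub> ff_const chi c : place_ideal chi O' \<longleftrightarrow> th f-cst c : vmax (th ` O')" for c
 using place_ideal_iff[OF assms(1), of "f \<ominus>\<^bsub>FF\<^esub> ff_const chi c"] assms(2) ff_const_carrier by auto
thus ?thesis unfolding place_value_def pval_def by simp
qed

end

subsection \<open>Values of polynomials\<close>

definition pe :: "complex poly poly => complex => complex => complex" where
"pe A s t = poly (poly A [:t:]) s"

lemma pe_simps [simp]:
"pe (A+B) s t = pe A s t+pe B s t" "pe (A-B) s t = pe A s t-pe B s t"
"pe (A*B) s t = pe A s t*pe B s t" "pe (- A) s t = - pe A s t"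
"pe 0 s t = 0" "pe 1 s t = 1" "pe (A ^ k) s t = pe A s t ^ k" "pe [:d:] s t = poly d s" "pe (smult d A) s t = poly d s*pe A s t"
"pe [:0,1:] s t = t" by(simp_all add: pe_def poly_power)

lemma pe_sum: "pe (SUM i:I. A i) s t = (SUM i:I. pe (A i) s t)"
by(induction I rule: infinite_finite_induct) simp_all

lemma poly_map_poly_pe: "poly (map_poly (%p. poly p s) A) t = pe A s t"
proof(induction A)
case (pCons c A)
have "map_poly (%p. poly p s) (pCons c A) = pCons (poly c s) (map_poly (%p. poly p s) A)"
 by(intro poly_eqI) (simp add: coeff_map_poly coeff_pCons split: nat.split)
thus ?case using pCons.IH by(simp add: pe_def)
qed (simp add: pe_def)

lemma clear_denominators:
fixes q :: "complex poly fract poly"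
shows "EX D B. D ~= 0 & fract_poly [:D:]*q = fract_poly B"
proof(induction q)
case 0 show ?case by(intro exI[of _ 1] exI[of _ 0]) simp
next
case (pCons c q)
then obtain D B where B: "D ~= 0" "fract_poly [:D:]*q = fract_poly B" by blast
obtain a b where c: "c = Fract a b" "b ~= 0" by(cases c) auto
have "c*to_fract b = to_fract a" using c by(simp add: to_fract_def eq_fract)
hence 1: "[:c:]*fract_poly [:b:] = fract_poly [:a:]" by(simp add: map_poly_pCons mult.commute)
have "fract_poly [:D*b:]*pCons c q = fract_poly [:D:]*fract_poly [:b:]*([:c:] + [:0,1:]*q)" by(simp add: map_poly_pCons mult.commute)
also have "... = fract_poly [:D:]*([:c:]*fract_poly [:b:])+fract_poly [:b:] * [:0,1:]*(fract_poly [:D:]*q)" by(simp only: alg)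
also have "... = fract_poly ([:D:] * [:a:] + [:b:] * [:0,1:]*B)" unfolding 1 B(2) by(simp add: map_poly_pCons)
finally show ?case using B(1) c(2) by(metis no_zero_divisors)
qed

context curve begin

text \<open>Bezout over C(x) with denominators cleared. The polynomial d plays the part of a
  resultant: its roots contain the x-coordinates of all common zeros of chi and A.\<close>

lemma clear_bezout:
assumes "~ chi dvd A"
obtains a b d where "d ~= 0" "a*chi+b*A = [:d:]"
proof -
have "~ fract_poly chi dvd fract_poly A" using assms fract_poly_dvdD[OF _ irr_fract(2)] by blast
then obtain a b where ab: "a*fract_poly chi+b*fract_poly A = 1" using coprime_bezout by blast
obtain D B where B: "D ~= 0" "fract_poly [:D:]*a = fract_poly B" using clear_denominators by blast
obtain E C where C: "E ~= 0" "fract_poly [:E:]*b = fract_poly C" using clear_denominators by blast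
have "fract_poly ([:E:]*B*chi + [:D:]*C*A)
  = fract_poly [:E:]*(fract_poly [:D:]*a)*fract_poly chi
   + fract_poly [:D:]*(fract_poly [:E:]*b)*fract_poly A" unfolding B C fract_poly_add fract_poly_mult by(simp only: mult.assoc)
also have "... = fract_poly [:D:]*fract_poly [:E:]*(a*fract_poly chi+b*fract_poly A)" by(simp only: alg)
also have "... = fract_poly ([:D:] * [:E:])" unfolding ab by(simp only: mult_1_right fract_poly_mult)
finally have "[:E:]*B*chi + [:D:]*C*A = [:D*E:]" unfolding fract_poly_eq_iff by simp
moreover have "D*E ~= 0" using B C by simp
ultimately show ?thesis using that by blast
qed

lemma fiber_poly: 
shows "degree (map_poly (%p. poly p s) chi) = n" "lead_coeff (map_poly (%p. poly p s) chi) = 1"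
proof -
show d: "degree (map_poly (%p. poly p s) chi) = n"
proof(rule antisym)
 show "degree (map_poly (%p. poly p s) chi) <= n" by(rule degree_le) (simp add: coeff_map_poly coeff_eq_0 degree_chi)
 have "Polynomial.coeff (map_poly (%p. poly p s) chi) n = 1" using degree_chi by(simp add: coeff_map_poly)
 thus "n <= degree (map_poly (%p. poly p s) chi)" by(intro le_degree) simp
qed
show "lead_coeff (map_poly (%p. poly p s) chi) = 1" using degree_chi by(simp add: d coeff_map_poly)
qed

lemma finite_fiber: "finite {t. pe chi s t = 0}"
proof -
have "map_poly (%p. poly p s) chi ~= 0" using fiber_poly(2)[of s] by auto
thus ?thesis using poly_roots_finite by(simp add: poly_map_poly_pe[symmetric])
qed

lemma finite_common_zeros:
assumes "~ chi dvd A"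
shows "finite {(s,t). pe chi s t = 0 & pe A s t = 0}"
proof -
obtain a b d where d: "d ~= 0" "a*chi+b*A = [:d:]" by(rule clear_bezout[OF assms])
have "{(s,t). pe chi s t = 0 & pe A s t = 0} <= (SIGMA s:{s. poly d s = 0}. {t. pe chi s t = 0})"
proof safe
 fix s t assume "pe chi s t = 0" "pe A s t = 0"
 hence "pe (a*chi+b*A) s t = 0" by simp
 hence "pe [:d:] s t = 0" by(simp only: d(2))
 thus "poly d s = 0" by simp
qed
moreover have "finite (SIGMA s:{s. poly d s = 0}. {t. pe chi s t = 0})" by(intro finite_SigmaI finite_fiber poly_roots_finite[OF d(1)])
ultimately show ?thesis by(rule finite_subset)
qed

lemma pe_zero_if_ev_zero: "ev A = 0 ==> pe chi s t = 0 ==> pe A s t = 0"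
unfolding ev_eq_0_iff by auto

end

subsection \<open>Laurent monomials and charts\<close>

definition lm :: "'a::field => 'a => int \<times> int => 'a" where
"lm s t w = s powi fst w*t powi snd w"

lemma lm_add: "s ~= 0 ==> t ~= 0 ==> lm s t (a+b) = lm s t a*lm s t b"
by(simp add: lm_def power_int_add)

lemma lm_nonzero: "s ~= 0 ==> t ~= 0 ==> lm s t a ~= 0" by(simp add: lm_def)

lemma lm_minus: "lm s t (- a) = inverse (lm s t a)"
by(simp add: lm_def power_int_minus)

lemma lm_diff: "s ~= 0 ==> t ~= 0 ==> lm s t (a-b) = lm s t a/lm s t b"
using lm_add[of s t a "- b"] by(simp add: lm_minus divide_inverse)

lemma lm_powi: "lm s t (k*fst w,k * snd w) = lm s t w powi k"
proof -
have "s powi (k*fst w) = (s powi fst w) powi k" "t powi (k * snd w) = (t powi snd w) powi k" by(metis power_int_mult mult.commute)+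
thus ?thesis by(simp add: lm_def power_int_mult_distrib)
qed

definition ipt :: "mon => int \<times> int" where "ipt e = (ix e,iy e)"

text \<open>Twice the signed area of the triangle e, f, h. As a function of the last argument it is
  an affine form vanishing on the line through e and f.\<close>

definition det3 :: "mon => mon => mon => int" where
"det3 e f h = (ix f-ix e)*(iy h-iy e)
 - (iy f-iy e)*(ix h-ix e)"

type_synonym triple = "mon \<times> mon \<times> (mon)"

text \<open>The line through e and f supports A, with A on its left; e is the first point of A on
  that line, f - e is primitive, and h lies at lattice distance one. Thus h - e and f - e form a
  lattice basis adapted to an edge.\<close>

definition charts :: "mon set => triple set" where
"charts A = {(e,f,h). e : A & f : A & h : A & det3 e f h = 1 &
  (ALL g:A. det3 e f g >= 0 & (det3 e f g = 0 --> det3 e g h >= 0))}"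

definition bas :: "triple => mon" where "bas h = fst h"
definition wU :: "triple => int \<times> int" where "wU h = ipt (snd (snd h))-ipt (fst h)"
definition wV :: "triple => int \<times> int" where "wV h = ipt (fst (snd h))-ipt (fst h)"
text \<open>\<open>dd\<close> and \<open>jj\<close> are the coordinates of g - e in the lattice
  basis h - e, f - e. The first is the distance from the edge, nonnegative on A and therefore kept
  as a natural number; the second may be negative off the edge.\<close>

definition dd :: "triple => mon => nat" where
"dd h g = nat (det3 (fst h) (fst (snd h)) g)"
definition jj :: "triple => mon => int" where "jj h g = det3 (fst h) g (snd (snd h))"

text \<open>Cramer's rule for the basis h - e, f - e. Multiplying the left side by the determinant 1
  turns it into a polynomial identity.\<close>

lemma det_expand:
assumes "det3 e f h = 1"
shows "ipt g-ipt e = (det3 e f g*fst (ipt h-ipt e)+det3 e g h*fst (ipt f-ipt e),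
  det3 e f g * snd (ipt h-ipt e)+det3 e g h * snd (ipt f-ipt e))"
proof -
have *: "x*det3 e f h = x" for x using assms by simp
have "fst (ipt g-ipt e) = det3 e f g*fst (ipt h-ipt e)+det3 e g h*fst (ipt f-ipt e)"
 by(subst *[of "fst (ipt g-ipt e)", symmetric]) (simp add: det3_def ipt_def alg)
moreover have "snd (ipt g-ipt e) = det3 e f g * snd (ipt h-ipt e)+det3 e g h * snd (ipt f-ipt e)"
 by(subst *[of "snd (ipt g-ipt e)", symmetric]) (simp add: det3_def ipt_def alg)
ultimately show ?thesis by(intro prod_eqI) simp_all
qed

lemma lm_chart:
assumes "q : charts A" "g : A" "s ~= 0" "t ~= 0"
shows "lm s t (ipt g-ipt (bas q)) = lm s t (wU q)^dd q g*lm s t (wV q) powi jj q g"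
proof -
obtain e f h where th: "q = (e,f,h)" by(cases q)
have d: "det3 e f h = 1" "det3 e f g >= 0" using assms(1,2) unfolding charts_def th by auto
have "lm s t (ipt g-ipt e) = lm s t (det3 e f g*fst (wU q),det3 e f g * snd (wU q))
  * lm s t (det3 e g h*fst (wV q),det3 e g h * snd (wV q))"
 by(subst det_expand[OF d(1)], subst lm_add[symmetric]) (simp_all add: assms wU_def wV_def th)
thus ?thesis unfolding lm_powi using d(2) by(simp add: th bas_def dd_def jj_def power_int_def)
qed

text \<open>With c the coefficients of chi this is chi divided by the monomial of the base point e,
  in the coordinates U and V: a polynomial in U, a Laurent polynomial in V. \<open>gU\<close> and
  \<open>gV\<close> are its partial derivatives.\<close>

definition gth :: "(mon => complex) => mon set => triple => complex \<times> complex => complex" where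
"gth c A h p = (SUM g:A. c g*(fst p^dd h g * snd p powi jj h g))"
definition gU :: "(mon => complex) => mon set => triple => complex \<times> complex => complex" where
"gU c A h p = (SUM g:A. c g*(of_nat (dd h g)*fst p^(dd h g-1) * snd p powi jj h g))"
definition gV :: "(mon => complex) => mon set => triple => complex \<times> complex => complex" where
"gV c A h p = (SUM g:A. c g*(fst p^dd h g*(of_int (jj h g) * snd p powi (jj h g-1))))"

definition cpts :: "(mon => complex) => mon set => triple => (complex \<times> complex) set" where
"cpts c A h = {p. snd p ~= 0 & gth c A h p = 0}"

text \<open>Faces described by duality: an affine relation whose negative part is supported in S has
  its positive part there too. A relation says that a product of powers of monomials is 1, which is
  how valuations and homogeneous coordinates give rise to closed faces.\<close>

definition closed_face :: "mon set => mon set => bool" where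
"closed_face A S \<longleftrightarrow> S <= A & (ALL w::mon => int.
  (SUM g:A. w g) = 0 --> (SUM g:A. w g*ix g) = 0 --> (SUM g:A. w g*iy g) = 0 -->
  (ALL g:A. w g < 0 --> g : S) --> (ALL g:A. w g > 0 --> g : S))"

text \<open>\<open>smooth\<close> combines smoothness in the torus with transversality to the
  boundary, since for \<open>fst p = 0\<close> it forces \<open>gV\<close> to be nonzero.
  \<open>faces\<close> supplies a chart along each closed face with two points, whose third point
  leaves S unless S is everything. \<open>unimodular\<close> provides monomials from whose ratios x
  and y are recovered.\<close>

locale nondeg = curve chi n ev th
for chi :: "complex poly poly" and n :: nat and ev :: "complex poly poly => 'l::field" and th :: "ff_elem => 'l" +
fixes A :: "mon set"
assumes finA: "finite A" and suppA: "coeff_vec chi g ~= 0 \<longleftrightarrow> g : A"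
 and smooth: "h : charts A ==> p : cpts (coeff_vec chi) A h ==>
   gV (coeff_vec chi) A h p ~= 0 | fst p ~= 0 & gU (coeff_vec chi) A h p ~= 0"
 and faces: "closed_face A S ==> a : S ==> b : S ==> a ~= b ==>
   EX h:charts A. fst h : S & fst (snd h) : S & (snd (snd h) : S --> S = A)"
 and unimodular: "EX b. {(0,0),(0,1),(1,b)} <= A"

definition mono2 :: "complex => mon => complex poly poly" where
"mono2 c g = [:[:c:]:] * [:[:0,1:]:]^fst g * [:0,1:] ^ snd g"

lemma mono2_monom: "mono2 c g = monom (monom c (fst g)) (snd g)"
proof -
have "([:[:0,1:]:] :: complex poly poly) ^ k = [:[:0,1:] ^ k:]" for k by(induction k) (simp_all add: one_pCons)
thus ?thesis by(simp add: mono2_def monom_altdef)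
qed

lemma poly_as_sum:
assumes "finite A" "!!g. coeff_vec chi g ~= 0 ==> g : A"
shows "chi = (SUM g:A. mono2 (coeff_vec chi g) g)"
proof(intro poly_eqI)
fix m a
have "Polynomial.coeff (Polynomial.coeff (SUM g:A. mono2 (coeff_vec chi g) g) m) a
  = (SUM g:A. if g = (a,m) then coeff_vec chi g else 0)" unfolding coeff_sum by(intro sum.cong) (auto simp: mono2_monom coeff_monom)
also have "... = coeff_vec chi (a,m)" using assms by(auto simp: sum.delta')
finally show "Polynomial.coeff (Polynomial.coeff chi m) a =
  Polynomial.coeff (Polynomial.coeff (SUM g:A. mono2 (coeff_vec chi g) g) m) a" by(simp add: coeff_vec_def)
qed

lemma pe_mono2: "pe (mono2 c g) s t = c*(mn s t g)"
by(simp add: mono2_def)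

lemma (in curve) ev_mono2: "ev (mono2 c g) = cst c*(mn Xc Yc g)"
unfolding mono2_def ev_mult ev_power cst_def Xc_def Yc_def by(simp only: mult.assoc)

context nondeg begin

abbreviation "cc \<equiv> coeff_vec chi"
abbreviation (input) "lp s t h \<equiv> (lm s t (wU h),lm s t (wV h))"

lemma pe_chi: "pe chi s t = (SUM g:A. cc g*(mn s t g))"
proof -
have "pe chi s t = pe (SUM g:A. mono2 (cc g) g) s t" using poly_as_sum[OF finA, of chi] suppA by auto
thus ?thesis by(simp only: pe_sum pe_mono2)
qed

lemma sum_chi: "(SUM g:A. cst (cc g)*(mn Xc Yc g)) = 0"
proof -
have "ev chi = 0" by(simp add: ev_eq_0_iff)
moreover have "ev chi = ev (SUM g:A. mono2 (cc g) g)" using poly_as_sum[OF finA, of chi] suppA by auto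
ultimately show ?thesis by(simp only: ev_sum ev_mono2)
qed

lemma lm_nat: "s ~= 0 ==> t ~= 0 ==> s^fst g*t ^ snd g = lm s t (ipt e)*lm s t (ipt g-ipt e)"
using lm_add[of s t "ipt e" "ipt g-ipt e"] by(simp add: lm_def ipt_def power_int_def)

lemma pe_chi_chart:
assumes "h : charts A" "s ~= 0" "t ~= 0"
shows "pe chi s t = lm s t (ipt (bas h))*gth cc A h (lp s t h)" unfolding pe_chi gth_def sum_distrib_left
proof(intro sum.cong refl)
fix g assume "g : A"
thus "cc g*(mn s t g) = lm s t (ipt (bas h)) *
  (cc g*(fst (lp s t h)^dd h g * snd (lp s t h) powi jj h g))" using assms lm_nat[of s t g "bas h"] lm_chart[OF assms(1), of g s t] by simp
qed

definition Uc where "Uc h = lm Xc Yc (wU h)"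
definition Vc where "Vc h = lm Xc Yc (wV h)"

lemma Uc_nonzero: "Uc h ~= 0" and Vc_nonzero: "Vc h ~= 0"
unfolding Uc_def Vc_def using lm_nonzero Xc_nonzero Yc_nonzero by blast+

lemma sum_chart:
assumes "h : charts A"
shows "(SUM g:A. cst (cc g)*(Uc h^dd h g*Vc h powi jj h g)) = 0"
proof -
have "(SUM g:A. cst (cc g)*(mn Xc Yc g))
  = lm Xc Yc (ipt (bas h))*(SUM g:A. cst (cc g)*(Uc h^dd h g*Vc h powi jj h g))" unfolding sum_distrib_left
proof(intro sum.cong refl)
 fix g assume "g : A"
 thus "cst (cc g)*(mn Xc Yc g) = lm Xc Yc (ipt (bas h)) *
   (cst (cc g)*(Uc h^dd h g*Vc h powi jj h g))"
  using assms lm_nat[OF Xc_nonzero Yc_nonzero, of g "bas h"] lm_chart[OF assms _ Xc_nonzero Yc_nonzero, of g] by(simp add: Uc_def Vc_def)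
qed
thus ?thesis using sum_chi lm_nonzero[OF Xc_nonzero Yc_nonzero] by simp
qed

end

text \<open>The monomial map with the inverse exponent matrix: it recovers x (\<open>backS\<close>)
  and y (\<open>backT\<close>) from the chart coordinates U and V.\<close>

definition backS :: "triple => 'a::field => 'a => 'a" where
"backS h u v = u powi (- snd (wV h)) * v powi (snd (wU h))"
definition backT :: "triple => 'a::field => 'a => 'a" where
"backT h u v = u powi (fst (wV h)) * v powi (- fst (wU h))"

lemma back_nonzero: "u ~= 0 ==> v ~= 0 ==> backS h u v ~= 0 & backT h u v ~= 0"
by(simp add: backS_def backT_def)

lemma powi_comb:
fixes u v :: "'a::field"
assumes "u ~= 0" "v ~= 0"
shows "(u powi a * v powi b) powi c*(u powi a' * v powi b') powi c'
 = u powi (a*c+a'*c') * v powi (b*c+b'*c')" using assms by(simp add: power_int_mult_distrib power_int_add power_int_mult[symmetric] mult_ac)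

lemma chart_det: "h : charts A ==> fst (wV h) * snd (wU h) - snd (wV h)*fst (wU h) = 1"
by(auto simp: charts_def wU_def wV_def det3_def ipt_def)

lemma lm_back:
fixes u v :: "'a::field"
assumes "h : charts A" "u ~= 0" "v ~= 0"
shows "lm (backS h u v) (backT h u v) (wU h) = u" "lm (backS h u v) (backT h u v) (wV h) = v"
proof -
note d = chart_det[OF assms(1)]
have "- snd (wV h)*fst (wU h)+fst (wV h) * snd (wU h) = 1"
 "snd (wU h)*fst (wU h) + - fst (wU h) * snd (wU h) = 0"
 "- snd (wV h)*fst (wV h)+fst (wV h) * snd (wV h) = 0"
 "snd (wU h)*fst (wV h) + - fst (wU h) * snd (wV h) = 1" using d by(simp_all add: alg)
thus "lm (backS h u v) (backT h u v) (wU h) = u" "lm (backS h u v) (backT h u v) (wV h) = v"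
 unfolding lm_def backS_def backT_def powi_comb[OF assms(2,3)] by simp_all
qed

lemma back_lm:
fixes s t :: "'a::field"
assumes "h : charts A" "s ~= 0" "t ~= 0"
shows "backS h (lm s t (wU h)) (lm s t (wV h)) = s" "backT h (lm s t (wU h)) (lm s t (wV h)) = t"
proof -
note d = chart_det[OF assms(1)]
have "fst (wU h) * - snd (wV h)+fst (wV h) * snd (wU h) = 1"
 "snd (wU h) * - snd (wV h) + snd (wV h) * snd (wU h) = 0"
 "fst (wU h)*fst (wV h)+fst (wV h) * - fst (wU h) = 0"
 "snd (wU h)*fst (wV h) + snd (wV h) * - fst (wU h) = 1" using d by(simp_all add: alg)
thus "backS h (lm s t (wU h)) (lm s t (wV h)) = s" "backT h (lm s t (wU h)) (lm s t (wV h)) = t"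
 unfolding lm_def backS_def backT_def powi_comb[OF assms(2,3)] by simp_all
qed

section \<open>Calculus in a chart and branches of the curve\<close>

lemma gth_deriv:
assumes "snd p ~= 0"
shows "(gth c A q has_derivative (%h. gU c A q p*fst h+gV c A q p * snd h)) (at p)"
proof -
have 1: "((%p. fst p ^ k) has_derivative (%h. (of_nat k*fst p^(k-1))*fst h)) (at p)"
 for k :: nat and p :: "complex \<times> complex" by(auto intro!: derivative_eq_intros simp: alg)
have 2: "((%p. snd p powi j) has_derivative (%h. (of_int j * snd p powi (j-1)) * snd h)) (at p)"
 for j :: int
proof -
 have "((%x. x powi j) hfd of_int j * snd p powi (j-1)*1) (at (snd p))" by(rule DERIV_power_int[OF DERIV_ident disjI2[OF assms]])
 hence "((%x. x powi j) has_derivative (%h. (of_int j * snd p powi (j-1))*h)) (at (snd p))" by(simp add: has_field_derivative_def)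
 from has_derivative_compose[where s=UNIV and x=p, OF has_derivative_snd[OF has_derivative_ident] this]
 show ?thesis by simp
qed
have "((%p. SUM g:A. c g*(fst p^dd q g * snd p powi jj q g)) has_derivative
  (%h. SUM g:A. c g*(fst p^dd q g*((of_int (jj q g) * snd p powi (jj q g-1)) * snd h)
   + (of_nat (dd q g)*fst p^(dd q g-1))*fst h * snd p powi jj q g))) (at p)"
 by(intro has_derivative_sum has_derivative_mult_right has_derivative_mult 1 2)
moreover have "(%h. SUM g:A. c g*(fst p^dd q g*((of_int (jj q g) * snd p powi (jj q g-1)) * snd h)
   + (of_nat (dd q g)*fst p^(dd q g-1))*fst h * snd p powi jj q g))
  = (%h. gU c A q p*fst h+gV c A q p * snd h)" unfolding gU_def gV_def sum_distrib_right sum.distrib[symmetric]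
 by(intro ext sum.cong refl) (simp add: alg)
ultimately show ?thesis unfolding gth_def[abs_def] by simp
qed

lemma gUV_cont: "continuous_on {p. snd p ~= 0} (gU c A h)" "continuous_on {p. snd p ~= 0} (gV c A h)"
"continuous_on {p. snd p ~= 0} (gth c A h)" unfolding gU_def[abs_def] gV_def[abs_def] gth_def[abs_def] by(intro continuous_intros; auto)+

lemma gth_partial:
assumes "snd p ~= 0"
shows "((%u. gth c A q (u,snd p)) hfd gU c A q p) (at (fst p))"
 "((%v. gth c A q (fst p,v)) hfd gV c A q p) (at (snd p))"
proof -
have "((%u. (u,snd p)) has_derivative (%h. (h,0))) (at (fst p))"
 "((%v. (fst p,v)) has_derivative (%h. (0,h))) (at (snd p))" by(auto intro!: derivative_eq_intros)
note * = this[THEN has_derivative_compose, of "gth c A q"]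
have g: "(gth c A q has_derivative (%h. gU c A q p*fst h+gV c A q p * snd h)) (at (fst p,snd p))" using gth_deriv[OF assms] by simp
show "((%u. gth c A q (u,snd p)) hfd gU c A q p) (at (fst p))"
 "((%v. gth c A q (fst p,v)) hfd gV c A q p) (at (snd p))" using *[OF g] by(simp_all add: has_field_derivative_def)
qed

text \<open>The flag b tells which chart coordinate, shifted to vanish at the centre, is the
  parameter: u if b holds, v otherwise. In the second case the whole branch stays off the boundary u
  = 0.\<close>

definition curve_par :: "(mon => complex) => mon set => triple => (complex => complex \<times> complex)
 => real => bool => bool" where
"curve_par c A h G r b \<longleftrightarrow> r > 0 & (%u. fst (G u)) hol_on ball 0 r &
  (%u. snd (G u)) hol_on ball 0 r &
  (ALL u:ball 0 r. G u : cpts c A h &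
   (if b then fst (G u) = fst (G 0)+u & gV c A h (G u) ~= 0
    else snd (G u) = snd (G 0)+u & fst (G u) ~= 0 & gU c A h (G u) ~= 0))"

abbreviation (in nondeg) "cpar \<equiv> curve_par cc A"

lemma curve_par_exists:
assumes p: "p : cpts c A ch" and nz: "if b then gV c A ch p ~= 0 else fst p ~= 0 & gU c A ch p ~= 0"
shows "EX C r ep. curve_par c A ch C r b & C 0 = p & ep > 0 &
  (ALL q:cpts c A ch. dist q p < ep --> q : C ` ball 0 r)"
proof(cases b)
case True
have open': "open {p::complex\<times>complex. snd p ~= 0}" by(intro open_Collect_neq continuous_intros)
define S where "S = {p. snd p ~= 0} \<inter> {p. gV c A ch p ~= 0}"
have S: "open S" unfolding S_def using continuous_open_preimage[OF gUV_cont(2)[of c A ch] open', of "- {0}"] by(auto simp: vimage_def Int_def)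
have pS: "p : S" using p nz True by(auto simp: S_def cpts_def)
have Sne: "snd q ~= 0" "gV c A ch q ~= 0" if "q : S" for q using that by(auto simp: S_def)
have c: "continuous_on S (gU c A ch)" "continuous_on S (gV c A ch)" using gUV_cont[THEN continuous_on_subset, of S] by(auto simp: S_def)
have p0: "gth c A ch p = 0" using p by(simp add: cpts_def)
obtain r F ep where I: "r > 0" "F hol_on ball (fst p) r" "F (fst p) = snd p"
 "!!u. u : ball (fst p) r ==> (u,F u) : S & gth c A ch (u,F u) = 0"
 "ep > 0" "!!q. dist q p < ep ==> gth c A ch q = 0 ==> fst q : ball (fst p) r & snd q = F (fst q)"
 by(rule implicit_function_complex[OF S pS p0 gth_deriv[OF Sne(1)] c Sne(2)]) (assumption | rule that)+
define C where "C = (%x. (fst p+x,F (fst p+x)))"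
have sh: "fst p+x : ball (fst p) r" if "x : ball 0 r" for x using that by(simp add: dist_norm)
have "(F \<circ> (%x. fst p+x)) hol_on ball 0 r"
 by(rule holomorphic_on_compose_gen[OF _ I(2)]) (use sh in \<open>auto intro!: holomorphic_intros\<close>)
moreover have "C x : cpts c A ch & gV c A ch (C x) ~= 0" if "x : ball 0 r" for x
 using I(4)[OF sh[OF that]] Sne[of "(fst p+x,F (fst p+x))"] by(auto simp: C_def cpts_def)
ultimately have "curve_par c A ch C r b" unfolding curve_par_def using True I(1) by(auto simp: C_def o_def intro!: holomorphic_intros)
moreover have "q : C ` ball 0 r" if q: "q : cpts c A ch" "dist q p < ep" for q
proof -
 have "fst q : ball (fst p) r" "snd q = F (fst q)" using I(6)[OF q(2)] q(1) by(auto simp: cpts_def)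
 hence "q = C (fst q-fst p)" "fst q-fst p : ball 0 r" by(auto simp: C_def prod_eq_iff dist_norm norm_minus_commute)
 thus ?thesis by blast
qed
moreover have "C 0 = p" using I(3) by(simp add: C_def prod_eq_iff)
ultimately show ?thesis using I(5) by blast
next
case False
\<comment> \<open>Exchanging the two coordinates reduces this case to the same implicit function
  theorem.\<close>
define sw where "sw = (%p::complex\<times>complex. (snd p,fst p))"
have sw: "bounded_linear sw" unfolding sw_def by(intro bounded_linear_Pair bounded_linear_snd bounded_linear_fst)
have swc: "continuous_on T sw" for T by(rule linear_continuous_on[OF sw])
have dsw: "dist (sw a) (sw b) = dist a b" for a b by(simp add: sw_def dist_prod_def add.commute)
define G where "G = (%p. gth c A ch (sw p))"
define S where "S = sw -` ({p. snd p ~= 0} \<inter> {p. fst p ~= 0} \<inter> {p. gU c A ch p ~= 0})"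
have open': "open ({p::complex\<times>complex. snd p ~= 0} \<inter> {p. fst p ~= 0})" by(intro open_Int open_Collect_neq continuous_intros)
have cU: "continuous_on ({p::complex\<times>complex. snd p ~= 0} \<inter> {p. fst p ~= 0}) (gU c A ch)"
 by(rule continuous_on_subset[OF gUV_cont(1)]) auto
have "open ({p. snd p ~= 0} \<inter> {p. fst p ~= 0} \<inter> {p. gU c A ch p ~= 0})"
 using continuous_open_preimage[OF cU open', of "- {0}"] by(auto simp: vimage_def Int_def)
hence S: "open S" unfolding S_def by(intro open_vimage swc)
have pS: "sw p : S" using p nz False by(auto simp: S_def cpts_def sw_def)
have Sne: "fst q ~= 0" "snd q ~= 0" "gU c A ch (sw q) ~= 0" if "q : S" for q using that by(auto simp: S_def sw_def)
have c: "continuous_on S (%q. gU c A ch (sw q))" "continuous_on S (%q. gV c A ch (sw q))"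
 by(rule continuous_on_compose2[OF gUV_cont(1) swc] continuous_on_compose2[OF gUV_cont(2) swc],
   auto simp: S_def)+
have der: "(G has_derivative (%h. gV c A ch (sw q)*fst h+gU c A ch (sw q) * snd h)) (at q)" if "q : S" for q
proof -
 have "(sw has_derivative sw) (at q)" by(rule bounded_linear_imp_has_derivative[OF sw])
 moreover have "snd (sw q) ~= 0" using Sne(1)[OF that] by(simp add: sw_def)
 ultimately have "((%q. gth c A ch (sw q)) has_derivative
   (%h. gU c A ch (sw q)*fst (sw h)+gV c A ch (sw q) * snd (sw h))) (at q)"
  using has_derivative_compose[where f=sw and g="gth c A ch" and s=UNIV and x=q, OF _ gth_deriv] by blast
 thus ?thesis unfolding G_def by(simp add: sw_def add.commute)
qed
have p0: "G (sw p) = 0" using p by(simp add: cpts_def G_def sw_def)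
obtain r F ep where I: "r > 0" "F hol_on ball (fst (sw p)) r" "F (fst (sw p)) = snd (sw p)"
 "!!u. u : ball (fst (sw p)) r ==> (u,F u) : S & G (u,F u) = 0"
 "ep > 0" "!!q. dist q (sw p) < ep ==> G q = 0 ==> fst q : ball (fst (sw p)) r & snd q = F (fst q)"
 by(rule implicit_function_complex[OF S pS p0 der c(2,1) Sne(3)]) (assumption | rule that)+
define C where "C = (%x. (F (snd p+x),snd p+x))"
have sh: "snd p+x : ball (fst (sw p)) r" if "x : ball 0 r" for x using that by(simp add: dist_norm sw_def)
have "(F \<circ> (%x. snd p+x)) hol_on ball 0 r"
 by(rule holomorphic_on_compose_gen[OF _ I(2)]) (use sh in \<open>auto intro!: holomorphic_intros simp: sw_def\<close>)
moreover have "C x : cpts c A ch & fst (C x) ~= 0 & gU c A ch (C x) ~= 0" if "x : ball 0 r" for x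
 using I(4)[OF sh[OF that]] Sne[of "(snd p+x,F (snd p+x))"] by(auto simp: C_def cpts_def sw_def G_def)
ultimately have "curve_par c A ch C r b" unfolding curve_par_def using False I(1) by(auto simp: C_def o_def intro!: holomorphic_intros)
moreover have "q : C ` ball 0 r" if q: "q : cpts c A ch" "dist q p < ep" for q
proof -
 have "fst (sw q) : ball (fst (sw p)) r" "snd (sw q) = F (fst (sw q))" using I(6)[of "sw q"] q by(auto simp: cpts_def dsw G_def) (auto simp: sw_def)
 hence "q = C (snd q - snd p)" "snd q - snd p : ball 0 r" by(auto simp: C_def prod_eq_iff dist_norm norm_minus_commute sw_def)
 thus ?thesis by blast
qed
moreover have "C 0 = p" using I(3) by(simp add: C_def prod_eq_iff sw_def)
ultimately show ?thesis using I(5) by blast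
qed

context nondeg begin

subsection \<open>The coordinate ring of a chart\<close>

text \<open>\<open>rep h a F\<close> says that \<open>a\<close> is a polynomial in \<open>U\<close>, \<open>V\<close>, \<open>1/V\<close> and \<open>F\<close> the function on points it
  defines.\<close>

inductive rep :: "triple => 'l => (complex \<times> complex => complex) => bool" for h where
cst: "rep h (cst c) (%_. c)"
| U: "rep h (Uc h) fst"
| V: "rep h (Vc h) snd"
| iV: "rep h (inverse (Vc h)) (%p. inverse (snd p))"
| add: "rep h a F ==> rep h b G ==> rep h (a+b) (%p. F p+G p)"
| mult: "rep h a F ==> rep h b G ==> rep h (a*b) (%p. F p*G p)"

lemma lm_K: "lm Xc Yc w : K" unfolding lm_def by(intro K_mult K_powi K_Xc K_Yc)

lemma rep_K: "rep h a F ==> a : K"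
by(induction rule: rep.induct) (auto simp: Uc_def Vc_def intro: K_cst K_inverse K_add K_mult lm_K)

lemma rep_minus: "rep h a F ==> rep h (- a) (%p. - F p)"
using rep.mult[OF rep.cst[of h "-1"]] by(fastforce simp: cst_minus)

lemma rep_diff: "rep h a F ==> rep h b G ==> rep h (a-b) (%p. F p-G p)"
using rep.add[OF _ rep_minus, of h a F b G] by simp

lemma rep_power: "rep h a F ==> rep h (a ^ k) (%p. F p ^ k)"
by(induction k) (use rep.cst[of h 1] in \<open>auto intro: rep.mult\<close>)

lemma rep_Vpowi: "rep h (Vc h powi j) (%p. snd p powi j)"
using rep_power[OF rep.V, of h] rep_power[OF rep.iV, of h] by(cases j rule: int_cases2) (auto simp: power_int_minus power_inverse)

lemma rep_sum: "(!!i. i : I ==> rep h (a i) (F i)) ==> rep h (SUM i:I. a i) (%p. SUM i:I. F i p)"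
by(induction I rule: infinite_finite_induct) (use rep.cst[of h 0] in \<open>auto intro: rep.add\<close>)

lemma rep_lm: "rep h (Uc h^d*Vc h powi j) (%p. fst p^d * snd p powi j)"
by(intro rep.mult rep_power rep_Vpowi rep.U)

lemma rep_gth: assumes "h : charts A" shows "rep h 0 (gth cc A h)"
proof -
have "rep h (SUM g:A. cst (cc g)*(Uc h^dd h g*Vc h powi jj h g)) (gth cc A h)"
 unfolding gth_def[abs_def] by(intro rep_sum rep.mult[OF rep.cst] rep_lm)
thus ?thesis using sum_chart[OF assms] by simp
qed

definition pos2 :: "nat => complex poly poly" where "pos2 N = mono2 1 (N,N)"

lemma pos2_add: "pos2 (N+M) = pos2 N*pos2 M"
by(simp add: pos2_def mono2_def power_add one_pCons[symmetric] mult_ac)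

lemma clear_lm:
fixes x y :: "'b::field"
assumes "x ~= 0" "y ~= 0"
shows "x^nat (\<bar>fst w\<bar>+\<bar>snd w\<bar>)*y^nat (\<bar>fst w\<bar>+\<bar>snd w\<bar>)*lm x y w
 = x^nat (\<bar>fst w\<bar>+\<bar>snd w\<bar>+fst w)*y^nat (\<bar>fst w\<bar>+\<bar>snd w\<bar> + snd w)"
proof -
define N where "N = nat (\<bar>fst w\<bar>+\<bar>snd w\<bar>)"
define a b where "a = nat (\<bar>fst w\<bar>+\<bar>snd w\<bar>+fst w)" and "b = nat (\<bar>fst w\<bar>+\<bar>snd w\<bar> + snd w)"
have ab: "int a = int N+fst w" "int b = int N + snd w" by(auto simp: a_def b_def N_def)
have "x^N*x powi fst w = x powi int a" unfolding ab using assms by(simp add: power_int_add)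
moreover have "y^N*y powi snd w = y powi int b" unfolding ab using assms by(simp add: power_int_add)
ultimately show ?thesis unfolding N_def[symmetric] a_def[symmetric] b_def[symmetric] by(simp add: lm_def mult_ac)
qed

lemma lm_clear:
"EX N B. ev (pos2 N)*lm Xc Yc w = ev B &
  (ALL s t. s ~= 0 --> t ~= 0 --> pe (pos2 N) s t*lm s t w = pe B s t)" by(rule exI[of _ "nat (\<bar>fst w\<bar>+\<bar>snd w\<bar>)"],
  rule exI[of _ "mono2 1 (nat (\<bar>fst w\<bar>+\<bar>snd w\<bar>+fst w),nat (\<bar>fst w\<bar>+\<bar>snd w\<bar> + snd w))"])
 (simp add: pos2_def ev_mono2 pe_mono2 clear_lm Xc_nonzero Yc_nonzero)

text \<open>A power of xy clears all negative exponents, so an element of the chart ring becomes a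
  polynomial in x and y whose values on the torus are those of the represented function. Identities
  in the function field thereby become statements about points.\<close>

lemma rep_torus:
assumes "rep h a F"
shows "EX N B. ev (pos2 N)*a = ev B &
  (ALL s t. s ~= 0 --> t ~= 0 --> pe (pos2 N) s t*F (lp s t h) = pe B s t)" using assms
proof(induction rule: rep.induct)
case (cst c)
show ?case by(rule exI[of _ 0], rule exI[of _ "[:[:c:]:]"]) (simp add: pos2_def mono2_def cst_def ev_one one_pCons[symmetric])
next
case U show ?case using lm_clear[of "wU h"] by(simp add: Uc_def)
next
case V show ?case using lm_clear[of "wV h"] by(simp add: Vc_def)
next
case iV show ?case using lm_clear[of "- wV h"] by(simp add: Vc_def lm_minus)
next
case (add a F b G)
then obtain N B M C where *: "ev (pos2 N)*a = ev B"
 "!!s t. s ~= 0 ==> t ~= 0 ==> pe (pos2 N) s t*F (lp s t h) = pe B s t"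
 "ev (pos2 M)*b = ev C"
 "!!s t. s ~= 0 ==> t ~= 0 ==> pe (pos2 M) s t*G (lp s t h) = pe C s t" by metis
have "ev (pos2 (N+M))*(a+b) = ev (pos2 M*B+pos2 N*C)" unfolding pos2_add ev_mult ev_add *(1,3)[symmetric] by(simp add: alg)
moreover have "pe (pos2 (N+M)) s t*(F (lp s t h)+G (lp s t h))
  = pe (pos2 M*B+pos2 N*C) s t" if "s ~= 0" "t ~= 0" for s t unfolding pos2_add pe_simps *(2,4)[OF that, symmetric] by(simp add: alg)
ultimately show ?case by blast
next
case (mult a F b G)
then obtain N B M C where *: "ev (pos2 N)*a = ev B"
 "!!s t. s ~= 0 ==> t ~= 0 ==> pe (pos2 N) s t*F (lp s t h) = pe B s t"
 "ev (pos2 M)*b = ev C"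
 "!!s t. s ~= 0 ==> t ~= 0 ==> pe (pos2 M) s t*G (lp s t h) = pe C s t" by metis
have "ev (pos2 (N+M))*(a*b) = ev (B*C)" unfolding pos2_add ev_mult ev_add *(1,3)[symmetric] by(simp add: alg)
moreover have "pe (pos2 (N+M)) s t*(F (lp s t h)*G (lp s t h))
  = pe (B*C) s t" if "s ~= 0" "t ~= 0" for s t unfolding pos2_add pe_simps *(2,4)[OF that, symmetric] by(simp add: alg)
ultimately show ?case by blast
qed

lemma rep_holomorphic:
assumes "rep h a F" "(%u. fst (G u)) hol_on S" "(%u. snd (G u)) hol_on S"
 "!!u. u : S ==> snd (G u) ~= 0"
shows "(%u. F (G u)) hol_on S" using assms(1) by(induction rule: rep.induct) (auto intro!: holomorphic_intros assms)

text \<open>First order expansion at p, simultaneously for the field element and for its function,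
  with cofactors that again belong to the chart ring. Products follow the Leibniz pattern F G - F(p)
  G(p) = (F - F(p)) G + F(p) (G - G(p)).\<close>

lemma rep_taylor:
assumes "rep h a F" "snd p ~= 0"
shows "EX a1 A1 a2 A2. rep h a1 A1 & rep h a2 A2 &
  a = cst (F p)+(Uc h-cst (fst p))*a1+(Vc h-cst (snd p))*a2 &
  (ALL q. snd q ~= 0 --> F q = F p+(fst q-fst p)*A1 q+(snd q - snd p)*A2 q)" using assms(1)
proof(induction rule: rep.induct)
case (cst c)
show ?case using rep.cst[of h 0] by(intro exI[of _ 0] exI[of _ "%_. 0"]) simp
next
case U
show ?case using rep.cst[of h 0] rep.cst[of h 1] by(intro exI[of _ 1] exI[of _ "%_. 1"] exI[of _ 0] exI[of _ "%_. 0"]) simp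
next
case V
show ?case by(rule exI[of _ 0], rule exI[of _ "%_. 0"], rule exI[of _ 1], rule exI[of _ "%_. 1"])
  (use rep.cst[of h 0] rep.cst[of h 1] in simp)
next
case iV
have r: "rep h (cst (- inverse (snd p))*inverse (Vc h)) (%q. - inverse (snd p)*inverse (snd q))" by(intro rep.mult rep.cst rep.iV)
have "inverse (Vc h) = cst (inverse (snd p))+(Vc h-cst (snd p))*(cst (- inverse (snd p))*inverse (Vc h))"
proof -
 have E: "cst (- inverse (snd p)) = - inverse (cst (snd p))" "cst (inverse (snd p)) = inverse (cst (snd p))" by(simp_all only: cst_minus cst_inverse)
 have "inverse v = inverse c+(v-c)*(- inverse c*inverse v)" if "c ~= 0" "v ~= 0" for c v :: 'l using that by(simp add: field_simps)
 thus ?thesis unfolding E using assms(2) Vc_nonzero by(metis cst_eq_0)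
qed
moreover have "inverse (snd q) = inverse (snd p)+(snd q - snd p)*(- inverse (snd p)*inverse (snd q))"
 if "snd q ~= 0" for q :: "complex \<times> complex" using that assms(2) by(simp add: field_simps)
ultimately show ?case by(rule_tac exI[of _ 0], rule_tac exI[of _ "%_. 0"],
   rule_tac exI[of _ "cst (- inverse (snd p))*inverse (Vc h)"],
   rule_tac exI[of _ "%q. - inverse (snd p)*inverse (snd q)"])
  (use r rep.cst[of h 0] in auto)
next
case (add a F b G)
then obtain a1 A1 a2 A2 b1 B1 b2 B2 where *: "rep h a1 A1" "rep h a2 A2" "rep h b1 B1" "rep h b2 B2"
 "a = cst (F p)+(Uc h-cst (fst p))*a1+(Vc h-cst (snd p))*a2"
 "b = cst (G p)+(Uc h-cst (fst p))*b1+(Vc h-cst (snd p))*b2"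
 "!!q. snd q ~= 0 ==> F q = F p+(fst q-fst p)*A1 q+(snd q - snd p)*A2 q"
 "!!q. snd q ~= 0 ==> G q = G p+(fst q-fst p)*B1 q+(snd q - snd p)*B2 q" by metis
have "a+b = cst (F p+G p)+(Uc h-cst (fst p))*(a1+b1)+(Vc h-cst (snd p))*(a2+b2)" unfolding *(5,6) cst_add by(simp add: alg)
moreover have "F q+G q = F p+G p+(fst q-fst p)*(A1 q+B1 q)+(snd q - snd p)*(A2 q+B2 q)"
 if "snd q ~= 0" for q by(subst *(7)[OF that], subst *(8)[OF that]) (simp add: alg)
ultimately show ?case using rep.add[OF *(1,3)] rep.add[OF *(2,4)] by blast
next
case (mult a F b G)
then obtain a1 A1 a2 A2 b1 B1 b2 B2 where *: "rep h a1 A1" "rep h a2 A2" "rep h b1 B1" "rep h b2 B2"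
 "a = cst (F p)+(Uc h-cst (fst p))*a1+(Vc h-cst (snd p))*a2"
 "b = cst (G p)+(Uc h-cst (fst p))*b1+(Vc h-cst (snd p))*b2"
 "!!q. snd q ~= 0 ==> F q = F p+(fst q-fst p)*A1 q+(snd q - snd p)*A2 q"
 "!!q. snd q ~= 0 ==> G q = G p+(fst q-fst p)*B1 q+(snd q - snd p)*B2 q" by metis
define c1 c2 where "c1 = a1*b+cst (F p)*b1" and "c2 = a2*b+cst (F p)*b2"
have r: "rep h c1 (%q. A1 q*G q+F p*B1 q)" "rep h c2 (%q. A2 q*G q+F p*B2 q)" unfolding c1_def c2_def by(intro rep.add rep.mult * mult.hyps rep.cst)+
have "a*b = cst (F p*G p)+(Uc h-cst (fst p))*c1+(Vc h-cst (snd p))*c2"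
proof -
 have "a*b = (a-cst (F p))*b+cst (F p)*(b-cst (G p))+cst (F p*G p)" by(simp add: cst_mult alg)
 also have "a-cst (F p) = (Uc h-cst (fst p))*a1+(Vc h-cst (snd p))*a2" unfolding *(5) by simp
 also have "b-cst (G p) = (Uc h-cst (fst p))*b1+(Vc h-cst (snd p))*b2" unfolding *(6) by simp
 finally show ?thesis unfolding c1_def c2_def by(simp add: alg)
qed
moreover have "F q*G q = F p*G p+(fst q-fst p)*(A1 q*G q+F p*B1 q)
  + (snd q - snd p)*(A2 q*G q+F p*B2 q)" if "snd q ~= 0" for q
proof -
 have "F q*G q = (F q-F p)*G q+F p*(G q-G p)+F p*G p" by(simp add: alg)
 also have "F q-F p = (fst q-fst p)*A1 q+(snd q - snd p)*A2 q" using *(7)[OF that] by simp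
 also have "G q-G p = (fst q-fst p)*B1 q+(snd q - snd p)*B2 q" using *(8)[OF that] by simp
 finally show ?thesis by(simp add: alg)
qed
ultimately show ?case using r by blast
qed

lemma torus_chart_point:
assumes "h : charts A" "p : cpts cc A h" "fst p ~= 0"
shows "pe chi (backS h (fst p) (snd p)) (backT h (fst p) (snd p)) = 0"
 "lm (backS h (fst p) (snd p)) (backT h (fst p) (snd p)) (wU h) = fst p"
 "lm (backS h (fst p) (snd p)) (backT h (fst p) (snd p)) (wV h) = snd p"
 "backS h (fst p) (snd p) ~= 0" "backT h (fst p) (snd p) ~= 0"
proof -
have v: "snd p ~= 0" "gth cc A h p = 0" using assms(2) by(auto simp: cpts_def)
show l: "lm (backS h (fst p) (snd p)) (backT h (fst p) (snd p)) (wU h) = fst p"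
 "lm (backS h (fst p) (snd p)) (backT h (fst p) (snd p)) (wV h) = snd p" using lm_back[OF assms(1,3) v(1)] by auto
show nz: "backS h (fst p) (snd p) ~= 0" "backT h (fst p) (snd p) ~= 0" using back_nonzero assms(3) v(1) by blast+
show "pe chi (backS h (fst p) (snd p)) (backT h (fst p) (snd p)) = 0" unfolding pe_chi_chart[OF assms(1) nz] l using v(2) by simp
qed

lemma pe_pos2: "pe (pos2 N) s t = s^N*t^N" by(simp add: pos2_def pe_mono2)

lemma rep_zero_torus:
assumes "h : charts A" "rep h 0 F" "p : cpts cc A h" "fst p ~= 0"
shows "F p = 0"
proof -
note T = torus_chart_point[OF assms(1,3,4)]
obtain N B where B: "ev (pos2 N)*0 = ev B"
  "ALL s t. s ~= 0 --> t ~= 0 --> pe (pos2 N) s t*F (lp s t h) = pe B s t" using rep_torus[OF assms(2)] by blast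
have "pe B (backS h (fst p) (snd p)) (backT h (fst p) (snd p)) = 0" by(rule pe_zero_if_ev_zero[OF _ T(1)]) (use B(1) in simp)
with B(2)[rule_format, OF T(4,5)] show ?thesis using T by(simp add: pe_pos2)
qed

lemma par_at:
assumes "cpar h G r b" "u : ball 0 r"
shows "G u : cpts cc A h" "b ==> fst (G u) = fst (G 0)+u" "b ==> gV cc A h (G u) ~= 0"
 "~ b ==> snd (G u) = snd (G 0)+u" "~ b ==> fst (G u) ~= 0"
 "~ b ==> gU cc A h (G u) ~= 0"
proof -
have *: "G u : cpts cc A h &
   (if b then fst (G u) = fst (G 0)+u & gV cc A h (G u) ~= 0
    else snd (G u) = snd (G 0)+u & fst (G u) ~= 0 & gU cc A h (G u) ~= 0)" using assms unfolding curve_par_def by blast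
show "G u : cpts cc A h" using * by blast
show "b ==> fst (G u) = fst (G 0)+u" "b ==> gV cc A h (G u) ~= 0"
 "~ b ==> snd (G u) = snd (G 0)+u" "~ b ==> fst (G u) ~= 0"
 "~ b ==> gU cc A h (G u) ~= 0" using * by(metis (full_types))+
qed

lemma par_r: "cpar h G r b ==> r > 0"
unfolding curve_par_def by blast

lemma par_holomorphic:
assumes "cpar h G r b"
shows "(%u. fst (G u)) hol_on ball 0 r" "(%u. snd (G u)) hol_on ball 0 r" using assms unfolding curve_par_def by blast+

lemma par_snd_nz: "cpar h G r b ==> u : ball 0 r ==> snd (G u) ~= 0"
using par_at(1) unfolding cpts_def by blast

lemma par_rep_holomorphic:
"cpar h G r b ==> rep h a F ==> (%u. F (G u)) hol_on ball 0 r" by(rule rep_holomorphic) (auto intro: par_holomorphic dest: par_snd_nz)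

lemma par_rep_tendsto:
assumes "cpar h G r b" "rep h a F"
shows "((%u. F (G u)) ---> F (G 0)) (at 0)"
proof -
have "r > 0" by(rule par_r[OF assms(1)])
hence "continuous (at 0) (%u. F (G u))" using holomorphic_on_imp_continuous_on[OF par_rep_holomorphic[OF assms]]
 by(simp add: continuous_on_eq_continuous_at)
thus ?thesis by(simp add: continuous_at)
qed

lemma par_fst_nz:
assumes "cpar h G r b" "u : ball 0 r" "fst (G 0) ~= 0 --> u ~= - fst (G 0)" "u ~= 0"
shows "fst (G u) ~= 0"
proof(cases b)
case True
hence eq: "fst (G u) = fst (G 0)+u" using par_at(2)[OF assms(1,2)] by blast
show ?thesis
proof
 assume "fst (G u) = 0"
 hence "- fst (G 0) = u" using eq minus_unique by metis
 thus False using assms(3,4) by auto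
qed
qed (use par_at(5)[OF assms(1,2)] in blast)

lemma par_eventually_fst_nz:
assumes "cpar h G r b"
shows "eventually (%u. u : ball 0 r & fst (G u) ~= 0) (at 0)"
proof -
have r: "r > 0" by(rule par_r[OF assms])
have "eventually (%u::complex. u : ball 0 r) (at 0)" using r by(intro eventually_at_in_open') auto
moreover have "eventually (%u::complex. u ~= 0) (at 0)" by(simp add: eventually_at_filter)
moreover have "eventually (%u. fst (G 0) ~= 0 --> u ~= - fst (G 0)) (at 0)"
 by(cases "fst (G 0) = 0") (auto intro!: tendsto_imp_eventually_ne[OF tendsto_ident_at])
ultimately show ?thesis by eventually_elim (use par_fst_nz[OF assms] in auto)
qed

text \<open>In the torus this is \<open>rep_zero_torus\<close>. A boundary point is the limit of
  torus points of its branch, so continuity settles it. Hence an element determines its function on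
  the curve.\<close>

lemma rep_zero:
assumes "h : charts A" "rep h 0 F" "p : cpts cc A h"
shows "F p = 0"
proof(cases "fst p = 0")
case False thus ?thesis using rep_zero_torus assms by blast
next
case True
hence "gV cc A h p ~= 0" using smooth[OF assms(1,3)] by blast
then obtain G r where g: "cpar h G r True" "G 0 = p" using curve_par_exists[OF assms(3), of True] by auto
have "eventually (%u. F (G u) = 0) (at 0)" using par_eventually_fst_nz[OF g(1)]
 by eventually_elim (use rep_zero_torus[OF assms(1,2)] par_at(1)[OF g(1)] in blast)
hence "((%u. F (G u)) ---> 0) (at 0)" by(rule tendsto_eventually)
thus ?thesis using par_rep_tendsto[OF g(1) assms(2)] g(2) tendsto_unique[of "at (0::complex)"] by auto
qed

lemma rep_eq:
assumes "h : charts A" "rep h a F" "rep h a G" "p : cpts cc A h"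
shows "F p = G p" using rep_zero[OF assms(1) _ assms(4), of "%p. F p-G p"] rep_diff[OF assms(2,3)] by simp

definition unif :: "triple => complex \<times> complex => bool => 'l" where
"unif h p b = (if b then Uc h-cst (fst p) else Vc h-cst (snd p))"
definition unifF :: "complex \<times> complex => bool => complex \<times> complex => complex" where
"unifF p b q = (if b then fst q-fst p else snd q - snd p)"

definition smooth_at :: "triple => complex \<times> complex => bool => bool" where
"smooth_at h p b \<longleftrightarrow> p : cpts cc A h & (if b then gV cc A h p ~= 0 else fst p ~= 0 & gU cc A h p ~= 0)"

lemma rep_unif: "rep h (unif h p b) (unifF p b)"
unfolding unif_def unifF_def[abs_def] by(cases b) (auto intro!: rep_diff rep.intros)

text \<open>Expand the relation gth = 0 at p: it reads (U - u) a1 + (V - v) a2 = 0, and the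
  functions of a1 and a2 take at p the values of the partial derivatives. The nonzero one is the
  cofactor g, invertible at p, which makes the other coordinate difference a multiple of the
  uniformizer.\<close>

lemma unif_generates:
assumes th: "h : charts A" and sm: "smooth_at h p b"
shows "EX g G a1 A1 a2 A2. rep h g G & G p ~= 0 & rep h a1 A1 & rep h a2 A2 &
  g*(Uc h-cst (fst p)) = unif h p b*a1 & g*(Vc h-cst (snd p)) = unif h p b*a2"
proof -
have p: "snd p ~= 0" "gth cc A h p = 0" using sm by(auto simp: smooth_at_def cpts_def)
obtain a1 A1 a2 A2 where T: "rep h a1 A1" "rep h a2 A2"
 "0 = cst (gth cc A h p)+(Uc h-cst (fst p))*a1+(Vc h-cst (snd p))*a2"
 "!!q. snd q ~= 0 ==> gth cc A h q = gth cc A h p+(fst q-fst p)*A1 q+(snd q - snd p)*A2 q" using rep_taylor[OF rep_gth[OF th] p(1)] by blast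
have rel: "(Uc h-cst (fst p))*a1+(Vc h-cst (snd p))*a2 = 0" using T(3) p(2) by simp
have cont: "continuous (at x) (%u. H (u,snd p))" if "rep h a H" for a H x
proof -
 have "(%u. H (u,snd p)) hol_on UNIV" using rep_holomorphic[OF that, of "%u. (u,snd p)" UNIV] p(1) by(auto intro!: holomorphic_intros)
 thus ?thesis using holomorphic_on_imp_continuous_on continuous_on_eq_continuous_at open_UNIV by blast
qed
have cont2: "continuous (at x) (%v. H (fst p,v))" if "rep h a H" "x ~= 0" for a H x
proof -
 have "(%v. H (fst p,v)) hol_on (-{0})" using rep_holomorphic[OF that(1), of "%v. (fst p,v)" "-{0}"] by(auto intro!: holomorphic_intros)
 thus ?thesis using holomorphic_on_imp_continuous_on continuous_on_eq_continuous_at[of "- {0::complex}"] that(2) by fastforce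
qed
have A1: "A1 p = gU cc A h p"
proof -
 have "((%u. (u-fst p)*A1 (u,snd p)) hfd A1 (fst p,snd p)) (at (fst p))" unfolding DERIV_caratheodory_within[of _ _ _ UNIV]
  by(intro exI[of _ "%u. A1 (u,snd p)"]) (use cont[OF T(1)] in simp)
 moreover have "(%u. (u-fst p)*A1 (u,snd p)) = (%u. gth cc A h (u,snd p))" by(intro ext) (use T(4) p in auto)
 ultimately have "((%u. gth cc A h (u,snd p)) hfd A1 p) (at (fst p))" by simp
 from DERIV_unique[OF this gth_partial(1)[OF p(1)]] show ?thesis .
qed
have A2: "A2 p = gV cc A h p"
proof -
 have "((%v. (v - snd p)*A2 (fst p,v)) hfd A2 (fst p,snd p)) (at (snd p))" unfolding DERIV_caratheodory_within[of _ _ _ UNIV]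
  by(intro exI[of _ "%v. A2 (fst p,v)"]) (use cont2[OF T(2) p(1)] in simp)
 moreover have "((%v. (v - snd p)*A2 (fst p,v)) hfd gV cc A h p) (at (snd p))" by(rule hfd_transform[OF gth_partial(2)[OF p(1)], of "- {0}"])
   (use T(4) p in auto)
 ultimately have "A2 (fst p,snd p) = gV cc A h p" by(rule DERIV_unique)
 thus ?thesis by simp
qed
show ?thesis
proof(cases b)
 case True
 have "a2*(Uc h-cst (fst p)) = unif h p b*a2" "a2*(Vc h-cst (snd p)) = unif h p b*(- a1)"
  using rel True by(simp_all add: unif_def alg eq_neg_iff_add_eq_0) 
 moreover have "A2 p ~= 0" using sm True A2 by(simp add: smooth_at_def)
 ultimately show ?thesis using T(2) rep_minus[OF T(1)] by blast
next
 case False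
 have "a1*(Vc h-cst (snd p)) = unif h p b*a1" "a1*(Uc h-cst (fst p)) = unif h p b*(- a2)"
  using rel False by(simp_all add: unif_def alg eq_neg_iff_add_eq_0)
 moreover have "A1 p ~= 0" using sm False A1 by(simp add: smooth_at_def)
 ultimately show ?thesis using T(1) rep_minus[OF T(2)] by blast
qed
qed

lemma unif_divides:
assumes "h : charts A" "smooth_at h p b" "rep h a F" "F p = 0"
shows "EX g G a' F'. rep h g G & G p ~= 0 & rep h a' F' & g*a = unif h p b*a'"
proof -
have p: "snd p ~= 0" using assms by(auto simp: smooth_at_def cpts_def)
obtain a1 A1 a2 A2 where T: "rep h a1 A1" "rep h a2 A2"
 "a = cst (F p)+(Uc h-cst (fst p))*a1+(Vc h-cst (snd p))*a2" using rep_taylor[OF assms(3) p] by blast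
obtain g G b1 B1 b2 B2 where g: "rep h g G" "G p ~= 0" "rep h b1 B1" "rep h b2 B2"
  "g*(Uc h-cst (fst p)) = unif h p b*b1" "g*(Vc h-cst (snd p)) = unif h p b*b2" using unif_generates[OF assms(1,2)] by blast
have "g*a = g*(Uc h-cst (fst p))*a1+g*(Vc h-cst (snd p))*a2" unfolding T(3) using assms(4) by(simp add: alg)
also have "... = unif h p b*(b1*a1+b2*a2)" unfolding g(5,6) by(simp add: alg)
finally show ?thesis using g(1,2) rep.add[OF rep.mult[OF g(3) T(1)] rep.mult[OF g(4) T(2)]] by blast
qed

end

context nondeg begin

subsection \<open>Values at valuation rings\<close>

text \<open>The relation behind \<open>pval\<close>: it composes under field operations without
  presupposing that a value exists.\<close>

definition hv :: "'l => 'l set => complex => bool" where "hv f W c \<longleftrightarrow> f-cst c : vmax W"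

lemma vmax_sub: "x : vmax W ==> x : W" by(simp add: vmax_def)

lemma vmaxI: assumes "vring W" "x : K" "x ~= 0 ==> inverse x ~: W" shows "x : vmax W"
using assms vringD(6)[OF assms(1,2)] vring_0_1[OF assms(1)] unfolding vmax_def by auto

lemma vmax_mult: assumes W: "vring W" and x: "x : vmax W" and y: "y : W" shows "x*y : vmax W"
proof(rule vmaxI[OF W])
show "x*y : K" using vringD(1,5)[OF W] vmax_sub[OF x] y by blast
assume nz: "x*y ~= 0"
show "inverse (x*y) ~: W"
proof
 assume "inverse (x*y) : W"
 hence "y*inverse (x*y) : W" using vringD(5)[OF W y] by blast
 moreover have "y*inverse (x*y) = inverse x" using nz by(simp add: field_simps)
 ultimately have "inverse x : W" by(simp only:)
 thus False using x nz unfolding vmax_def by auto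
qed
qed

lemma vmax_add: assumes W: "vring W" and x: "x : vmax W" and y: "y : vmax W" shows "x+y : vmax W"
proof(cases "x = 0 | y = 0")
case True thus ?thesis using x y by auto
next
case False
have K: "x : K" "y : K" using vringD(1)[OF W] vmax_sub[OF x] vmax_sub[OF y] by auto
have "x/y : W | inverse (x/y) : W" using vringD(6)[OF W K_divide[OF K]] by blast
thus ?thesis
proof
 assume "x/y : W"
 hence "y*(1+x/y) : vmax W" by(intro vmax_mult[OF W y] vringD(4)[OF W] vring_0_1[OF W])
 moreover have "y*(1+x/y) = x+y" using False by(simp add: field_simps)
 ultimately show ?thesis by simp
next
 assume "inverse (x/y) : W"
 hence "x*(1+inverse (x/y)) : vmax W" by(intro vmax_mult[OF W x] vringD(4)[OF W] vring_0_1[OF W])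
 moreover have "x*(1+inverse (x/y)) = x+y" using False by(simp add: field_simps)
 ultimately show ?thesis by simp
qed
qed

lemma vmax_0: "vring W ==> 0 : vmax W" unfolding vmax_def using vring_0_1 by blast

lemma cst_vmax: "vring W ==> cst c : vmax W \<longleftrightarrow> c = 0"
using vringD(3)[of W "inverse c"] vmax_0[of W] by(auto simp: vmax_def cst_inverse)

lemma vmax_uminus: "vring W ==> x : vmax W ==>-x : vmax W"
using vmax_mult[of W x "cst (-1)"] vringD(3)[of W "-1"] by(simp add: cst_minus)

lemma vmax_sum: "vring W ==> (!!i. i : I ==> f i : vmax W) ==> (SUM i:I. f i) : vmax W"
by(induction I rule: infinite_finite_induct) (auto intro: vmax_add vmax_0)

lemma vring_prod: "vring W ==> (!!i. i : I ==> f i : W) ==> (PROD i:I. f i) : W"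
by(induction I rule: infinite_finite_induct) (auto intro: vringD(5) vring_0_1)

lemma vring_power: "vring W ==> f : W ==> f ^ k : W"
by(induction k) (auto intro: vringD(5) vring_0_1)

lemma hv_mem: "vring W ==> hv f W c ==> f : W"
using vringD(4)[of W "f-cst c" "cst c"] vringD(3)[of W c] vmax_sub unfolding hv_def by auto

lemma hv_unique: assumes "vring W" "hv f W c" "hv f W d" shows "c = d"
proof -
have "(f-cst d) + - (f-cst c) : vmax W" using assms vmax_add vmax_uminus unfolding hv_def by blast
hence "cst (c-d) : vmax W" by(simp add: cst_diff)
thus ?thesis using cst_vmax[OF assms(1)] by simp
qed

lemma hv_pval: "vring W ==> hv f W c ==> pval f W = c"
unfolding pval_def hv_def[symmetric] by(rule the_equality) (auto dest: hv_unique)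

lemma hv_cst: "vring W ==> hv (cst c) W c" by(simp add: hv_def vmax_0)

lemma hv_add: "vring W ==> hv f W c ==> hv g W d ==> hv (f+g) W (c+d)"
using vmax_add[of W "f-cst c" "g-cst d"] by(simp add: hv_def cst_add alg)

lemma hv_mult: assumes W: "vring W" and f: "hv f W c" and g: "hv g W d" shows "hv (f*g) W (c*d)"
proof -
have "(f-cst c)*g+(g-cst d)*cst c : vmax W" using f g by(intro vmax_add[OF W] vmax_mult[OF W] hv_mem[OF W g] vringD(3)[OF W]) (simp_all add: hv_def)
moreover have "(f-cst c)*g+(g-cst d)*cst c = f*g-cst (c*d)" by(simp add: cst_mult alg)
ultimately show ?thesis by(simp add: hv_def)
qed

lemma hv_power: "vring W ==> hv f W c ==> hv (f ^ k) W (c ^ k)"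
by(induction k) (use hv_cst[of W 1] in \<open>auto intro: hv_mult\<close>)

lemma hv_inverse_mem: assumes W: "vring W" and f: "hv f W c" "c ~= 0" shows "inverse f : W"
proof(rule ccontr)
assume n: "inverse f ~: W"
have "f : vmax W" using n hv_mem[OF W f(1)] by(simp add: vmax_def)
hence "hv f W 0" by(simp add: hv_def)
thus False using hv_unique[OF W f(1)] f(2) by blast
qed

lemma hv_inverse: assumes W: "vring W" and f: "hv f W c" "c ~= 0" shows "hv (inverse f) W (inverse c)"
proof -
have i: "inverse f : W" by(rule hv_inverse_mem[OF assms])
have nz: "f ~= 0"
proof
 assume "f = 0" hence "cst (-c) : vmax W" using f(1) by(simp add: hv_def cst_minus)
 thus False using cst_vmax[OF W] f(2) by simp
qed
have cn: "cst c ~= 0" using f(2) by simp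
have "(f-cst c)*(inverse f*cst (- inverse c)) : vmax W" using f i by(intro vmax_mult[OF W] vringD(5)[OF W] vringD(3)[OF W]) (simp_all add: hv_def)
moreover have "(f-cst c)*(inverse f*cst (- inverse c)) = inverse f-cst (inverse c)"
 unfolding cst_minus cst_inverse using nz cn by(simp add: field_simps)
ultimately show ?thesis by(simp add: hv_def)
qed

lemma hv_powi: "vring W ==> hv f W c ==> c ~= 0 ==> hv (f powi k) W (c powi k)"
by(cases k rule: int_cases2) (auto simp: power_int_minus intro: hv_power hv_inverse)

lemma hv_lm: "vring W ==> hv Xc W s ==> hv Yc W t ==> s ~= 0 ==> t ~= 0 ==> hv (lm Xc Yc w) W (lm s t w)"
unfolding lm_def by(intro hv_mult hv_powi)

lemma hv_rep:
assumes W: "vring W" and "rep h a F" and U: "hv (Uc h) W (fst p)" and V: "hv (Vc h) W (snd p)" "snd p ~= 0"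
shows "hv a W (F p)" using assms(2) by(induction rule: rep.induct)
 (auto intro: hv_cst[OF W] U V hv_inverse[OF W V] hv_add[OF W] hv_mult[OF W])

lemma hv_gth_zero:
assumes "vring W" "h : charts A" "hv (Uc h) W (fst p)" "hv (Vc h) W (snd p)" "snd p ~= 0"
shows "p : cpts cc A h" using hv_unique[OF assms(1) hv_rep[OF assms(1) rep_gth[OF assms(2)] assms(3-5)]] hv_cst[OF assms(1), of 0]
 assms(5) by(auto simp: cpts_def)

subsection \<open>Local rings of smooth points\<close>

text \<open>The local ring of the curve at p. That H does not vanish at p already makes the
  denominator c nonzero in the field, by \<open>rep_nz\<close>.\<close>

definition Oloc :: "triple => complex \<times> complex => 'l set" where
"Oloc h p = {a/c | a c F H. rep h a F & rep h c H & H p ~= 0}"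

lemma Oloc_I: "rep h a F ==> rep h c H ==> H p ~= 0 ==> a/c : Oloc h p"
unfolding Oloc_def by blast

lemma Oloc_E: assumes "f : Oloc h p"
obtains a c F H where "f = a/c" "rep h a F" "rep h c H" "H p ~= 0" using assms unfolding Oloc_def by blast

lemma rep_nz: "h : charts A ==> rep h c H ==> p : cpts cc A h ==> H p ~= 0 ==> c ~= 0"
using rep_zero by blast

lemma unifF_par:
assumes "cpar h G r b" "u : ball 0 r"
shows "unifF (G 0) b (G u) = u" using par_at(2,4)[OF assms] by(cases b) (auto simp: unifF_def)

text \<open>A nonzero element cannot vanish along a whole branch: by \<open>rep_torus\<close> the
  branch would give infinitely many common zeros of chi and a polynomial that chi does not divide.
  Hence the order of vanishing at the centre is finite.\<close>

lemma rep_order: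
assumes th: "h : charts A" and par: "cpar h C r b" and a: "rep h a F" "a ~= 0"
shows "EX k L. L ~= 0 & ((%u. F (C u)/u ^ k) ---> L) (at 0)"
proof -
have r: "r > 0" by(rule par_r[OF par])
have "EX w:ball 0 r. F (C w) ~= 0"
proof(rule ccontr)
 assume "~ ?thesis"
 hence Z: "F (C w) = 0" if "w : ball 0 r" for w using that by blast
 obtain N B where B: "ev (pos2 N)*a = ev B"
  "!!s t. s ~= 0 ==> t ~= 0 ==> pe (pos2 N) s t*F (lp s t h) = pe B s t" using rep_torus[OF a(1)] by blast
 have "ev (pos2 N) ~= 0" using Xc_nonzero Yc_nonzero by(simp add: pos2_def ev_mono2)
 hence "~ chi dvd B" using B(1) a(2) by(metis ev_eq_0_iff mult_eq_0_iff)
 hence fin: "finite {(s,t). pe chi s t = 0 & pe B s t = 0}" by(rule finite_common_zeros)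
 define D where "D = {w : ball 0 r. fst (C w) ~= 0}"
 define G where "G = (%w. (backS h (fst (C w)) (snd (C w)),backT h (fst (C w)) (snd (C w))))"
 have "G ` D <= {(s,t). pe chi s t = 0 & pe B s t = 0}"
 proof clarify
  fix w s t assume w: "w : D" and st: "(s,t) = G w"
  note T = torus_chart_point[OF th par_at(1)[OF par], of w]
  have w': "w : ball 0 r" "fst (C w) ~= 0" using w by(auto simp: D_def)
  note T = T[OF w']
  have "pe B s t = 0" using B(2)[OF T(4,5)] Z[OF w'(1)] st unfolding T(2,3) by(simp add: G_def)
  thus "pe chi s t = 0 & pe B s t = 0" using T(1) st by(simp add: G_def)
 qed
 hence "finite (G ` D)" using fin finite_subset by blast
 moreover have "inj_on G D"
 proof(rule inj_onI)
  fix w w' assume w: "w : D" "w' : D" "G w = G w'"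
  have b: "w : ball 0 r" "w' : ball 0 r" "fst (C w) ~= 0" "fst (C w') ~= 0" using w by(auto simp: D_def)
  have "C w = C w'" using torus_chart_point(2,3)[OF th par_at(1)[OF par b(1)] b(3)]
    torus_chart_point(2,3)[OF th par_at(1)[OF par b(2)] b(4)] w(3) by(metis G_def prod.inject prod_eqI)
  thus "w = w'" using unifF_par[OF par b(1)] unifF_par[OF par b(2)] by metis
 qed
 ultimately have "finite D" using finite_imageD by blast
 moreover have "eventually (%w. w : D) (at 0)" using par_eventually_fst_nz[OF par] by(simp add: D_def)
 ultimately show False using islimpt_finite[of D 0] eventually_frequently[of "at (0::complex)"] by(simp add: islimpt_conv_frequently_at)
qed
then obtain k g R where g: "R > 0" "R <= r" "g hol_on ball 0 R"
  "ALL w:ball 0 R. F (C w) = w ^ k*g w & g w ~= 0" using holomorphic_order[OF par_rep_holomorphic[OF par a(1)] r] by blast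
have "isCont g 0" using g(1,3) holomorphic_on_imp_continuous_on by(metis at_within_open centre_in_ball continuous_on_eq_continuous_within open_ball)
hence "(g ---> g 0) (at 0)" by(simp add: isCont_def)
moreover have "eventually (%w. g w = F (C w)/w ^ k) (at 0)"
proof -
 have "eventually (%w::complex. w : ball 0 R) (at 0)" using g(1) by(intro eventually_at_in_open') auto
 moreover have "eventually (%w::complex. w ~= 0) (at 0)" by(simp add: eventually_at_filter)
 ultimately show ?thesis by eventually_elim (use g(4) in simp)
qed
ultimately have "((%w. F (C w)/w ^ k) ---> g 0) (at 0)" using tendsto_cong by fastforce
thus ?thesis using g(1,4) by(metis centre_in_ball)
qed

lemma par_smooth:
assumes "cpar h G r b" "u : ball 0 r"
shows "smooth_at h (G u) b" using par_at[OF assms] by(simp add: smooth_at_def)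

lemma smooth_par:
assumes "smooth_at h p b"
obtains G r ep where "cpar h G r b" "G 0 = p" "ep > 0"
 "!!q. q : cpts cc A h ==> dist q p < ep ==> q : G ` ball 0 r" using curve_par_exists[of p cc A h b] assms unfolding smooth_at_def by blast

lemma unif_nz: assumes "h : charts A" "smooth_at h p b" shows "unif h p b ~= 0"
proof
assume z: "unif h p b = 0"
obtain G r ep where g: "cpar h G r b" "G 0 = p" by(rule smooth_par[OF assms(2)]) blast
have r: "r > 0" by(rule par_r[OF g(1)])
have m: "of_real (r/2) : ball (0::complex) r" using r by simp
have "rep h 0 (unifF p b)" using rep_unif[of h p b] z by simp
hence "unifF p b (G (of_real (r/2))) = 0" using rep_zero[OF assms(1) _ par_at(1)[OF g(1) m]] by blast
thus False using unifF_par[OF g(1) m] g(2) r by simp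
qed

text \<open>Discreteness of the valuation. Each division by the uniformizer lowers the analytic
  order of vanishing along the branch by one, and this order is finite by
  \<open>rep_order\<close>.\<close>

lemma rep_factor:
assumes th: "h : charts A" and sm: "smooth_at h p b" and a: "rep h a F" "a ~= 0"
shows "EX k g G a' F'. rep h g G & G p ~= 0 & rep h a' F' & F' p ~= 0 & g*a = unif h p b ^ k*a'"
proof -
obtain C r ep where par: "cpar h C r b" "C 0 = p" by(rule smooth_par[OF sm]) blast
have inb: "eventually (%w::complex. w : ball 0 r) (at 0)" "eventually (%w::complex. w ~= 0) (at 0)"
 by(rule eventually_at_in_open') (use par_r[OF par(1)] in \<open>auto simp: eventually_at_filter\<close>)
have pc: "p : cpts cc A h" using sm by(simp add: smooth_at_def)
have "EX j g G a' F'. rep h g G & G p ~= 0 & rep h a' F' & F' p ~= 0 & g*a = unif h p b^j*a'"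
 if "rep h a F" "L ~= 0" "((%u. F (C u)/u ^ k) ---> L) (at 0)" for a F L k using that
proof(induction k arbitrary: a F L)
 case 0
 have "F p = L" using tendsto_unique[OF _ par_rep_tendsto[OF par(1) 0(1)]] 0(3) par(2) by simp
 thus ?case using 0 rep.cst[of h 1] by(intro exI[of _ 0] exI[of _ "1::'l"] exI[of _ "%_. 1"] exI[of _ a] exI[of _ F]) auto
next
 case (Suc k)
 have "((%u. F (C u)/u^Suc k*u^Suc k) ---> L*0) (at 0)" using Suc.prems(3) by(intro tendsto_intros) (auto intro!: tendsto_eq_intros)
 moreover have "eventually (%u. F (C u)/u^Suc k*u^Suc k = F (C u)) (at 0)" using inb(2) by eventually_elim simp
 ultimately have "((%u. F (C u)) ---> 0) (at 0)" using tendsto_cong by fastforce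
 hence "F p = 0" using tendsto_unique[OF _ par_rep_tendsto[OF par(1) Suc.prems(1)]] par(2) by auto
 then obtain g G a1 F1 where d: "rep h g G" "G p ~= 0" "rep h a1 F1" "g*a = unif h p b*a1" using unif_divides[OF th sm Suc.prems(1)] by blast
 have eq: "G q*F q = unifF p b q*F1 q" if "q : cpts cc A h" for q using rep_eq[OF th rep.mult[OF d(1) Suc.prems(1)] _ that, of "%q. unifF p b q*F1 q"]
   rep.mult[OF rep_unif d(3)] d(4) by simp
 have "((%u. G (C u)*(F (C u)/u^Suc k)) ---> G (C 0)*L) (at 0)" by(intro tendsto_mult par_rep_tendsto[OF par(1) d(1)] Suc.prems(3))
 moreover have "eventually (%u. G (C u)*(F (C u)/u^Suc k) = F1 (C u)/u ^ k) (at 0)" using inb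
 proof eventually_elim
  case (elim u)
  have "G (C u)*F (C u) = u*F1 (C u)" using eq[OF par_at(1)[OF par(1) elim(1)]] unifF_par[OF par(1) elim(1)] par(2) by simp
  thus ?case using elim(2) by(simp add: field_simps)
 qed
 ultimately have "((%u. F1 (C u)/u ^ k) ---> G (C 0)*L) (at 0)" using tendsto_cong by fastforce
 from Suc.IH[OF d(3) _ this] Suc.prems(2) d(2) par(2)
 obtain j g' G' a' F' where IH: "rep h g' G'" "G' p ~= 0" "rep h a' F'" "F' p ~= 0" "g'*a1 = unif h p b^j*a'" by auto
 have "g'*g*a = g'*(unif h p b*a1)" using d(4) by(simp add: mult.assoc)
 also have "... = unif h p b*(g'*a1)" by(simp add: mult_ac)
 also have "... = unif h p b^Suc j*a'" unfolding IH(5) by(simp add: mult_ac)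
 finally show ?case using rep.mult[OF IH(1) d(1)] IH(2-4) d(2)
  by(intro exI[of _ "Suc j"] exI[of _ "g'*g"] exI[of _ "%p. G' p*G p"] exI[of _ a'] exI[of _ F']) auto
qed
thus ?thesis using rep_order[OF th par(1) a] a(1) by blast
qed

end

context nondeg begin

text \<open>The chart ring has the whole function field as its field of fractions, because x and y
  are Laurent monomials in U and V.\<close>

lemma frac_field:
assumes th: "h : charts A" and "f : K"
shows "EX a c F H. rep h a F & rep h c H & c ~= 0 & f = a/c"
proof -
define Q where "Q = {f. EX a c F H. rep h a F & rep h c H & c ~= 0 & f = a/c}"
have Q_I: "a/c : Q" if "rep h a F" "rep h c H" "c ~= 0" for a c F H unfolding Q_def using that by blast
have Q_rep: "a : Q" if "rep h a F" for a F using Q_I[OF that rep.cst[of h 1]] by simp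
have Q_add: "f+g : Q" if fQ: "f : Q" and gQ: "g : Q" for f g
proof -
 obtain a c F H where f: "rep h a F" "rep h c H" "c ~= 0" "f = a/c" using fQ unfolding Q_def by blast
 obtain a' c' F' H' where g: "rep h a' F'" "rep h c' H'" "c' ~= 0" "g = a'/c'" using gQ unfolding Q_def by blast
 have "f+g = (a*c'+a'*c)/(c*c')" using f g by(simp add: field_simps)
 thus ?thesis using Q_I[OF rep.add[OF rep.mult[OF f(1) g(2)] rep.mult[OF g(1) f(2)]] rep.mult[OF f(2) g(2)]] f(3) g(3) by simp
qed
have Q_mult: "f*g : Q" if fQ: "f : Q" and gQ: "g : Q" for f g
proof -
 obtain a c F H where f: "rep h a F" "rep h c H" "c ~= 0" "f = a/c" using fQ unfolding Q_def by blast
 obtain a' c' F' H' where g: "rep h a' F'" "rep h c' H'" "c' ~= 0" "g = a'/c'" using gQ unfolding Q_def by blast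
 have "f*g = (a*a')/(c*c')" using f g by simp
 thus ?thesis using Q_I[OF rep.mult[OF f(1) g(1)] rep.mult[OF f(2) g(2)]] f(3) g(3) by simp
qed
have Q_inv: "inverse f : Q" if fQ: "f : Q" for f
proof(cases "f = 0")
 case False
 obtain a c F H where f: "rep h a F" "rep h c H" "c ~= 0" "f = a/c" using fQ unfolding Q_def by blast
 hence "inverse f = c/a" "a ~= 0" using False by auto
 thus ?thesis using Q_I[OF f(2,1)] by simp
qed (use fQ in simp)
have Q_power: "f ^ k : Q" if "f : Q" for f k by(induction k) (use that Q_mult Q_rep[OF rep.cst[of h 1]] in auto)
have Q_powi: "f powi k : Q" if "f : Q" for f k by(cases k rule: int_cases2) (auto simp: power_int_minus intro: Q_power Q_inv that)
have "Xc : Q" "Yc : Q" using back_lm[OF th Xc_nonzero Yc_nonzero] Q_powi[OF Q_rep[OF rep.U]] Q_powi[OF Q_rep[OF rep.V]] Q_mult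
 unfolding backS_def backT_def Uc_def[symmetric] Vc_def[symmetric] by metis+
hence Q_ev0: "ev (mono2 c g) : Q" for c g unfolding ev_mono2 by(intro Q_mult Q_power Q_rep[OF rep.cst])
have Q_sum: "(SUM i:I. f i) : Q" if "!!i. i : I ==> f i : Q" for I f
 using that by(induction I rule: infinite_finite_induct) (use Q_rep[OF rep.cst[of h 0]] Q_add in auto)
have Q_ev: "ev B : Q" for B
proof -
 define S where "S = (SIGMA m:{..degree B}. {..degree (Polynomial.coeff B m)})"
 have fin: "finite (prod.swap ` S)" unfolding S_def by(intro finite_imageI finite_SigmaI) auto
 have "g : prod.swap ` S" if "coeff_vec B g ~= 0" for g
 proof -
  have "Polynomial.coeff (Polynomial.coeff B (snd g)) (fst g) ~= 0" using that by(cases g) (simp add: coeff_vec_def)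
  hence "(snd g,fst g) : S" unfolding S_def by(metis (no_types, lifting) SigmaI atMost_iff coeff_0 le_degree)
  thus ?thesis by(metis image_eqI prod.swap_def swap_swap fst_conv snd_conv)
 qed
 from poly_as_sum[OF fin this] have "ev B = ev (SUM g:prod.swap ` S. mono2 (coeff_vec B g) g)" by simp
 also have "... : Q" unfolding ev_sum by(rule Q_sum, rule Q_ev0)
 finally show ?thesis .
qed
obtain B C where "f = ev B/ev C" using assms(2) unfolding K_def by blast
hence "f : Q" using Q_mult[OF Q_ev Q_inv[OF Q_ev]] by(simp add: divide_inverse)
thus ?thesis unfolding Q_def by blast
qed

lemma Oloc_K: "f : Oloc h p ==> f : K"
unfolding Oloc_def using rep_K K_divide by blast

lemma Oloc_mult: assumes "f : Oloc h p" "g : Oloc h p" shows "f*g : Oloc h p"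
proof -
obtain a c F H where f: "f = a/c" "rep h a F" "rep h c H" "H p ~= 0" by(rule Oloc_E[OF assms(1)])
obtain a' c' F' H' where g: "g = a'/c'" "rep h a' F'" "rep h c' H'" "H' p ~= 0" by(rule Oloc_E[OF assms(2)])
have "f*g = (a*a')/(c*c')" by(simp add: f g)
thus ?thesis using Oloc_I[OF rep.mult[OF f(2) g(2)] rep.mult[OF f(3) g(3)], of p] f(4) g(4) by simp
qed

lemma Oloc_add:
assumes "h : charts A" "p : cpts cc A h" "f : Oloc h p" "g : Oloc h p" shows "f+g : Oloc h p"
proof -
obtain a c F H where f: "f = a/c" "rep h a F" "rep h c H" "H p ~= 0" by(rule Oloc_E[OF assms(3)])
obtain a' c' F' H' where g: "g = a'/c'" "rep h a' F'" "rep h c' H'" "H' p ~= 0" by(rule Oloc_E[OF assms(4)])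
have "c ~= 0" "c' ~= 0" using rep_nz[OF assms(1) _ assms(2)] f g by blast+
hence "f+g = (a*c'+a'*c)/(c*c')" by(simp add: f g field_simps)
thus ?thesis using Oloc_I[OF rep.add[OF rep.mult[OF f(2) g(3)] rep.mult[OF g(2) f(3)]] rep.mult[OF f(3) g(3)], of p] f(4) g(4) by simp
qed

lemma Oloc_rep: "rep h a F ==> a : Oloc h p"
using Oloc_I[OF _ rep.cst[of h 1], of a F p] by simp

lemma K_factor:
assumes th: "q : charts A" and sm: "smooth_at q p b" and f: "f : K" "f ~= 0"
shows "EX m w. f = unif q p b powi m*w & w : Oloc q p & inverse w : Oloc q p & w ~= 0"
proof -
have pc: "p : cpts cc A q" using sm by(simp add: smooth_at_def)
obtain a c F H where ac: "rep q a F" "rep q c H" "c ~= 0" "f = a/c" using frac_field[OF th f(1)] by blast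
hence "a ~= 0" using f(2) by auto
then obtain k g G a' F' where k: "rep q g G" "G p ~= 0" "rep q a' F'" "F' p ~= 0" "g*a = unif q p b ^ k*a'" using rep_factor[OF th sm ac(1)] by blast
obtain l h L c' H' where l: "rep q h L" "L p ~= 0" "rep q c' H'" "H' p ~= 0" "h*c = unif q p b^l*c'" using rep_factor[OF th sm ac(2,3)] by blast
have nz: "g ~= 0" "a' ~= 0" "h ~= 0" "c' ~= 0" using rep_nz[OF th _ pc] k l by blast+
have T: "unif q p b ~= 0" by(rule unif_nz[OF th sm])
have "a = unif q p b ^ k*a'/g" "c = unif q p b^l*c'/h" using k(5) l(5) nz by(simp_all add: field_simps)
hence "f = (unif q p b ^ k/unif q p b^l)*((a'*h)/(g*c'))" using ac(4) nz by(simp add: mult_ac)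
also have "unif q p b ^ k/unif q p b^l = unif q p b powi (int k-int l)" using T by(simp add: power_int_diff)
finally show ?thesis using Oloc_I[OF rep.mult[OF k(3) l(1)] rep.mult[OF k(1) l(3)], of p]
  Oloc_I[OF rep.mult[OF k(1) l(3)] rep.mult[OF k(3) l(1)], of p] k l nz by(intro exI[of _ "int k-int l"] exI[of _ "(a'*h)/(g*c')"]) auto
qed

lemma Oloc_power: "f : Oloc h p ==> f ^ k : Oloc h p"
by(induction k) (use Oloc_rep[OF rep.cst[of h 1]] in \<open>auto intro: Oloc_mult\<close>)

lemma unif_Oloc: "unif h p b : Oloc h p" by(rule Oloc_rep[OF rep_unif])

lemma unif_inverse: assumes th: "h : charts A" and sm: "smooth_at h p b"
shows "inverse (unif h p b) ~: Oloc h p"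
proof
have pc: "p : cpts cc A h" using sm by(simp add: smooth_at_def)
assume "inverse (unif h p b) : Oloc h p"
then obtain a c F H where *: "inverse (unif h p b) = a/c" "rep h a F" "rep h c H" "H p ~= 0" by(rule Oloc_E)
have "c ~= 0" using rep_nz[OF th _ pc] * by blast
hence "c = unif h p b*a" using *(1) unif_nz[OF th sm] by(simp add: field_simps)
hence "H p = unifF p b p*F p" using rep_eq[OF th *(3) _ pc] rep.mult[OF rep_unif *(2)] by metis
thus False using *(4) by(cases b) (auto simp: unifF_def)
qed

lemma vring_Oloc: assumes th: "h : charts A" and sm: "smooth_at h p b" shows "vring (Oloc h p)"
proof -
have pc: "p : cpts cc A h" using sm by(simp add: smooth_at_def)
have T: "unif h p b ~= 0" by(rule unif_nz[OF th sm])
have "f : Oloc h p | inverse f : Oloc h p" if fK: "f : K" "f ~= 0" for f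
proof -
 obtain m w where mw: "f = unif h p b powi m*w" "w : Oloc h p" "inverse w : Oloc h p" "w ~= 0" using K_factor[OF th sm fK] by blast
 show ?thesis
 proof(cases "m >= 0")
  case True
  hence "f = unif h p b^nat m*w" using mw(1) by(simp add: power_int_def)
  thus ?thesis using Oloc_mult[OF Oloc_power[OF unif_Oloc] mw(2)] by simp
 next
  case False
  hence "inverse f = unif h p b^nat (- m)*inverse w" using mw(1) by(simp add: power_int_def power_inverse)
  thus ?thesis using Oloc_mult[OF Oloc_power[OF unif_Oloc] mw(3)] by simp
 qed
qed
moreover have "Oloc h p ~= K" using unif_inverse[OF th sm] K_inverse[OF Oloc_K[OF unif_Oloc]] by metis
moreover have "Oloc h p <= K" using Oloc_K by blast
moreover have "range cst <= Oloc h p" using Oloc_rep[OF rep.cst] by blast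
ultimately show ?thesis unfolding vring_def using Oloc_add[OF th pc] Oloc_mult by simp
qed

lemma Oloc_hv:
assumes th: "h : charts A" and sm: "smooth_at h p b" and r: "rep h a F" "rep h c H" "H p ~= 0"
shows "hv (a/c) (Oloc h p) (F p/H p)"
proof -
have pc: "p : cpts cc A h" using sm by(simp add: smooth_at_def)
have cn: "c ~= 0" using rep_nz[OF th r(2) pc r(3)] .
define d where "d = F p/H p"
define x where "x = a-cst d*c"
have x: "rep h x (%q. F q-d*H q)" unfolding x_def by(intro rep_diff r rep.mult rep.cst)
have eq: "a/c-cst d = x/c" using cn by(simp add: x_def field_simps)
have "x/c : vmax (Oloc h p)"
proof(rule vmaxI[OF vring_Oloc[OF th sm] Oloc_K[OF Oloc_I[OF x r(2,3)]]])
 assume nz: "x/c ~= 0"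
 show "inverse (x/c) ~: Oloc h p"
 proof
  assume "inverse (x/c) : Oloc h p"
  then obtain a' c' F' H' where *: "inverse (x/c) = a'/c'" "rep h a' F'" "rep h c' H'" "H' p ~= 0" by(rule Oloc_E)
  have "c' ~= 0" using rep_nz[OF th _ pc] * by blast
  hence "c*c' = x*a'" using *(1) nz by(simp add: field_simps)
  hence "H p*H' p = (F p-d*H p)*F' p" using rep_eq[OF th rep.mult[OF r(2) *(3)] _ pc] rep.mult[OF x *(2)] by metis
  thus False using *(4) r(3) by(simp add: d_def)
 qed
qed
thus ?thesis unfolding hv_def eq[symmetric] d_def .
qed

lemma Oloc_hv_rep:
assumes "h : charts A" "smooth_at h p b" "rep h a F"
shows "hv a (Oloc h p) (F p)" using Oloc_hv[OF assms rep.cst[of h 1]] by simp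

text \<open>A discrete valuation ring is maximal among proper subrings of its field: W contains the
  local ring, and if it were larger it would contain the inverse of the uniformizer, which lies in
  the maximal ideal of W.\<close>

theorem Oloc_unique:
assumes th: "h : charts A" and sm: "smooth_at h p b" and W: "vring W"
 and U: "hv (Uc h) W (fst p)" and V: "hv (Vc h) W (snd p)"
shows "W = Oloc h p"
proof -
have pc: "p : cpts cc A h" using sm by(simp add: smooth_at_def)
hence v: "snd p ~= 0" by(simp add: cpts_def)
have sub: "Oloc h p <= W"
proof
 fix f assume "f : Oloc h p"
 then obtain a c F H where f: "f = a/c" "rep h a F" "rep h c H" "H p ~= 0" by(rule Oloc_E)
 have "a : W" using hv_mem[OF W hv_rep[OF W f(2) U V v]] .
 moreover have "inverse c : W" using hv_inverse_mem[OF W hv_rep[OF W f(3) U V v] f(4)] .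
 ultimately show "f : W" unfolding f(1) divide_inverse by(rule vringD(5)[OF W])
qed
have T: "unif h p b : vmax W" using hv_rep[OF W rep_unif U V v, of p b] by(cases b) (simp_all add: hv_def unifF_def)
have "f : Oloc h p" if f: "f : W" for f
proof(rule ccontr)
 assume n: "f ~: Oloc h p"
 have nz: "f ~= 0" using n vring_0_1[OF vring_Oloc[OF th sm]] by metis
 have fK: "f : K" using f vringD(1)[OF W] by blast
 obtain m w where mw: "f = unif h p b powi m*w" "w : Oloc h p" "inverse w : Oloc h p" "w ~= 0" using K_factor[OF th sm fK nz] by blast
 have "m < 0"
 proof(rule ccontr)
  assume "~ m < 0"
  hence "f = unif h p b^nat m*w" using mw(1) by(simp add: power_int_def)
  thus False using n Oloc_mult[OF Oloc_power[OF unif_Oloc] mw(2)] by simp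
 qed
 then obtain k where k: "m = - int (Suc k)" by(metis int_cases4 less_int_code(1) neg_int_cases not_less gr0_implies_Suc of_nat_0_less_iff neg_less_0_iff_less)
 \<comment> \<open>With f = unif^(-(k+1)) w this product is 1, although its first factor lies in the
   maximal ideal.\<close>
 have "unif h p b*(unif h p b ^ k*f*inverse w) : vmax W"
  by(intro vmax_mult[OF W T] vringD(5)[OF W] vring_power[OF W] vmax_sub[OF T] f subsetD[OF sub mw(3)])
 moreover have "unif h p b powi m = inverse (unif h p b^Suc k)" unfolding k by(simp only: power_int_minus power_int_of_nat)
 hence "unif h p b*(unif h p b ^ k*f*inverse w) = 1" unfolding mw(1) using unif_nz[OF th sm] mw(4) by(simp add: field_simps)
 ultimately have "cst 1 : vmax W" by simp
 thus False using cst_vmax[OF W, of 1] by simp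
qed
thus ?thesis using sub by blast
qed

subsection \<open>Classification of the places\<close>

text \<open>Over the complex numbers q splits into linear factors. The maximal ideal is prime, so it
  contains one of the factors y - z.\<close>

lemma residue_exists:
assumes W: "vring W" and y: "y : W" and q: "q ~= 0" and z: "poly (map_poly cst q) y : vmax W"
shows "EX z. poly q z = 0 & hv y W z"
proof -
have mp_mult: "map_poly cst (a*c) = map_poly cst a*map_poly cst c" for a c by(rule poly_eqI) (simp add: coeff_map_poly coeff_mult cst_sum cst_mult)
obtain S where S: "q = smult (lead_coeff q) (\<Prod>x\<in>#S. [:- x,1:])" using alg_closed_imp_factorization[OF q] by blast
have prime: "a : vmax W | c : vmax W" if "a : W" "c : W" "a*c : vmax W" for a c
proof(rule ccontr)
 assume "~ ?thesis"
 hence "inverse a : W" "inverse c : W" "a ~= 0" "c ~= 0" using that unfolding vmax_def by auto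
 hence "a*c*(inverse a*inverse c) : vmax W" by(intro vmax_mult[OF W that(3)] vringD(5)[OF W])
 moreover have "a*c*(inverse a*inverse c) = cst 1" using \<open>a ~= 0\<close> \<open>c ~= 0\<close> by(simp add: field_simps)
 ultimately show False using cst_vmax[OF W, of 1] by simp
qed
have mem: "poly (map_poly cst a) y : W" for a
proof(induction a)
 case (pCons c a)
 have "map_poly cst (pCons c a) = pCons (cst c) (map_poly cst a)" by(intro poly_eqI) (simp add: coeff_map_poly coeff_pCons split: nat.split)
 thus ?case using pCons.IH by(auto intro!: vringD(4,5)[OF W] y vringD(3)[OF W])
qed (use vring_0_1[OF W] in simp)
have ex: "\<exists>x\<in>#S. hv y W x" if "poly (map_poly cst (\<Prod>x\<in>#S. [:- x,1:])) y : vmax W" for S using that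
proof(induction S)
 case empty thus ?case using cst_vmax[OF W, of 1] by simp
next
 case (add x S)
 have "poly (map_poly cst [:- x,1:]) y = y-cst x" by(simp add: map_poly_pCons cst_minus)
 moreover have "poly (map_poly cst [:- x,1:]) y*poly (map_poly cst (\<Prod>x\<in>#S. [:- x,1:])) y : vmax W"
  using add.prems by(simp add: mp_mult del: mult_pCons_left)
 ultimately have "y-cst x : vmax W | poly (map_poly cst (\<Prod>x\<in>#S. [:- x,1:])) y : vmax W" using prime[OF mem mem] by metis
 thus ?case using add.IH by(auto simp: hv_def)
qed
have "map_poly cst (smult (lead_coeff q) a) = smult (cst (lead_coeff q)) (map_poly cst a)" for a by(rule poly_eqI) (simp add: coeff_map_poly cst_mult)
hence "cst (lead_coeff q)*poly (map_poly cst (\<Prod>x\<in>#S. [:- x,1:])) y : vmax W" using z by(subst (asm) S) simp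
moreover have "cst (lead_coeff q) ~: vmax W" using cst_vmax[OF W] q by simp
ultimately have "poly (map_poly cst (\<Prod>x\<in>#S. [:- x,1:])) y : vmax W" using prime[OF vringD(3)[OF W] mem] by blast
then obtain x where x: "x \<in># S" "hv y W x" using ex by blast
have "poly q x = 0"
proof -
 obtain S' where "S = add_mset x S'" using multi_member_split[OF x(1)] by blast
 hence "[:- x,1:] dvd (\<Prod>x\<in>#S. [:- x,1:])" by(simp del: mult_pCons_left)
 thus ?thesis by(subst S) (auto simp: poly_eq_0_iff_dvd intro: dvd_smult)
qed
thus ?thesis using x(2) by blast
qed

lemma hv_ev_const: assumes "vring W" "hv Xc W c" shows "hv (ev [:p:]) W (poly p c)"
proof(induction p)
case 0 show ?case using hv_cst[OF assms(1), of 0] by(simp add: ev_zero)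
next
case (pCons a p)
have "[:pCons a p:] = [:[:a:]:] + [:[:0,1:]:] * [:p:]" by simp
hence "ev [:pCons a p:] = cst a+Xc*ev [:p:]" by(simp only: ev_add ev_mult cst_def Xc_def)
thus ?case using hv_add[OF assms(1) hv_cst[OF assms(1)] hv_mult[OF assms pCons.IH]] by simp
qed

lemma ev_fiber:
assumes W: "vring W" and c: "hv Xc W c" and Y: "Yc : W"
shows "ev B-poly (map_poly cst (map_poly (%p. poly p c) B)) Yc : vmax W"
proof(induction B)
case 0 show ?case using vmax_0[OF W] by(simp add: ev_zero)
next
case (pCons a B)
have "pCons a B = [:a:] + [:0,1:]*B" by simp
hence e: "ev (pCons a B) = ev [:a:]+Yc*ev B" by(simp only: ev_add ev_mult Yc_def)
have m: "map_poly cst (map_poly (%p. poly p c) (pCons a B))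
  = pCons (cst (poly a c)) (map_poly cst (map_poly (%p. poly p c) B))" by(intro poly_eqI) (simp add: coeff_map_poly coeff_pCons split: nat.split)
have "(ev [:a:]-cst (poly a c))+(ev B-poly (map_poly cst (map_poly (%p. poly p c) B)) Yc)*Yc : vmax W"
 using hv_ev_const[OF W c, of a] by(intro vmax_add[OF W] vmax_mult[OF W pCons.IH Y]) (simp add: hv_def)
thus ?case unfolding e m by(simp add: alg)
qed

end

context nondeg begin

definition Mon :: "mon => 'l" where "Mon g = lm Xc Yc (ipt g)"

lemma Mon_nz: "Mon g ~= 0" unfolding Mon_def by(rule lm_nonzero[OF Xc_nonzero Yc_nonzero])
lemma Mon_K: "Mon g : K" unfolding Mon_def by(rule lm_K)
lemma Mon_div: "Mon g/Mon e = lm Xc Yc (ipt g-ipt e)"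
unfolding Mon_def by(rule lm_diff[OF Xc_nonzero Yc_nonzero, symmetric])

lemma Mon_chart: "h : charts A ==> g : A ==> Mon g/Mon (bas h) = Uc h^dd h g*Vc h powi jj h g"
unfolding Mon_div Uc_def Vc_def by(rule lm_chart[OF _ _ Xc_nonzero Yc_nonzero])

lemma smooth_at_ex: "h : charts A ==> p : cpts cc A h ==> EX b. smooth_at h p b & (fst p = 0 --> b)"
using smooth[of h p] unfolding smooth_at_def by(metis (full_types))

lemma prod_powi_lm:
"(PROD g:S. (Mon g/Mon e) powi w g) = lm Xc Yc ((SUM g:S. w g*ix g)-(SUM g:S. w g)*ix e,
  (SUM g:S. w g*iy g)-(SUM g:S. w g)*iy e)" if "finite S" using that
proof(induction S)
case (insert g S)
have 1: "(Mon g/Mon e) powi w g = lm Xc Yc (w g*fst (ipt g-ipt e),w g * snd (ipt g-ipt e))" unfolding Mon_div lm_powi ..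
have 2: "(w g*fst (ipt g-ipt e),w g * snd (ipt g-ipt e)) +
  ((SUM g:S. w g*ix g)-(SUM g:S. w g)*ix e,(SUM g:S. w g*iy g)-(SUM g:S. w g)*iy e)
  = ((SUM g:insert g S. w g*ix g)-(SUM g:insert g S. w g)*ix e,
   (SUM g:insert g S. w g*iy g)-(SUM g:insert g S. w g)*iy e)" using insert.hyps by(simp add: ipt_def alg)
show ?case unfolding prod.insert[OF insert.hyps] insert.IH 1 2[symmetric] by(rule lm_add[OF Xc_nonzero Yc_nonzero, symmetric])
qed (simp add: lm_def)

text \<open>A valuation ring orders the monomials totally by divisibility; e is one of least
  valuation.\<close>

lemma maximal_monomial:
assumes W: "vring W" and S: "finite S" "S ~= {}"
shows "EX e:S. ALL g:S. Mon g/Mon e : W" using S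
proof(induction S rule: finite_ne_induct)
case (singleton x) thus ?case using vring_0_1[OF W] Mon_nz by simp
next
case (insert x S)
then obtain e where e: "e : S" "ALL g:S. Mon g/Mon e : W" by blast
show ?case
proof(cases "Mon x/Mon e : W")
 case True thus ?thesis using e by blast
next
 case False
 hence i: "Mon e/Mon x : W" using vringD(6)[OF W K_divide[OF Mon_K Mon_K]] by fastforce
 have "Mon g/Mon x : W" if "g : S" for g
 proof -
  have "(Mon g/Mon e)*(Mon e/Mon x) : W" using vringD(5)[OF W] e(2) that i by blast
  thus ?thesis using Mon_nz[of e] by simp
 qed
 thus ?thesis using vring_0_1[OF W] Mon_nz by(intro bexI[of _ x]) auto
qed
qed

text \<open>An affine relation w makes the product of the (Mon g / Mon e)^(w g) equal to 1. If the
  factors with negative exponent are units, all factors lie in W, and a factor of 1 is a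
  unit.\<close>

lemma unit_face_closed:
assumes W: "vring W" and e: "e : A" "!!g. g : A ==> Mon g/Mon e : W"
shows "closed_face A {g : A. Mon e/Mon g : W}" unfolding closed_face_def
proof(intro conjI allI impI ballI)
fix w :: "mon => int" and g0
assume s: "(SUM g:A. w g) = 0" "(SUM g:A. w g*ix g) = 0" "(SUM g:A. w g*iy g) = 0"
 and neg: "ALL g:A. w g < 0 --> g : {g : A. Mon e/Mon g : W}" and g0: "g0 : A" "w g0 > 0"
define x where "x = (%g. Mon g/Mon e)"
have xnz: "x g ~= 0" for g using Mon_nz by(simp add: x_def)
have "(PROD g:A. x g powi w g) = 1" unfolding x_def prod_powi_lm[OF finA] s by(simp add: lm_def)
hence "x g0 powi w g0*(PROD g:A-{g0}. x g powi w g) = 1" using prod.remove[OF finA g0(1)] by metis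
moreover have "(PROD g:A-{g0}. x g powi w g) : W"
proof(rule vring_prod[OF W])
 fix g assume g: "g : A-{g0}"
 show "x g powi w g : W"
 proof(cases "w g < 0")
  case True
  hence "Mon e/Mon g : W" using neg g by blast
  hence "inverse (x g) : W" by(simp add: x_def)
  hence "inverse (x g)^nat (- w g) : W" by(rule vring_power[OF W])
  thus ?thesis using True by(simp add: power_int_def power_inverse)
 next
  case False
  thus ?thesis using vring_power[OF W e(2)] g by(simp add: x_def power_int_def)
 qed
qed
ultimately have "x g0^nat (w g0)*(PROD g:A-{g0}. x g powi w g) = 1" "(PROD g:A-{g0}. x g powi w g) : W" using g0(2) by(simp_all add: power_int_def)
then obtain y where y: "x g0^nat (w g0)*y = 1" "y : W" by blast
have "nat (w g0) = Suc (nat (w g0)-1)" using g0(2) by simp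
hence "x g0*(x g0^(nat (w g0)-1)*y) = 1" using y(1) by(metis mult.assoc power_Suc)
hence "inverse (x g0) = x g0^(nat (w g0)-1)*y" by(rule inverse_unique)
moreover have "x g0^(nat (w g0)-1)*y : W" using vringD(5)[OF W vring_power[OF W] y(2)] e(2)[OF g0(1)] by(simp add: x_def)
ultimately show "g0 : {g : A. Mon e/Mon g : W}" using g0(1) by(simp add: x_def)
qed simp

text \<open>q is the edge polynomial, the restriction of \<open>gth\<close> to u = 0. Only the base
  point has both coordinates zero, so the constant coefficient of q is the coefficient of chi there,
  which is nonzero.\<close>

lemma wedge_root_poly:
assumes th: "ch : charts A"
defines "q \<equiv> (SUM g:{g:A. dd ch g = 0}. monom (cc g) (nat (jj ch g)))"
shows "q ~= 0" "poly (map_poly cst q) v = (SUM g:{g:A. dd ch g = 0}. cst (cc g) * v powi jj ch g)"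
 "!!g. g : A ==> dd ch g = 0 ==> jj ch g >= 0"
proof -
obtain e f h where t: "ch = (e,f,h)" by(cases ch)
have c: "e : A" "det3 e f h = 1" "!!g. g : A ==> det3 e f g >= 0"
 "!!g. g : A ==> det3 e f g = 0 ==> det3 e g h >= 0" using th unfolding t charts_def by auto
show j: "!!g. g : A ==> dd ch g = 0 ==> jj ch g >= 0" using c(3,4) by(fastforce simp: t dd_def jj_def)
have inj: "g = e" if "g : A" "dd ch g = 0" "jj ch g = 0" for g
proof -
 have "det3 e f g = 0" "det3 e g h = 0" using that c(3)[of g] by(auto simp: t dd_def jj_def)
 hence "ipt g-ipt e = 0" using det_expand[OF c(2), of g] by(simp add: zero_prod_def)
 thus ?thesis by(auto simp: ipt_def prod_eq_iff)
qed
have e0: "dd ch e = 0" "jj ch e = 0" by(simp_all add: t dd_def jj_def det3_def)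
have "Polynomial.coeff q 0 = (SUM g:{g:A. dd ch g = 0}. if g = e then cc e else 0)" unfolding q_def coeff_sum coeff_monom
 by(intro sum.cong refl) (use inj j e0 in \<open>auto simp: order_antisym\<close>)
also have "... = cc e" using c(1) e0(1) finA by(subst sum.delta) auto
finally have "Polynomial.coeff q 0 ~= 0" using suppA c(1) by simp
thus "q ~= 0" by auto
have mps: "map_poly cst (SUM g:S. f g) = (SUM g:S. map_poly cst (f g))" for S :: "mon set" and f
 by(rule poly_eqI) (simp add: coeff_map_poly coeff_sum cst_sum)
have mpm: "map_poly cst (monom c k) = monom (cst c) k" for c k by(rule poly_eqI) (simp add: coeff_map_poly coeff_monom)
show "poly (map_poly cst q) v = (SUM g:{g:A. dd ch g = 0}. cst (cc g) * v powi jj ch g)" unfolding q_def mps mpm poly_sum poly_monom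
 by(intro sum.cong refl) (use j in \<open>auto simp: power_int_def\<close>)
qed

text \<open>The monomials of least valuation form a closed face S with at least two points, so
  \<open>faces\<close> provides a chart in which U and V lie in W and V is a unit. If S is not all
  of A, U has value 0 and V a root of the edge polynomial as value. If S = A, x and y are units and
  have nonzero values.\<close>

theorem vring_classify:
assumes W: "vring W"
shows "EX ch:charts A. EX p:cpts cc A ch. hv (Uc ch) W (fst p) & hv (Vc ch) W (snd p)"
proof -
have A0: "(0,0) : A" using unimodular by auto
obtain e0 where e0: "e0 : A" "!!g. g : A ==> Mon g/Mon e0 : W" using maximal_monomial[OF W finA] A0 by blast
define S where "S = {g : A. Mon e0/Mon g : W}"
have SA: "S <= A" by(auto simp: S_def)
have cl: "closed_face A S" unfolding S_def by(rule unit_face_closed[OF W e0])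
have "Mon e0/Mon e0 = 1" using Mon_nz by simp
hence eS: "e0 : S" using e0(1) vring_0_1[OF W] by(simp add: S_def)
have nS: "Mon g/Mon e0 : vmax W" if "g : A" "g ~: S" for g using that e0(2) by(auto simp: S_def vmax_def)
\<comment> \<open>With a single monomial of least valuation, chi = 0 divided by it would express its
  nonzero coefficient as an element of the maximal ideal.\<close>
have "EX g:S. g ~= e0"
proof(rule ccontr)
 assume "~ ?thesis"
 hence nv: "Mon g/Mon e0 : vmax W" if "g : A-{e0}" for g using nS that by blast
 have "(SUM g:A. cst (cc g)*(Mon g/Mon e0)) = 0" using sum_chi by(simp add: sum_divide_distrib[symmetric] Mon_def lm_def ipt_def power_int_def)
 hence "cst (cc e0)*(Mon e0/Mon e0)+(SUM g:A-{e0}. (Mon g/Mon e0)*cst (cc g)) = 0" by(subst (asm) sum.remove[OF finA e0(1)]) (simp add: mult.commute)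
 hence "cst (cc e0) = - (SUM g:A-{e0}. (Mon g/Mon e0)*cst (cc g))" using Mon_nz[of e0] by(simp add: eq_neg_iff_add_eq_0)
 also have "... : vmax W" by(intro vmax_uminus[OF W] vmax_sum[OF W] vmax_mult[OF W] nv vringD(3)[OF W])
 finally show False using cst_vmax[OF W] suppA[of e0] e0(1) by simp
qed
then obtain g1 where g1: "g1 : S" "g1 ~= e0" by blast
from faces[OF cl eS g1(1) g1(2)[symmetric]] obtain ch where th: "ch : charts A" "fst ch : S" "fst (snd ch) : S"
 "snd (snd ch) : S --> S = A" by blast
obtain e f h where t: "ch = (e,f,h)" by(cases ch)
have m: "e : A" "f : A" "h : A" "e : S" "f : S" using th unfolding t charts_def by auto
have div: "Mon a/Mon b : W" if "a : A" "b : S" for a b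
proof -
 have "(Mon a/Mon e0)*(Mon e0/Mon b) : W" using e0(2)[OF that(1)] that(2) by(intro vringD(5)[OF W]) (auto simp: S_def)
 thus ?thesis using Mon_nz[of e0] by simp
qed
have UV: "Uc ch = Mon h/Mon e" "Vc ch = Mon f/Mon e" unfolding Mon_div Uc_def Vc_def wU_def wV_def t by simp_all
have mem: "Uc ch : W" "Vc ch : W" "inverse (Vc ch) : W" unfolding UV using div m by simp_all
have Vn: "v ~= 0" if v: "hv (Vc ch) W v" for v
proof
 assume "v = 0"
 hence "Vc ch : vmax W" using v by(simp add: hv_def)
 thus False using mem(3) Vc_nonzero by(auto simp: vmax_def)
qed
have "EX u v. hv (Uc ch) W u & hv (Vc ch) W v"
proof(cases "h : S")
 case False
 have "Uc ch : vmax W"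
 proof(rule vmaxI[OF W])
  show "Uc ch : K" using mem(1) vringD(1)[OF W] by blast
  show "inverse (Uc ch) ~: W"
  proof
   assume "inverse (Uc ch) : W"
   hence "Mon e/Mon h : W" unfolding UV by simp
   hence "(Mon e0/Mon e)*(Mon e/Mon h) : W" using div[OF e0(1) m(4)] vringD(5)[OF W] by blast
   hence "h : S" using Mon_nz[of e] m(3) by(simp add: S_def)
   thus False using False by blast
  qed
 qed
 hence U: "hv (Uc ch) W 0" by(simp add: hv_def)
 define q where "q = (SUM g:{g:A. dd ch g = 0}. monom (cc g) (nat (jj ch g)))"
 note q = wedge_root_poly[OF th(1), folded q_def]
 have "(SUM g:A. cst (cc g)*(Uc ch^dd ch g*Vc ch powi jj ch g)) = 0" by(rule sum_chart[OF th(1)])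
 hence "(SUM g:{g:A. dd ch g = 0}. cst (cc g)*(Uc ch^dd ch g*Vc ch powi jj ch g))
   + (SUM g:A-{g:A. dd ch g = 0}. cst (cc g)*(Uc ch^dd ch g*Vc ch powi jj ch g)) = 0"
  by(subst (asm) sum.subset_diff[of "{g:A. dd ch g = 0}"]) (auto simp: finA add.commute)
 moreover have "(SUM g:{g:A. dd ch g = 0}. cst (cc g)*(Uc ch^dd ch g*Vc ch powi jj ch g))
   = poly (map_poly cst q) (Vc ch)" unfolding q(2) by(intro sum.cong) auto
 ultimately have "poly (map_poly cst q) (Vc ch)
   = - (SUM g:A-{g:A. dd ch g = 0}. cst (cc g)*(Uc ch^dd ch g*Vc ch powi jj ch g))" by(simp add: eq_neg_iff_add_eq_0)
 also have "... : vmax W"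
 proof(intro vmax_uminus[OF W] vmax_sum[OF W])
  fix g assume g: "g : A-{g:A. dd ch g = 0}"
  have Vp: "Vc ch powi k : W" for k using vring_power[OF W mem(2)] vring_power[OF W mem(3)]
   by(cases k rule: int_cases2) (auto simp: power_int_minus power_inverse)
  have "Uc ch*(cst (cc g)*Uc ch^(dd ch g-1)*Vc ch powi jj ch g) : vmax W"
   using \<open>Uc ch : vmax W\<close> by(intro vmax_mult[OF W] vringD(5)[OF W] vringD(3)[OF W] vring_power[OF W mem(1)] Vp)
  moreover have "Uc ch^dd ch g = Uc ch*Uc ch^(dd ch g-1)" using g by(cases "dd ch g") auto
  ultimately show "cst (cc g)*(Uc ch^dd ch g*Vc ch powi jj ch g) : vmax W" by(simp add: mult_ac)
 qed
 finally have "EX z. hv (Vc ch) W z" using residue_exists[OF W mem(2) q(1)] by blast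
 thus ?thesis using U by blast
next
 case True
 hence SA': "S = A" using th(4) by(simp add: t)
 obtain b where b: "(0,0) : A" "(0,1) : A" "(1,b) : A" using unimodular by auto
 have Y: "Yc : W" "inverse Yc : W" using div[of "(0,1)" "(0,0)"] div[of "(0,0)" "(0,1)"] b SA' by(auto simp: Mon_def lm_def ipt_def divide_inverse)
 have "Mon (1,b)/Mon (0,0) = Xc*Yc^b" "Mon (0,0)/Mon (1,b) = inverse (Xc*Yc^b)" by(simp_all add: Mon_def lm_def ipt_def power_int_def divide_inverse)
 hence "Xc*Yc^b : W" "inverse (Xc*Yc^b) : W" using div b SA' by metis+
 hence "Xc*Yc^b*inverse Yc^b : W" "inverse (Xc*Yc^b)*Yc^b : W" using vringD(5)[OF W] vring_power[OF W Y(1)] vring_power[OF W Y(2)] by blast+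
 hence X: "Xc : W" "inverse Xc : W" using Yc_nonzero by(simp_all add: field_simps)
 \<comment> \<open>If x had no value, every nonzero polynomial in x would be a unit of W by
   \<open>residue_exists\<close>; since denominators can be taken in C[x], W would be the whole
   field.\<close>
 have "EX c. hv Xc W c"
 proof(rule ccontr)
  assume no: "~ ?thesis"
  have evp: "poly (map_poly cst d) Xc = ev [:d:]" for d
  proof(induction d)
   case (pCons a d)
   have "map_poly cst (pCons a d) = pCons (cst a) (map_poly cst d)" by(intro poly_eqI) (simp add: coeff_map_poly coeff_pCons split: nat.split)
   moreover have "[:pCons a d:] = [:[:a:]:] + [:[:0,1:]:] * [:d:]" by simp
   hence "ev [:pCons a d:] = cst a+Xc*ev [:d:]" by(simp only: ev_add ev_mult cst_def Xc_def)
   ultimately show ?case using pCons.IH by simp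
  qed (simp add: ev_zero)
  have poly_mem: "ev [:d:] : W" for d
  proof(induction d)
   case (pCons a d)
   have "[:pCons a d:] = [:[:a:]:] + [:[:0,1:]:] * [:d:]" by simp
   hence "ev [:pCons a d:] = cst a+Xc*ev [:d:]" by(simp only: ev_add ev_mult cst_def Xc_def)
   thus ?case using pCons.IH X(1) vringD(3,4,5)[OF W] by metis
  qed (use vring_0_1[OF W] in \<open>simp add: ev_zero\<close>)
  have ev_mem: "ev B : W" for B
  proof(induction B)
   case (pCons a B)
   have "pCons a B = [:a:] + [:0,1:]*B" by simp
   hence "ev (pCons a B) = ev [:a:]+Yc*ev B" by(simp only: ev_add ev_mult Yc_def)
   thus ?case using pCons.IH Y(1) poly_mem vringD(4,5)[OF W] by metis
  qed (use vring_0_1[OF W] in \<open>simp add: ev_zero\<close>)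
  have "f : W" if f: "f : K" for f
  proof -
   obtain B d where Bd: "d ~= 0" "f = ev B/ev [:d:]" by(rule K_quot[OF f])
   have "ev [:d:] ~: vmax W" using residue_exists[OF W X(1) Bd(1)] no unfolding evp by blast
   hence "inverse (ev [:d:]) : W" using poly_mem unfolding vmax_def by blast
   thus ?thesis unfolding Bd(2) divide_inverse by(rule vringD(5)[OF W ev_mem])
  qed
  thus False using vringD(1,2)[OF W] by blast
 qed
 then obtain c where c: "hv Xc W c" by blast
 have unit_nz: "z ~= 0" if "hv y W z" "inverse y : W" "y ~= 0" for y z using that by(auto simp: hv_def vmax_def)
 have cn: "c ~= 0" using unit_nz[OF c X(2) Xc_nonzero] .
 have "map_poly (%p. poly p c) chi ~= 0" using fiber_poly(2)[of c] by auto
 moreover have "poly (map_poly cst (map_poly (%p. poly p c) chi)) Yc : vmax W"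
  using vmax_uminus[OF W ev_fiber[OF W c Y(1), of chi]] by(simp add: ev_eq_0_iff[of chi, THEN iffD2])
 ultimately obtain s where s: "hv Yc W s" using residue_exists[OF W Y(1)] by blast
 have sn: "s ~= 0" using unit_nz[OF s Y(2) Yc_nonzero] .
 show ?thesis unfolding Uc_def Vc_def using hv_lm[OF W c s cn sn] by blast
qed
then obtain u v where uv: "hv (Uc ch) W u" "hv (Vc ch) W v" by blast
have "(u,v) : cpts cc A ch" using hv_gth_zero[OF W th(1), of "(u,v)"] uv Vn by simp
thus ?thesis using th(1) uv by(intro bexI[of _ ch] bexI[of _ "(u,v)"]) auto
qed

end

context nondeg begin

subsection \<open>Local parametrizations of the Riemann surface\<close>

definition Pl :: "triple => complex \<times> complex => place" where "Pl h p = place_of (Oloc h p)"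

lemma Pl_place: "h : charts A ==> smooth_at h p b ==> Pl h p : places chi"
unfolding Pl_def by(rule place_of_places[OF vring_Oloc])

lemma th_Pl: "th ` Pl h p = Oloc h p"
unfolding Pl_def by(rule image_place_of) (use Oloc_K in blast)

lemma Pl_mem: "f : carrier FF ==> f : Pl h p \<longleftrightarrow> th f : Oloc h p"
by(simp add: Pl_def place_of_def)

lemma place_unique:
assumes "h : charts A" "smooth_at h p b" "P : places chi"
 "hv (Uc h) (th ` P) (fst p)" "hv (Vc h) (th ` P) (snd p)"
shows "P = Pl h p" using Oloc_unique[OF assms(1,2) vring_image[OF assms(3)] assms(4,5)] place_of_image[OF assms(3)] by(simp add: Pl_def)

lemma place_classify:
assumes "P : places chi"
obtains h p b where "h : charts A" "smooth_at h p b" "fst p = 0 --> b" "P = Pl h p"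
proof -
obtain h p where th: "h : charts A" "p : cpts cc A h" "hv (Uc h) (th ` P) (fst p)" "hv (Vc h) (th ` P) (snd p)"
 using vring_classify[OF vring_image[OF assms]] by blast
obtain b where "smooth_at h p b" "fst p = 0 --> b" using smooth_at_ex[OF th(1,2)] by blast
thus ?thesis using that th place_unique[OF th(1) _ assms th(3,4)] by blast
qed

lemma Oloc_has_value:
assumes "h : charts A" "smooth_at h p b" "a : Oloc h p"
shows "hv a (Oloc h p) (pval a (Oloc h p))"
proof -
obtain x c F H where f: "a = x/c" "rep h x F" "rep h c H" "H p ~= 0" by(rule Oloc_E[OF assms(3)])
have "hv a (Oloc h p) (F p/H p)" unfolding f(1) by(rule Oloc_hv[OF assms(1,2) f(2-4)])
thus ?thesis using hv_pval[OF vring_Oloc[OF assms(1,2)]] by simp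
qed

lemma place_has_value:
assumes "P : places chi" "a : th ` P"
shows "hv a (th ` P) (pval a (th ` P))"
proof -
obtain h p b where "h : charts A" "smooth_at h p b" "P = Pl h p" by(rule place_classify[OF assms(1)]) blast
thus ?thesis using Oloc_has_value[of h p b a] assms(2) by(simp add: th_Pl)
qed

definition fe :: "'l => ff_elem" where "fe a = inv_into (carrier FF) th a"

lemma fe: assumes "a : K" shows "fe a : carrier FF" "th (fe a) = a"
using assms th_image f_inv_into_f[of a th "carrier FF"] inv_into_into[of a th "carrier FF"] unfolding fe_def by auto

lemma fe_mem: assumes "P : places chi" "a : K" shows "fe a : P \<longleftrightarrow> a : th ` P"
using th_mem_iff[OF places_carrier[OF assms(1)] fe(1)[OF assms(2)]] fe(2)[OF assms(2)] by simp

lemma fe_value: assumes "P : places chi" "a : K" shows "pv chi (fe a) P = pval a (th ` P)"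
using place_value_eq[OF assms(1) fe(1)[OF assms(2)]] fe(2)[OF assms(2)] by simp

lemma par_continuous: assumes "cpar h G r b" shows "continuous_on (ball 0 r) G"
proof -
have "continuous_on (ball 0 r) (%u. (fst (G u),snd (G u)))" by(intro continuous_on_Pair holomorphic_on_imp_continuous_on par_holomorphic[OF assms])
thus ?thesis by simp
qed

lemma unifF_bound: "norm (unifF p b q) <= dist q p"
proof -
have "dist (fst q) (fst p) <= dist q p" "dist (snd q) (snd p) <= dist q p" by(rule dist_fst_le, rule dist_snd_le)
thus ?thesis by(simp add: unifF_def dist_norm)
qed

text \<open>\<open>curve_par_exists\<close> gives local uniqueness only around the centre. A second
  parametrization centred at G u0 uses the same coordinate as parameter, hence agrees with G after
  the shift by u0, and this carries the uniqueness over.\<close>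

lemma par_local_unique:
assumes par: "cpar h G r b" and D: "open D" "D <= ball 0 r" "u0 : D"
shows "EX ep>0. ALL q:cpts cc A h. dist q (G u0) < ep --> q : G ` D"
proof -
have t0: "u0 : ball 0 r" using D by blast
obtain G' r' ep' where g: "cpar h G' r' b" "G' 0 = G u0" "ep' > 0"
 "!!q. q : cpts cc A h ==> dist q (G u0) < ep' ==> q : G' ` ball 0 r'" by(rule smooth_par[OF par_smooth[OF par t0]]) blast
have "isCont G u0" using par_continuous[OF par] t0 continuous_on_eq_continuous_at open_ball by blast
then obtain d1 where d1: "d1 > 0" "!!u. dist u u0 < d1 ==> dist (G u) (G u0) < ep'" using g(3) unfolding continuous_at_eps_delta by metis
obtain d2 where d2: "d2 > 0" "ball u0 d2 <= D" using D openE by blast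
have "q : G ` D" if q: "q : cpts cc A h" "dist q (G u0) < Min {ep',d1,d2}" for q
proof -
 obtain S where s: "S : ball 0 r'" "q = G' S" using g(4)[OF q(1)] q(2) by auto
 have us: "unifF (G u0) b q = S" using unifF_par[OF g(1) s(1)] g(2) s(2) by simp
 have "norm S < d1" "norm S < d2" using unifF_bound[of "G u0" b q] q(2) us by auto
 hence d: "dist (u0+S) u0 < d1" "u0+S : D" using d2(2) by(auto simp: dist_norm subset_eq norm_minus_commute)
 have b: "u0+S : ball 0 r" using d(2) D(2) by blast
 obtain S' where s': "S' : ball 0 r'" "G (u0+S) = G' S'" using g(4)[OF par_at(1)[OF par b] d1(2)[OF d(1)]] by blast
 have "S' = unifF (G u0) b (G (u0+S))" using unifF_par[OF g(1) s'(1)] g(2) s'(2) by simp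
 also have "... = unifF (G 0) b (G (u0+S))-unifF (G 0) b (G u0)" by(simp add: unifF_def)
 also have "... = S" using unifF_par[OF par b] unifF_par[OF par t0] by simp
 finally have "q = G (u0+S)" using s' s(2) by simp
 thus ?thesis using d(2) by blast
qed
thus ?thesis using g(3) d1(1) d2(1) by(intro exI[of _ "Min {ep',d1,d2}"]) auto
qed

lemma par_reg_local:
assumes th: "h : charts A" and par: "cpar h G r b" and t0: "u0 : ball 0 r" and f: "f : Oloc h (G u0)"
shows "EX de>0. EX g. ball u0 de <= ball 0 r & g hol_on ball u0 de &
  (ALL u:ball u0 de. f : Oloc h (G u) & pval f (Oloc h (G u)) = g u)"
proof -
obtain x c F H where x: "f = x/c" "rep h x F" "rep h c H" "H (G u0) ~= 0" by(rule Oloc_E[OF f])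
have hF: "(%u. F (G u)) hol_on ball 0 r" "(%u. H (G u)) hol_on ball 0 r" using par_rep_holomorphic[OF par] x by blast+
have "open (ball 0 r \<inter> (%u. H (G u)) -` (- {0}))" by(rule continuous_open_preimage[OF holomorphic_on_imp_continuous_on[OF hF(2)]]) auto
moreover have "u0 : ball 0 r \<inter> (%u. H (G u)) -` (- {0})" using t0 x(4) by auto
ultimately obtain de where d: "de > 0" "ball u0 de <= ball 0 r \<inter> (%u. H (G u)) -` (- {0})" using openE by blast
have H: "H (G u) ~= 0" "u : ball 0 r" if "u : ball u0 de" for u using d(2) that by auto
have sub: "ball u0 de <= ball 0 r" using d(2) by blast
have "(%u. F (G u)/H (G u)) hol_on ball u0 de"
 by(intro holomorphic_on_divide holomorphic_on_subset[OF hF(1) sub] holomorphic_on_subset[OF hF(2) sub] H(1))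
moreover have "f : Oloc h (G u) & pval f (Oloc h (G u)) = F (G u)/H (G u)" if t: "u : ball u0 de" for u using Oloc_I[OF x(2,3) H(1)[OF t]] x(1)
  hv_pval[OF vring_Oloc[OF th par_smooth[OF par H(2)[OF t]]] Oloc_hv[OF th par_smooth[OF par H(2)[OF t]] x(2,3) H(1)[OF t]]] by simp
ultimately show ?thesis using d(1) sub by blast
qed

text \<open>What remains of a branch once the toric chart is forgotten: exactly the data needed to
  compare a disc of places with the charts in \<open>rs_charts\<close>.\<close>

definition gpar :: "(complex => place) => real => bool" where
"gpar G r \<longleftrightarrow> r > 0 & G ` ball 0 r <= places chi & inj_on G (ball 0 r) &
  (ALL Q. openin (rs_topology chi) Q --> open {u:ball 0 r. G u : Q}) &
  (ALL D. open D --> D <= ball 0 r --> openin (rs_topology chi) (G ` D)) &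
  (ALL f:carrier FF. open {u:ball 0 r. f : G u} &
   (%u. pv chi f (G u)) hol_on {u:ball 0 r. f : G u})"

lemma rs_subbasic:
assumes "f : carrier FF" "open W"
shows "openin (rs_topology chi) {P : places chi. f : P & pv chi f P : W}"
unfolding rs_topology_def by(rule topology_generated_by_Basis) (use assms in blast)

lemma par_value_holo:
assumes th: "h : charts A" and par: "cpar h G r b" and f: "f : carrier FF"
shows "open {u:ball 0 r. f : Pl h (G u)}"
 "(%u. pv chi f (Pl h (G u))) hol_on {u:ball 0 r. f : Pl h (G u)}"
proof -
have loc: "EX de>0. EX g. g hol_on ball u0 de & ball u0 de <= {u:ball 0 r. f : Pl h (G u)} &
  (ALL u:ball u0 de. pv chi f (Pl h (G u)) = g u)" if "u0 : {u:ball 0 r. f : Pl h (G u)}" for u0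
proof -
 have t: "u0 : ball 0 r" "th f : Oloc h (G u0)" using that Pl_mem[OF f] by auto
 obtain de g where d: "de > 0" "ball u0 de <= ball 0 r" "g hol_on ball u0 de"
  "!!u. u:ball u0 de ==> th f : Oloc h (G u) & pval (th f) (Oloc h (G u)) = g u" using par_reg_local[OF th par t] by blast
 have "pv chi f (Pl h (G u)) = g u" if "u : ball u0 de" for u
  using place_value_eq[OF Pl_place[OF th par_smooth[OF par]] f, of u] d(2,4) that by(auto simp: th_Pl)
 thus ?thesis using d Pl_mem[OF f] by blast
qed
show o: "open {u:ball 0 r. f : Pl h (G u)}" unfolding open_contains_ball using loc by meson
show "(%u. pv chi f (Pl h (G u))) hol_on {u:ball 0 r. f : Pl h (G u)}" unfolding holomorphic_on_open[OF o]
proof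
 fix u0 assume "u0 : {u:ball 0 r. f : Pl h (G u)}"
 then obtain de g where d: "de > 0" "g hol_on ball u0 de"
  "ALL u:ball u0 de. pv chi f (Pl h (G u)) = g u" using loc by meson
 obtain D where "(g hfd D) (at u0)" using d(1,2) holomorphic_on_open[OF open_ball] by(meson centre_in_ball)
 hence "((%u. pv chi f (Pl h (G u))) hfd D) (at u0)" by(rule hfd_transform[of _ _ _ "ball u0 de"]) (use d in auto)
 thus "EX D. ((%u. pv chi f (Pl h (G u))) hfd D) (at u0)" by blast
qed
qed

text \<open>Continuity is tested on the subbasis of the topology. For openness, the values of U and
  V at a nearby place single out a nearby point of the curve, which lies on the branch by
  \<open>par_local_unique\<close>, and \<open>Oloc_unique\<close> identifies the place with that
  point.\<close>

lemma par_gpar: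
assumes th: "h : charts A" and par: "cpar h C r b"
shows "gpar (%u. Pl h (C u)) r"
proof -
let ?G = "%u. Pl h (C u)"
have pl: "?G u : places chi" if "u : ball 0 r" for u using Pl_place[OF th par_smooth[OF par that]] .
have hvr: "hv a (th ` ?G u) (F (C u))" if "u : ball 0 r" "rep h a F" for u a F
 unfolding th_Pl by(rule Oloc_hv_rep[OF th par_smooth[OF par that(1)] that(2)])
have inj: "inj_on ?G (ball 0 r)"
proof(rule inj_onI)
 fix x y assume xy: "x : ball 0 r" "y : ball 0 r" "?G x = ?G y"
 have "hv (unif h (C 0) b) (th ` ?G x) x" "hv (unif h (C 0) b) (th ` ?G y) y"
  using hvr[OF xy(1) rep_unif, of "C 0" b] hvr[OF xy(2) rep_unif, of "C 0" b] unifF_par[OF par xy(1)] unifF_par[OF par xy(2)] by simp_all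
 thus "x = y" using hv_unique[OF vring_image[OF pl[OF xy(1)]]] xy(3) by metis
qed
have T1: "open {u:ball 0 r. ?G u : Q}" if "openin (rs_topology chi) Q" for Q
proof -
 have "generate_topology_on {{\<O> : places chi. f : \<O> & pv chi f \<O> : W} | f W. f : carrier FF & open W} Q"
  using that unfolding rs_topology_def by(rule openin_topology_generated_by)
 thus ?thesis
 proof(induction rule: generate_topology_on.induct)
  case Empty thus ?case by simp
 next
  case (Int a b)
  have "{u:ball 0 r. ?G u : a \<inter> b} = {u:ball 0 r. ?G u : a} \<inter> {u:ball 0 r. ?G u : b}" by auto
  thus ?case using Int.IH by(simp only: open_Int)
 next
  case (UN S)
  have "{u:ball 0 r. ?G u : \<Union>S} = (UN k:S. {u:ball 0 r. ?G u : k})" by auto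
  thus ?case using UN.IH by auto
 next
  case (Basis s)
  then obtain f W where f: "f : carrier FF" "open W" "s = {\<O> : places chi. f : \<O> & pv chi f \<O> : W}" by blast
  note v = par_value_holo[OF th par f(1)]
  have "{u:ball 0 r. ?G u : s} = {u:ball 0 r. f : ?G u} \<inter> (%u. pv chi f (?G u)) -` W" unfolding f(3) using pl by auto
  thus ?case using continuous_open_preimage[OF holomorphic_on_imp_continuous_on[OF v(2)] v(1) f(2)] by simp
 qed
qed
have T2: "openin (rs_topology chi) (?G ` D)" if D: "open D" "D <= ball 0 r" for D
proof(subst openin_subopen, intro ballI)
 fix P assume "P : ?G ` D"
 then obtain u0 where t0: "u0 : D" "P = ?G u0" by blast
 have tb: "u0 : ball 0 r" using D(2) t0(1) by blast
 obtain ep where e: "ep > 0" "ALL q:cpts cc A h. dist q (C u0) < ep --> q : C ` D" using par_local_unique[OF par D t0(1)] by blast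
 \<comment> \<open>The bound ep/2 on each coordinate keeps the distance below ep; the other bound
   keeps the second coordinate away from 0.\<close>
 define d where "d = min (ep/2) (norm (snd (C u0)))"
 have d: "d > 0" using e(1) par_snd_nz[OF par tb] by(simp add: d_def)
 have UK: "Uc h : K" "Vc h : K" unfolding Uc_def Vc_def by(rule lm_K)+
 define N where "N = {P : places chi. fe (Uc h) : P & pv chi (fe (Uc h)) P : ball (fst (C u0)) d}
   \<inter> {P : places chi. fe (Vc h) : P & pv chi (fe (Vc h)) P : ball (snd (C u0)) d}"
 have "openin (rs_topology chi) N" unfolding N_def by(intro openin_Int rs_subbasic fe UK) auto
 moreover have "P : N"
 proof -
  have h: "hv (Uc h) (th ` P) (fst (C u0))" "hv (Vc h) (th ` P) (snd (C u0))" unfolding t0(2) by(rule hvr[OF tb rep.U], rule hvr[OF tb rep.V])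
  have Pp: "P : places chi" unfolding t0(2) by(rule pl[OF tb])
  note vr = vring_image[OF Pp]
  show ?thesis unfolding N_def using Pp hv_mem[OF vr h(1)] hv_mem[OF vr h(2)] hv_pval[OF vr h(1)] hv_pval[OF vr h(2)] d
   by(simp add: fe_mem[OF Pp UK(1)] fe_mem[OF Pp UK(2)] fe_value[OF Pp UK(1)] fe_value[OF Pp UK(2)])
 qed
 moreover have "N <= ?G ` D"
 proof
  fix P' assume P': "P' : N"
  hence pp: "P' : places chi" by(simp add: N_def)
  note vr = vring_image[OF pp]
  define q where "q = (pval (Uc h) (th ` P'),pval (Vc h) (th ` P'))"
  have m: "Uc h : th ` P'" "Vc h : th ` P'" "dist (fst (C u0)) (fst q) < d" "dist (snd (C u0)) (snd q) < d"
   using P' by(auto simp: N_def q_def fe_mem[OF pp UK(1)] fe_mem[OF pp UK(2)] fe_value[OF pp UK(1)] fe_value[OF pp UK(2)])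
  have h: "hv (Uc h) (th ` P') (fst q)" "hv (Vc h) (th ` P') (snd q)" unfolding q_def using place_has_value[OF pp] m by simp_all
  have "snd q ~= 0" using m(4) by(auto simp: d_def)
  hence qc: "q : cpts cc A h" using hv_gth_zero[OF vr th h] by blast
  have "dist q (C u0) <= dist (fst q) (fst (C u0))+dist (snd q) (snd (C u0))" unfolding dist_prod_def by(rule sqrt_sum_squares_le_sum) auto
  also have "... < d+d" using m(3,4) by(intro add_strict_mono) (simp_all add: dist_commute)
  also have "... <= ep" by(simp add: d_def)
  finally obtain u where t: "u : D" "q = C u" using e(2) qc by blast
  have "smooth_at h q b" using par_smooth[OF par, of u] t D(2) by blast
  hence "P' = Pl h q" using place_unique[OF th _ pp h] by blast
  thus "P' : ?G ` D" using t by blast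
 qed
 ultimately show "EX T. openin (rs_topology chi) T & P : T & T <= ?G ` D" by blast
qed
show ?thesis unfolding gpar_def using par_r[OF par] pl inj T1 T2 par_value_holo[OF th par] by blast
qed

end

context nondeg begin

subsection \<open>Charts and holomorphic forms along parametrizations\<close>

lemma gparD:
assumes "gpar G r"
shows "r > 0" "u : ball 0 r ==> G u : places chi" "inj_on G (ball 0 r)"
 "openin (rs_topology chi) Q ==> open {u:ball 0 r. G u : Q}"
 "open D ==> D <= ball 0 r ==> openin (rs_topology chi) (G ` D)"
 "f : carrier FF ==> open {u:ball 0 r. f : G u}"
 "f : carrier FF ==> (%u. pv chi f (G u)) hol_on {u:ball 0 r. f : G u}" using assms unfolding gpar_def by(simp_all add: image_subset_iff)

lemma rs_chartsE:
assumes "(U,F) : RC chi"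
obtains f where "f : carrier FF" "F = pv chi f" "openin (rs_topology chi) U"
 "!!P. P : U ==> f : P" "open (F ` U)" "inj_on F U"
proof -
obtain f where f: "f : carrier FF" "F = pv chi f" "openin (rs_topology chi) U"
 "!!P. P : U ==> f : P" "open (F ` U)"
 "homeomorphic_map (subtopology (rs_topology chi) U) (top_of_set (F ` U)) F" using assms unfolding rs_charts_def by auto
have "topspace (subtopology (rs_topology chi) U) = U" using openin_subset[OF f(3)] by(simp add: Int_absorb1)
hence "inj_on F U" using homeomorphic_imp_injective_map[OF f(6)] by simp
thus ?thesis using f that by blast
qed

lemma gpar_chart:
assumes G: "gpar G r" and D: "open D" "D <= ball 0 r" and f: "f : carrier FF" "!!u. u : D ==> f : G u"
 and inj: "inj_on (%u. pv chi f (G u)) D"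
shows "(G ` D,pv chi f) : RC chi"
proof -
let ?F = "pv chi f"
let ?g = "%u. ?F (G u)"
have holo: "?g hol_on D" by(rule holomorphic_on_subset[OF gparD(7)[OF G f(1)]]) (use D f in auto)
have opn: "open (?g ` S)" if "open S" "S <= D" for S
 by(rule open_mapping_thm3) (use that holo inj in \<open>auto intro: holomorphic_on_subset inj_on_subset\<close>)
have im: "?F ` G ` S = ?g ` S" for S by(simp add: image_image)
have oU: "openin (rs_topology chi) (G ` D)" by(rule gparD(5)[OF G D])
have ts: "topspace (subtopology (rs_topology chi) (G ` D)) = G ` D" using openin_subset[OF oU] by(simp add: Int_absorb1)
have "homeomorphic_map (subtopology (rs_topology chi) (G ` D)) (top_of_set (?F ` G ` D)) ?F"
proof(rule bijective_open_imp_homeomorphic_map)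
 show "continuous_map (subtopology (rs_topology chi) (G ` D)) (top_of_set (?F ` G ` D)) ?F" unfolding continuous_map_in_subtopology
 proof(intro conjI)
  show "continuous_map (subtopology (rs_topology chi) (G ` D)) euclidean ?F" unfolding continuous_map_def ts
  proof(intro conjI allI impI)
   fix W :: "complex set" assume "openin euclidean W"
   hence "openin (rs_topology chi) {P : places chi. f : P & ?F P : W}" by(intro rs_subbasic f) simp
   moreover have "{P : G ` D. ?F P : W} = {P : places chi. f : P & ?F P : W} \<inter> G ` D" using f(2) D(2) gparD(2)[OF G] by auto
   ultimately show "openin (subtopology (rs_topology chi) (G ` D)) {P : G ` D. ?F P : W}" unfolding openin_subtopology by blast
  qed auto
  show "?F : topspace (subtopology (rs_topology chi) (G ` D)) \<rightarrow> ?F ` G ` D" unfolding ts by blast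
 qed
 show "open_map (subtopology (rs_topology chi) (G ` D)) (top_of_set (?F ` G ` D)) ?F" unfolding open_map_def
 proof(intro allI impI)
  fix S assume "openin (subtopology (rs_topology chi) (G ` D)) S"
  then obtain T where T: "openin (rs_topology chi) T" "S = T \<inter> G ` D" unfolding openin_subtopology by blast
  have "S = G ` ({u:ball 0 r. G u : T} \<inter> D)" unfolding T(2) using D(2) by auto
  hence "?F ` S = ?g ` ({u:ball 0 r. G u : T} \<inter> D)" using im by simp
  moreover have "open (?g ` ({u:ball 0 r. G u : T} \<inter> D))" by(rule opn) (use gparD(4)[OF G T(1)] D(1) in \<open>auto intro: open_Int\<close>)
  moreover have "?F ` S <= ?F ` G ` D" using T(2) by blast
  ultimately show "openin (top_of_set (?F ` G ` D)) (?F ` S)" by(simp add: open_subset)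
 qed
 show "?F ` topspace (subtopology (rs_topology chi) (G ` D)) = topspace (top_of_set (?F ` G ` D))" unfolding ts by simp
 show "inj_on ?F (topspace (subtopology (rs_topology chi) (G ` D)))" unfolding ts using inj by(auto simp: inj_on_def)
qed
moreover have "open (?F ` G ` D)" unfolding im by(rule opn[OF D(1) order_refl])
ultimately show ?thesis unfolding rs_charts_def using f oU by blast
qed

lemma chart_inverse:
assumes c: "(U,F) : RC chi" and G: "gpar G r"
 and D_def: "D = {u:ball 0 r. G u : U}" and g_def: "g = (%u. F (G u))"
obtains Q where "open D" "g hol_on D" "inj_on g D" "open (g ` D)" "Q hol_on (g ` D)"
 "!!u. u : D ==> Q (g u) = u & deriv g u*deriv Q (g u) = 1"
 "!!w. w : g ` D ==> Q w : D & g (Q w) = w & inv_into U F w = G (Q w)"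
proof -
obtain f where f: "f : carrier FF" "F = pv chi f" "openin (rs_topology chi) U"
 "!!P. P : U ==> f : P" "open (F ` U)" "inj_on F U" by(rule rs_chartsE[OF c]) blast
have o: "open D" unfolding D_def by(rule gparD(4)[OF G f(3)])
have h: "g hol_on D" unfolding g_def f(2) by(rule holomorphic_on_subset[OF gparD(7)[OF G f(1)]]) (use f(4) in \<open>auto simp: D_def\<close>)
have i: "inj_on g D" using inj_onD[OF gparD(3)[OF G]] inj_onD[OF f(6)] unfolding inj_on_def g_def D_def by blast
obtain Q where p: "Q hol_on (g ` D)" "!!z. z : D ==> deriv g z*deriv Q (g z) = 1" "!!z. z : D ==> Q (g z) = z"
 by(rule holomorphic_has_inverse[OF h o i]) blast
have inv: "inv_into U F (g u) = G u" if "u : D" for u using inv_into_f_f[OF f(6)] that by(simp add: g_def D_def)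
show ?thesis by(rule that[OF o h i open_mapping_thm3[OF h o i] p(1)]) (use p inv in auto)
qed

lemma chart_deriv_nz:
assumes "(U,F) : RC chi" "gpar G r" "u : ball 0 r" "G u : U"
shows "deriv (%u. F (G u)) u ~= 0"
proof(rule chart_inverse[OF assms(1,2) refl refl])
fix Q assume "!!u'. u' : {u:ball 0 r. G u : U} ==> Q (F (G u')) = u' &
  deriv (%u. F (G u)) u'*deriv Q (F (G u')) = 1"
from this[of u] show ?thesis using assms(3,4) by auto
qed

lemma deriv_along_chart:
assumes c: "(U,F) : RC chi" and G: "gpar G r" and t: "u : ball 0 r" "G u : U"
 and k: "((%u. k (G u)) hfd d) (at u)"
shows "((%w. k (inv_into U F w)) hfd d/deriv (%u. F (G u)) u) (at (F (G u)))"
proof -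
define g where "g = (%u. F (G u))"
define D where "D = {u:ball 0 r. G u : U}"
obtain Q where p: "open (g ` D)" "Q hol_on (g ` D)"
 "!!u. u : D ==> Q (g u) = u & deriv g u*deriv Q (g u) = 1"
 "!!w. w : g ` D ==> Q w : D & g (Q w) = w & inv_into U F w = G (Q w)" by(rule chart_inverse[OF c G D_def g_def]) blast
have tD: "u : D" using t by(simp add: D_def)
have "(Q hfd deriv Q (g u)) (at (g u))" by(rule holomorphic_derivI[OF p(2,1)]) (use tD in blast)
hence "((%w. k (G (Q w))) hfd d*deriv Q (g u)) (at (g u))" using DERIV_chain2[of "%u. k (G u)" d Q "g u"] k p(3)[OF tD] by simp
hence "((%w. k (inv_into U F w)) hfd d*deriv Q (g u)) (at (g u))" by(rule hfd_transform[OF _ p(1)]) (use tD p(4) in auto)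
moreover have "inverse (deriv g u) = deriv Q (g u)" using p(3)[OF tD] by(intro inverse_unique) simp
hence "d*deriv Q (g u) = d/deriv g u" by(simp add: divide_inverse)
ultimately show ?thesis by(simp add: g_def)
qed

lemma chart_value_deriv:
assumes c: "(U,F) : RC chi" and G: "gpar G r" and t: "u : ball 0 r" "G u : U"
shows "((%u. F (G u)) hfd deriv (%u. F (G u)) u) (at u)"
proof -
obtain f where f: "f : carrier FF" "F = pv chi f" "openin (rs_topology chi) U"
 "!!P. P : U ==> f : P" by(rule rs_chartsE[OF c]) blast
show ?thesis unfolding f(2) by(rule holomorphic_derivI[OF gparD(7)[OF G f(1)] gparD(6)[OF G f(1)]]) (use t f(4) in auto)
qed

lemma transition_deriv:
assumes c: "(U,F) : RC chi" "(V,Q) : RC chi" and G: "gpar G r"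
 and t: "u : ball 0 r" "G u : U" "G u : V"
shows "deriv (%w. F (inv_into V Q w)) (Q (G u)) = deriv (%u. F (G u)) u/deriv (%u. Q (G u)) u"
by(rule DERIV_imp_deriv, rule deriv_along_chart[OF c(2) G t(1,3) chart_value_deriv[OF c(1) G t(1,2)]])

lemma formsD:
assumes "W : HF chi"
shows "~ (c : RC chi & p : fst c) ==> W (c,p) = 0"
 "(U,F) : RC chi ==> (%w. W ((U,F),inv_into U F w)) hol_on F ` U"
 "(U,F) : RC chi ==> (V,Q) : RC chi ==> p : U ==> p : V ==>
  W ((V,Q),p) = W ((U,F),p)*deriv (%w. F (inv_into V Q w)) (Q p)"
proof -
have a: "(ALL c p. ~ (c : RC chi & p : fst c) --> W (c,p) = 0)"
 "(ALL (U,F):RC chi. (%w. W ((U,F),inv_into U F w)) hol_on F ` U)"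
 "(ALL (U,F):RC chi. ALL (V,Q):RC chi. ALL p:U \<inter> V.
     W ((V,Q),p) = W ((U,F),p)*deriv (%w. F (inv_into V Q w)) (Q p))" using assms unfolding holomorphic_forms_def by blast+
show "~ (c : RC chi & p : fst c) ==> W (c,p) = 0" using a(1) by blast
show "(U,F) : RC chi ==> (%w. W ((U,F),inv_into U F w)) hol_on F ` U" using bspec[OF a(2)] by fastforce
show "(U,F) : RC chi ==> (V,Q) : RC chi ==> p : U ==> p : V ==>
  W ((V,Q),p) = W ((U,F),p)*deriv (%w. F (inv_into V Q w)) (Q p)" using bspec[OF a(3), of "(U,F)"] by fastforce
qed

text \<open>Both sides are the coefficient of the form with respect to du, so the choice of the
  chart does not matter.\<close>

lemma form_along:
assumes w: "W : HF chi"
 and c: "(U,F) : RC chi" "(V,Q) : RC chi" and G: "gpar G r"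
 and t: "u : ball 0 r" "G u : U" "G u : V"
shows "W ((V,Q),G u)*deriv (%u. Q (G u)) u = W ((U,F),G u)*deriv (%u. F (G u)) u"
using formsD(3)[OF w c t(2,3)] transition_deriv[OF c G t] chart_deriv_nz[OF c(2) G t(1,3)] by simp

lemma form_along_holomorphic:
assumes w: "W : HF chi" and c: "(U,F) : RC chi" and G: "gpar G r"
shows "(%u. W ((U,F),G u)) hol_on {u:ball 0 r. G u : U}"
proof -
define g where "g = (%u. F (G u))"
define D where "D = {u:ball 0 r. G u : U}"
obtain Q where p: "g hol_on D" "!!u. u : D ==> Q (g u) = u & deriv g u*deriv Q (g u) = 1"
 "!!w. w : g ` D ==> Q w : D & g (Q w) = w & inv_into U F w = G (Q w)" by(rule chart_inverse[OF c G D_def g_def]) blast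
have "g ` D <= F ` U" by(auto simp: g_def D_def)
hence "((%w. W ((U,F),inv_into U F w)) \<circ> g) hol_on D" by(intro holomorphic_on_compose_gen[OF p(1) formsD(2)[OF w c]]) auto
moreover have "((%w. W ((U,F),inv_into U F w)) \<circ> g) u = W ((U,F),G u)" if "u : D" for u using p(2)[OF that] p(3)[of "g u"] that by auto
ultimately show ?thesis unfolding D_def[symmetric] using holomorphic_cong by(metis (no_types, lifting))
qed

text \<open>The coefficients are continuous along a parametrization, so vanishing at the points near
  the centre but off it is enough.\<close>

lemma form_zero:
assumes w: "w : HF chi"
 and v: "!!P. P : places chi ==> EX G r. gpar G r & G 0 = P &
  eventually (%u. ALL c:RC chi. G u : fst c --> w (c,G u) = 0) (at 0)"
shows "w = (%_. 0)"
proof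
fix cp :: "place chart \<times> place"
obtain U F P where cp: "cp = ((U,F),P)" by(metis surj_pair)
show "w cp = 0"
proof(cases "(U,F) : RC chi & P : U")
 case False thus ?thesis using formsD(1)[OF w] cp by simp
next
 case True
 obtain f where f: "openin (rs_topology chi) U" by(rule rs_chartsE[OF conjunct1[OF True]]) blast
 have "\<Union> {{\<O> : places chi. f : \<O> & pv chi f \<O> : W} |f W. f : carrier FF & open W} <= places chi" by blast
 hence "P : places chi" using openin_subset[OF f] True by(auto simp: rs_topology_def topology_generated_by_topspace)
 then obtain G r where G: "gpar G r" "G 0 = P"
  "eventually (%u. ALL c:RC chi. G u : fst c --> w (c,G u) = 0) (at 0)" using v by blast
 define D where "D = {u:ball 0 r. G u : U}"
 have D: "open D" "0 : D" using gparD(4)[OF G(1) f] gparD(1)[OF G(1)] G(2) True by(auto simp: D_def)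
 have "(%u. w ((U,F),G u)) hol_on D" unfolding D_def by(rule form_along_holomorphic[OF w conjunct1[OF True] G(1)])
 hence "isCont (%u. w ((U,F),G u)) 0" using holomorphic_on_imp_continuous_on continuous_on_eq_continuous_at[OF D(1)] D(2) by blast
 hence 1: "((%u. w ((U,F),G u)) ---> w ((U,F),G 0)) (at 0)" by(simp add: isCont_def)
 have "eventually (%u. u : D) (at 0)" using D by(intro eventually_at_in_open') auto
 hence "eventually (%u. w ((U,F),G u) = 0) (at 0)" using G(3) by eventually_elim (use True in \<open>auto simp: D_def\<close>)
 hence "((%u. w ((U,F),G u)) ---> 0) (at 0)" by(rule tendsto_eventually)
 thus ?thesis using 1 tendsto_unique[of "at (0::complex)"] cp G(2) by auto
qed
qed

text \<open>The form h dx. A limit replaces the value because the formula itself is meaningless at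
  places where x or h has a pole, although the form may extend there.\<close>

definition form_of :: "(place => complex) => place chart \<times> place => complex" where
"form_of h = (%((U,F),P). if (U,F) : RC chi & P : U then
  Lim (at (F P)) (%w. h (inv_into U F w)*deriv (%w. pv chi (ff_x chi) (inv_into U F w)) w) else 0)"

definition form_local :: "(place => complex) => (complex => place) => real => (complex => complex) => bool" where
"form_local h G r e \<longleftrightarrow> gpar G r & e hol_on ball 0 r &
  eventually (%u. ff_x chi : G u &
   h (G u)*deriv (%u. pv chi (ff_x chi) (G u)) u = e u) (at 0)"

text \<open>Off the centre h dx equals e du. The chart has a holomorphic inverse along the disc, so
  the limit defining \<open>form_of\<close> exists at every point, including the centre, and equals
  the continuous expression e / F'.\<close>

lemma form_of_local:
assumes l: "form_local h G r e" and c: "(U,F) : RC chi" "G 0 : U"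
shows "EX de>0. de <= r & (ALL u:ball 0 de. G u : U & form_of h ((U,F),G u) = e u/deriv (%u. F (G u)) u)"
proof -
have G: "gpar G r" and eta: "e hol_on ball 0 r" and ev: "eventually (%u. ff_x chi : G u &
   h (G u)*deriv (%u. pv chi (ff_x chi) (G u)) u = e u) (at 0)" using l unfolding form_local_def by auto
define g where "g = (%u. F (G u))"
define D where "D = {u:ball 0 r. G u : U}"
obtain Q where p: "open D" "g hol_on D" "open (g ` D)" "Q hol_on (g ` D)"
 "!!u. u : D ==> Q (g u) = u & deriv g u*deriv Q (g u) = 1"
 "!!w. w : g ` D ==> Q w : D & g (Q w) = w & inv_into U F w = G (Q w)" by(rule chart_inverse[OF c(1) G D_def g_def]) blast
have "0 : D" using c(2) gparD(1)[OF G] by(simp add: D_def)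
hence "eventually (%u. u : D) (at 0)" using p(1) by(intro eventually_at_in_open') auto
with ev have "eventually (%u. u : D & ff_x chi : G u &
   h (G u)*deriv (%u. pv chi (ff_x chi) (G u)) u = e u) (at 0)" by eventually_elim blast
then obtain d where d: "d > 0" "!!u. u ~= 0 ==> dist u 0 < d ==> u : D & ff_x chi : G u &
   h (G u)*deriv (%u. pv chi (ff_x chi) (G u)) u = e u" unfolding eventually_at by blast
have inD: "u : D" if "u : ball 0 d" for u using d(2)[of u] that \<open>0 : D\<close> by(cases "u = 0") (auto simp: dist_commute)
define E where "E = g ` (ball 0 d)"
have oE: "open E" unfolding E_def
proof(rule open_mapping_thm3)
 show "g hol_on ball 0 d" by(rule holomorphic_on_subset[OF p(2)]) (use inD in blast)
 show "inj_on g (ball 0 d)" using p(5) inD by(metis inj_onI)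
qed simp
have EgD: "E <= g ` D" unfolding E_def using inD by blast
have psiE: "Q w : ball 0 d" if "w : E" for w using that p(5) inD unfolding E_def by auto
have val: "h (inv_into U F w)*deriv (%w. pv chi (ff_x chi) (inv_into U F w)) w = e (Q w)*deriv Q w"
 if w: "w : E" "w ~= g 0" for w
proof -
 have pw: "Q w : D" "g (Q w) = w" "inv_into U F w = G (Q w)" using p(6) EgD w(1) by blast+
 have nz: "Q w ~= 0" using pw(2) w(2) by auto
 have dd: "ff_x chi : G (Q w)"
   "h (G (Q w))*deriv (%u. pv chi (ff_x chi) (G u)) (Q w) = e (Q w)" using d(2)[OF nz] psiE[OF w(1)] by(auto simp: dist_commute)
 have b: "Q w : ball 0 r" "G (Q w) : U" using pw(1) by(auto simp: D_def)
 have "((%u. pv chi (ff_x chi) (G u)) has_field_derivative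
   deriv (%u. pv chi (ff_x chi) (G u)) (Q w)) (at (Q w))" by(rule holomorphic_derivI[OF gparD(7,6)[OF G ff_xy_carrier(1)]]) (use b dd in auto)
 from DERIV_imp_deriv[OF deriv_along_chart[OF c(1) G b this]]
 have "deriv (%w. pv chi (ff_x chi) (inv_into U F w)) w
   = deriv (%u. pv chi (ff_x chi) (G u)) (Q w)/deriv g (Q w)" using pw(2) by(simp add: g_def)
 moreover have "deriv g (Q w)*deriv Q w = 1" using p(5)[OF pw(1)] pw(2) by simp
 hence "inverse (deriv g (Q w)) = deriv Q w" by(rule inverse_unique)
 hence "deriv Q w = 1/deriv g (Q w)" by(simp add: divide_inverse)
 ultimately show ?thesis unfolding pw(3) using dd(2) by simp
qed
have cont: "isCont (%w. e (Q w)*deriv Q w) w" if "w : E" for w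
proof -
 have "(e \<circ> Q) hol_on g ` D" by(rule holomorphic_on_compose_gen[OF p(4) eta]) (use p(6) in \<open>auto simp: D_def\<close>)
 hence "(%w. e (Q w)*deriv Q w) hol_on g ` D" unfolding o_def by(intro holomorphic_on_mult holomorphic_deriv p)
 hence "continuous_on (g ` D) (%w. e (Q w)*deriv Q w)" by(rule holomorphic_on_imp_continuous_on)
 thus ?thesis unfolding continuous_on_eq_continuous_at[OF p(3)] using EgD that by blast
qed
have "form_of h ((U,F),G u) = e u/deriv g u" if t: "u : ball 0 d" for u
proof -
 have wE: "g u : E" using t by(simp add: E_def)
 have "eventually (%w. w : E) (at (g u))" using oE wE by(intro eventually_at_in_open') auto
 moreover have "eventually (%w. w ~= g 0) (at (g u))"
 proof(cases "g u = g 0")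
  case True thus ?thesis by(simp add: eventually_at_filter)
 next
  case False thus ?thesis by(intro tendsto_imp_eventually_ne[OF tendsto_ident_at])
 qed
 ultimately have "eventually (%w. e (Q w)*deriv Q w = h (inv_into U F w) *
   deriv (%w. pv chi (ff_x chi) (inv_into U F w)) w) (at (g u))" by eventually_elim (use val in auto)
 moreover have "((%w. e (Q w)*deriv Q w) ---> e (Q (g u))*deriv Q (g u)) (at (g u))" using cont[OF wE] by(simp add: isCont_def)
 ultimately have "((%w. h (inv_into U F w)*deriv (%w. pv chi (ff_x chi) (inv_into U F w)) w)
   ---> e (Q (g u))*deriv Q (g u)) (at (g u))" using tendsto_cong by fastforce
 hence "Lim (at (g u)) (%w. h (inv_into U F w)*deriv (%w. pv chi (ff_x chi) (inv_into U F w)) w)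
   = e (Q (g u))*deriv Q (g u)" by(intro tendsto_Lim) auto
 moreover have "Q (g u) = u" using p(5)[OF inD[OF t]] by auto
 moreover have "inverse (deriv g u) = deriv Q (g u)" using p(5)[OF inD[OF t]] by(intro inverse_unique) simp
 hence "deriv Q (g u) = 1/deriv g u" by(simp add: divide_inverse)
 moreover have "G u : U" using inD[OF t] by(simp add: D_def)
 ultimately show ?thesis using c(1) unfolding form_of_def by(simp add: g_def)
qed
moreover have "d <= r"
proof(rule ccontr)
 assume "~ d <= r"
 hence "of_real r : ball (0::complex) d" using gparD(1)[OF G] by simp
 hence "of_real r : D" by(rule inD)
 hence "of_real r : ball (0::complex) r" unfolding D_def by blast
 thus False using gparD(1)[OF G] by simp
qed
ultimately show ?thesis using d(1) inD by(intro exI[of _ d]) (auto simp: g_def D_def)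
qed

theorem form_of_holomorphic:
assumes loc: "!!P. P : places chi ==> EX G r et. form_local h G r et & G 0 = P"
shows "form_of h : HF chi"
proof -
have pl: "P : places chi" if cU: "(U,F) : RC chi" and PU: "P : U" for U F P
proof -
 obtain f where f: "openin (rs_topology chi) U" by(rule rs_chartsE[OF cU]) blast
 thus ?thesis using openin_subset[OF f] PU by(auto simp: rs_topology_def topology_generated_by_topspace)
qed
have a1: "(%w. form_of h ((U,F),inv_into U F w)) hol_on F ` U" if c: "(U,F) : RC chi" for U F
proof -
 obtain f where f: "open (F ` U)" "inj_on F U" by(rule rs_chartsE[OF c]) blast
 have "EX d. ((%w. form_of h ((U,F),inv_into U F w)) hfd d) (at (F P))" if P: "P : U" for P
 proof -
  obtain G r et where l: "form_local h G r et" "G 0 = P" using loc[OF pl[OF c P]] by blast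
  have G: "gpar G r" and eta: "et hol_on ball 0 r" using l(1) unfolding form_local_def by auto
  obtain de where d: "de > 0" "de <= r"
   "!!u. u : ball 0 de ==> G u : U & form_of h ((U,F),G u) = et u/deriv (%u. F (G u)) u" using form_of_local[OF l(1) c] l(2) P by auto
  have sub: "ball 0 de <= ball (0::complex) r" using d(2) by auto
  have "(%u. F (G u)) hol_on ball 0 de" unfolding holomorphic_on_open[OF open_ball] using chart_value_deriv[OF c G] d(3) sub by blast
  hence "(%u. et u/deriv (%u. F (G u)) u) hol_on ball 0 de" using chart_deriv_nz[OF c G] d(3) sub
   by(intro holomorphic_on_divide holomorphic_deriv holomorphic_on_subset[OF eta sub]) auto
  then obtain e where "((%u. et u/deriv (%u. F (G u)) u) hfd e) (at 0)"
   using d(1) unfolding holomorphic_on_open[OF open_ball] by(meson centre_in_ball)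
  hence "((%u. form_of h ((U,F),G u)) hfd e) (at 0)" by(rule hfd_transform[of _ _ _ "ball 0 de"]) (use d in auto)
  from deriv_along_chart[OF c G _ _ this] show ?thesis using gparD(1)[OF G] l(2) P by auto
 qed
 thus ?thesis unfolding holomorphic_on_open[OF f(1)] by blast
qed
have a2: "form_of h ((V,Q),P) = form_of h ((U,F),P)*deriv (%w. F (inv_into V Q w)) (Q P)"
 if c: "(U,F) : RC chi" "(V,Q) : RC chi" and P: "P : U" "P : V" for U F V Q P
proof -
 obtain G r et where l: "form_local h G r et" "G 0 = P" using loc[OF pl[OF c(1) P(1)]] by blast
 have G: "gpar G r" using l(1) unfolding form_local_def by auto
 have z: "0 : ball (0::complex) r" "G 0 : U" "G 0 : V" using gparD(1)[OF G] l(2) P by auto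
 have "form_of h ((U,F),G 0) = et 0/deriv (%u. F (G u)) 0"
  "form_of h ((V,Q),G 0) = et 0/deriv (%u. Q (G u)) 0"
  using form_of_local[OF l(1) c(1) z(2)] form_of_local[OF l(1) c(2) z(3)] by(meson centre_in_ball)+
 thus ?thesis using transition_deriv[OF c G z] chart_deriv_nz[OF c(1) G z(1,2)] l(2) by simp
qed
have a3: "form_of h (c,p) = 0" if "~ (c : RC chi & p : fst c)" for c p using that by(cases c) (auto simp: form_of_def)
show ?thesis unfolding holomorphic_forms_def case_prod_unfold
proof(rule CollectI, intro conjI)
 show "ALL c p. ~ (c : RC chi & p : fst c) --> form_of h (c,p) = 0" using a3 by blast
 show "ALL c:RC chi. (%w. form_of h ((fst c,snd c),inv_into (fst c) (snd c) w)) hol_on snd c ` fst c"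
 proof
  fix c assume "c : RC chi"
  hence "(fst c,snd c) : RC chi" by simp
  thus "(%w. form_of h ((fst c,snd c),inv_into (fst c) (snd c) w)) hol_on snd c ` fst c" by(rule a1)
 qed
 show "ALL c:RC chi. ALL c':RC chi. ALL p:fst c \<inter> fst c'. form_of h ((fst c',snd c'),p) =
   form_of h ((fst c,snd c),p)*deriv (%w. snd c (inv_into (fst c') (snd c') w)) (snd c' p)"
 proof(intro ballI)
  fix c c' p assume "c : RC chi" "c' : RC chi" and p: "p : fst c \<inter> fst c'"
  hence c: "(fst c,snd c) : RC chi" "(fst c',snd c') : RC chi" by simp_all
  show "form_of h ((fst c',snd c'),p) =
   form_of h ((fst c,snd c),p)*deriv (%w. snd c (inv_into (fst c') (snd c') w)) (snd c' p)" by(rule a2[OF c]) (use p in blast)+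
 qed
qed
qed

end

subsection \<open>The toric surface\<close>

lemma poly_fun_prod: "finite S ==> (!!i. i : S ==> poly_fun (f i)) ==> poly_fun (%z. PROD i:S. f i z)"
by(induction S rule: finite_induct) (auto intro: poly_fun.intros)

lemma poly_fun_power: "poly_fun f ==> poly_fun (%z. f z ^ k)"
by(induction k) (auto intro: poly_fun.intros)

lemma poly_fun_holomorphic:
"poly_fun f ==> (!!i. (%u. z u i) hol_on S) ==> (%u. f (z u)) hol_on S" by(induction rule: poly_fun.induct) (auto intro!: holomorphic_intros)

text \<open>A differential at z tested on curves that are differentiable in each coordinate. This
  avoids a norm on the coordinate space, whose index set may be infinite.\<close>

definition lin_deriv :: "(('i => complex) => complex) => ('i => complex) => (('i => complex) => complex) => bool" where
"lin_deriv f z D \<longleftrightarrow> (ALL w w'. D (%i. w i+w' i) = D w+D w') & (ALL a w. D (%i. a*w i) = a*D w) &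
 (ALL ze w. ze 0 = z --> (ALL i. ((%t. ze t i) hfd w i) (at 0)) -->
   ((%t. f (ze t)) hfd D w) (at (0::complex)))"

lemma lin_derivD:
assumes "lin_deriv f z D"
shows "D (%i. w i+w' i) = D w+D w'" "D (%i. a*w i) = a*D w"
 "ze 0 = z ==> (!!i. ((%t. ze t i) hfd w i) (at 0)) ==>
   ((%t. f (ze t)) hfd D w) (at (0::complex))" using assms unfolding lin_deriv_def by blast+

lemma poly_fun_derivative:
assumes "poly_fun f" shows "EX D. lin_deriv f z D" using assms
proof(induction rule: poly_fun.induct)
case (const c) thus ?case by(intro exI[of _ "%_. 0"]) (auto simp: lin_deriv_def)
next
case (coord i) thus ?case by(intro exI[of _ "%w. w i"]) (auto simp: lin_deriv_def)
next
case (add f g)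
then obtain D E where D: "lin_deriv f z D" and E: "lin_deriv g z E" by blast
have "lin_deriv (%z. f z+g z) z (%w. D w+E w)" unfolding lin_deriv_def
proof(intro conjI allI impI)
 fix ze w assume h: "ze 0 = z" "ALL i. ((%t. ze t i) hfd w i) (at (0::complex))"
 show "((%t. f (ze t)+g (ze t)) hfd D w+E w) (at 0)" by(intro DERIV_add lin_derivD(3)[OF D] lin_derivD(3)[OF E] h(1) h(2)[rule_format])
qed (simp_all add: lin_derivD(1,2)[OF D] lin_derivD(1,2)[OF E] alg)
thus ?case by blast
next
case (mult f g)
then obtain D E where D: "lin_deriv f z D" and E: "lin_deriv g z E" by blast
have "lin_deriv (%z. f z*g z) z (%w. D w*g z+E w*f z)" unfolding lin_deriv_def
proof(intro conjI allI impI)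
 fix ze w assume h: "ze 0 = z" "ALL i. ((%t. ze t i) hfd w i) (at (0::complex))"
 show "((%t. f (ze t)*g (ze t)) hfd D w*g z+E w*f z) (at 0)"
  using DERIV_mult[OF lin_derivD(3)[OF D h(1) h(2)[rule_format]] lin_derivD(3)[OF E h(1) h(2)[rule_format]]] h(1) by simp
qed (simp_all add: lin_derivD(1,2)[OF D] lin_derivD(1,2)[OF E] alg)
thus ?case by blast
qed

definition binom :: "mon set => (mon => nat) => (mon => nat) => (mon => complex) => complex" where
"binom A p q z = (PROD g:A. z g^p g)-(PROD g:A. z g^q g)"

text \<open>Equal total degrees make the binomial homogeneous; equal sums of lattice points make its
  two monomials agree on the torus.\<close>

lemma binom_toric:
assumes "finite A" "lattice_points P = A" "(SUM g:A. p g) = (SUM g:A. q g)"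
 "(SUM g:A. p g*fst g) = (SUM g:A. q g*fst g)" "(SUM g:A. p g * snd g) = (SUM g:A. q g * snd g)"
shows "binom A p q : toric_ideal P"
proof -
have "poly_fun (%z. (PROD g:A. z g^p g)+(-1)*(PROD g:A. z g^q g))"
 by(intro poly_fun.add poly_fun.mult poly_fun.const poly_fun_prod assms(1) poly_fun_power poly_fun.coord)
hence pf: "poly_fun (binom A p q)" by(simp add: binom_def[abs_def])
have "binom A p q (%i. c*z i) = c^(SUM g:A. p g)*binom A p q z" for c z
proof -
 have "(PROD g:A. (c*z g)^r g) = c^(SUM g:A. r g)*(PROD g:A. z g^r g)" for r by(simp add: power_mult_distrib prod.distrib power_sum)
 thus ?thesis using assms(3) by(simp add: binom_def alg)
qed
moreover have "binom A p q (torus_point P s t) = 0" for s t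
proof -
 have "(PROD g:A. torus_point P s t g^r g) = s^(SUM g:A. r g*fst g)*t^(SUM g:A. r g * snd g)" for r
 proof -
  have "(PROD g:A. torus_point P s t g^r g) = (PROD g:A. s^(r g*fst g)*t^(r g * snd g))"
   by(intro prod.cong refl) (auto simp: torus_point_def assms(2) power_mult_distrib power_mult[symmetric] mult.commute split: prod.splits)
  thus ?thesis by(simp add: prod.distrib power_sum)
 qed
 thus ?thesis using assms(4,5) by(simp add: binom_def)
qed
ultimately show ?thesis unfolding toric_ideal_def homogeneous_poly_fun_def using pf by blast
qed

lemma chart_vertices:
assumes "h : charts A"
shows "dd h (fst h) = 0" "jj h (fst h) = 0" "dd h (fst (snd h)) = 0" "jj h (fst (snd h)) = 1"
 "dd h (snd (snd h)) = 1" "jj h (snd (snd h)) = 0" using assms by(auto simp: charts_def dd_def jj_def det3_def)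

lemma chart_in: "h : charts A ==> fst h : A & fst (snd h) : A & snd (snd h) : A"
by(auto simp: charts_def)

lemma bas_fst: "bas h = fst h" by(simp add: bas_def)

text \<open>The affine relation expressing a lattice point through the three points of a chart, with all
  coefficients moved to the side where they are nonnegative.\<close>

definition relp :: "triple => mon => mon => nat" where
"relp h g x = (if x = g then 1 else 0)+(if x = fst (snd h) then nat (- jj h g) else 0)
  + (if x = fst h then nat (int (dd h g)+jj h g-1) else 0)"
definition relq :: "triple => mon => mon => nat" where
"relq h g x = (if x = snd (snd h) then dd h g else 0)+(if x = fst (snd h) then nat (jj h g) else 0)
  + (if x = fst h then nat (1-int (dd h g)-jj h g) else 0)"

lemma prod_if: "finite A ==> a : A ==> (PROD x:A. z x^(if x = a then k else 0)) = z a ^ k"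
for z :: "'b => 'c::comm_monoid_mult"
proof -
assume "finite A" "a : A"
moreover have "z x^(if x = a then k else 0) = (if x = a then z a ^ k else 1)" for x by simp
ultimately show ?thesis by simp
qed

lemma sum_if: "finite A ==> a : A ==> (SUM x:A. (if x = a then k else 0)*w x) = k*w a"
for w :: "'b => nat"
proof -
assume "finite A" "a : A"
moreover have "(if x = a then k else 0)*w x = (if x = a then k*w a else 0)" for x by simp
ultimately show ?thesis by simp
qed

lemma rel_toric:
assumes A: "finite A" "lattice_points P = A" and th: "q : charts A" and g: "g : A"
shows "binom A (relp q g) (relq q g) : toric_ideal P"
 "binom A (relp q g) (relq q g) z = z g*z (fst (snd q))^nat (- jj q g)*z (fst q)^nat (int (dd q g)+jj q g-1)
  - z (snd (snd q))^dd q g*z (fst (snd q))^nat (jj q g)*z (fst q)^nat (1-int (dd q g)-jj q g)"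
proof -
obtain e f h where t: "q = (e,f,h)" by(cases q)
have m: "e : A" "f : A" "h : A" "det3 e f h = 1" "det3 e f g >= 0" using th g unfolding t charts_def by auto
have d: "int (dd q g) = det3 e f g" "jj q g = det3 e g h" using m(5) by(simp_all add: t dd_def jj_def)
note ex = det_expand[OF m(4), of g]
have x1: "ix g-ix e = int (dd q g)*(ix h-ix e)+jj q g*(ix f-ix e)"
 "iy g-iy e = int (dd q g)*(iy h-iy e)+jj q g*(iy f-iy e)" using ex unfolding d by(simp_all add: ipt_def)
show "binom A (relp q g) (relq q g) z = z g*z (fst (snd q))^nat (- jj q g)*z (fst q)^nat (int (dd q g)+jj q g-1)
  - z (snd (snd q))^dd q g*z (fst (snd q))^nat (jj q g)*z (fst q)^nat (1-int (dd q g)-jj q g)"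
 using m g A(1) by(simp add: binom_def relp_def relq_def power_add prod.distrib prod_if t)
have sums: "(SUM x:A. relp q g x*w x) = w g+nat (- jj q g)*w f+nat (int (dd q g)+jj q g-1)*w e"
 "(SUM x:A. relq q g x*w x) = dd q g*w h+nat (jj q g)*w f+nat (1-int (dd q g)-jj q g)*w e" for w
 using m g A(1) sum_if[of A g 1 w] by(simp_all add: relp_def relq_def distrib_right sum.distrib sum_if t)
have nn: "int (nat a)-int (nat (- a)) = a" for a by simp
have key: "(SUM x:A. relp q g x*w x) = (SUM x:A. relq q g x*w x)"
 if w: "int (w g)-int (w e) = int (dd q g)*(int (w h)-int (w e))+jj q g*(int (w f)-int (w e))" for w
proof -
 have "int (w g) = int (dd q g)*int (w h)+(int (nat (jj q g))-int (nat (- jj q g)))*int (w f)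
   + (int (nat (1-int (dd q g)-jj q g))-int (nat (- (1-int (dd q g)-jj q g))))*int (w e)" unfolding nn using w by(simp add: alg)
 moreover have "- (1-int (dd q g)-jj q g) = int (dd q g)+jj q g-1" by simp
 ultimately have "int (w g+nat (- jj q g)*w f+nat (int (dd q g)+jj q g-1)*w e)
  = int (dd q g*w h+nat (jj q g)*w f+nat (1-int (dd q g)-jj q g)*w e)" by(simp add: left_diff_distrib)
 thus ?thesis unfolding sums by(simp only: of_nat_eq_iff)
qed
show "binom A (relp q g) (relq q g) : toric_ideal P" using key[of "%_. 1"] key[of fst] key[of snd] x1 by(intro binom_toric A) simp_all
qed

context nondeg begin

text \<open>Homogeneous coordinates of a point of a chart, normalized to 1 at the base point. Unlike
  torus coordinates they still make sense for \<open>fst p = 0\<close>.\<close>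

definition zpt :: "triple => complex \<times> complex => mon => complex" where
"zpt h p g = (if g : A then fst p^dd h g * snd p powi jj h g else 0)"

lemma zpt_vertices:
assumes "h : charts A"
shows "zpt h p (bas h) = 1" "zpt h p (fst (snd h)) = snd p" "zpt h p (snd (snd h)) = fst p"
using chart_vertices[OF assms] chart_in[OF assms] by(auto simp: zpt_def bas_fst)

text \<open>For u nonzero the vector is a multiple of a torus point, where the ideal vanishes by
  definition; u = 0 follows by continuity.\<close>

lemma zpt_ideal:
assumes P: "lattice_points P = A" and th: "h : charts A" and p: "snd p ~= 0" and f: "f : toric_ideal P"
shows "f (zpt h p) = 0"
proof -
have pf: "poly_fun f" and hom: "EX d::nat. ALL c z. f (%i. c*z i) = c^d*f z"
 and tor: "!!s t. s ~= 0 ==> t ~= 0 ==> f (torus_point P s t) = 0" using f unfolding toric_ideal_def homogeneous_poly_fun_def by auto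
have nz: "f (zpt h (u,snd p)) = 0" if u: "u ~= 0" for u
proof -
 define s t where "s = backS h u (snd p)" and "t = backT h u (snd p)"
 have st: "s ~= 0" "t ~= 0" using back_nonzero[OF u p] by(auto simp: s_def t_def)
 have l: "lm s t (wU h) = u" "lm s t (wV h) = snd p" using lm_back[OF th u p] by(auto simp: s_def t_def)
 have "torus_point P s t = (%g. lm s t (ipt (bas h))*zpt h (u,snd p) g)"
 proof
  fix g show "torus_point P s t g = lm s t (ipt (bas h))*zpt h (u,snd p) g" using lm_nat[OF st, of g "bas h"] lm_chart[OF th _ st, of g] l P
   by(auto simp: torus_point_def zpt_def split: prod.splits)
 qed
 moreover obtain d :: nat where "ALL c z. f (%i. c*z i) = c^d*f z" using hom by blast
 ultimately have "lm s t (ipt (bas h))^d*f (zpt h (u,snd p)) = 0" using tor[OF st] by metis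
 thus ?thesis using lm_nonzero[OF st] by simp
qed
show ?thesis
proof(cases "fst p = 0")
 case False thus ?thesis using nz[OF False] by simp
next
 case True
 have "(%u. f (zpt h (u,snd p))) hol_on UNIV"
 proof(rule poly_fun_holomorphic[OF pf])
  fix g show "(%u. zpt h (u,snd p) g) hol_on UNIV" by(cases "g : A") (auto simp: zpt_def intro!: holomorphic_intros)
 qed
 hence "isCont (%u. f (zpt h (u,snd p))) 0" by(metis UNIV_I continuous_on_eq_continuous_at holomorphic_on_imp_continuous_on open_UNIV)
 hence "((%u. f (zpt h (u,snd p))) ---> f (zpt h (0,snd p))) (at 0)" by(simp add: isCont_def)
 moreover have "eventually (%u. f (zpt h (u,snd p)) = 0) (at 0)" using nz by(simp add: eventually_at_filter)
 hence "((%u. f (zpt h (u,snd p))) ---> 0) (at 0)" by(rule tendsto_eventually)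
 ultimately have "f (zpt h (0,snd p)) = 0" using tendsto_unique[of "at (0::complex)"] by auto
 thus ?thesis using True by(metis prod.collapse)
qed
qed

lemma zpt_section: "lattice_points P = A ==> toric_section P chi (%g. c*zpt h p g) = c*gth cc A h p"
by(simp add: toric_section_def gth_def zpt_def sum_distrib_left mult_ac)

lemma proj_point_scale:
assumes c: "c ~= 0" shows "proj_point (%g. c*z g) = proj_point z"
proof(rule equalityI)
have sub: "proj_point (%g. k*y g) <= proj_point y" if k: "k ~= 0" for k and y :: "'i => complex"
proof
 fix x assume "x : proj_point (%g. k*y g)"
 then obtain d where d: "d ~= 0" "x = (%i. d*(k*y i))" unfolding proj_point_def by blast
 have "x = (%i. (d * k)*y i)" unfolding d(2) by(rule ext) (rule mult.assoc[symmetric])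
 moreover have "d * k ~= 0" using d(1) k by simp
 ultimately have "EX c. x = (%i. c*y i) & c ~= 0" by(rule_tac exI[of _ "d * k"]) (rule conjI)
 thus "x : proj_point y" unfolding proj_point_def mem_Collect_eq .
qed
show "proj_point (%g. c*z g) <= proj_point z" by(rule sub[OF c])
show "proj_point z <= proj_point (%g. c*z g)" using sub[of "inverse c" "%g. c*z g"] c by(simp add: mult.assoc[symmetric])
qed

lemma zpt_curve:
assumes P: "lattice_points P = A" and th: "h : charts A" and p: "p : cpts cc A h"
shows "proj_point (zpt h p) : toric_curve P chi"
proof -
have v: "snd p ~= 0" "gth cc A h p = 0" using p by(auto simp: cpts_def)
have "zpt h p ~= (%_. 0)" using zpt_vertices(1)[OF th, of p] by(metis one_neq_zero)
moreover have "ALL e. e ~: lattice_points P --> zpt h p e = 0" using P by(simp add: zpt_def)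
ultimately have "proj_point (zpt h p) : toric_surface P" unfolding toric_surface_def using zpt_ideal[OF P th v(1)] by blast
moreover have "toric_section P chi z = 0" if "z : proj_point (zpt h p)" for z
 using that zpt_section[OF P, of _ h p] v(2) by(auto simp: proj_point_def)
ultimately show ?thesis unfolding toric_curve_def by blast
qed

lemma solve_relation:
fixes x y w v :: complex
assumes nz: "y ~= 0" "x ~= 0" and eq: "v * y^nat (- j)*x^nat (- k) = w*y^nat j*x^nat k"
shows "v = w*y powi j*x powi k"
proof -
have pw: "t^nat k = t powi k*t^nat (- k)" if "t ~= 0" for t :: complex and k using that by(cases "k >= 0") (auto simp: power_int_def power_inverse)
have "v * (y^nat (- j)*x^nat (- k)) = (w*y powi j*x powi k)*(y^nat (- j)*x^nat (- k))"
 using eq unfolding pw[OF nz(1), of j] pw[OF nz(2), of k] by(simp only: mult_ac)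
thus ?thesis using nz by simp
qed

text \<open>The nonvanishing coordinates form a closed face, by the binomials of the ideal, and
  there are at least two of them, since a single one could not satisfy the equation of the section.
  This gives a chart, and the relations of \<open>rel_toric\<close> express every coordinate through
  those at the three chart points.\<close>

lemma toric_curve_classify:
assumes P: "lattice_points P = A" and L: "L : toric_curve P chi" and zL: "z : L"
shows "EX h:charts A. EX p:cpts cc A h. EX c. c ~= 0 & z = (%g. c*zpt h p g) & L = proj_point (zpt h p)"
proof -
obtain z0 where z0: "L = proj_point z0" "z0 ~= (%_. 0)" "!!e. e ~: A ==> z0 e = 0" "!!f. f : toric_ideal P ==> f z0 = 0"
 using L P unfolding toric_curve_def toric_surface_def by auto
obtain k where k: "k ~= 0" "z = (%i. k*z0 i)" using zL unfolding z0(1) proj_point_def by blast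
have z: "z ~= (%_. 0)" "!!e. e ~: A ==> z e = 0" using z0(2,3) k by(auto simp: fun_eq_iff)
have zi: "f z = 0" if fI: "f : toric_ideal P" for f
proof -
 have "EX d::nat. ALL c z. f (%i. c*z i) = c^d*f z" using fI unfolding toric_ideal_def homogeneous_poly_fun_def by blast
 then obtain d :: nat where "ALL c z. f (%i. c*z i) = c^d*f z" by blast
 thus ?thesis using z0(4)[OF fI] unfolding k(2) by simp
qed
have Lz: "L = proj_point z" unfolding z0(1) k(2) by(rule proj_point_scale[OF k(1), symmetric])
have sec: "(SUM g:A. cc g*z g) = 0" using L zL P unfolding toric_curve_def toric_section_def by auto
define S where "S = {g : A. z g ~= 0}"
have cl: "closed_face A S" unfolding closed_face_def
proof(intro conjI allI impI ballI)
 fix w :: "mon => int" and g0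
 assume s: "(SUM g:A. w g) = 0" "(SUM g:A. w g*ix g) = 0" "(SUM g:A. w g*iy g) = 0"
  and neg: "ALL g:A. w g < 0 --> g : S" and g0: "g0 : A" "0 < w g0"
 define a b where "a = (%g. nat (w g))" and "b = (%g. nat (- w g))"
 have ab: "int (a g)-int (b g) = w g" for g by(simp add: a_def b_def)
 have eq: "(SUM g:A. a g * k g) = (SUM g:A. b g * k g)" if "(SUM g:A. w g*int (k g)) = 0" for k
 proof -
  have "int (SUM g:A. a g * k g)-int (SUM g:A. b g * k g) = (SUM g:A. (int (a g)-int (b g))*int (k g))" by(simp add: sum_subtractf left_diff_distrib)
  hence "int (SUM g:A. a g * k g)-int (SUM g:A. b g * k g) = 0" unfolding ab that .
  thus ?thesis by linarith
 qed
 have "binom A a b : toric_ideal P" using eq[of "%_. 1"] eq[of fst] eq[of snd] s by(intro binom_toric finA P) simp_all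
 hence "(PROD g:A. z g^a g) = (PROD g:A. z g^b g)" using zi[of "binom A a b"] by(simp add: binom_def)
 moreover have "(PROD g:A. z g^b g) ~= 0" using neg finA by(auto simp: S_def b_def)
 ultimately have "z g0^a g0 ~= 0" using finA g0(1) by(metis prod_zero)
 thus "g0 : S" using g0 by(auto simp: S_def a_def)
qed (auto simp: S_def)
obtain e where e: "e : S" using z by(auto simp: S_def fun_eq_iff)
have "EX e':S. e' ~= e"
proof(rule ccontr)
 assume "~ ?thesis"
 hence "(SUM g:A. cc g*z g) = (SUM g:A. if g = e then cc e*z e else 0)" by(intro sum.cong) (auto simp: S_def)
 thus False using sec e finA suppA[of e] by(auto simp: S_def)
qed
then obtain e' where e': "e' : S" "e' ~= e" by blast
obtain h where th: "h : charts A" "fst h : S" "fst (snd h) : S" using faces[OF cl e e'(1) e'(2)[symmetric]] by blast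
have nz: "z (fst h) ~= 0" "z (fst (snd h)) ~= 0" using th by(auto simp: S_def)
define p where "p = (z (snd (snd h))/z (fst h),z (fst (snd h))/z (fst h))"
have zg: "z g = z (fst h)*zpt h p g" for g
proof(cases "g : A")
 case True
 define x y where "x = z (fst h)" and "y = z (fst (snd h))"
 define d j where "d = dd h g" and "j = jj h g"
 have "z g*y^nat (- j)*x^nat (int d+j-1) = z (snd (snd h))^d*y^nat j*x^nat (1-int d-j)"
  using zi[OF rel_toric(1)[OF finA P th(1) True]] unfolding rel_toric(2)[OF finA P th(1) True] x_def y_def d_def j_def by simp
 moreover have "int d+j-1 = - (1-int d-j)" by simp
 ultimately have "z g = z (snd (snd h))^d*y powi j*x powi (1-int d-j)"
  using solve_relation[of y x "z g" j "1-int d-j" "z (snd (snd h))^d"] nz by(simp add: x_def y_def)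
 also have "... = x*((z (snd (snd h))/x)^d*(y/x) powi j)"
  using nz by(simp add: x_def[symmetric] power_divide power_int_divide_distrib power_int_diff power_int_add field_simps)
 finally show ?thesis using True by(simp add: zpt_def p_def x_def y_def d_def j_def)
qed (use z(2) in \<open>simp add: zpt_def\<close>)
have "p : cpts cc A h"
proof -
 have "(SUM g:A. cc g*z g) = z (fst h)*gth cc A h p" by(subst zg) (simp add: gth_def zpt_def sum_distrib_left mult_ac)
 thus ?thesis using sec nz by(simp add: cpts_def p_def)
qed
moreover have "L = proj_point (zpt h p)" unfolding Lz using proj_point_scale[OF nz(1), of "zpt h p"] zg by(metis ext)
ultimately show ?thesis using th(1) nz(1) zg by blast
qed

subsection \<open>The identification of the places with the points of the toric curve\<close>

text \<open>Any chart point representing the place may be chosen; \<open>Phi_Pl\<close> shows that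
  the choice is immaterial.\<close>

definition Phi :: "place => (mon => complex) set" where
"Phi Q = (SOME L. EX h p b. h : charts A & smooth_at h p b & Q = Pl h p & L = proj_point (zpt h p))"

lemma hv_zpt:
assumes "h : charts A" "smooth_at h p b" "g : A"
shows "hv (Mon g/Mon (bas h)) (Oloc h p) (zpt h p g)" unfolding Mon_chart[OF assms(1,3)]
using Oloc_hv_rep[OF assms(1,2) rep_lm[of h "dd h g" "jj h g"]] assms(3) by(simp add: zpt_def)

lemma bas_in: "h : charts A ==> bas h : A" using chart_in by(simp add: bas_fst)

lemma zpt_rescale:
assumes W: "vring W" and e: "e : A" "e' : A"
 and z: "!!g. g : A ==> hv (Mon g/Mon e) W (z g)" and z': "!!g. g : A ==> hv (Mon g/Mon e') W (z' g)"
 and g: "g : A"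
shows "z' e ~= 0" "z' g = z' e*z g"
proof -
have "hv ((Mon e/Mon e')*(Mon e'/Mon e)) W (z' e*z e')" by(intro hv_mult[OF W] z z' e)
moreover have "(Mon e/Mon e')*(Mon e'/Mon e) = cst 1" using Mon_nz by simp
ultimately have "z' e*z e' = 1" using hv_unique[OF W] hv_cst[OF W] by metis
thus "z' e ~= 0" by auto
have "hv ((Mon e/Mon e')*(Mon g/Mon e)) W (z' e*z g)" by(intro hv_mult[OF W] z z' e g)
moreover have "(Mon e/Mon e')*(Mon g/Mon e) = Mon g/Mon e'" using Mon_nz[of e] by simp
ultimately show "z' g = z' e*z g" using hv_unique[OF W] z'[OF g] by metis
qed

text \<open>The entries of \<open>zpt\<close> are the values at the place of the monomials divided
  by the monomial of the base point. Another chart only changes the denominator, so the two vectors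
  are proportional.\<close>

lemma Phi_Pl:
assumes th: "h : charts A" and sm: "smooth_at h p b"
shows "Phi (Pl h p) = proj_point (zpt h p)" unfolding Phi_def
proof(rule some_equality)
show "EX h' p' b'. h' : charts A & smooth_at h' p' b' & Pl h p = Pl h' p' & proj_point (zpt h p) = proj_point (zpt h' p')" using assms by blast
fix L assume "EX h' p' b'. h' : charts A & smooth_at h' p' b' & Pl h p = Pl h' p' & L = proj_point (zpt h' p')"
then obtain h' p' b' where t: "h' : charts A" "smooth_at h' p' b'" "Pl h p = Pl h' p'" "L = proj_point (zpt h' p')" by blast
have O: "Oloc h p = Oloc h' p'" using t(3) th_Pl by metis
have z': "hv (Mon g/Mon (bas h')) (Oloc h p) (zpt h' p' g)" if "g : A" for g unfolding O by(rule hv_zpt[OF t(1,2) that])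
have r: "zpt h' p' (bas h) ~= 0" "g : A ==> zpt h' p' g = zpt h' p' (bas h)*zpt h p g" for g
 using zpt_rescale[of "Oloc h p" "bas h" "bas h'" "zpt h p" "zpt h' p'"]
  vring_Oloc[OF th sm] bas_in[OF th] bas_in[OF t(1)] hv_zpt[OF th sm] z' by blast+
have "zpt h' p' = (%g. zpt h' p' (bas h)*zpt h p g)"
proof
 fix g show "zpt h' p' g = zpt h' p' (bas h)*zpt h p g" using r(2)[of g] by(cases "g : A") (auto simp: zpt_def)
qed
thus "L = proj_point (zpt h p)" unfolding t(4) using proj_point_scale[OF r(1)] by metis
qed

text \<open>The homogeneous coordinates determine the values of all ratios of monomials, in
  particular of U and V, and these determine the place.\<close>

lemma Phi_inj: "inj_on Phi (places chi)"
proof(rule inj_onI)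
fix Q Q' assume Q: "Q : places chi" "Q' : places chi" "Phi Q = Phi Q'"
obtain h p b where t: "h : charts A" "smooth_at h p b" "Q = Pl h p" by(rule place_classify[OF Q(1)]) blast
obtain h' p' b' where t': "h' : charts A" "smooth_at h' p' b'" "Q' = Pl h' p'" by(rule place_classify[OF Q(2)]) blast
have "proj_point (zpt h p) = proj_point (zpt h' p')" using Q(3) Phi_Pl t t' by metis
moreover have "zpt h p : proj_point (zpt h p)" unfolding proj_point_def by(intro CollectI exI[of _ 1]) auto
ultimately obtain c where c: "c ~= 0" "zpt h p = (%g. c*zpt h' p' g)" unfolding proj_point_def by auto
have one: "c*zpt h' p' (bas h) = 1" using zpt_vertices(1)[OF t(1), of p] c(2) by metis
hence nz: "zpt h' p' (bas h) ~= 0" by auto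
note W = vring_Oloc[OF t'(1,2)]
have hg: "hv (Mon g/Mon (bas h)) (Oloc h' p') (zpt h p g)" if g: "g : A" for g
proof -
 have "hv ((Mon g/Mon (bas h'))*inverse (Mon (bas h)/Mon (bas h'))) (Oloc h' p') (zpt h' p' g*inverse (zpt h' p' (bas h)))"
  by(intro hv_mult[OF W] hv_inverse[OF W] hv_zpt[OF t'(1,2)] g bas_in t(1) nz)
 moreover have E: "(Mon g/Mon (bas h'))*inverse (Mon (bas h)/Mon (bas h')) = Mon g/Mon (bas h)" by(simp add: Mon_nz)
 have F: "inverse (zpt h' p' (bas h)) = c" using one by(intro inverse_unique) (simp add: mult.commute)
 have "zpt h' p' g*c = zpt h p g" using c(2) by(simp add: mult.commute)
 ultimately show ?thesis unfolding E F by(simp only:)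
qed
have "hv (Uc h) (th ` Q') (fst p)" "hv (Vc h) (th ` Q') (snd p)"
 using hg[of "snd (snd h)"] hg[of "fst (snd h)"] chart_in[OF t(1)] zpt_vertices[OF t(1), of p] t'(3)
 unfolding th_Pl Mon_div Uc_def Vc_def wU_def wV_def bas_fst by(simp_all add: th_Pl)
thus "Q = Q'" using place_unique[OF t(1,2) Q(2)] t(3) by simp
qed

lemma Phi_image:
assumes P: "lattice_points P = A"
shows "Phi ` places chi = toric_curve P chi"
proof(intro equalityI subsetI)
fix L assume "L : Phi ` places chi"
then obtain Q where Q: "Q : places chi" "L = Phi Q" by blast
obtain h p b where t: "h : charts A" "smooth_at h p b" "Q = Pl h p" by(rule place_classify[OF Q(1)]) blast
have "p : cpts cc A h" using t(2) by(simp add: smooth_at_def)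
thus "L : toric_curve P chi" using zpt_curve[OF P t(1)] Phi_Pl[OF t(1,2)] Q(2) t(3) by simp
next
fix L assume L: "L : toric_curve P chi"
have "EX z0. L = proj_point z0" using L unfolding toric_curve_def toric_surface_def by blast
then obtain z where "L = proj_point z" by blast
hence z: "z : L" unfolding proj_point_def by(simp add: exI[of _ "1::complex"])
obtain h p where t: "h : charts A" "p : cpts cc A h" "L = proj_point (zpt h p)" using toric_curve_classify[OF P L z] by blast
obtain b where "smooth_at h p b" using smooth_at_ex[OF t(1,2)] by blast
thus "L : Phi ` places chi" using Phi_Pl[OF t(1)] Pl_place[OF t(1)] t(3) by(metis imageI)
qed

lemma Phi_torus:
assumes P: "lattice_points P = A" and Q: "Q : places chi" "ff_x chi : Q" "ff_y chi : Q"
 and nz: "pv chi (ff_x chi) Q ~= 0" "pv chi (ff_y chi) Q ~= 0"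
shows "Phi Q = proj_point (torus_point P (pv chi (ff_x chi) Q) (pv chi (ff_y chi) Q))"
proof -
obtain h p b where t: "h : charts A" "smooth_at h p b" "Q = Pl h p" by(rule place_classify[OF Q(1)]) blast
define s u where "s = pv chi (ff_x chi) Q" and "u = pv chi (ff_y chi) Q"
have st: "s ~= 0" "u ~= 0" using nz by(auto simp: s_def u_def)
note W = vring_image[OF Q(1)]
have X: "th (ff_x chi) = Xc" "th (ff_y chi) = Yc" by(simp_all add: th_x th_y Xc_def Yc_def)
have "Xc : th ` Q" "Yc : th ` Q" using imageI[OF Q(2), of th] imageI[OF Q(3), of th] X by simp_all
hence "hv Xc (th ` Q) s" "hv Yc (th ` Q) u" using place_has_value[OF Q(1), of Xc] place_has_value[OF Q(1), of Yc] Q(2,3) X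
  place_value_eq[OF Q(1) ff_xy_carrier(1)] place_value_eq[OF Q(1) ff_xy_carrier(2)] by(auto simp: s_def u_def)
hence l: "hv (Mon g/Mon e) (th ` Q) (lm s u (ipt g-ipt e))" for g e unfolding Mon_div using hv_lm[OF W] st by blast
have "torus_point P s u = (%g. lm s u (ipt (bas h))*zpt h p g)"
proof
 fix g
 have "zpt h p g = lm s u (ipt g-ipt (bas h))" if "g : A" using hv_unique[OF W _ l[of g "bas h"]] hv_zpt[OF t(1,2) that] t(3) th_Pl by metis
 thus "torus_point P s u g = lm s u (ipt (bas h))*zpt h p g"
  using lm_nat[OF st, of g "bas h"] P by(auto simp: torus_point_def zpt_def split: prod.splits)
qed
hence "proj_point (torus_point P s u) = proj_point (zpt h p)" using proj_point_scale[OF lm_nonzero[OF st]] by metis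
thus ?thesis using Phi_Pl[OF t(1,2)] t(3) by(simp add: s_def u_def)
qed

lemma coord_ratio_zpt:
assumes "h : charts A"
shows "coord_ratio i (bas h) (proj_point (zpt h p)) = zpt h p i" unfolding coord_ratio_def
proof(rule the_equality)
have e: "zpt h p (bas h) = 1" by(rule zpt_vertices(1)[OF assms])
show "ALL z:proj_point (zpt h p). z i = zpt h p i*z (bas h)" by(auto simp: proj_point_def e)
fix r assume "ALL z:proj_point (zpt h p). z i = r*z (bas h)"
moreover have "zpt h p : proj_point (zpt h p)" unfolding proj_point_def by(intro CollectI exI[of _ 1]) auto
ultimately show "r = zpt h p i" using e by auto
qed

lemma unif_chart:
assumes th: "h : charts A" and par: "cpar h G r b"
shows "((%u. Pl h (G u)) ` ball 0 r,pv chi (fe (unif h (G 0) b))) : RC chi"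
 "u : ball 0 r ==> pv chi (fe (unif h (G 0) b)) (Pl h (G u)) = u"
proof -
have K: "unif h (G 0) b : K" by(rule rep_K[OF rep_unif])
have v: "fe (unif h (G 0) b) : Pl h (G u) & pv chi (fe (unif h (G 0) b)) (Pl h (G u)) = u"
 if t: "u : ball 0 r" for u
proof -
 note sm = par_smooth[OF par t]
 have "hv (unif h (G 0) b) (Oloc h (G u)) u" using Oloc_hv_rep[OF th sm rep_unif, of "G 0" b] unifF_par[OF par t] by simp
 thus ?thesis using fe_mem[OF Pl_place[OF th sm] K] fe_value[OF Pl_place[OF th sm] K] hv_mem[OF vring_Oloc[OF th sm]]
   hv_pval[OF vring_Oloc[OF th sm]] by(simp add: th_Pl)
qed
thus "u : ball 0 r ==> pv chi (fe (unif h (G 0) b)) (Pl h (G u)) = u" by blast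
show "((%u. Pl h (G u)) ` ball 0 r,pv chi (fe (unif h (G 0) b))) : RC chi"
proof(rule gpar_chart[OF par_gpar[OF th par]])
 show "inj_on (%u. pv chi (fe (unif h (G 0) b)) (Pl h (G u))) (ball 0 r)" using v by(intro inj_onI) metis
qed (use v fe(1)[OF K] in auto)
qed

theorem Phi_identifies:
assumes P: "lattice_points P = A"
shows "identifies_with_curve P chi Phi" unfolding identifies_with_curve_def
proof(intro conjI ballI impI)
show "Phi ` places chi = toric_curve P chi" by(rule Phi_image[OF P])
show "holomorphic_embedding (places chi) (RC chi) Phi" unfolding holomorphic_embedding_def
proof(intro conjI Phi_inj ballI)
 fix Q assume Q: "Q : places chi"
 obtain h p b where t: "h : charts A" "smooth_at h p b" "Q = Pl h p" by(rule place_classify[OF Q]) blast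
 obtain G r ep where g: "cpar h G r b" "G 0 = p" by(rule smooth_par[OF t(2)]) blast
 define U where "U = (%u. Pl h (G u)) ` ball 0 r"
 define F where "F = pv chi (fe (unif h (G 0) b))"
 have c: "(U,F) : RC chi" and v: "!!u. u : ball 0 r ==> F (Pl h (G u)) = u" using unif_chart[OF t(1) g(1)] by(auto simp: U_def F_def)
 have r: "r > 0" by(rule par_r[OF g(1)])
 have inj: "inj_on F U" using v by(auto simp: U_def inj_on_def)
 have im: "F ` U = ball 0 r" using v by(force simp: U_def)
 have inv: "inv_into U F w = Pl h (G w)" if "w : ball 0 r" for w using inv_into_f_f[OF inj, of "Pl h (G w)"] v[OF that] that by(simp add: U_def)
 have rat: "coord_ratio i (bas h) (Phi (inv_into U F w)) = zpt h (G w) i" if "w : ball 0 r" for w i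
  unfolding inv[OF that] Phi_Pl[OF t(1) par_smooth[OF g(1) that]] by(rule coord_ratio_zpt[OF t(1)])
 have "Q : U" unfolding U_def t(3) using r g(2) by(intro image_eqI[of _ _ 0]) auto
 moreover have "ALL q:U. ALL z:Phi q. z (bas h) ~= 0"
 proof(intro ballI)
  fix q z assume "q : U" "z : Phi q"
  then obtain u where "u : ball 0 r" "z : proj_point (zpt h (G u))" using Phi_Pl[OF t(1) par_smooth[OF g(1)]] by(auto simp: U_def)
  thus "z (bas h) ~= 0" using zpt_vertices(1)[OF t(1), of "G u"] by(auto simp: proj_point_def)
 qed
 moreover have "(%w. coord_ratio i (bas h) (Phi (inv_into U F w))) hol_on F ` U" for i
 proof -
  have "(%w. zpt h (G w) i) hol_on ball 0 r"
   by(cases "i : A") (auto simp: zpt_def intro!: holomorphic_intros par_holomorphic[OF g(1)] par_snd_nz[OF g(1)])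
  thus ?thesis unfolding im by(rule holomorphic_transform) (simp add: rat)
 qed
 \<comment> \<open>The coordinate at the third or second chart point is u or v itself, hence a
   constant plus the parameter, with derivative 1.\<close>
 moreover have "EX i. deriv (%w. coord_ratio i (bas h) (Phi (inv_into U F w))) (F Q) ~= 0"
 proof -
  have p0: "F Q = 0" using v[of 0] r g(2) t(3) by simp
  have d: "deriv (%w. coord_ratio i (bas h) (Phi (inv_into U F w))) (F Q) = 1"
   if i: "!!w. w : ball 0 r ==> zpt h (G w) i = k+w" for i k
  proof(rule DERIV_imp_deriv, rule hfd_transform[of "%w. k+w" _ _ "ball 0 r"])
   show "((%w. k+w) hfd 1) (at (F Q))" by(auto intro!: derivative_eq_intros)
  qed (use rat i r p0 in auto)
  show ?thesis
  proof(cases b)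
   case True
   have "zpt h (G w) (snd (snd h)) = fst (G 0)+w" if "w : ball 0 r" for w using zpt_vertices(3)[OF t(1)] par_at(2)[OF g(1) that True] by metis
   from d[OF this] show ?thesis by(metis zero_neq_one)
  next
   case False
   have "zpt h (G w) (fst (snd h)) = snd (G 0)+w" if "w : ball 0 r" for w using zpt_vertices(2)[OF t(1)] par_at(4)[OF g(1) that False] by metis
   from d[OF this] show ?thesis by(metis zero_neq_one)
  qed
 qed
 ultimately have "EX j. Q : U & (ALL q:U. ALL z:Phi q. z j ~= 0) &
   (ALL i. (%w. coord_ratio i j (Phi (inv_into U F w))) hol_on F ` U) &
   (EX i. deriv (%w. coord_ratio i j (Phi (inv_into U F w))) (F Q) ~= 0)" by(rule_tac exI[of _ "bas h"]) (intro conjI allI)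
 thus "EX (U,F):RC chi. EX j. Q : U & (ALL q:U. ALL z:Phi q. z j ~= 0) &
   (ALL i. (%w. coord_ratio i j (Phi (inv_into U F w))) hol_on F ` U) &
   (EX i. deriv (%w. coord_ratio i j (Phi (inv_into U F w))) (F Q) ~= 0)" by(intro bexI[OF _ c]) (simp only: prod.case)
qed
qed (rule Phi_torus[OF P])

end

subsection \<open>Dimensions\<close>

lemma sum_fun_at: "(SUM v:S. F v) x = (SUM v:S. F v x)" for F :: "'a => 'b => complex"
by(induction S rule: infinite_finite_induct) (simp_all add: plus_fun_def zero_fun_def)

lemma has_cdim_family:
fixes w :: "'a => 'i => complex"
assumes fin: "finite I" and ind: "!!c. (!!x. (SUM i:I. c i*w i x) = 0) ==> ALL i:I. c i = 0"
 and V: "V = {%x. SUM i:I. c i*w i x | c. True}"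
shows "has_cdim V (card I)"
proof -
have inj: "inj_on w I"
proof(rule inj_onI, rule ccontr)
 fix i j assume ij: "i : I" "j : I" "w i = w j" "i ~= j"
 \<comment> \<open>A repeated vector would yield this nontrivial relation.\<close>
 define c where "c = (%k. if k = i then 1 else if k = j then -1 else (0::complex))"
 have "(SUM k:I. c k*w k x) = 0" for x
 proof -
  have "(SUM k:I. c k*w k x) = (SUM k:{i,j}. c k*w k x)" by(rule sum.mono_neutral_right) (use fin ij in \<open>auto simp: c_def\<close>)
  thus ?thesis using ij by(simp add: c_def)
 qed
 hence "c i = 0" using ind ij(1) by blast
 thus False by(simp add: c_def)
qed
have sumw: "(SUM v:w ` I. (%x. u v * v x)) = (%x. SUM i:I. u (w i)*w i x)" for u by(rule ext) (simp add: sum_fun_at sum.reindex[OF inj])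
have "cfun.independent (w ` I)"
proof(rule cfun.independent_if_scalars_zero)
 show "finite (w ` I)" using fin by simp
 fix u v assume u: "(SUM v:w ` I. (%x. u v * v x)) = 0" and v: "v : w ` I"
 have "(SUM i:I. u (w i)*w i x) = 0" for x using fun_cong[OF u[unfolded sumw], of x] by simp
 hence "ALL i:I. u (w i) = 0" by(rule ind)
 thus "u v = 0" using v by auto
qed
moreover have "cfun.span (w ` I) = V"
proof -
 have "cfun.span (w ` I) = range (%u. %x. SUM i:I. u (w i)*w i x)" by(simp only: cfun.span_finite[OF finite_imageI[OF fin]] sumw)
 also have "... = V"
 proof(intro equalityI subsetI)
  fix y assume "y : V"
  then obtain c where c: "y = (%x. SUM i:I. c i*w i x)" unfolding V by blast
  have "y = (%x. SUM i:I. c (inv_into I w (w i))*w i x)" unfolding c by(intro ext sum.cong refl) (simp add: inv_into_f_f[OF inj])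
  thus "y : range (%u. %x. SUM i:I. u (w i)*w i x)" by(intro image_eqI[of _ _ "%v. c (inv_into I w v)"]) auto
 qed (auto simp: V)
 finally show ?thesis .
qed
ultimately show ?thesis unfolding has_cdim_def using fin card_image[OF inj] by(intro exI[of _ "w ` I"]) simp
qed

context nondeg begin

subsection \<open>Smoothness of the toric curve\<close>

text \<open>The differential of (l,u,v) -> l \<open>zpt\<close>(u,v) at l = 1: a is the radial
  component, b and d are the components along u and v.\<close>

definition tanv :: "triple => complex \<times> complex => complex => complex => complex => mon => complex" where
"tanv h p a b d g = (if g : A then a*(fst p^dd h g * snd p powi jj h g)
  + b*(of_nat (dd h g)*fst p^(dd h g-1) * snd p powi jj h g)
  + d*(fst p^dd h g*(of_int (jj h g) * snd p powi (jj h g-1))) else 0)"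

lemma tanv_vertices:
assumes "h : charts A"
shows "tanv h p a b d (fst h) = a" "tanv h p a b d (fst (snd h)) = a * snd p+d"
 "tanv h p a b d (snd (snd h)) = a*fst p+b" using chart_vertices[OF assms] chart_in[OF assms] by(simp_all add: tanv_def)

lemma tanv_section:
assumes P: "lattice_points P = A"
shows "toric_section P chi (tanv h p a b d) = a*gth cc A h p+b*gU cc A h p+d*gV cc A h p"
unfolding toric_section_def P gth_def gU_def gV_def sum_distrib_left sum.distrib[symmetric] by(intro sum.cong refl) (simp add: tanv_def alg)

lemma tanv_tangent:
assumes P: "lattice_points P = A" and th: "h : charts A" and p: "snd p ~= 0" and l: "l ~= 0"
 and f: "f : toric_ideal P" and D: "lin_deriv f (%g. l*zpt h p g) D"
shows "D (tanv h p a b d) = 0"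
proof -
\<comment> \<open>Dividing by l compensates for the scale of the base vector, so that the curve
  \<open>ze\<close> has velocity exactly \<open>tanv h p a b d\<close>.\<close>
define q where "q = (%t. (fst p+t*(b/l),snd p+t*(d/l)))"
define ze where "ze = (%t g. (l+t*a)*zpt h (q t) g)"
have "((%t. f (ze t)) hfd D (tanv h p a b d)) (at 0)"
proof(rule lin_derivD(3)[OF D])
 show "ze 0 = (%g. l*zpt h p g)" by(simp add: ze_def q_def)
 fix g show "((%t. ze t g) hfd tanv h p a b d g) (at 0)"
 proof(cases "g : A")
  case True
  have 1: "((%t. (fst p+t*(b/l))^dd h g) has_field_derivative
    of_nat (dd h g)*fst p^(dd h g-1)*(b/l)) (at 0)" using l by(auto intro!: derivative_eq_intros)
  have lin: "((%t. snd p+t*(d/l)) hfd d/l) (at 0)" using l by(auto intro!: derivative_eq_intros)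
  have 2: "((%t. (snd p+t*(d/l)) powi jj h g) has_field_derivative
    of_int (jj h g) * snd p powi (jj h g-1)*(d/l)) (at 0)" using DERIV_power_int[OF lin, of "jj h g"] p by simp
  have 3: "((%t. l+t*a) hfd a) (at 0)" by(auto intro!: derivative_eq_intros)
  have eq: "(%t. ze t g) = (%t. (l+t*a)*((fst p+t*(b/l))^dd h g*(snd p+t*(d/l)) powi jj h g))" using True by(simp add: ze_def q_def zpt_def)
  show ?thesis unfolding eq by(rule DERIV_cong[OF DERIV_mult[OF 3 DERIV_mult[OF 1 2]]]) (use l True in \<open>simp add: tanv_def alg\<close>)
 qed (simp add: ze_def zpt_def tanv_def)
qed
moreover have "((%t. f (ze t)) hfd 0) (at 0)"
proof(rule hfd_transform[of "%_. 0" 0 0 "{t. snd (q t) ~= 0}"])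
 show "open {t. snd (q t) ~= 0}" unfolding q_def by(intro open_Collect_neq continuous_intros)
 show "0 : {t. snd (q t) ~= 0}" using p by(simp add: q_def)
 fix t assume t: "t : {t. snd (q t) ~= 0}"
 obtain k :: nat where "ALL c z. f (%i. c*z i) = c ^ k*f z" using f unfolding toric_ideal_def homogeneous_poly_fun_def by blast
 thus "0 = f (ze t)" using zpt_ideal[OF P th _ f, of "q t"] t by(simp add: ze_def)
qed simp
ultimately show ?thesis by(rule DERIV_unique)
qed

lemma ideal_deriv:
assumes D: "lin_deriv f z D"
shows "deriv (%t. f (%e. z e+t*w e)) 0 = D w"
proof(rule DERIV_imp_deriv, rule lin_derivD(3)[OF D])
show "(%e. z e+0*w e) = z" by simp
show "((%t. z i+t*w i) hfd w i) (at 0)" for i by(auto intro!: derivative_eq_intros)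
qed

text \<open>For the hard inclusion subtract from w the vector \<open>tanv\<close> with the same
  entries at the three chart points. In the binomial that expresses the coordinate g through these
  points only the factor z g still varies, with a nonzero cofactor, so the difference vanishes at g
  as well.\<close>

lemma cone_tangent_eq:
assumes P: "lattice_points P = A" and th: "h : charts A" and p: "p : cpts cc A h" and l: "l ~= 0"
shows "cone_tangent_space P chi (%g. l*zpt h p g)
 = {tanv h p a b d | a b d. b*gU cc A h p+d*gV cc A h p = 0}" (is "_ = ?R")
proof(intro equalityI subsetI)
let ?T = "cone_tangent_space P chi" and ?z = "%g. l*zpt h p g"
have v: "snd p ~= 0" "gth cc A h p = 0" using p by(auto simp: cpts_def)
have pf: "EX D. lin_deriv f ?z D" if "f : toric_ideal P" for f
 using that poly_fun_derivative unfolding toric_ideal_def homogeneous_poly_fun_def by blast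
{
 fix w assume "w : ?R"
 then obtain a b d where w: "w = tanv h p a b d" "b*gU cc A h p+d*gV cc A h p = 0" by blast
 have "deriv (%t. f (%e. ?z e+t*w e)) 0 = 0" if f: "f : toric_ideal P" for f
 proof -
  obtain D where D: "lin_deriv f ?z D" using pf[OF f] by blast
  show ?thesis unfolding ideal_deriv[OF D] w(1) by(rule tanv_tangent[OF P th v(1) l f D])
 qed
 moreover have "toric_section P chi w = 0" unfolding w(1) tanv_section[OF P] using w(2) v(2) by simp
 moreover have "ALL e. e ~: lattice_points P --> w e = 0" by(simp add: w(1) tanv_def P)
 ultimately show "w : ?T ?z" unfolding cone_tangent_space_def by blast
next
 fix w assume "w : ?T ?z"
 hence w: "!!e. e ~: A ==> w e = 0" "!!f. f : toric_ideal P ==> deriv (%t. f (%e. ?z e+t*w e)) 0 = 0"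
  "toric_section P chi w = 0" unfolding cone_tangent_space_def P by auto
 define a where "a = w (fst h)"
 define b where "b = w (snd (snd h))-a*fst p"
 define d where "d = w (fst (snd h))-a * snd p"
 define y where "y = (%i. w i+(-1)*tanv h p a b d i)"
 have y0: "y (fst h) = 0" "y (fst (snd h)) = 0" "y (snd (snd h)) = 0" using tanv_vertices[OF th, of p a b d] by(simp_all add: y_def a_def b_def d_def)
 have yg: "y g = 0" for g
 proof(cases "g : A & g ~= fst h & g ~= fst (snd h) & g ~= snd (snd h)")
  case False thus ?thesis using y0 w(1)[of g] by(auto simp: y_def tanv_def)
 next
  case True
  hence gA: "g : A" by blast
  let ?f = "binom A (relp h g) (relq h g)"
  have f: "?f : toric_ideal P" by(rule rel_toric(1)[OF finA P th gA])
  obtain D where D: "lin_deriv ?f ?z D" using pf[OF f] by blast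
  have "D w = 0" using w(2)[OF f] ideal_deriv[OF D, of w] by simp
  moreover have "D (tanv h p a b d) = 0" by(rule tanv_tangent[OF P th v(1) l f D])
  ultimately have Dy: "D y = 0" unfolding y_def using lin_derivD(1)[OF D, of w "%i. (-1)*tanv h p a b d i"]
    lin_derivD(2)[OF D, of "-1" "tanv h p a b d"] by simp
  define C where "C = ?z (fst (snd h))^nat (- jj h g)*?z (fst h)^nat (int (dd h g)+jj h g-1)"
  define C' where "C' = ?z (snd (snd h))^dd h g*?z (fst (snd h))^nat (jj h g)*?z (fst h)^nat (1-int (dd h g)-jj h g)"
  have "(%t. ?f (%e. ?z e+t*y e)) = (%t. (?z g+t*y g)*C-C')" unfolding rel_toric(2)[OF finA P th gA] C_def C'_def y0 by(simp add: mult.assoc)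
  moreover have "((%t. (?z g+t*y g)*C-C') hfd y g*C) (at 0)" by(auto intro!: derivative_eq_intros)
  ultimately have "D y = y g*C" using ideal_deriv[OF D, of y] DERIV_imp_deriv by metis
  moreover have "C ~= 0" using zpt_vertices[OF th, of p] v(1) l by(simp add: C_def bas_fst)
  ultimately show ?thesis using Dy by simp
 qed
 have weq: "w = tanv h p a b d"
 proof
  fix g show "w g = tanv h p a b d g" using yg[of g] by(simp add: y_def)
 qed
 have "b*gU cc A h p+d*gV cc A h p = 0" using w(3) v(2) unfolding weq tanv_section[OF P] by simp
 thus "w : ?R" using weq by blast
}
qed

theorem smooth_toric:
assumes P: "lattice_points P = A"
shows "smooth_toric_curve P chi" unfolding smooth_toric_curve_def
proof(intro ballI)
fix L z assume L: "L : toric_curve P chi" "z : L"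
obtain h p l where t: "h : charts A" "p : cpts cc A h" "l ~= 0" "z = (%g. l*zpt h p g)" using toric_curve_classify[OF P L] by blast
define u v where "u = gU cc A h p" and "v = gV cc A h p"
have uv: "u ~= 0 | v ~= 0" using smooth[OF t(1,2)] by(auto simp: u_def v_def)
\<comment> \<open>The radial vector, and a spanning vector (v, -u) of the line orthogonal to the
  nonzero gradient (u, v).\<close>
define w where "w = (%i::bool. if i then tanv h p 1 0 0 else tanv h p 0 v (- u))"
have comb: "(SUM i:UNIV. c i*w i x) = tanv h p (c True) (c False * v) (c False*(- u)) x" for c x by(simp add: UNIV_bool w_def tanv_def alg)
have "has_cdim (cone_tangent_space P chi z) (card (UNIV :: bool set))"
proof(rule has_cdim_family[where w=w])
 fix c assume "!!x. (SUM i:UNIV. c i*w i x) = 0"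
 hence z: "tanv h p (c True) (c False * v) (c False*(- u)) x = 0" for x unfolding comb .
 have "c True = 0" using z[of "fst h"] tanv_vertices(1)[OF t(1)] by simp
 moreover have "c False * v = 0" "c False*(- u) = 0"
  using z[of "snd (snd h)"] z[of "fst (snd h)"] tanv_vertices(2,3)[OF t(1)] \<open>c True = 0\<close> by simp_all
 ultimately show "ALL i:UNIV. c i = 0" using uv by(auto simp: UNIV_bool)
next
 show "cone_tangent_space P chi z = {%x. SUM i:UNIV. c i*w i x |c. True}"
  unfolding t(4) cone_tangent_eq[OF P t(1,2,3)] comb u_def[symmetric] v_def[symmetric]
 proof(intro equalityI subsetI)
  fix y assume "y : {tanv h p a b d |a b d. b*u+d * v = 0}"
  then obtain a b d where y: "y = tanv h p a b d" "b*u+d * v = 0" by blast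
  obtain k where k: "b = k * v" "d = k*(- u)"
  proof(cases "v = 0")
   case True
   hence "b = 0" using uv y(2) by simp
   thus ?thesis using that[of "- d/u"] True uv by simp
  next
   case False
   have "d * v = - (b*u)" using y(2) by(simp add: eq_neg_iff_add_eq_0 add.commute)
   hence "d = b / v * (- u)" using False by(simp add: field_simps)
   thus ?thesis using that[of "b / v"] False by simp
  qed
  show "y : {%x. tanv h p (c True) (c False * v) (c False*(- u)) x |c. True}"
   unfolding y(1) k by(intro CollectI exI[of _ "%i. if i then a else k"]) auto
 next
  fix y assume "y : {%x. tanv h p (c True) (c False * v) (c False*(- u)) x |c. True}"
  then obtain c where "y = tanv h p (c True) (c False * v) (c False*(- u))" by auto
  moreover have "c False * v * u+c False*(- u) * v = 0" by(simp add: alg)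
  ultimately show "y : {tanv h p a b d |a b d. b*u+d * v = 0}" by blast
 qed
qed simp
thus "has_cdim (cone_tangent_space P chi z) 2" by simp
qed

end

context nondeg begin

subsection \<open>The differential of the coordinate \<open>x\<close>\<close>

lemma hv_ev:
assumes W: "vring W" and X: "hv Xc W s" and Y: "hv Yc W t"
shows "hv (ev B) W (pe B s t)"
proof(induction B)
case 0 show ?case using hv_cst[OF W, of 0] by(simp add: ev_zero)
next
case (pCons c B)
have "pCons c B = [:c:] + [:0,1:]*B" by simp
hence "ev (pCons c B) = ev [:c:]+Yc*ev B" by(simp only: ev_add ev_mult Yc_def)
moreover have "pe (pCons c B) s t = poly c s+t*pe B s t" by(simp add: pe_def)
ultimately show ?case using hv_add[OF W hv_ev_const[OF W X] hv_mult[OF W Y pCons.IH]] by simp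
qed

lemma torus_hv:
assumes th: "h : charts A" and sm: "smooth_at h p b" and u: "fst p ~= 0"
shows "hv Xc (Oloc h p) (backS h (fst p) (snd p))" "hv Yc (Oloc h p) (backT h (fst p) (snd p))"
proof -
note W = vring_Oloc[OF th sm]
have v: "snd p ~= 0" using sm by(simp add: smooth_at_def cpts_def)
have h: "hv (Uc h) (Oloc h p) (fst p)" "hv (Vc h) (Oloc h p) (snd p)" by(rule Oloc_hv_rep[OF th sm rep.U], rule Oloc_hv_rep[OF th sm rep.V])
have "hv (backS h (Uc h) (Vc h)) (Oloc h p) (backS h (fst p) (snd p))"
 "hv (backT h (Uc h) (Vc h)) (Oloc h p) (backT h (fst p) (snd p))" unfolding backS_def backT_def by(intro hv_mult[OF W] hv_powi[OF W] h u v)+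
thus "hv Xc (Oloc h p) (backS h (fst p) (snd p))" "hv Yc (Oloc h p) (backT h (fst p) (snd p))"
 using back_lm[OF th Xc_nonzero Yc_nonzero] by(simp_all add: Uc_def Vc_def)
qed

lemma torus_place_values:
assumes th: "h : charts A" and sm: "smooth_at h p b" and u: "fst p ~= 0"
shows "ff_x chi : Pl h p" "pv chi (ff_x chi) (Pl h p) = backS h (fst p) (snd p)"
proof -
note W = vring_Oloc[OF th sm]
have X: "th (ff_x chi) = Xc" by(simp add: th_x Xc_def)
show "ff_x chi : Pl h p" using hv_mem[OF W torus_hv(1)[OF assms]] by(simp add: Pl_mem ff_xy_carrier X)
show "pv chi (ff_x chi) (Pl h p) = backS h (fst p) (snd p)"
 using hv_pval[OF W torus_hv(1)[OF assms]] place_value_eq[OF Pl_place[OF th sm] ff_xy_carrier(1)] by(simp add: X th_Pl)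
qed

lemma pe_deriv: "((%t. pe B s t) hfd pe (pderiv B) s t) (at t)"
proof(induction B)
case (pCons c B)
have "((%t. poly c s+t*pe B s t) hfd 0+(1*pe B s t+pe (pderiv B) s t*t)) (at t)" by(intro DERIV_add DERIV_const DERIV_mult DERIV_ident pCons.IH)
moreover have "(%t. pe (pCons c B) s t) = (%t. poly c s+t*pe B s t)" by(rule ext) (simp add: pe_def)
moreover have "pe (pderiv (pCons c B)) s t = 0+(1*pe B s t+pe (pderiv B) s t*t)" by(simp add: pderiv_pCons pe_def)
ultimately show ?case by simp
qed (simp add: pe_def)

lemma lm_deriv:
assumes "t ~= 0"
shows "((%t. lm s t w) hfd of_int (snd w)*lm s t w/t) (at (t::complex))"
proof -
have "((%t. s powi fst w*t powi snd w) hfd s powi fst w*(of_int (snd w)*t powi (snd w-1)*1)) (at t)"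
 by(intro DERIV_cmult DERIV_power_int DERIV_ident) (use assms in auto)
thus ?thesis using assms by(simp add: lm_def[abs_def] power_int_diff mult_ac)
qed

lemma gth_comp_deriv:
assumes f: "(f hfd f') (at x)" "(k hfd k') (at x)" and nz: "k x ~= 0"
shows "((%x. gth c A q (f x,k x)) hfd gU c A q (f x,k x)*f'+gV c A q (f x,k x) * k') (at x)"
proof -
have "((%x. (f x,k x)) has_derivative (%h. (f'*h,k'*h))) (at x)" using f unfolding has_field_derivative_def by(intro has_derivative_Pair)
hence "((%x. gth c A q (f x,k x)) has_derivative (%h. gU c A q (f x,k x)*(f'*h)+gV c A q (f x,k x)*(k'*h))) (at x)"
 using has_derivative_compose[of "%x. (f x,k x)" "%h. (f'*h,k'*h)" x UNIV "gth c A q"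
   "%h. gU c A q (f x,k x)*fst h+gV c A q (f x,k x) * snd h"] gth_deriv[of "(f x,k x)" c A q] nz by simp
moreover have "(%h. gU c A q (f x,k x)*(f'*h)+gV c A q (f x,k x)*(k'*h))
  = (*) (gU c A q (f x,k x)*f'+gV c A q (f x,k x) * k')" by(auto simp: alg)
ultimately show ?thesis unfolding has_field_derivative_def by simp
qed

text \<open>Differentiate chi = L gth in y, where L is the monomial of the base point. The term with
  the derivative of L drops out because gth vanishes at p.\<close>

lemma chi_y_chart:
assumes th: "h : charts A" and st: "s ~= 0" "t ~= 0"
 and p: "p = (lp s t h)" "gth cc A h p = 0"
shows "t*pe (pderiv chi) s t = lm s t (ipt (bas h)) *
 (gU cc A h p*(of_int (snd (wU h))*fst p)+gV cc A h p*(of_int (snd (wV h)) * snd p))"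
proof -
define L where "L = lm s t (ipt (bas h))"
have "((%t. lm s t (ipt (bas h))*gth cc A h (lp s t h)) has_field_derivative
  (of_int (snd (ipt (bas h)))*lm s t (ipt (bas h))/t)*gth cc A h (lp s t h)
  + (gU cc A h (lp s t h)*(of_int (snd (wU h))*lm s t (wU h)/t)
   + gV cc A h (lp s t h)*(of_int (snd (wV h))*lm s t (wV h)/t))*lm s t (ipt (bas h))) (at t)"
 by(intro DERIV_mult lm_deriv gth_comp_deriv st lm_nonzero)
hence D: "((%t. lm s t (ipt (bas h))*gth cc A h (lp s t h)) has_field_derivative
  L*(gU cc A h p*(of_int (snd (wU h))*fst p)+gV cc A h p*(of_int (snd (wV h)) * snd p))/t) (at t)"
 by(rule DERIV_cong) (use p in \<open>simp add: L_def alg add_divide_distrib\<close>)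
have "((%t. pe chi s t) has_field_derivative
  L*(gU cc A h p*(of_int (snd (wU h))*fst p)+gV cc A h p*(of_int (snd (wV h)) * snd p))/t) (at t)"
proof(rule hfd_transform[OF D, of "- {0}"])
 fix x assume "x : - {0::complex}"
 thus "lm s x (ipt (bas h))*gth cc A h (lm s x (wU h),lm s x (wV h)) = pe chi s x" using pe_chi_chart[OF th st(1), of x] by simp
qed (use st in auto)
hence "pe (pderiv chi) s t = L*(gU cc A h p*(of_int (snd (wU h))*fst p)+gV cc A h p*(of_int (snd (wV h)) * snd p))/t"
 using DERIV_unique[OF pe_deriv] by blast
thus ?thesis using st by(simp add: L_def)
qed

definition sg :: "triple => (complex => complex \<times> complex) => complex => complex" where
"sg h G u = backS h (fst (G u)) (snd (G u))"
definition tg :: "triple => (complex => complex \<times> complex) => complex => complex" where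
"tg h G u = backT h (fst (G u)) (snd (G u))"

lemma par_torus:
assumes th: "h : charts A" and par: "cpar h G r b" and t: "u : ball 0 r" and u: "fst (G u) ~= 0"
shows "sg h G u ~= 0" "tg h G u ~= 0" "pe chi (sg h G u) (tg h G u) = 0"
 "lm (sg h G u) (tg h G u) (wU h) = fst (G u)" "lm (sg h G u) (tg h G u) (wV h) = snd (G u)"
 "ff_x chi : Pl h (G u)" "pv chi (ff_x chi) (Pl h (G u)) = sg h G u"
 "hv Xc (Oloc h (G u)) (sg h G u)" "hv Yc (Oloc h (G u)) (tg h G u)" unfolding sg_def tg_def
using torus_chart_point[OF th par_at(1)[OF par t] u] torus_place_values[OF th par_smooth[OF par t] u]
 torus_hv[OF th par_smooth[OF par t] u] by blast+

lemma par_derivs: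
assumes par: "cpar h G r b" and t: "u : ball 0 r"
shows "((%u. fst (G u)) hfd deriv (%u. fst (G u)) u) (at u)"
 "((%u. snd (G u)) hfd deriv (%u. snd (G u)) u) (at u)"
 "gU cc A h (G u)*deriv (%u. fst (G u)) u+gV cc A h (G u)*deriv (%u. snd (G u)) u = 0"
 "b ==> deriv (%u. fst (G u)) u = 1" "~ b ==> deriv (%u. snd (G u)) u = 1"
proof -
show d: "((%u. fst (G u)) hfd deriv (%u. fst (G u)) u) (at u)"
 "((%u. snd (G u)) hfd deriv (%u. snd (G u)) u) (at u)" using par_holomorphic[OF par] t by(auto intro: holomorphic_derivI)
have "((%u. gth cc A h (fst (G u),snd (G u))) has_field_derivative
  gU cc A h (fst (G u),snd (G u))*deriv (%u. fst (G u)) u+gV cc A h (fst (G u),snd (G u))*deriv (%u. snd (G u)) u) (at u)"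
 by(intro gth_comp_deriv d par_snd_nz[OF par t])
moreover have "((%u. gth cc A h (fst (G u),snd (G u))) hfd 0) (at u)"
proof(rule hfd_transform[of "%_. 0" 0 u "ball 0 r"])
 fix x :: complex assume "x : ball 0 r"
 thus "0 = gth cc A h (fst (G x),snd (G x))" using par_at(1)[OF par] by(simp add: cpts_def)
qed (use t in auto)
ultimately show "gU cc A h (G u)*deriv (%u. fst (G u)) u+gV cc A h (G u)*deriv (%u. snd (G u)) u = 0" using DERIV_unique by fastforce
have lin: "((%u. a+u) hfd 1) (at u)" for a :: complex by(auto intro!: derivative_eq_intros)
show "deriv (%u. fst (G u)) u = 1" if b: b
proof(rule DERIV_imp_deriv, rule hfd_transform[OF lin[of "fst (G 0)"], of "ball 0 r"])
 fix x :: complex assume "x : ball 0 r"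
 from par_at(2)[OF par this b] show "fst (G 0)+x = fst (G x)" by(rule sym)
qed (use t in auto)
show "deriv (%u. snd (G u)) u = 1" if b: "~ b"
proof(rule DERIV_imp_deriv, rule hfd_transform[OF lin[of "snd (G 0)"], of "ball 0 r"])
 fix x :: complex assume "x : ball 0 r"
 from par_at(4)[OF par this b] show "snd (G 0)+x = snd (G x)" by(rule sym)
qed (use t in auto)
qed

lemma sg_deriv:
assumes par: "cpar h G r b" and t: "u : ball 0 r" and u: "fst (G u) ~= 0"
shows "(sg h G hfd sg h G u*(of_int (snd (wU h))*deriv (%u. snd (G u)) u / snd (G u)
  - of_int (snd (wV h))*deriv (%u. fst (G u)) u/fst (G u))) (at u)"
proof -
have v: "snd (G u) ~= 0" by(rule par_snd_nz[OF par t])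
note d = par_derivs(1,2)[OF par t]
let ?a = "- snd (wV h)" and ?c = "snd (wU h)"
have "((%u. fst (G u) powi ?a * snd (G u) powi ?c) has_field_derivative
  of_int ?a*fst (G u) powi (?a-1)*deriv (%u. fst (G u)) u * snd (G u) powi ?c
  + of_int ?c * snd (G u) powi (?c-1)*deriv (%u. snd (G u)) u*fst (G u) powi ?a) (at u)" by(intro DERIV_mult DERIV_power_int d disjI2 u v)
moreover have "fst (G u) powi (?a-1) = fst (G u) powi ?a/fst (G u)"
 "snd (G u) powi (?c-1) = snd (G u) powi ?c / snd (G u)" using u v by(simp_all add: power_int_diff)
ultimately show ?thesis unfolding sg_def[abs_def] backS_def by(elim DERIV_cong) (simp add: alg)
qed

text \<open>The adjunction formula in a chart: up to sign both sides are the residue of \<open>dx dy / chi\<close>.\<close>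

lemma residue_formula:
assumes th: "h : charts A" and par: "cpar h G r b" and t: "u : ball 0 r" and u: "fst (G u) ~= 0"
shows "(if b then-gV cc A h (G u) else gU cc A h (G u))*fst (G u) * snd (G u)*deriv (sg h G) u
 * lm (sg h G u) (tg h G u) (ipt (bas h)) = sg h G u*tg h G u*pe (pderiv chi) (sg h G u) (tg h G u)"
proof -
note T = par_torus[OF th par t u]
have v: "snd (G u) ~= 0" by(rule par_snd_nz[OF par t])
define s where "s = sg h G u"
define a c x y where "a = gU cc A h (G u)" and "c = gV cc A h (G u)" and "x = fst (G u)" and "y = snd (G u)"
define x' y' where "x' = deriv (%u. fst (G u)) u" and "y' = deriv (%u. snd (G u)) u"
define p q :: complex where "p = of_int (snd (wU h))" and "q = of_int (snd (wV h))"
define L where "L = lm (sg h G u) (tg h G u) (ipt (bas h))"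
have "gth cc A h (G u) = 0" using par_at(1)[OF par t] by(simp add: cpts_def)
hence cy: "tg h G u*pe (pderiv chi) s (tg h G u) = L*(a*(p*x)+c*(q*y))"
 using chi_y_chart[OF th T(1,2), of "G u"] T(4,5) by(simp add: s_def a_def c_def p_def q_def x_def y_def L_def)
have ds: "deriv (sg h G) u = s*(p*y'/y-q*x'/x)"
 using DERIV_imp_deriv[OF sg_deriv[OF par t u]] by(simp add: s_def p_def q_def x_def y_def x'_def y'_def)
have rel: "a*x'+c*y' = 0" using par_derivs(3)[OF par t] by(simp add: a_def c_def x'_def y'_def)
have xy: "x ~= 0" "y ~= 0" using u v by(simp_all add: x_def y_def)
have E: "x*y*deriv (sg h G) u = s*(p*y'*x-q*x'*y)" unfolding ds using xy by(simp add: field_simps)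
have "(if b then-c else a)*(p*y'*x-q*x'*y) = a*(p*x)+c*(q*y)"
proof(cases b)
 case True
 have x1: "x' = 1" using par_derivs(4)[OF par t True] by(simp add: x'_def)
 hence "c*y' = - a" using rel by(simp add: add_eq_0_iff)
 moreover have "- c*(p*y'*x-q*x'*y) = - (p*x)*(c*y')+c*q*y" by(simp add: x1 alg)
 ultimately have "- c*(p*y'*x-q*x'*y) = - (p*x)*(- a)+c*q*y" by(simp only:)
 thus ?thesis using True by(simp add: alg)
next
 case False
 have y1: "y' = 1" using par_derivs(5)[OF par t False] by(simp add: y'_def)
 hence "a*x' = - c" using rel by(simp add: add_eq_0_iff2)
 moreover have "a*(p*y'*x-q*x'*y) = a*p*x-(a*x')*q*y" by(simp add: y1 alg)
 ultimately have "a*(p*y'*x-q*x'*y) = a*p*x-(- c)*q*y" by(simp only:)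
 thus ?thesis using False by(simp add: alg)
qed
hence "(if b then-c else a)*(x*y*deriv (sg h G) u)*L = s*(L*(a*(p*x)+c*(q*y)))" unfolding E by(metis (no_types, lifting) mult.assoc mult.commute)
thus ?thesis unfolding cy[symmetric] by(cases b) (simp_all add: s_def a_def c_def x_def y_def L_def mult_ac)
qed

end

context nondeg begin

subsection \<open>Generic points and forms along them\<close>

text \<open>The value 0 together with the x-coordinates of ramification points and of zeros of y.
  Over its complement the fibre lies in the torus and is unramified.\<close>

definition bad :: "complex set" where
"bad = insert 0 (fst ` ({(s,t). pe chi s t = 0 & pe (pderiv chi) s t = 0} \<union> {(s,t). pe chi s t = 0 & pe [:0,1:] s t = 0}))"

lemma not_dvd_pderiv: "~ chi dvd pderiv chi"
proof
assume d: "chi dvd pderiv chi"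
have "pderiv chi ~= 0" using degree_chi n_pos by(simp add: pderiv_eq_0_iff)
hence "degree chi <= degree (pderiv chi)" using d by(rule dvd_imp_degree_le[rotated])
thus False using degree_chi n_pos degree_pderiv[of chi] by simp
qed

lemma finite_bad: "finite bad"
proof -
have "~ chi dvd [:0,1:]" using Yc_nonzero ev_eq_0_iff by(simp add: Yc_def)
thus ?thesis unfolding bad_def by(intro finite.insertI finite_imageI finite_UnI finite_common_zeros not_dvd_pderiv)
qed

lemma good_point:
assumes "s ~: bad" "pe chi s t = 0" shows "s ~= 0" "t ~= 0" "pe (pderiv chi) s t ~= 0"
proof -
show "s ~= 0" using assms by(auto simp: bad_def)
show "pe (pderiv chi) s t ~= 0" using assms by(force simp: bad_def image_iff)
show "t ~= 0"
proof
 assume "t = 0"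
 hence "pe [:0,1:] s t = 0" by simp
 thus False using assms by(force simp del: pe_simps simp: bad_def image_iff)
qed
qed

lemma eventually_avoid:
assumes par: "cpar h G r b" and Z: "finite Z" and th: "h : charts A"
shows "eventually (%u. u : ball 0 r & fst (G u) ~= 0 & (sg h G u,tg h G u) ~: Z) (at 0)"
proof -
define N where "N = unifF (G 0) b ` (%(s,t). (lp s t h)) ` Z"
have "finite (N-{0})" using Z by(simp add: N_def)
hence "open (- (N-{0}))" by(intro open_Compl finite_imp_closed)
hence "eventually (%u. u : - (N-{0})) (at 0)" by(intro eventually_at_in_open') auto
moreover have "eventually (%u::complex. u ~= 0) (at 0)" by(simp add: eventually_at_filter)
ultimately show ?thesis using par_eventually_fst_nz[OF par]
proof eventually_elim
 case (elim u)
 hence t: "u : ball 0 r" "fst (G u) ~= 0" by blast+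
 have "u : N" if "(sg h G u,tg h G u) : Z"
 proof -
  have "(fst (G u),snd (G u)) : (%(s,t). (lp s t h)) ` Z" using par_torus(4,5)[OF th par t] by(intro image_eqI[OF _ that]) simp
  hence "unifF (G 0) b (G u) : N" unfolding N_def by simp
  thus ?thesis using unifF_par[OF par t(1)] by simp
 qed
 thus ?case using elim by blast
qed
qed

lemma eventually_good:
assumes th: "h : charts A" and par: "cpar h G r b"
shows "eventually (%u. u : ball 0 r & fst (G u) ~= 0 & sg h G u ~: bad & pe chi (sg h G u) (tg h G u) = 0) (at 0)"
proof -
have "finite (SIGMA s:bad. {t. pe chi s t = 0})" by(intro finite_SigmaI finite_bad finite_fiber)
from eventually_avoid[OF par this th] show ?thesis
proof eventually_elim
 case (elim u)
 hence t: "u : ball 0 r" "fst (G u) ~= 0" by blast+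
 show ?case using elim par_torus(3)[OF th par t] by blast
qed
qed

lemma charts_nonempty: "charts A ~= {}"
proof -
obtain b where "{(0,0),(0,1),(1,b)} <= A" using unimodular by blast
moreover have "closed_face A A" by(auto simp: closed_face_def)
ultimately show ?thesis using faces[of A "(0,0)" "(0,1)"] by auto
qed

definition th0 :: triple where "th0 = (SOME h. h : charts A)"

lemma th0: "th0 : charts A" unfolding th0_def using charts_nonempty by(simp add: some_in_eq)

definition tp :: "triple => complex => complex => complex \<times> complex" where
"tp h s t = (lp s t h)"

text \<open>Names the place over a torus point through one fixed chart; by \<open>Pl_pt\<close>
  every other chart gives the same place.\<close>

definition pt :: "complex => complex => place" where "pt s t = Pl th0 (tp th0 s t)"

lemma tp_cpts:
assumes "h : charts A" "s ~= 0" "t ~= 0" "pe chi s t = 0"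
shows "tp h s t : cpts cc A h" "fst (tp h s t) ~= 0" using pe_chi_chart[OF assms(1-3)] assms lm_nonzero[of s t] by(simp_all add: tp_def cpts_def)

lemma Pl_pt:
assumes th: "h : charts A" and par: "cpar h G r b" and t: "u : ball 0 r" and u: "fst (G u) ~= 0"
shows "Pl h (G u) = pt (sg h G u) (tg h G u)"
proof -
note T = par_torus[OF th par t u]
note sm = par_smooth[OF par t]
note W = vring_Oloc[OF th sm]
obtain b0 where b0: "smooth_at th0 (tp th0 (sg h G u) (tg h G u)) b0" using smooth_at_ex[OF th0 tp_cpts(1)[OF th0 T(1-3)]] by blast
show ?thesis unfolding pt_def
proof(rule place_unique[OF th0 b0 Pl_place[OF th sm]])
 show "hv (Uc th0) (th ` Pl h (G u)) (fst (tp th0 (sg h G u) (tg h G u)))"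
  "hv (Vc th0) (th ` Pl h (G u)) (snd (tp th0 (sg h G u) (tg h G u)))" unfolding th_Pl Uc_def Vc_def tp_def fst_conv snd_conv by(intro hv_lm[OF W] T)+
qed
qed

lemma sg_nz_deriv:
assumes th: "h : charts A" and par: "cpar h G r b" and t: "u : ball 0 r" and u: "fst (G u) ~= 0"
 and g: "sg h G u ~: bad"
shows "deriv (sg h G) u ~= 0"
proof
assume "deriv (sg h G) u = 0"
thus False using residue_formula[OF th par t u] par_torus[OF th par t u] good_point[OF g] by auto
qed

lemma sg_holomorphic:
assumes par: "cpar h G r b" and D: "D <= ball 0 r" "!!u. u : D ==> fst (G u) ~= 0"
shows "sg h G hol_on D" "tg h G hol_on D"
proof -
have h: "(%u. fst (G u)) hol_on D" "(%u. snd (G u)) hol_on D" using par_holomorphic[OF par] D(1) by(auto intro: holomorphic_on_subset)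
have "snd (G u) ~= 0" if "u : D" for u using par_snd_nz[OF par] D(1) that by blast
thus "sg h G hol_on D" "tg h G hol_on D" unfolding sg_def[abs_def] tg_def[abs_def] backS_def backT_def using D(2)
 by(intro holomorphic_intros h; blast)+
qed

text \<open>Off \<open>bad\<close> the derivative of x along a branch is nonzero, by
  \<open>residue_formula\<close>. So x itself is a chart there and y a holomorphic function of
  x.\<close>

lemma local_section:
assumes s0: "s0 ~: bad" "pe chi s0 t0 = 0"
obtains U W F where "(U,pv chi (ff_x chi)) : RC chi" "open W" "s0 : W" "F hol_on W" "F s0 = t0"
 "!!s. s : W ==> pe chi s (F s) = 0 & pt s (F s) : U"
 "!!om. om : HF chi ==> (%s. om ((U,pv chi (ff_x chi)),pt s (F s))) hol_on W"
proof -
let ?X = "pv chi (ff_x chi)"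
note g0 = good_point[OF s0]
note p0 = tp_cpts[OF th0 g0(1,2) s0(2)]
obtain b where "smooth_at th0 (tp th0 s0 t0) b" using smooth_at_ex[OF th0 p0(1)] by blast
then obtain C r where par: "cpar th0 C r b" "C 0 = tp th0 s0 t0" by(rule smooth_par) blast
have r: "0 < r" by(rule par_r[OF par(1)])
have st0: "sg th0 C 0 = s0" "tg th0 C 0 = t0" using back_lm[OF th0 g0(1,2)] by(simp_all add: sg_def tg_def par(2) tp_def)
define D0 where "D0 = {u:ball 0 r. fst (C u) ~= 0}"
have D0: "open D0" "D0 <= ball 0 r" "0 : D0" "!!u. u : D0 ==> fst (C u) ~= 0"
proof -
 have "continuous_on (ball 0 r) (%u. fst (C u))" using par_holomorphic(1)[OF par(1)] by(rule holomorphic_on_imp_continuous_on)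
 from continuous_open_preimage[OF this open_ball, of "- {0}"]
 have "open (ball 0 r \<inter> (%u. fst (C u)) -` (- {0}))" by(simp add: open_Compl)
 moreover have "ball 0 r \<inter> (%u. fst (C u)) -` (- {0}) = D0" by(auto simp: D0_def)
 ultimately show "open D0" by simp
qed (use r p0 par(2) in \<open>auto simp: D0_def\<close>)
note hol = sg_holomorphic[OF par(1) D0(2,4)]
have nz: "deriv (sg th0 C) 0 ~= 0" using sg_nz_deriv[OF th0 par(1), of 0] r D0(4)[OF D0(3)] s0(1) st0(1) by simp
obtain de where d: "de > 0" "ball 0 de <= D0" "inj_on (sg th0 C) (ball 0 de)"
 using has_complex_derivative_locally_injective[OF hol(1) D0(3,1) nz] by blast
define G where "G = (%u. Pl th0 (C u))"
define D where "D = ball (0::complex) de"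
have D: "open D" "D <= ball 0 r" "0 : D" "!!u. u : D ==> fst (C u) ~= 0" using d D0 by(auto simp: D_def)
have XG: "ff_x chi : G u" "?X (G u) = sg th0 C u" "G u = pt (sg th0 C u) (tg th0 C u)" if "u : D" for u
 using par_torus[OF th0 par(1) subsetD[OF D(2) that] D(4)[OF that]] Pl_pt[OF th0 par(1) subsetD[OF D(2) that] D(4)[OF that]] by(simp_all add: G_def)
have inj: "inj_on (sg th0 C) D" using d(3) by(simp add: D_def)
have injX: "inj_on (%u. ?X (G u)) D" using inj XG(2) by(simp add: inj_on_def)
have chart: "(G ` D,?X) : RC chi" by(rule gpar_chart[OF par_gpar[OF th0 par(1), folded G_def] D(1,2) ff_xy_carrier(1) XG(1) injX])
have holD: "sg th0 C hol_on D" "tg th0 C hol_on D" using hol d(2) by(auto simp: D_def intro: holomorphic_on_subset)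
obtain Q where psi: "Q hol_on (sg th0 C ` D)" "!!z. z : D ==> deriv (sg th0 C) z*deriv Q (sg th0 C z) = 1"
 "!!z. z : D ==> Q (sg th0 C z) = z" using holomorphic_has_inverse[OF holD(1) D(1) inj] by blast
have oW: "open (sg th0 C ` D)" by(rule open_mapping_thm3[OF holD(1) D(1) inj])
have XU: "?X ` (G ` D) = sg th0 C ` D" using XG(2) by(simp add: image_image)
have inv: "inv_into (G ` D) ?X s = pt s (tg th0 C (Q s))" if s: "s : sg th0 C ` D" for s
proof -
 obtain u where t: "u : D" "s = sg th0 C u" using s by blast
 have "inj_on ?X (G ` D)" using injX unfolding inj_on_def by blast
 hence "inv_into (G ` D) ?X (?X (G u)) = G u" using t(1) by(intro inv_into_f_f) auto
 thus ?thesis using XG[OF t(1)] psi(3)[OF t(1)] t(2) by simp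
qed
show ?thesis
proof(rule that[OF chart oW, of "%s. tg th0 C (Q s)"])
 show "s0 : sg th0 C ` D" using st0(1) D(3) by blast
 show "(%s. tg th0 C (Q s)) hol_on sg th0 C ` D" by(rule holomorphic_on_compose_gen[OF psi(1) holD(2), unfolded o_def]) (use psi(3) in auto)
 show "tg th0 C (Q s0) = t0" using psi(3)[OF D(3)] st0 by simp
 show "pe chi s (tg th0 C (Q s)) = 0 & pt s (tg th0 C (Q s)) : G ` D" if s: "s : sg th0 C ` D" for s
 proof -
  obtain u where t: "u : D" "s = sg th0 C u" using s by blast
  thus ?thesis using par_torus(3)[OF th0 par(1) subsetD[OF D(2) t(1)] D(4)[OF t(1)]] psi(3)[OF t(1)] XG(3)[OF t(1)] by auto
 qed
 fix om assume "om : HF chi"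
 from formsD(2)[OF this chart]
 have "(%w. om ((G ` D,?X),inv_into (G ` D) ?X w)) hol_on sg th0 C ` D" unfolding XU .
 thus "(%s. om ((G ` D,?X),pt s (tg th0 C (Q s)))) hol_on sg th0 C ` D" by(rule holomorphic_transform) (simp add: inv)
qed
qed

text \<open>The coefficient of dx. By \<open>xcoef_chart\<close> the choice of the domain is
  immaterial: two charts with the same function x have transition derivative 1.\<close>

definition xcoef :: "(place chart \<times> place => complex) => place => complex" where
"xcoef W P = W ((SOME U. (U,pv chi (ff_x chi)) : RC chi & P : U,pv chi (ff_x chi)),P)"

lemma xcoef_chart:
assumes w: "W : HF chi"
 and U: "(U,pv chi (ff_x chi)) : RC chi" "P : U"
shows "xcoef W P = W ((U,pv chi (ff_x chi)),P)"
proof -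
let ?X = "pv chi (ff_x chi)"
define V where "V = (SOME U. (U,?X) : RC chi & P : U)"
have "(V,?X) : RC chi & P : V" unfolding V_def by(rule someI[of "%U. (U,?X) : RC chi & P : U" U]) (use U in blast)
hence V: "(V,?X) : RC chi" "P : V" by blast+
obtain f where f: "open (?X ` U)" "inj_on ?X U" using U(1) by(rule rs_chartsE) blast
have "((%w. ?X (inv_into U ?X w)) hfd 1) (at (?X P))"
proof(rule hfd_transform[OF DERIV_ident f(1)])
 show "?X P : ?X ` U" using U(2) by blast
 fix w assume "w : ?X ` U" thus "w = ?X (inv_into U ?X w)" by(simp add: f_inv_into_f)
qed
hence "W ((U,?X),P) = W ((V,?X),P)*1" using formsD(3)[OF w V(1) U(1) V(2) U(2)] V DERIV_imp_deriv by(metis (no_types, lifting))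
thus ?thesis by(simp add: xcoef_def V_def)
qed

end

context nondeg begin

subsection \<open>The residue forms\<close>

text \<open>The shift by (1,1) comes from x^a y^b dx / chi_y = x^(a+1) y^(b+1) dx / (x y
  chi_y).\<close>

definition inn :: "mon set" where
"inn = {g. ALL h:charts A. 0 < det3 (fst h) (fst (snd h)) (Suc (fst g),Suc (snd g))}"

definition hres :: "mon => place => complex" where
"hres g P = pval (Xc^fst g*Yc ^ snd g/ev (pderiv chi)) (th ` P)"

lemma hres_good:
assumes th: "h : charts A" and par: "cpar h G r b" and t: "u : ball 0 r" and u: "fst (G u) ~= 0"
 and g: "sg h G u ~: bad"
shows "hres w (Pl h (G u)) = sg h G u^fst w*tg h G u ^ snd w/pe (pderiv chi) (sg h G u) (tg h G u)"
proof -
note T = par_torus[OF th par t u]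
note W = vring_Oloc[OF th par_smooth[OF par t]]
show ?thesis unfolding hres_def th_Pl divide_inverse
 by(intro hv_pval[OF W] hv_mult[OF W] hv_power[OF W] hv_inverse[OF W] hv_ev[OF W] T good_point(3)[OF g])
qed

lemma par_deriv_x:
assumes th: "h : charts A" and par: "cpar h G r b" and t: "u : ball 0 r" and u: "fst (G u) ~= 0"
shows "deriv (%u. pv chi (ff_x chi) (Pl h (G u))) u = deriv (sg h G) u"
proof(rule deriv_cong_ev[OF _ refl])
have "open (ball 0 r \<inter> (%u. fst (G u)) -` (- {0}))"
 by(intro continuous_open_preimage holomorphic_on_imp_continuous_on[OF par_holomorphic(1)[OF par]] open_ball open_Compl closed_singleton)
hence "eventually (%u. u : ball 0 r \<inter> (%u. fst (G u)) -` (- {0})) (nhds u)" by(rule eventually_nhds_in_open) (use t u in auto)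
thus "eventually (%u. pv chi (ff_x chi) (Pl h (G u)) = sg h G u) (nhds u)"
proof eventually_elim
 case (elim x)
 thus ?case by(intro par_torus(7)[OF th par]) auto
qed
qed

lemma lm_generic:
assumes th: "q : charts A" and st: "s ~= 0" "t ~= (0::'c::field)"
shows "lm s t (ipt w) = lm s t (ipt (bas q))*(lm s t (wU q) powi det3 (fst q) (fst (snd q)) w*lm s t (wV q) powi jj q w)"
proof -
obtain e f h where T: "q = (e,f,h)" by(cases q)
have d: "det3 e f h = 1" using th unfolding charts_def T by auto
have "lm s t (ipt w-ipt e) = lm s t (det3 e f w*fst (wU q),det3 e f w * snd (wU q))
  * lm s t (det3 e w h*fst (wV q),det3 e w h * snd (wV q))" by(subst det_expand[OF d(1)], subst lm_add[symmetric]) (simp_all add: st wU_def wV_def T)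
hence "lm s t (ipt w-ipt e) = lm s t (wU q) powi det3 e f w*lm s t (wV q) powi det3 e w h" unfolding lm_powi .
moreover have "lm s t (ipt w) = lm s t (ipt e)*lm s t (ipt w-ipt e)" using lm_add[OF st, of "ipt e" "ipt w-ipt e"] by simp
ultimately show ?thesis by(simp add: T bas_def jj_def)
qed

text \<open>By \<open>residue_formula\<close> the form has, up to sign, the local coefficient
  u^(D-1) v^(j-1) divided by a nonvanishing partial derivative, where D is the distance of the
  shifted lattice point from the edge. It is holomorphic at u = 0 because D >= 1.\<close>

lemma residue_form_local:
assumes w: "w : inn" and th: "h : charts A" and par: "cpar h G r b"
shows "EX e. form_local (hres w) (%x. Pl h (G x)) r e"
proof -
let ?w = "(Suc (fst w),Suc (snd w))"
let ?g = "%x. if b then-gV cc A h (G x) else gU cc A h (G x)"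
define d where "d = nat (det3 (fst h) (fst (snd h)) ?w)-1"
have d: "det3 (fst h) (fst (snd h)) ?w = int (Suc d)" using w th unfolding inn_def d_def by fastforce
define e where "e = (%x. fst (G x)^d * snd (G x) powi (jj h ?w-1)/?g x)"
note h = par_holomorphic[OF par]
have gnz: "?g x ~= 0" if "x : ball 0 r" for x using par_at(3,6)[OF par that] by auto
have gh: "?g hol_on ball 0 r"
proof -
 have "(%x. gV cc A h (G x)) hol_on ball 0 r" "(%x. gU cc A h (G x)) hol_on ball 0 r"
  unfolding gV_def gU_def by(intro holomorphic_intros h; use par_snd_nz[OF par] in blast)+
 thus ?thesis by(cases b) (simp_all add: holomorphic_on_minus)
qed
have "(%x. fst (G x)^d * snd (G x) powi (jj h ?w-1)) hol_on ball 0 r" by(intro holomorphic_intros h; use par_snd_nz[OF par] in blast)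
hence "e hol_on ball 0 r" unfolding e_def using gh gnz by(rule holomorphic_on_divide)
moreover have "eventually (%x. ff_x chi : Pl h (G x) &
   hres w (Pl h (G x))*deriv (%x. pv chi (ff_x chi) (Pl h (G x))) x = e x) (at 0)" using eventually_good[OF th par]
proof eventually_elim
 case (elim x)
 hence E: "x : ball 0 r" "fst (G x) ~= 0" "sg h G x ~: bad" by blast+
 note T = par_torus[OF th par E(1,2)]
 define s t u v L c y where "s = sg h G x" and "t = tg h G x" and "u = fst (G x)" and "v = snd (G x)"
  and "L = lm s t (ipt (bas h))" and "c = ?g x" and "y = pe (pderiv chi) s t"
 have nz: "s ~= 0" "t ~= 0" "u ~= 0" "v ~= 0" "L ~= 0" "c ~= 0" "y ~= 0" "deriv (sg h G) x ~= 0"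
  using T(1,2) E(2) par_snd_nz[OF par E(1)] lm_nonzero[OF T(1,2)] gnz[OF E(1)] good_point(3)[OF E(3) T(3)]
   sg_nz_deriv[OF th par E] by(simp_all add: s_def t_def u_def v_def L_def c_def y_def)
 have R: "c*u * v * deriv (sg h G) x*L = s*t*y" using residue_formula[OF th par E(1,2)] by(simp add: s_def t_def u_def v_def L_def c_def y_def)
 have "s^Suc (fst w)*t^Suc (snd w) = lm s t (ipt ?w)" by(simp add: lm_def ipt_def power_int_def nat_add_distrib)
 also have "... = L*(u powi int (Suc d) * v powi jj h ?w)" using lm_generic[OF th T(1,2), of ?w] T(4,5) d by(simp add: s_def t_def u_def v_def L_def)
 also have "u powi int (Suc d) = u^d*u" unfolding power_int_of_nat by simp
 also have "v powi jj h ?w = v powi (jj h ?w-1) * v" using nz by(simp add: power_int_diff)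
 also have "L*(u^d*u*(v powi (jj h ?w-1) * v)) = L*(u^d * v powi (jj h ?w-1))*(u * v)" by(simp add: mult_ac)
 finally have M: "s^fst w*t ^ snd w*(s*t) = L*(u^d * v powi (jj h ?w-1))*(u * v)" by(simp add: mult_ac)
 have "s^fst w*t ^ snd w/y*deriv (sg h G) x = s^fst w*t ^ snd w*(s*t)*deriv (sg h G) x/(s*t*y)" using nz by(simp add: field_simps)
 also have "... = u^d * v powi (jj h ?w-1)/c" unfolding M R[symmetric] using nz by(simp add: field_simps)
 finally have "s^fst w*t ^ snd w/y*deriv (sg h G) x = e x" by(simp add: e_def u_def v_def c_def)
 thus ?case using T(6) by(simp add: hres_good[OF th par E] par_deriv_x[OF th par E(1,2)] s_def t_def y_def)
qed
ultimately show ?thesis using par_gpar[OF th par] unfolding form_local_def by blast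
qed

lemma place_par:
assumes "P : places chi"
obtains h G r b where "h : charts A" "cpar h G r b" "P = Pl h (G 0)"
proof -
obtain h p b where t: "h : charts A" "smooth_at h p b" "P = Pl h p" by(rule place_classify[OF assms]) blast
obtain G r where "cpar h G r b" "G 0 = p" by(rule smooth_par[OF t(2)]) blast
thus ?thesis using that t by blast
qed

lemma residue_form: "w : inn ==> form_of (hres w) : HF chi"
proof(rule form_of_holomorphic)
fix P assume w: "w : inn" and P: "P : places chi"
obtain h C r b where t: "h : charts A" "cpar h C r b" "P = Pl h (C 0)" by(rule place_par[OF P]) (erule (2) that)
obtain e where "form_local (hres w) (%u. Pl h (C u)) r e" using residue_form_local[OF w t(1,2)] by blast
thus "EX G r e. form_local (hres w) G r e & G 0 = P" using t(3) by(intro exI[of _ "%u. Pl h (C u)"] exI[of _ r] exI[of _ e]) simp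
qed

lemma xcoef_along:
assumes w: "w : HF chi"
 and th: "h : charts A" and par: "cpar h G r b" and t: "u : ball 0 r" and u: "fst (G u) ~= 0"
 and g: "sg h G u ~: bad" and c: "(U,F) : RC chi" "Pl h (G u) : U"
shows "w ((U,F),Pl h (G u))*deriv (%u. F (Pl h (G u))) u = xcoef w (pt (sg h G u) (tg h G u))*deriv (sg h G) u"
proof -
note T = par_torus[OF th par t u]
obtain V where V: "(V,pv chi (ff_x chi)) : RC chi" "Pl h (G u) : V"
proof(rule local_section[OF g T(3)])
 fix U W F assume "(U,pv chi (ff_x chi)) : RC chi" "sg h G u : W" "F (sg h G u) = tg h G u"
  "!!s. s : W ==> pe chi s (F s) = 0 & pt s (F s) : U"
 thus thesis using that Pl_pt[OF th par t u] by metis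
qed
show ?thesis using form_along[OF w c(1) V(1) par_gpar[OF th par] t c(2) V(2)] xcoef_chart[OF w V] Pl_pt[OF th par t u]
 by(simp add: par_deriv_x[OF th par t u])
qed

lemma xcoef_residue:
assumes w: "w : inn" and th: "h : charts A" and par: "cpar h C r b"
shows "eventually (%u. xcoef (form_of (hres w)) (pt (sg h C u) (tg h C u))
  = sg h C u^fst w*tg h C u ^ snd w/pe (pderiv chi) (sg h C u) (tg h C u)) (at 0)"
proof -
let ?G = "%u. Pl h (C u)" and ?f = "form_of (hres w)"
obtain e where eta: "form_local (hres w) ?G r e" using residue_form_local[OF w th par] by blast
define U where "U = ?G ` ball 0 r"
obtain F where c: "(U,F) : RC chi" using unif_chart(1)[OF th par] unfolding U_def by blast
have r: "r > 0" by(rule par_r[OF par])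
have U: "?G u : U" if "u : ball 0 r" for u using that by(simp add: U_def)
obtain de where d: "de > 0" "!!u. u : ball 0 de ==> ?f ((U,F),?G u) = e u/deriv (%u. F (?G u)) u" using form_of_local[OF eta c U] r by auto
have "eventually (%u::complex. u : ball 0 de) (at 0)" using d(1) by(intro eventually_at_in_open') auto
moreover have "eventually (%u. ff_x chi : ?G u & hres w (?G u)*deriv (%u. pv chi (ff_x chi) (?G u)) u = e u) (at 0)"
 using eta unfolding form_local_def by blast
ultimately show ?thesis using eventually_good[OF th par]
proof eventually_elim
 case (elim u)
 hence E: "u : ball 0 r" "fst (C u) ~= 0" "sg h C u ~: bad" by blast+
 have "?f ((U,F),?G u)*deriv (%u. F (?G u)) u = e u" using d(2) elim(1) chart_deriv_nz[OF c par_gpar[OF th par] E(1) U[OF E(1)]] by simp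
 hence "xcoef ?f (pt (sg h C u) (tg h C u))*deriv (sg h C) u = hres w (?G u)*deriv (sg h C) u"
  using xcoef_along[OF residue_form[OF w] th par E c U[OF E(1)]] elim(2) par_deriv_x[OF th par E(1,2)] by simp
 hence "xcoef ?f (pt (sg h C u) (tg h C u)) = hres w (?G u)" using sg_nz_deriv[OF th par E] mult_right_cancel by blast
 thus ?case unfolding hres_good[OF th par E] .
qed
qed

lemma forms_sum:
assumes "!!i. i : I ==> w i : HF chi"
shows "(%x. SUM i:I. c i*w i x) : HF chi" unfolding holomorphic_forms_def
proof(intro CollectI conjI allI impI ballI; clarify?)
fix U F P assume *: "~ ((U,F) : RC chi & P : fst (U,F))"
show "(SUM i:I. c i*w i ((U,F),P)) = 0" by(intro sum.neutral ballI) (simp add: formsD(1)[OF assms *])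
next
fix U F assume c: "(U,F) : RC chi"
show "(%z. SUM i:I. c i*w i ((U,F),inv_into U F z)) hol_on F ` U" by(intro holomorphic_intros formsD(2)[OF assms c])
next
fix U F V Q P assume c: "(U,F) : RC chi" "(V,Q) : RC chi" "P : U" "P : V"
show "(SUM i:I. c i*w i ((V,Q),P)) = (SUM i:I. c i*w i ((U,F),P))*deriv (%w. F (inv_into V Q w)) (Q P)"
 unfolding sum_distrib_right by(intro sum.cong refl) (simp add: formsD(3)[OF assms c])
qed

lemma form_eq:
assumes w: "W : HF chi" "W' : HF chi"
 and e: "!!h C r b. h : charts A ==> cpar h C r b ==>
  eventually (%u. xcoef W (pt (sg h C u) (tg h C u)) = xcoef W' (pt (sg h C u) (tg h C u))) (at 0)"
shows "W = W'"
proof -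
have sum2: "(SUM i::bool:UNIV. (if i then 1 else -1)*(if i then W else W') x) = W x-W' x" for x by(simp add: UNIV_bool)
have f: "(%x. W x-W' x) : HF chi" using forms_sum[of "UNIV :: bool set" "%i. if i then W else W'" "%i. if i then 1 else -1"] w unfolding sum2 by simp
have "(%x. W x-W' x) = (%_. 0)"
proof(rule form_zero[OF f])
 fix P assume P: "P : places chi"
 obtain h C r b where t: "h : charts A" "cpar h C r b" "P = Pl h (C 0)" by(rule place_par[OF P]) (erule (2) that)
 let ?G = "%u. Pl h (C u)"
 note G = par_gpar[OF t(1,2)]
 have "eventually (%u. ALL c:RC chi. ?G u : fst c --> W (c,?G u)-W' (c,?G u) = 0) (at 0)" using eventually_good[OF t(1,2)] e[OF t(1,2)]
 proof eventually_elim
  case (elim u)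
  hence E: "u : ball 0 r" "fst (C u) ~= 0" "sg h C u ~: bad" by blast+
  show ?case
  proof(intro ballI impI)
   fix c assume c: "c : RC chi" "?G u : fst c"
   obtain U F where cU: "c = (U,F)" by(cases c)
   have cc: "(U,F) : RC chi" "?G u : U" using c cU by auto
   have "W ((U,F),?G u)*deriv (%u. F (?G u)) u = W' ((U,F),?G u)*deriv (%u. F (?G u)) u"
    unfolding xcoef_along[OF w(1) t(1,2) E cc] xcoef_along[OF w(2) t(1,2) E cc] elim(2) ..
   thus "W (c,?G u)-W' (c,?G u) = 0" using chart_deriv_nz[OF cc(1) G E(1) cc(2)] cU by simp
  qed
 qed
 thus "EX G r. gpar G r & G 0 = P & eventually (%u. ALL c:RC chi. G u : fst c --> W (c,G u)-W' (c,G u) = 0) (at 0)"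
  using G t(3) by(intro exI[of _ ?G] exI[of _ r] conjI) auto
qed
thus ?thesis by(intro ext) (metis eq_iff_diff_eq_0)
qed

lemma xcoef_sum:
assumes w: "!!i. i : I ==> w i : HF chi" and g: "s ~: bad" "pe chi s t = 0"
shows "xcoef (%x. SUM i:I. c i*w i x) (pt s t) = (SUM i:I. c i*xcoef (w i) (pt s t))"
proof -
obtain U where U: "(U,pv chi (ff_x chi)) : RC chi" "pt s t : U"
proof(rule local_section[OF g])
 fix U W F assume "(U,pv chi (ff_x chi)) : RC chi" "s : W" "F s = t"
  "!!s. s : W ==> pe chi s (F s) = 0 & pt s (F s) : U"
 thus thesis using that by metis
qed
have f: "(%x. SUM i:I. c i*w i x) : HF chi" by(rule forms_sum[OF w])
have "(SUM i:I. c i*w i ((U,pv chi (ff_x chi)),pt s t)) = (SUM i:I. c i*xcoef (w i) (pt s t))" by(intro sum.cong refl) (simp add: xcoef_chart[OF w U])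
thus ?thesis using xcoef_chart[OF f U] by simp
qed

text \<open>A combination that vanishes along a branch has infinitely many zeros in common with chi,
  so chi divides it; its degree in y is below n, so it is zero.\<close>

lemma monomials_independent:
assumes I: "finite I" "!!g. g : I ==> snd g < n" and th: "q : charts A" and par: "cpar q G r b"
 and z: "eventually (%u. (SUM g:I. c g*(sg q G u^fst g*tg q G u ^ snd g)) = 0) (at 0)"
shows "ALL g:I. c g = 0"
proof -
define B where "B = (SUM g:I. mono2 (c g) g)"
have pB: "pe B s t = (SUM g:I. c g*(mn s t g))" for s t by(simp add: B_def pe_sum pe_mono2)
have "chi dvd B"
proof(rule ccontr)
 assume "~ chi dvd B"
 from eventually_avoid[OF par finite_common_zeros[OF this] th] z
 have "eventually (%u. False) (at (0::complex))"
 proof eventually_elim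
  case (elim u)
  hence "pe chi (sg q G u) (tg q G u) = 0" using par_torus(3)[OF th par] by blast
  thus ?case using elim by(simp add: pB)
 qed
 thus False by simp
qed
moreover have "degree B < n"
proof(cases "I = {}")
 case False
 have "degree (mono2 (c g) g) <= n-1" if "g : I" for g
  unfolding mono2_monom using degree_monom_le[of "monom (c g) (fst g)" "snd g"] I(2)[OF that] by linarith
 hence "degree B <= n-1" unfolding B_def by(intro degree_sum_le I(1))
 thus ?thesis using n_pos by linarith
qed (simp add: B_def n_pos)
ultimately have "B = 0" using dvd_imp_degree_le[of chi B] degree_chi by fastforce
have "c g = 0" if g: "g : I" for g
proof -
 have "0 = Polynomial.coeff (Polynomial.coeff B (snd g)) (fst g)" by(simp add: \<open>B = 0\<close>)
 also have "... = (SUM h:I. if h = g then c h else 0)" unfolding B_def coeff_sum by(intro sum.cong) (auto simp: mono2_monom coeff_monom prod_eq_iff)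
 finally show ?thesis using g I(1) by simp
qed
thus ?thesis by blast
qed

end

subsection \<open>Behaviour at the boundary\<close>

lemma bounded_subsequence:
fixes z :: "nat => 'g => complex"
assumes "finite A" "!!k g. g : A ==> norm (z k g) <= 1"
shows "EX R l. strict_mono R & (ALL g:A. (%k. z (R k) g) ----> l g)" using assms
proof(induction A rule: finite_induct)
case empty show ?case by(intro exI[of _ "%k. k"]) (simp add: strict_mono_def)
next
case (insert a A)
obtain R l where r: "strict_mono R" "ALL g:A. (%k. z (R k) g) ----> l g" using insert.IH insert.prems by auto
have "bounded (range (%k. z (R k) a))" using insert.prems by(intro boundedI[of _ 1]) auto
then obtain x R' where x: "strict_mono R'" "((%k. z (R k) a) \<circ> R') ----> x" using bounded_imp_convergent_subsequence by metis
have "(%k. z (R (R' k)) g) ----> l g" if "g : A" for g using LIMSEQ_subseq_LIMSEQ[OF r(2)[rule_format, OF that] x(1)] by(simp add: o_def)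
moreover have "strict_mono (R \<circ> R')" using r(1) x(1) by(rule strict_mono_o)
ultimately show ?case using x(2) insert.hyps(2) by(intro exI[of _ "R \<circ> R'"] exI[of _ "l(a := x)"]) (auto simp: o_def)
qed

lemma poly_fun_tendsto:
"poly_fun f ==> (!!i. (%k. z k i) ----> l i) ==> (%k. f (z k)) ----> f l" by(induction rule: poly_fun.induct) (auto intro: tendsto_intros)

lemma holomorphic_ball_isCont: "f hol_on ball a r ==> z : ball a r ==> isCont f z"
using continuous_on_eq_continuous_at[OF open_ball] holomorphic_on_imp_continuous_on by blast

text \<open>Writing f = w^k g with k > 0 and g nonvanishing gives f / f' = w g / (k g + w
  g').\<close>

lemma zero_ratio_tendsto:
assumes f: "f hol_on ball 0 r" "r > 0" "f 0 = 0" and d: "eventually (%w. deriv f w ~= 0) (at 0)"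
shows "((%w. f w/deriv f w) ---> 0) (at (0::complex))"
proof -
have "EX w:ball 0 r. f w ~= 0"
proof(rule ccontr)
 assume c: "~ (EX w:ball 0 r. f w ~= 0)"
 have "eventually (%w::complex. w : ball 0 r) (at 0)" using f(2) by(intro eventually_at_in_open') auto
 with d have "eventually (%w::complex. False) (at 0)"
 proof eventually_elim
  case (elim w)
  have "deriv f w = deriv (%_. 0) w" by(rule complex_derivative_transform_within_open[OF f(1), of "%_. 0"]) (use elim(2) c in auto)
  thus ?case using elim(1) by simp
 qed
 thus False by simp
qed
then obtain k g R where g: "R > 0" "R <= r" "g hol_on ball 0 R" "ALL w:ball 0 R. f w = w ^ k*g w & g w ~= 0"
 using holomorphic_order[OF f(1,2)] by blast
have k: "k > 0" using g(1,4) f(3) by(cases k) auto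
have z: "0 : ball (0::complex) R" using g(1) by simp
have "isCont g 0" using g(3) z by(rule holomorphic_ball_isCont)
hence c1: "(g ---> g 0) (at 0)" by(simp add: isCont_def)
have "deriv g hol_on ball 0 R" using g(3) by(rule holomorphic_deriv) simp
hence "isCont (deriv g) 0" using z by(rule holomorphic_ball_isCont)
hence c2: "(deriv g ---> deriv g 0) (at 0)" by(simp add: isCont_def)
have "((%w. w*g w/(of_nat k*g w+w*deriv g w)) ---> 0*g 0/(of_nat k*g 0+0*deriv g 0)) (at 0)" by(intro tendsto_intros c1 c2) (use k g(4) z in auto)
hence "((%w. w*g w/(of_nat k*g w+w*deriv g w)) ---> 0) (at 0)" by simp
thus ?thesis
proof(rule Lim_transform_eventually)
 have "eventually (%w::complex. w : ball 0 R-{0}) (at 0)" using z by(intro eventually_at_in_open) auto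
 thus "eventually (%w. w*g w/(of_nat k*g w+w*deriv g w) = f w/deriv f w) (at 0)"
 proof eventually_elim
  case (elim w)
  have "(g hfd deriv g w) (at w)" using g(3) elim by(auto intro: holomorphic_derivI)
  hence D: "((%w. w ^ k*g w) hfd of_nat k*w^(k-1)*g w+w ^ k*deriv g w) (at w)" by(auto intro!: derivative_eq_intros)
  have "(f hfd of_nat k*w^(k-1)*g w+w ^ k*deriv g w) (at w)" by(rule hfd_transform[OF D, of "ball 0 R"]) (use g(4) elim in auto)
  hence "deriv f w = w^(k-1)*(of_nat k*g w+w*deriv g w)" using k by(cases k) (simp_all add: DERIV_imp_deriv alg)
  moreover have "f w = w^(k-1)*(w*g w)" using g(4) elim k by(cases k) auto
  ultimately show ?case using elim by simp
 qed
qed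
qed

context nondeg begin

text \<open>Along a branch x either has a finite value at the centre or a pole. Apply
  \<open>zero_ratio_tendsto\<close> to x minus its value, respectively to 1/x.\<close>

lemma sg_ratio:
assumes th: "h : charts A" and par: "cpar h G r b"
shows "isCont (sg h G) 0 & ((%u. (sg h G u - sg h G 0)/deriv (sg h G) u) ---> 0) (at 0)
 | fst (G 0) = 0 & filterlim (sg h G) at_infinity (at 0) & ((%u. sg h G u/deriv (sg h G) u) ---> 0) (at 0)"
proof -
define a be where "a = - snd (wV h)" and "be = snd (wU h)"
have sg: "sg h G = (%u. fst (G u) powi a * snd (G u) powi be)" by(rule ext) (simp add: sg_def backS_def a_def be_def)
note h = par_holomorphic[OF par]
have r: "r > 0" by(rule par_r[OF par])
have vnz: "snd (G u) ~= 0" if "u : ball 0 r" for u by(rule par_snd_nz[OF par that])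
have dnz: "eventually (%u. u : ball 0 r & fst (G u) ~= 0 & sg h G u ~= 0 & deriv (sg h G) u ~= 0) (at 0)" using eventually_good[OF th par]
proof eventually_elim
 case (elim u)
 hence E: "u : ball 0 r" "fst (G u) ~= 0" "sg h G u ~: bad" by blast+
 thus ?case using sg_nz_deriv[OF th par E] par_torus(1)[OF th par E(1,2)] by blast
qed
show ?thesis
proof(cases "fst (G 0) ~= 0 | a >= 0")
 \<comment> \<open>Since x = u^a v^be with v nonzero, x is holomorphic at the centre exactly in this
   case.\<close>
 case True
 obtain r' where r': "r' > 0" "sg h G hol_on ball 0 r'"
 proof(cases "a >= 0")
  case True
  have "sg h G hol_on ball 0 r" unfolding sg using True by(simp add: power_int_def[of _ a]) (intro holomorphic_intros h; use vnz in blast)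
  thus ?thesis using that r by blast
 next
  case False
  hence nz: "fst (G 0) ~= 0" using True by blast
  have "open (ball 0 r \<inter> (%u. fst (G u)) -` (- {0}))"
   by(intro continuous_open_preimage holomorphic_on_imp_continuous_on[OF h(1)] open_ball open_Compl closed_singleton)
  then obtain e where e: "e > 0" "ball 0 e <= ball 0 r \<inter> (%u. fst (G u)) -` (- {0})"
   using nz r unfolding open_contains_ball by(metis (no_types, lifting) ComplI Int_iff centre_in_ball singletonD vimageI)
  have "sg h G hol_on ball 0 e" by(rule sg_holomorphic(1)[OF par]) (use e(2) in auto)
  thus ?thesis using that e(1) by blast
 qed
 have z: "0 : ball (0::complex) r'" using r'(1) by simp
 have cont: "isCont (sg h G) 0" using r'(2) z by(rule holomorphic_ball_isCont)
 have "eventually (%w::complex. w : ball 0 r') (at 0)" using z by(intro eventually_at_in_open') auto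
 hence D: "eventually (%u. deriv (%u. sg h G u - sg h G 0) u = deriv (sg h G) u) (at 0)"
 proof eventually_elim
  case (elim w)
  have "(sg h G hfd deriv (sg h G) w) (at w)" using r'(2) elim(1) by(auto intro: holomorphic_derivI)
  from DERIV_diff[OF this DERIV_const[of "sg h G 0"]] show ?case by(intro DERIV_imp_deriv) simp
 qed
 have "((%u. (sg h G u - sg h G 0)/deriv (%u. sg h G u - sg h G 0) u) ---> 0) (at 0)"
 proof(rule zero_ratio_tendsto[OF _ r'(1)])
  show "(%u. sg h G u - sg h G 0) hol_on ball 0 r'" by(intro holomorphic_intros r'(2))
  show "eventually (%w. deriv (%u. sg h G u - sg h G 0) w ~= 0) (at 0)" using D dnz by eventually_elim simp
 qed simp
 hence "((%u. (sg h G u - sg h G 0)/deriv (sg h G) u) ---> 0) (at 0)" by(rule Lim_transform_eventually) (use D in eventually_elim, simp)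
 thus ?thesis using cont by blast
next
 case False
 hence u0: "fst (G 0) = 0" and neg: "a < 0" by auto
 define R where "R = (%u. inverse (sg h G u))"
 have rho: "R = (%u. fst (G u)^nat (- a) * snd (G u) powi (- be))"
  using neg by(intro ext) (simp add: R_def sg power_int_minus power_int_def[of _ a] flip: power_inverse)
 have rh: "R hol_on ball 0 r" unfolding rho by(intro holomorphic_intros h; use vnz in blast)
 have r0: "R 0 = 0" unfolding rho using u0 neg by simp
 have z: "0 : ball (0::complex) r" using r by simp
 have D: "eventually (%u. R u ~= 0 & deriv R u = - deriv (sg h G) u / sg h G u^2 & deriv R u ~= 0 &
   - (R u/deriv R u) = sg h G u/deriv (sg h G) u) (at 0)" using dnz
 proof eventually_elim
  case (elim u)
  hence "(sg h G hfd deriv (sg h G) u) (at u)" using sg_deriv[OF par] DERIV_imp_deriv by metis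
  from DERIV_inverse'[OF this] have e: "deriv R u = - deriv (sg h G) u / sg h G u^2"
   using elim unfolding R_def by(intro DERIV_imp_deriv) (simp add: power2_eq_square divide_inverse mult_ac)
  have "R u = 1 / sg h G u" by(simp add: R_def inverse_eq_divide)
  thus ?case unfolding e using elim by(simp add: power2_eq_square)
 qed
 have "((%u. R u/deriv R u) ---> 0) (at 0)" by(rule zero_ratio_tendsto[OF rh r r0]) (use D in \<open>auto elim: eventually_mono\<close>)
 from tendsto_minus[OF this] have "((%u. - (R u/deriv R u)) ---> 0) (at 0)" by simp
 hence "((%u. sg h G u/deriv (sg h G) u) ---> 0) (at 0)" by(rule Lim_transform_eventually) (use D in \<open>auto elim: eventually_mono\<close>)
 moreover have "filterlim (sg h G) at_infinity (at 0)"
 proof -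
  have "isCont R 0" using rh z by(rule holomorphic_ball_isCont)
  hence "(R ---> 0) (at 0)" using r0 by(simp add: isCont_def)
  hence "filterlim R (at 0) (at 0)" unfolding filterlim_at using D by(auto elim: eventually_mono)
  from filterlim_compose[OF filterlim_inverse_at_infinity this] show ?thesis by(simp add: R_def)
 qed
 ultimately show ?thesis using u0 by blast
qed
qed

text \<open>Compactness of the curve. Dividing by the largest monomial bounds all homogeneous
  coordinates by 1; a limit of a subsequence is nonzero and satisfies all the equations, hence is a
  point of the toric curve, and \<open>toric_curve_classify\<close> puts it into a chart.\<close>

lemma torus_limit:
fixes s t :: "nat => complex"
assumes P: "lattice_points P = A" and st: "!!k. s k ~= 0" "!!k. t k ~= 0" "!!k. pe chi (s k) (t k) = 0"
obtains R h p where "strict_mono R" "h : charts A" "p : cpts cc A h"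
 "(%k. tp h (s (R k)) (t (R k))) ----> p"
proof -
define mon where "mon = (%k g. s k^fst g*t k ^ snd g)"
have mnz: "mon k g ~= 0" for k g using st by(simp add: mon_def)
have "A ~= {}" using unimodular by blast
have "EX e:A. ALL g:A. norm (mon k g) <= norm (mon k e)" for k
proof -
 let ?N = "(%g. norm (mon k g)) ` A"
 have "Max ?N : ?N" using finA \<open>A ~= {}\<close> by(intro Max_in) auto
 then obtain e where e: "e : A" "Max ?N = norm (mon k e)" by blast
 have "norm (mon k g) <= Max ?N" if "g : A" for g using finA that by(intro Max_ge) auto
 thus ?thesis using e by(intro bexI[of _ e]) simp_all
qed
then obtain E where E: "!!k. E k : A" "!!k g. g : A ==> norm (mon k g) <= norm (mon k (E k))" by metis
define z where "z = (%k g. if g : A then mon k g/mon k (E k) else 0)"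
have zb: "norm (z k g) <= 1" if "g : A" for k g using E(2)[OF that] mnz by(simp add: z_def norm_divide divide_le_eq_1)
obtain R l0 where r: "strict_mono R" "ALL g:A. (%k. z (R k) g) ----> l0 g" using bounded_subsequence[of A z, OF finA zb] by blast
define l where "l = (%g. if g : A then l0 g else 0)"
have zl: "(%k. z (R k) g) ----> l g" for g
proof(cases "g : A")
 case True thus ?thesis using r(2) by(simp add: l_def)
next
 case False
 hence "(%k. z (R k) g) = (%_. 0)" by(simp add: z_def)
 thus ?thesis using False by(simp add: l_def)
qed
have scale: "z k = (%g. inverse (mon k (E k))*torus_point P (s k) (t k) g)" for k
 by(rule ext) (simp add: z_def torus_point_def P mon_def divide_inverse split: prod.split)
have fz: "f l = 0" if f: "f : toric_ideal P" for f
proof -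
 obtain d :: nat where d: "poly_fun f" "ALL c z. f (%i. c*z i) = c^d*f z" "ALL s t. s ~= 0 --> t ~= 0 --> f (torus_point P s t) = 0"
  using f unfolding toric_ideal_def homogeneous_poly_fun_def by blast
 have "f (z k) = 0" for k unfolding scale d(2)[rule_format] using d(3) st by simp
 moreover have "(%k. f (z (R k))) ----> f l" using zl by(rule poly_fun_tendsto[OF d(1)])
 ultimately have "(%_::nat. 0) ----> f l" by simp
 thus ?thesis by(simp add: LIMSEQ_const_iff)
qed
have sec: "(SUM g:A. cc g*l g) = 0"
proof -
 have "(%k. SUM g:A. cc g*z (R k) g) ----> (SUM g:A. cc g*l g)" by(intro tendsto_intros zl)
 moreover have "(SUM g:A. cc g*z k g) = 0" for k
 proof -
  have "(SUM g:A. cc g*z k g) = (SUM g:A. cc g*mon k g)/mon k (E k)" unfolding sum_divide_distrib by(intro sum.cong refl) (simp add: z_def)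
  thus ?thesis using st(3)[of k] by(simp add: pe_chi mon_def)
 qed
 ultimately have "(%_::nat. 0) ----> (SUM g:A. cc g*l g)" by simp
 thus ?thesis by(simp add: LIMSEQ_const_iff)
qed
have "l ~= (%_. 0)"
proof
 \<comment> \<open>The sum of the norms of the normalized coordinates never drops below 1, so
   neither does its limit.\<close>
 assume l: "l = (%_. 0)"
 have "(%k. SUM g:A. norm (z (R k) g)) ----> (SUM g:A. norm (l g))" by(intro tendsto_intros zl)
 moreover have "1 <= (SUM g:A. norm (z k g))" for k
 proof -
  have "1 = norm (z k (E k))" using E(1) mnz by(simp add: z_def)
  also have "... <= (SUM g:A. norm (z k g))" by(intro member_le_sum finA E(1)) auto
  finally show ?thesis .
 qed
 ultimately have "1 <= (SUM g:A. norm (l g))" by(intro LIMSEQ_le_const[of "%k. SUM g:A. norm (z (R k) g)"]) auto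
 thus False by(simp add: l)
qed
hence "proj_point l : toric_surface P" unfolding toric_surface_def P using fz by(auto simp: l_def)
moreover have "toric_section P chi y = 0" if y: "y : proj_point l" for y
proof -
 obtain c where "y = (%i. c*l i)" using y unfolding proj_point_def by blast
 hence "toric_section P chi y = c*(SUM g:A. cc g*l g)" unfolding toric_section_def P sum_distrib_left by(simp add: mult_ac)
 thus ?thesis using sec by simp
qed
ultimately have "proj_point l : toric_curve P chi" unfolding toric_curve_def by blast
moreover have "l : proj_point l" unfolding proj_point_def by(intro CollectI exI[of _ 1]) simp
ultimately obtain h p c where t: "h : charts A" "p : cpts cc A h" "c ~= 0" "l = (%g. c*zpt h p g)" using toric_curve_classify[OF P] by blast
have lim: "(%k. z (R k) g/z (R k) (bas h)) ----> zpt h p g" for g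
proof -
 have "(%k. z (R k) g/z (R k) (bas h)) ----> l g/l (bas h)" by(intro tendsto_intros zl) (simp add: t(3,4) zpt_vertices[OF t(1)])
 thus ?thesis using t(3) by(simp add: t(4) zpt_vertices[OF t(1)])
qed
have q: "z k g/z k (bas h) = lm (s k) (t k) (ipt g-ipt (bas h))" if "g : A" for k g
proof -
 have "z k g/z k (bas h) = mon k g/mon k (bas h)" using mnz that bas_in[OF t(1)] by(simp add: z_def)
 also have "... = lm (s k) (t k) (ipt g)/lm (s k) (t k) (ipt (bas h))" by(simp add: mon_def lm_def ipt_def)
 finally show ?thesis using lm_diff[OF st(1,2)] by metis
qed
have "(%k. lm (s (R k)) (t (R k)) (wU h)) ----> fst p" "(%k. lm (s (R k)) (t (R k)) (wV h)) ----> snd p"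
 using lim[of "snd (snd h)"] lim[of "fst (snd h)"] q[of "snd (snd h)"] q[of "fst (snd h)"] chart_in[OF t(1)] zpt_vertices[OF t(1), of p]
 by(simp_all add: wU_def wV_def bas_fst)
hence "(%k. tp h (s (R k)) (t (R k))) ----> (fst p,snd p)" unfolding tp_def by(rule tendsto_Pair)
thus ?thesis using that r(1) t by simp
qed

text \<open>Close to the limit point the sequence runs on the branch through it, and
  \<open>unifF\<close> reads off its parameter.\<close>

lemma boundary_sequence:
fixes s t :: "nat => complex"
assumes P: "lattice_points P = A" and st: "!!k. s k ~: bad" "!!k. pe chi (s k) (t k) = 0"
obtains R h G r b u where "strict_mono R" "h : charts A" "cpar h G r b" "u ----> 0"
 "eventually (%k. u k : ball 0 r & fst (G (u k)) ~= 0 & sg h G (u k) = s (R k) & tg h G (u k) = t (R k)) sequentially"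
proof -
note g = good_point[OF st]
obtain R h p where r: "strict_mono R" "h : charts A" "p : cpts cc A h" "(%k. tp h (s (R k)) (t (R k))) ----> p"
 by(rule torus_limit[OF P g(1,2) st(2)])
obtain b where b: "smooth_at h p b" using smooth_at_ex[OF r(2,3)] by blast
obtain G r0 ep where par: "cpar h G r0 b" "G 0 = p" "ep > 0"
 "!!q. q : cpts cc A h ==> dist q p < ep ==> q : G ` ball 0 r0" by(rule smooth_par[OF b]) blast
define q where "q = (%k. tp h (s (R k)) (t (R k)))"
define u where "u = (%k. unifF p b (q k))"
have qp: "q ----> p" using r(4) by(simp add: q_def)
have d0: "(%k. dist (q k) p) ----> 0" using tendsto_dist[OF qp tendsto_const[of p]] by simp
have "u ----> 0" by(rule Lim_null_comparison[OF _ d0]) (simp add: u_def unifF_bound)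
moreover have "eventually (%k. u k : ball 0 r0 & fst (G (u k)) ~= 0 & sg h G (u k) = s (R k) & tg h G (u k) = t (R k)) sequentially"
 using tendstoD[OF qp par(3)]
proof eventually_elim
 case (elim k)
 note c = tp_cpts[OF r(2) g(1,2) st(2), of "R k", folded q_def]
 have "q k : cpts cc A h" using c(1) by(simp add: q_def)
 then obtain x where x: "x : ball 0 r0" "q k = G x" using par(4) elim by blast
 have "u k = x" using unifF_par[OF par(1) x(1)] x(2) par(2) by(simp add: u_def)
 hence gx: "u k : ball 0 r0" "G (u k) = tp h (s (R k)) (t (R k))" using x by(simp_all add: q_def)
 thus ?case using tp_cpts(2)[OF r(2) g(1,2) st(2), of "R k"] back_lm[OF r(2) g(1,2), of "R k"] by(simp add: sg_def tg_def tp_def)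
qed
ultimately show ?thesis using that r(1,2) par(1) by blast
qed

lemma xcoef_times_deriv:
assumes w: "W : HF chi" and th: "h : charts A" and par: "cpar h C r b"
shows "EX e. isCont e 0 & (ALL u:ball 0 r. fst (C u) ~= 0 --> sg h C u ~: bad -->
  xcoef W (pt (sg h C u) (tg h C u))*deriv (sg h C) u = e u)"
proof -
let ?G = "%u. Pl h (C u)"
define U where "U = ?G ` ball 0 r"
obtain F where c: "(U,F) : RC chi" "!!u. u : ball 0 r ==> F (?G u) = u" using unif_chart[OF th par] unfolding U_def by blast
have U: "?G u : U" if "u : ball 0 r" for u using that by(simp add: U_def)
hence "{u : ball 0 r. ?G u : U} = ball 0 r" by auto
hence "(%u. W ((U,F),?G u)) hol_on ball 0 r" using form_along_holomorphic[OF w c(1) par_gpar[OF th par]] by simp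
hence "isCont (%u. W ((U,F),?G u)) 0" by(rule holomorphic_ball_isCont) (use par_r[OF par] in simp)
moreover have "xcoef W (pt (sg h C u) (tg h C u))*deriv (sg h C) u = W ((U,F),?G u)"
 if t: "u : ball 0 r" "fst (C u) ~= 0" "sg h C u ~: bad" for u
proof -
 have "((%u. F (?G u)) hfd 1) (at u)" by(rule hfd_transform[OF DERIV_ident open_ball t(1)]) (simp add: c(2))
 thus ?thesis using xcoef_along[OF w th par t c(1) U[OF t(1)]] by(simp add: DERIV_imp_deriv)
qed
ultimately show ?thesis by(intro exI[of _ "%u. W ((U,F),?G u)"]) blast
qed

text \<open>Along a branch xcoef times x' is continuous at the centre, so (x - b0) xcoef is (x -
  b0)/x' times a bounded factor and tends to 0 by \<open>sg_ratio\<close>.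
  \<open>boundary_sequence\<close> moves an arbitrary sequence onto a branch. For x tending to
  infinity, b0 = 0 gives the ratio x/x'.\<close>

lemma xcoef_small:
fixes s t :: "nat => complex"
assumes P: "lattice_points P = A" and w: "W : HF chi"
 and st: "!!k. s k ~: bad" "!!k. pe chi (s k) (t k) = 0"
 and lim: "(s ----> b0 & b0 : bad) | (filterlim s at_infinity sequentially & b0 = 0)"
shows "EX R. strict_mono R & (%k. (s (R k)-b0)*xcoef W (pt (s (R k)) (t (R k)))) ----> 0"
proof -
obtain R h G r b u where B: "strict_mono R" "h : charts A" "cpar h G r b" "u ----> 0"
 "eventually (%k. u k : ball 0 r & fst (G (u k)) ~= 0 & sg h G (u k) = s (R k) & tg h G (u k) = t (R k)) sequentially"
 by(rule boundary_sequence[OF P st])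
obtain e where eta: "isCont e 0" "!!u. u : ball 0 r ==> fst (G u) ~= 0 ==> sg h G u ~: bad ==>
  xcoef W (pt (sg h G u) (tg h G u))*deriv (sg h G) u = e u" using xcoef_times_deriv[OF w B(2,3)] by blast
have el: "(%k. e (u k)) ----> e 0" by(rule isCont_tendsto_compose[OF eta(1) B(4)])
have sr: "filterlim (%k. s (R k)) F sequentially" if "filterlim s F sequentially" for F using filterlim_compose[OF that filterlim_subseq[OF B(1)]] .
have ev: "eventually (%k. sg h G (u k) = s (R k)) sequentially" using B(5) by(auto elim: eventually_mono)
have ss: "filterlim (%k. sg h G (u k)) F sequentially" if "filterlim s F sequentially" for F
 using sr[OF that] filterlim_cong[OF refl refl ev] by blast
have concl: "EX R. strict_mono R & (%k. (s (R k)-b0)*xcoef W (pt (s (R k)) (t (R k)))) ----> 0"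
 if R: "((%u. (sg h G u-b0)/deriv (sg h G) u) ---> 0) (at 0)" and nz: "eventually (%k. u k ~= 0) sequentially"
proof -
 have "filterlim u (at 0) sequentially" unfolding filterlim_at using B(4) nz by auto
 from tendsto_mult[OF filterlim_compose[OF R this] el]
 have "(%k. (sg h G (u k)-b0)/deriv (sg h G) (u k)*e (u k)) ----> 0" by simp
 hence "(%k. (s (R k)-b0)*xcoef W (pt (s (R k)) (t (R k)))) ----> 0"
 proof(rule Lim_transform_eventually)
  show "eventually (%k. (sg h G (u k)-b0)/deriv (sg h G) (u k)*e (u k) = (s (R k)-b0)*xcoef W (pt (s (R k)) (t (R k)))) sequentially" using B(5)
  proof eventually_elim
   case (elim k)
   have g: "sg h G (u k) ~: bad" using elim st(1) by simp
   have "deriv (sg h G) (u k) ~= 0" using sg_nz_deriv[OF B(2,3) _ _ g] elim by blast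
   moreover have "xcoef W (pt (s (R k)) (t (R k)))*deriv (sg h G) (u k) = e (u k)" using eta(2)[OF _ _ g] elim by simp
   ultimately show ?case using elim by(simp flip: \<open>_ = e (u k)\<close>)
  qed
 qed
 thus ?thesis using B(1) by blast
qed
show ?thesis
proof(cases "isCont (sg h G) 0 & ((%u. (sg h G u - sg h G 0)/deriv (sg h G) u) ---> 0) (at 0)")
 case True
 have l1: "(%k. sg h G (u k)) ----> sg h G 0" using True isCont_tendsto_compose[OF _ B(4)] by blast
 have "~ filterlim s at_infinity sequentially" using ss[of at_infinity] not_tendsto_and_filterlim_at_infinity[OF _ l1] by auto
 hence b0: "s ----> b0" "b0 : bad" using lim by blast+
 have "sg h G 0 = b0" using LIMSEQ_unique[OF l1 ss[OF b0(1)]] .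
 moreover have "eventually (%k. u k ~= 0) sequentially" using ev
 proof eventually_elim
  case (elim k) thus ?case using st(1)[of "R k"] b0(2) \<open>sg h G 0 = b0\<close> by auto
 qed
 ultimately show ?thesis using concl True by simp
next
 case False
 hence T: "fst (G 0) = 0" "filterlim (sg h G) at_infinity (at 0)" "((%u. sg h G u/deriv (sg h G) u) ---> 0) (at 0)"
  using sg_ratio[OF B(2,3)] by blast+
 have nz: "eventually (%k. u k ~= 0) sequentially" using B(5)
 proof eventually_elim
  case (elim k) thus ?case using T(1) by auto
 qed
 have "filterlim u (at 0) sequentially" unfolding filterlim_at using B(4) nz by auto
 from filterlim_compose[OF T(2) this] have "~ s ----> b0"
  using ss not_tendsto_and_filterlim_at_infinity[of sequentially "%k. sg h G (u k)" b0] by auto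
 hence "b0 = 0" using lim by blast
 thus ?thesis using concl nz T(3) by simp
qed
qed

end

section \<open>Removable singularities and growth of polynomials\<close>

lemma holomorphic_extend_finite:
assumes "finite B" "f hol_on-B" "!!b. b : B ==> ((%z. (z-b)*f z) ---> 0) (at b)"
shows "EX g. g hol_on UNIV & (ALL z. z ~: B --> g z = f (z :: complex))" using assms
proof(induction B arbitrary: f rule: finite_induct)
case empty thus ?case by auto
next
case (insert b B)
have o: "open (- B)" using insert.hyps(1) by(intro open_Compl finite_imp_closed)
have e: "- insert b B = - B-{b}" by auto
have "b : interior (- B)" using o insert.hyps(2) by(simp add: interior_open)
then obtain g where g: "g hol_on-B" "ALL z:- B-{b}. g z = f z" using holomorphic_on_extend_lim[of f "- B" b] insert.prems e by auto
have "((%z. (z-c)*g z) ---> 0) (at c)" if c: "c : B" for c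
proof(rule Lim_transform_eventually[OF insert.prems(2)])
 have "open (- ((insert b B)-{c}))" using insert.hyps(1) by(intro open_Compl finite_imp_closed) auto
 hence "eventually (%z. z : - ((insert b B)-{c})-{c}) (at c)" by(intro eventually_at_in_open) auto
 thus "eventually (%z. (z-c)*f z = (z-c)*g z) (at c)"
 proof eventually_elim
  case (elim z)
  hence "z : - B-{b}" by blast
  thus ?case using g(2) by simp
 qed
qed (use c in blast)
from insert.IH[OF g(1) this] obtain k where k: "k hol_on UNIV" "ALL z. z ~: B --> k z = g z" by blast
thus ?case using g(2) by(intro exI[of _ k]) auto
qed

text \<open>A polynomial grows like a constant times |s|^degree. That the bound holds for every ep,
  not for just one constant, makes the inequality strict; this strictness later separates interior
  from boundary lattice points.\<close>

lemma poly_growth: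
fixes p :: "complex poly"
assumes "!!ep. ep > 0 ==> eventually (%s. norm (poly p s) <= ep*norm s powr K) at_infinity" and p: "p ~= 0"
shows "real (degree p) < K"
proof(rule ccontr)
assume K: "~ real (degree p) < K"
define c where "c = norm (lead_coeff p)/2"
have c: "c > 0" using p by(simp add: c_def)
have "((%s. poly p s / s^degree p) ---> lead_coeff p) at_infinity" by(rule poly_divide_tendsto_aux)
from tendstoD[OF this c] have 1: "eventually (%s. dist (poly p s / s^degree p) (lead_coeff p) < c) at_infinity" .
have 2: "eventually (%s::complex. 1 <= norm s) at_infinity" unfolding eventually_at_infinity by blast
have ev: "eventually (%s::complex. False) at_infinity" using 1 2 assms(1)[OF half_gt_zero[OF c]]
proof eventually_elim
 case (elim s)
 have "norm (lead_coeff p)-norm (poly p s / s^degree p) < c"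
  using elim(1) norm_triangle_ineq2[of "lead_coeff p" "poly p s / s^degree p"] by(simp add: dist_norm norm_minus_commute)
 hence "c < norm (poly p s)/norm s^degree p" by(simp add: c_def norm_divide norm_power)
 moreover have sp: "norm s^degree p > 0" using elim(2) by(intro zero_less_power) linarith
 ultimately have "c*norm s^degree p < norm (poly p s)" by(simp only: pos_less_divide_eq)
 also have "... <= c/2*norm s powr K" using elim(3) by simp
 also have "... <= c/2*norm s powr real (degree p)" using K elim(2) c by(intro mult_left_mono powr_mono) auto
 also have "norm s powr real (degree p) = norm s^degree p" using elim(2) by(intro powr_realpow) linarith
 finally have "c*norm s^degree p < c/2*norm s^degree p" .
 thus ?case using c sp by simp
qed
from ev obtain B where B: "ALL s::complex. ~ B <= norm s" unfolding eventually_at_infinity by blast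
thus False using B[rule_format, of "of_real \<bar>B\<bar>"] by simp
qed

context nondeg begin

subsection \<open>The trace argument\<close>

lemma A_height:
assumes "g : A" shows "snd g <= n" "snd g = n ==> g = (0,n)"
proof -
have nz: "Polynomial.coeff (Polynomial.coeff chi (snd g)) (fst g) ~= 0" using suppA[of g] assms by(simp add: coeff_vec_def split: prod.splits)
show "snd g <= n" using nz le_degree[of chi "snd g"] degree_chi by force
show "g = (0,n)" if e: "snd g = n"
proof -
 have "Polynomial.coeff chi n = 1" using degree_chi by simp
 hence "fst g = 0" using nz e by(simp add: coeff_1 split: if_splits)
 thus ?thesis using e by(simp add: prod_eq_iff)
qed
qed

lemma top_in: "(0,n) : A"
proof -
have "Polynomial.coeff chi n = 1" using degree_chi by simp
thus ?thesis using suppA[of "(0,n)"] by(simp add: coeff_vec_def)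
qed

lemma origin_in: "(0,0) : A" using unimodular by blast

text \<open>As a polynomial in s and t', this is the coefficient of t^b in the difference quotient
  (chi(s,t) - chi(s,t')) / (t - t').\<close>

definition Qb :: "nat => complex poly poly" where
"Qb b = (SUM g:{g:A. b < snd g}. mono2 (cc g) (fst g,snd g-Suc b))"

lemma pe_Qb: "pe (Qb b) s t = (SUM g:{g:A. b < snd g}. cc g*(s^fst g*t^(snd g-Suc b)))"
by(simp add: Qb_def pe_sum pe_mono2)

lemma pe_pderiv_chi: "pe (pderiv chi) s t = (SUM g:A. cc g*(s^fst g*(of_nat (snd g)*t^(snd g-1))))"
proof -
have "((%t. SUM g:A. cc g*(mn s t g)) has_field_derivative
  (SUM g:A. cc g*(s^fst g*(of_nat (snd g)*t^(snd g-1))))) (at t)" by(intro DERIV_sum DERIV_cmult) (auto intro!: derivative_eq_intros)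
thus ?thesis using DERIV_unique[OF pe_deriv[of chi s t]] by(simp add: pe_chi[abs_def])
qed

lemma lagrange_sum:
"(SUM b<n. pe (Qb b) s t'*t^b) = (SUM g:A. cc g*(s^fst g*(SUM b<snd g. t'^(snd g-Suc b)*t^b)))"
proof -
have "(SUM b<n. pe (Qb b) s t'*t^b)
  = (SUM b<n. SUM g:{g:A. b < snd g}. cc g*(s^fst g*(t'^(snd g-Suc b)*t^b)))" unfolding pe_Qb sum_distrib_right by(simp add: mult_ac)
also have "... = (SUM g:A. SUM b:{b. b < n & b < snd g}. cc g*(s^fst g*(t'^(snd g-Suc b)*t^b)))"
 using sum.swap_restrict[of "{..<n}" A "%b g. cc g*(s^fst g*(t'^(snd g-Suc b)*t^b))" "%b g. b < snd g"] finA by simp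
also have "... = (SUM g:A. cc g*(s^fst g*(SUM b<snd g. t'^(snd g-Suc b)*t^b)))"
proof(intro sum.cong refl)
 fix g assume "g : A"
 hence "{b. b < n & b < snd g} = {..<snd g}" using A_height(1)[of g] by auto
 thus "(SUM b:{b. b < n & b < snd g}. cc g*(s^fst g*(t'^(snd g-Suc b)*t^b)))
   = cc g*(s^fst g*(SUM b<snd g. t'^(snd g-Suc b)*t^b))" by(simp add: sum_distrib_left)
qed
finally show ?thesis .
qed

lemma lagrange_diff: "(t-t')*(SUM b<n. pe (Qb b) s t'*t^b) = pe chi s t-pe chi s t'"
proof -
have h: "(t-t')*(SUM b<k. t'^(k-Suc b)*t^b) = t ^ k-t' ^ k" for k by(rule power_diff_sumr2[symmetric])
have "(t-t')*(SUM b<n. pe (Qb b) s t'*t^b) = (SUM g:A. cc g*(s^fst g*(t ^ snd g-t' ^ snd g)))" unfolding lagrange_sum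
 by(subst sum_distrib_left, intro sum.cong refl) (simp only: mult.left_commute[of "t-t'"] h)
thus ?thesis by(simp add: pe_chi right_diff_distrib sum_subtractf)
qed

lemma lagrange_diag: "(SUM b<n. pe (Qb b) s t*t^b) = pe (pderiv chi) s t"
unfolding lagrange_sum pe_pderiv_chi
proof(intro sum.cong refl arg_cong[of _ _ "%x. cc g*(s^fst g*x)" for g])
fix g :: "mon"
have "(SUM b<snd g. t^(snd g-Suc b)*t^b) = (SUM b<snd g. t^(snd g-1))"
proof(intro sum.cong refl)
 fix b assume "b : {..<snd g}"
 hence "snd g-Suc b+b = snd g-1" by auto
 thus "t^(snd g-Suc b)*t^b = t^(snd g-1)" by(metis power_add)
qed
thus "(SUM b<snd g. t^(snd g-Suc b)*t^b) = of_nat (snd g)*t^(snd g-1)" by simp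
qed

text \<open>This bound replaces expansions at infinity, for r is arbitrary. On chi = 0 the terms
  with b < snd g sum to minus the remaining ones, after division by t^(b+1). For |t| <= r the first
  group has nonnegative powers of |t|, for |t| > r the second has negative ones; either way
  replacing |t| by r only enlarges the terms.\<close>

lemma Qb_bound:
assumes z: "pe chi s t = 0" and t: "t ~= 0" and r: "r > 0"
shows "norm (pe (Qb b) s t) <= (SUM g:A. norm (cc g)*norm s^fst g*r powr (real (snd g)-real b-1))"
proof -
let ?T = "%g. cc g*(s^fst g*t powi (iy g-int b-1))"
let ?B = "%g. norm (cc g)*norm s^fst g*r powr (real (snd g)-real b-1)"
have nT: "norm (?T g) = norm (cc g)*norm s^fst g*norm t powr (real (snd g)-real b-1)" for g
proof -
 have "norm (t powi (iy g-int b-1)) = norm t powr (real (snd g)-real b-1)"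
  using t powr_real_of_int'[of "norm t" "iy g-int b-1"] by(simp add: norm_power_int)
 thus ?thesis by(simp add: norm_mult norm_power)
qed
have Q: "pe (Qb b) s t = sum ?T {g:A. b < snd g}" unfolding pe_Qb
proof(intro sum.cong refl)
 fix g assume "g : {g:A. b < snd g}"
 hence "iy g-int b-1 = int (snd g-Suc b)" by auto
 thus "cc g*(s^fst g*t^(snd g-Suc b)) = ?T g" by(simp only: power_int_of_nat)
qed
have Z: "sum ?T A = 0"
proof -
 have "sum ?T A = t powi (- int b-1)*pe chi s t" unfolding pe_chi sum_distrib_left
 proof(intro sum.cong refl)
  fix g :: "mon"
  have "t powi (iy g-int b-1) = t powi (- int b-1)*t ^ snd g" using t power_int_add[of t "- int b-1" "iy g"] by(simp add: alg)
  thus "?T g = t powi (- int b-1)*(cc g*(mn s t g))" by simp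
 qed
 thus ?thesis using z by simp
qed
have split: "A = {g:A. b < snd g} \<union> {g:A. ~ b < snd g}" by auto
have "sum ?T A = sum ?T {g:A. b < snd g} + sum ?T {g:A. ~ b < snd g}" by(subst split, rule sum.union_disjoint) (use finA in auto)
hence Q': "pe (Qb b) s t = - sum ?T {g:A. ~ b < snd g}" using Z Q by(simp add: add_eq_0_iff2)
obtain S where S: "S <= A" "norm (pe (Qb b) s t) = norm (sum ?T S)" "!!g. g : S ==> norm (?T g) <= ?B g"
proof(cases "norm t <= r")
 case True
 show ?thesis
 proof(rule that[of "{g:A. b < snd g}"])
  fix g assume "g : {g:A. b < snd g}"
  thus "norm (?T g) <= ?B g" unfolding nT using True t by(intro mult_left_mono powr_mono2) auto
 qed (use Q in auto)
next
 case False
 show ?thesis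
 proof(rule that[of "{g:A. ~ b < snd g}"])
  fix g assume "g : {g:A. ~ b < snd g}"
  thus "norm (?T g) <= ?B g" unfolding nT using False r by(intro mult_left_mono powr_mono2') auto
 qed (use Q' in auto)
qed
have "norm (sum ?T S) <= sum ?B S" using S(3) by(intro sum_norm_le) blast
also have "... <= sum ?B A" using finA S(1) by(intro sum_mono2) auto
finally show ?thesis using S(2) by simp
qed

text \<open>The polynomials \<open>Qb b\<close> divided by chi_y form Euler's dual basis of 1, y,
  ..., y^(n-1) for the trace. Hence these traces are the coefficients of xcoef chi_y in powers of
  y.\<close>

definition trace :: "(place chart \<times> place => complex) => nat => complex => complex" where
"trace W b s = (SUM t:{t. pe chi s t = 0}. xcoef W (pt s t)*pe (Qb b) s t)"

text \<open>Lagrange interpolation: the difference quotient of chi vanishes at two distinct points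
  of a fibre and equals chi_y on the diagonal.\<close>

lemma trace_lagrange:
assumes "pe chi s t = 0"
shows "(SUM b<n. trace W b s*t^b) = xcoef W (pt s t)*pe (pderiv chi) s t"
proof -
have "(SUM b<n. trace W b s*t^b)
  = (SUM t':{t. pe chi s t = 0}. xcoef W (pt s t')*(SUM b<n. pe (Qb b) s t'*t^b))"
 unfolding trace_def sum_distrib_right sum_distrib_left by(subst sum.swap) (simp add: mult_ac)
also have "... = (SUM t':{t. pe chi s t = 0}. if t' = t then xcoef W (pt s t)*pe (pderiv chi) s t else 0)"
proof(intro sum.cong refl)
 fix t' assume "t' : {t. pe chi s t = 0}"
 hence "(t-t')*(SUM b<n. pe (Qb b) s t'*t^b) = 0" using lagrange_diff[of t t' s] assms by simp
 thus "xcoef W (pt s t')*(SUM b<n. pe (Qb b) s t'*t^b) = (if t' = t then xcoef W (pt s t)*pe (pderiv chi) s t else 0)" using lagrange_diag by auto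
qed
also have "... = xcoef W (pt s t)*pe (pderiv chi) s t" using assms finite_fiber by simp
finally show ?thesis .
qed

lemma card_fiber:
assumes "s ~: bad" shows "card {t. pe chi s t = 0} = n"
proof -
define q where "q = map_poly (%p. poly p s) chi"
have q: "poly q t = pe chi s t" for t by(simp add: q_def poly_map_poly_pe)
have "(poly q hfd pe (pderiv chi) s t) (at t)" for t using pe_deriv[of chi s t] by(simp add: q[abs_def])
hence q': "poly (pderiv q) t = pe (pderiv chi) s t" for t using DERIV_unique[OF poly_DERIV] by blast
have "rsquarefree q" unfolding rsquarefree_roots q q' using good_point(3)[OF assms] by blast
from complex_poly_decompose_rsquarefree[OF this] have e: "(PROD t | poly q t = 0. [:- t,1:]) = q" using fiber_poly(2)[of s] by(simp add: q_def)
have "degree (PROD t | poly q t = 0. [:- t,1:]) = (SUM t | poly q t = 0. degree [:- t,1:])" by(rule degree_prod_sum_eq) simp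
hence "degree q = card {t. poly q t = 0}" unfolding e by simp
thus ?thesis using fiber_poly(1)[of s] unfolding q by(simp add: q_def)
qed

lemma pe_holomorphic: "F hol_on W ==> (%s. pe B s (F s)) hol_on W"
proof(induction B)
case (pCons c B)
have "(%s. pe (pCons c B) s (F s)) = (%s. poly c s+F s*pe B s (F s))" by(rule ext) (simp add: pe_def)
thus ?case using pCons by(auto intro!: holomorphic_intros)
qed simp

text \<open>The local sections through the n points of a fibre stay distinct nearby, and
  neighbouring fibres also have n points. So the sections exhaust these fibres and the trace is a
  finite sum of holomorphic functions.\<close>

lemma trace_holomorphic:
assumes w: "w : HF chi"
shows "trace w b hol_on-bad"
proof -
have ob: "open (- bad)" using finite_bad by(intro open_Compl finite_imp_closed)
have "trace w b field_differentiable at s0" if s0: "s0 ~: bad" for s0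
proof -
 define T where "T = {t. pe chi s0 t = 0}"
 have fT: "finite T" by(simp add: T_def finite_fiber)
 define Sec where "Sec = (%t W F. open W & s0 : W & F hol_on W & F s0 = t & (ALL s:W. pe chi s (F s) = 0) &
   (%s. xcoef w (pt s (F s))) hol_on W)"
 have "ALL t:T. EX W F. Sec t W F"
 proof
  fix t assume "t : T"
  hence t: "pe chi s0 t = 0" by(simp add: T_def)
  obtain U W F where S: "(U,pv chi (ff_x chi)) : RC chi" "open W" "s0 : W" "F hol_on W" "F s0 = t"
   "!!s. s : W ==> pe chi s (F s) = 0 & pt s (F s) : U"
   "!!w. w : HF chi ==> (%s. w ((U,pv chi (ff_x chi)),pt s (F s))) hol_on W" by(rule local_section[OF s0 t]) blast
  have "(%s. xcoef w (pt s (F s))) hol_on W" by(rule holomorphic_transform[OF S(7)[OF w]]) (simp add: xcoef_chart[OF w S(1)] S(6))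
  hence "Sec t W F" unfolding Sec_def using S(2-6) by(intro conjI ballI) simp_all
  thus "EX W F. Sec t W F" by blast
 qed
 then obtain W F where Sec: "ALL t:T. Sec t (W t) (F t)" by metis
 have S: "open (W t) & s0 : W t & F t hol_on W t & F t s0 = t"
  "s : W t ==> pe chi s (F t s) = 0" "(%s. xcoef w (pt s (F t s))) hol_on W t" if "t : T" for t s using Sec that unfolding Sec_def by blast+
 define V where "V = (INT t:T. W t) \<inter>-bad"
 have V: "open V" "s0 : V" "!!t. t : T ==> V <= W t" "V <= - bad" using S(1) fT ob s0 by(auto simp: V_def intro!: open_Int open_INT)
 define D where "D = (%(t,t'). {s:V. F t s-F t' s ~= 0})"
 define V' where "V' = V \<inter> (INT x:{x:T\<times>T. fst x ~= snd x}. D x)"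
 have "open (D (t,t'))" if t: "t : T" "t' : T" for t t'
 proof -
  have "continuous_on V (F t)" "continuous_on V (F t')" using S(1) V(3) t by(meson holomorphic_on_imp_continuous_on holomorphic_on_subset)+
  hence "continuous_on V (%s. F t s-F t' s)" by(rule continuous_on_diff)
  from continuous_open_preimage[OF this V(1), of "- {0}"]
  have "open (V \<inter> (%s. F t s-F t' s) -` (- {0}))" by(simp add: open_Compl)
  moreover have "V \<inter> (%s. F t s-F t' s) -` (- {0}) = D (t,t')" by(auto simp: D_def)
  ultimately show ?thesis by simp
 qed
 hence oV': "open V'" unfolding V'_def using fT V(1) by(intro open_Int open_INT) auto
 have sV': "s0 : V'" using V(2) S(1) by(auto simp: V'_def D_def)
 have eq: "(SUM t:T. xcoef w (pt s (F t s))*pe (Qb b) s (F t s)) = trace w b s" if s: "s : V'" for s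
 proof -
  have sV: "s : V" using s by(simp add: V'_def)
  have inj: "inj_on (%t. F t s) T"
  proof(rule inj_onI, rule ccontr)
   fix t t' assume t: "t : T" "t' : T" "F t s = F t' s" "t ~= t'"
   hence "s : D (t,t')" using s by(auto simp: V'_def)
   thus False using t(3) by(simp add: D_def)
  qed
  have sub: "(%t. F t s) ` T <= {t. pe chi s t = 0}" using S(2) V(3) sV by blast
  have "card ((%t. F t s) ` T) = card {t. pe chi s t = 0}" using card_image[OF inj] card_fiber[OF s0] card_fiber[of s] V(4) sV by(auto simp: T_def)
  hence "(%t. F t s) ` T = {t. pe chi s t = 0}" using sub finite_fiber by(intro card_subset_eq)
  thus ?thesis unfolding trace_def using sum.reindex[OF inj, of "%t. xcoef w (pt s t)*pe (Qb b) s t"] by simp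
 qed
 have "(%s. SUM t:T. xcoef w (pt s (F t s))*pe (Qb b) s (F t s)) hol_on V'"
 proof(intro holomorphic_on_sum holomorphic_on_mult)
  fix t assume t: "t : T"
  have sub: "V' <= W t" using V(3)[OF t] by(auto simp: V'_def)
  show "(%s. xcoef w (pt s (F t s))) hol_on V'" using S(3)[OF t] sub by(rule holomorphic_on_subset)
  have "F t hol_on V'" using S(1)[OF t] sub holomorphic_on_subset by blast
  thus "(%s. pe (Qb b) s (F t s)) hol_on V'" by(rule pe_holomorphic)
 qed
 hence "trace w b hol_on V'" by(rule holomorphic_transform) (rule eq)
 thus ?thesis using sV' oV' holomorphic_on_imp_differentiable_at by blast
qed
thus ?thesis unfolding holomorphic_on_def by(metis ComplD field_differentiable_at_within)
qed

end

context nondeg begin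

lemma xcoef_small_at:
assumes P: "lattice_points P = A" and w: "W : HF chi" and b0: "b0 : bad" and e: "ep > 0"
shows "eventually (%s. s ~: bad --> (ALL t. pe chi s t = 0 --> norm ((s-b0)*xcoef W (pt s t)) < ep)) (at b0)"
proof(rule sequentially_imp_eventually_at, intro allI impI, rule ccontr)
fix f assume f: "(ALL k. f k ~= b0) & f ----> b0"
 and c: "~ eventually (%k. f k ~: bad --> (ALL t. pe chi (f k) t = 0 --> norm ((f k-b0)*xcoef W (pt (f k) t)) < ep)) sequentially"
obtain R :: "nat => nat" where r: "strict_mono R"
 "ALL k. ~ (f (R k) ~: bad --> (ALL t. pe chi (f (R k)) t = 0 --> norm ((f (R k)-b0)*xcoef W (pt (f (R k)) t)) < ep))"
 using not_eventually_sequentiallyD[OF c] by blast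
define s where "s = (%k. f (R k))"
have "ALL k. EX t. s k ~: bad & pe chi (s k) t = 0 & ep <= norm ((s k-b0)*xcoef W (pt (s k) t))" using r(2) by(auto simp: s_def not_less)
then obtain t where t: "!!k. s k ~: bad" "!!k. pe chi (s k) (t k) = 0" "!!k. ep <= norm ((s k-b0)*xcoef W (pt (s k) (t k)))" by metis
have "s ----> b0" unfolding s_def using LIMSEQ_subseq_LIMSEQ[OF conjunct2[OF f] r(1)] by(simp add: o_def)
hence "EX R'. strict_mono R' & (%k. (s (R' k)-b0)*xcoef W (pt (s (R' k)) (t (R' k)))) ----> 0" by(intro xcoef_small[OF P w t(1,2)]) (simp add: b0)
then obtain R' where "(%k. (s (R' k)-b0)*xcoef W (pt (s (R' k)) (t (R' k)))) ----> 0" by auto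
from tendsto_norm[OF this] have "(%k. norm ((s (R' k)-b0)*xcoef W (pt (s (R' k)) (t (R' k))))) ----> 0" by simp
hence "ep <= 0" by(rule LIMSEQ_le_const) (use t(3) in blast)
thus False using e by simp
qed

lemma xcoef_small_infinity:
assumes P: "lattice_points P = A" and w: "W : HF chi" and e: "ep > 0"
shows "eventually (%s. s ~: bad --> (ALL t. pe chi s t = 0 --> norm (s*xcoef W (pt s t)) < ep)) at_infinity"
proof(rule ccontr)
assume c: "~ ?thesis"
have "ALL k::nat. EX s t. real k <= norm s & s ~: bad & pe chi s t = 0 & ep <= norm (s*xcoef W (pt s t))"
 using c unfolding eventually_at_infinity by(meson not_less)
then obtain s t where t: "!!k. real k <= norm (s k)" "!!k. s k ~: bad" "!!k. pe chi (s k) (t k) = 0"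
 "!!k. ep <= norm (s k*xcoef W (pt (s k) (t k)))" by metis
have "filterlim (%k. norm (s k)) at_top sequentially" by(rule filterlim_at_top_mono[OF filterlim_real_sequentially]) (use t(1) in auto)
hence "filterlim s at_infinity sequentially" by(simp add: filterlim_at_infinity_conv_norm_at_top)
hence "EX R'. strict_mono R' & (%k. (s (R' k)-0)*xcoef W (pt (s (R' k)) (t (R' k)))) ----> 0" by(intro xcoef_small[OF P w t(2,3)]) simp
then obtain R' where "(%k. s (R' k)*xcoef W (pt (s (R' k)) (t (R' k)))) ----> 0" by auto
from tendsto_norm[OF this] have "(%k. norm (s (R' k)*xcoef W (pt (s (R' k)) (t (R' k))))) ----> 0" by simp
hence "ep <= 0" by(rule LIMSEQ_le_const) (use t(4) in blast)
thus False using e by simp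
qed

lemma trace_bound:
assumes s: "s ~: bad" and F: "!!t. pe chi s t = 0 ==> norm (xcoef W (pt s t)) <= M" and r: "r > 0"
shows "norm (trace W b s) <= real n*(M*(SUM g:A. norm (cc g)*norm s^fst g*r powr (real (snd g)-real b-1)))"
proof -
let ?C = "SUM g:A. norm (cc g)*norm s^fst g*r powr (real (snd g)-real b-1)"
have "norm (trace W b s) <= (SUM t:{t. pe chi s t = 0}. M*?C)" unfolding trace_def
proof(rule sum_norm_le)
 fix t assume "t : {t. pe chi s t = 0}"
 hence t: "pe chi s t = 0" by simp
 have M: "0 <= M" using F[OF t] norm_ge_zero order_trans by blast
 show "norm (xcoef W (pt s t)*pe (Qb b) s t) <= M*?C"
  unfolding norm_mult using F[OF t] Qb_bound[OF t good_point(2)[OF s t] r] M by(intro mult_mono) auto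
qed
thus ?thesis by(simp add: card_fiber[OF s])
qed

lemma eventually_not_bad: "eventually (%s. s ~: bad) at_infinity"
proof -
obtain R where "ALL x:bad. norm x <= R" using finite_imp_bounded[OF finite_bad] unfolding bounded_iff by blast
thus ?thesis unfolding eventually_at_infinity by(intro exI[of _ "R+1"]) force
qed

text \<open>Take r = |s|^S in \<open>Qb_bound\<close>: the half plane x + S y <= k containing A
  bounds each term by a multiple of |s|^(k - S(b+1)). The form contributes the factor
  o(1/|s|).\<close>

lemma trace_growth:
assumes P: "lattice_points P = A" and w: "W : HF chi" and e: "ep > 0"
 and k: "!!g. g : A ==> real (fst g)+S*real (snd g) <= k"
shows "eventually (%s. norm (trace W b s) <= ep*norm s powr (k-S*(real b+1)-1)) at_infinity"
proof -
define C where "C = (SUM g:A. norm (cc g))"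
\<comment> \<open>The added 1 keeps the denominator positive when C is 0.\<close>
define d where "d = ep/(real n*C+1)"
have C: "0 <= C" by(auto simp: C_def intro: sum_nonneg)
hence d: "d > 0" using e by(auto simp: d_def intro!: divide_pos_pos add_nonneg_pos)
have "eventually (%s::complex. 1 <= norm s) at_infinity" unfolding eventually_at_infinity by blast
with xcoef_small_infinity[OF P w d] eventually_not_bad show ?thesis
proof eventually_elim
 case (elim s)
 have s: "norm s > 0" using elim by linarith
 have F: "norm (xcoef W (pt s t)) <= d/norm s" if "pe chi s t = 0" for t
  using elim(1,2) that s by(auto simp: norm_mult pos_le_divide_eq mult.commute less_imp_le)
 define r where "r = norm s powr S"
 have r: "r > 0" using s by(simp add: r_def)
 let ?e = "k-S*(real b+1)"
 have "(SUM g:A. norm (cc g)*norm s^fst g*r powr (real (snd g)-real b-1)) <= (SUM g:A. norm (cc g)*norm s powr ?e)"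
 proof(rule sum_mono)
  fix g assume g: "g : A"
  have "norm s^fst g*r powr (real (snd g)-real b-1) = norm s powr (real (fst g)+S*(real (snd g)-real b-1))"
   using s by(simp add: r_def powr_powr powr_add powr_realpow)
  also have "... <= norm s powr ?e" using k[OF g] elim(3) by(intro powr_mono) (auto simp: alg)
  finally show "norm (cc g)*norm s^fst g*r powr (real (snd g)-real b-1) <= norm (cc g)*norm s powr ?e" by(simp add: mult.assoc mult_left_mono)
 qed
 also have "... = C*norm s powr ?e" by(simp add: C_def sum_distrib_right)
 finally have S: "(SUM g:A. norm (cc g)*norm s^fst g*r powr (real (snd g)-real b-1)) <= C*norm s powr ?e" .
 have "norm (trace W b s) <= real n*(d/norm s*(SUM g:A. norm (cc g)*norm s^fst g*r powr (real (snd g)-real b-1)))"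
  by(rule trace_bound[OF elim(2) F r])
 also have "... <= real n*(d/norm s*(C*norm s powr ?e))" using S d s by(intro mult_left_mono) auto
 also have "... = d*(real n*C)*(norm s powr ?e/norm s)" by simp
 also have "norm s powr ?e/norm s = norm s powr (?e-1)" using s by(simp add: powr_diff)
 also have "d*(real n*C)*norm s powr (?e-1) <= ep*norm s powr (?e-1)"
 proof(rule mult_right_mono)
  have "d*(real n*C) <= d*(real n*C+1)" using d by simp
  also have "... = ep" using C by(simp add: d_def add_nonneg_eq_0_iff)
  finally show "d*(real n*C) <= ep" .
 qed simp
 finally show ?case by(simp add: alg)
qed
qed

lemma trace_removable:
assumes P: "lattice_points P = A" and w: "W : HF chi" and b0: "b0 : bad"
shows "((%s. (s-b0)*trace W b s) ---> 0) (at b0)"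
proof(rule tendstoI)
fix ep :: real assume e: "ep > 0"
define C where "C = (SUM g:A. norm (cc g)*(norm b0+1)^fst g)"
define d where "d = ep/(real n*C+1)"
have C: "0 <= C" by(auto simp: C_def intro!: sum_nonneg mult_nonneg_nonneg)
hence d: "d > 0" using e by(auto simp: d_def intro!: divide_pos_pos add_nonneg_pos)
have o: "open (- (bad-{b0}))" using finite_bad by(intro open_Compl finite_imp_closed) auto
have "eventually (%s. s : - (bad-{b0})-{b0}) (at b0)" by(rule eventually_at_in_open[OF o]) auto
moreover have "eventually (%s. s : ball b0 1-{b0}) (at b0)" by(rule eventually_at_in_open) auto
ultimately show "eventually (%s. dist ((s-b0)*trace W b s) 0 < ep) (at b0)" using xcoef_small_at[OF P w b0 d]
proof eventually_elim
 case (elim s)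
 have sb: "s ~: bad" "s ~= b0" using elim(1) by blast+
 have nz: "norm (s-b0) > 0" using sb by simp
 have ns: "norm s <= norm b0+1" using elim(2) norm_triangle_ineq[of b0 "s-b0"] by(simp add: dist_norm norm_minus_commute)
 have F: "norm (xcoef W (pt s t)) <= d/norm (s-b0)" if "pe chi s t = 0" for t
  using elim(3) sb(1) that nz by(auto simp: norm_mult pos_le_divide_eq mult.commute less_imp_le)
 have "(SUM g:A. norm (cc g)*norm s^fst g*1 powr (real (snd g)-real b-1)) <= C"
  unfolding C_def by(intro sum_mono) (auto intro!: mult_left_mono power_mono ns)
 hence "real n*(d/norm (s-b0)*(SUM g:A. norm (cc g)*norm s^fst g*1 powr (real (snd g)-real b-1)))
  <= real n*(d/norm (s-b0)*C)" using d nz by(intro mult_left_mono) auto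
 hence "norm (trace W b s) <= real n*(d/norm (s-b0)*C)" using trace_bound[OF sb(1) F zero_less_one, of b] by linarith
 hence "norm (s-b0)*norm (trace W b s) <= norm (s-b0)*(real n*(d/norm (s-b0)*C))" by(intro mult_left_mono) auto
 also have "... = d*(real n*C)" using nz by simp
 also have "... < d*(real n*C+1)" using d by simp
 also have "... = ep" using C by(simp add: d_def add_nonneg_eq_0_iff)
 finally show ?case by(simp add: norm_mult)
qed
qed

text \<open>The trace extends holomorphically over the finitely many bad points. The half plane with
  S = 0 gives polynomial growth, so Liouville's theorem applies.\<close>

lemma trace_poly:
assumes P: "lattice_points P = A" and w: "W : HF chi"
shows "EX p. ALL s. s ~: bad --> trace W b s = poly p s"
proof -
obtain h where h: "h hol_on UNIV" "!!s. s ~: bad ==> h s = trace W b s"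
 using holomorphic_extend_finite[OF finite_bad trace_holomorphic[OF w, of b] trace_removable[OF P w]] by blast
define N where "N = Max (fst ` A)"
have G: "eventually (%s. norm (trace W b s) <= 1*norm s powr (real N-0*(real b+1)-1)) at_infinity"
 by(rule trace_growth[OF P w zero_less_one]) (use finA in \<open>simp add: N_def\<close>)
have "eventually (%s::complex. 1 <= norm s) at_infinity" unfolding eventually_at_infinity by blast
with G eventually_not_bad have "eventually (%s. norm (h s) <= 1*norm s^N) at_infinity"
proof eventually_elim
 case (elim s)
 have "norm (h s) <= norm s powr (real N-1)" using elim(1,2) h(2) by simp
 also have "... <= norm s powr real N" using elim(3) by(intro powr_mono) auto
 also have "... = norm s^N" using elim(3) by(intro powr_realpow) linarith
 finally show ?case by simp
qed
then obtain R where R: "!!s. R <= norm s ==> norm (h s) <= 1*norm s^N" unfolding eventually_at_infinity by blast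
define p where "p = (SUM k<=N. monom ((deriv ^^ k) h 0/fact k) k)"
have "h s = poly p s" for s using Liouville_polynomial[OF h(1) R, where ?\<xi> = s] by(simp add: p_def poly_sum poly_monom)
thus ?thesis using h(2) by metis
qed

text \<open>The points (0,0) and (0,n) of A, and the fact that nothing else reaches height n, leave
  only three kinds of chart lines: the two coordinate axes, and lines whose outer normal (mua,m)
  points to the right.\<close>

lemma chart_edge:
assumes th: "q : charts A"
shows "(ALL w. det3 (fst q) (fst (snd q)) w = ix w) | (ALL w. det3 (fst q) (fst (snd q)) w = iy w) |
 (EX mua m M. 0 < mua & (ALL w. det3 (fst q) (fst (snd q)) w = M-mua*ix w-m*iy w))"
proof -
obtain e f h where T: "q = (e,f,h)" by(cases q)
have c: "e : A" "f : A" "det3 e f h = 1" "!!g. g : A ==> det3 e f g >= 0" using th unfolding charts_def T by auto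
define mua m where "mua = iy f-iy e" and "m = ix e-ix f"
define M where "M = mua*ix e+m*iy e"
have D: "det3 e f w = M-mua*ix w-m*iy w" for w by(simp add: det3_def M_def mua_def m_def alg)
have he: "iy e <= int n" "iy f <= int n" using A_height(1) c by auto
have M0: "M >= 0" using c(4)[OF origin_in] by(simp add: D)
have Mn: "M-m*int n >= 0" using c(4)[OF top_in] by(simp add: D)
have e1: "mua*(ix h-ix e)+m*(iy h-iy e) = -1" using c(3) by(simp add: det3_def mua_def m_def alg)
consider "mua > 0" | "mua = 0" | "mua < 0" by linarith
thus ?thesis
proof cases
 case 1 thus ?thesis using D T by(intro disjI2 exI conjI) auto
next
 \<comment> \<open>A horizontal edge. For m = 1 it would be a top edge, but (0,n) is the only point
   at height n; m = -1 is the x-axis.\<close>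
 case 2
 have "\<bar>m\<bar> = 1" using e1 2 by(simp add: abs_zmult_eq_1) (metis abs_minus_cancel abs_mult abs_one zmult_eq_1_iff abs_zmult_eq_1 mult_minus_left)
 hence "m = 1 | m = -1" by arith
 thus ?thesis
 proof
  assume m: "m = 1"
  have "iy e >= int n" using Mn 2 m by(simp add: M_def)
  hence "snd e = n" "snd f = n" using he 2 by(auto simp: mua_def)
  hence "e = f" using A_height(2) c(1,2) by metis
  thus ?thesis using m by(simp add: m_def)
 next
  assume m: "m = -1"
  have "snd e = 0" using M0 2 m by(simp add: M_def)
  hence "det3 e f w = iy w" for w using D[of w] 2 m by(simp add: M_def)
  thus ?thesis using T by simp
 qed
next
 \<comment> \<open>The outer normal points to the left. The inequalities at the origin and at (0,n)
   force m = 0 and put the edge on the y-axis.\<close>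
 case 3
 have fe: "0 <= ix e" "0 <= ix f" "0 <= iy e" by auto
 have a: "m*iy e >= - mua*ix e" using M0 by(simp add: M_def)
 have b: "m*(iy e-int n) >= - mua*ix e" using Mn by(simp add: M_def alg)
 have p: "0 <= - mua*ix e" using 3 by(simp add: mult_nonpos_nonneg)
 have "m = 0"
 proof(rule ccontr)
  assume "m ~= 0"
  hence "m > 0 | m < 0" by arith
  thus False
  proof
   assume m: "m > 0"
   hence "iy e-int n >= 0" using b p by(metis zero_le_mult_iff not_less order_trans)
   hence "snd e = n" using he by simp
   hence "e = (0,n)" using A_height(2) c(1) by blast
   hence "ix f = - m" by(simp add: m_def)
   thus False using m by simp
  next
   assume m: "m < 0"
   hence "iy e <= 0" using a p by(metis zero_le_mult_iff not_less order_trans)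
   thus False using 3 by(simp add: mua_def)
  qed
 qed
 have e0: "fst e = 0"
 proof(rule ccontr)
  assume "fst e ~= 0"
  hence "0 < (- mua)*ix e" using 3 by(intro mult_pos_pos) auto
  thus False using a \<open>m = 0\<close> by simp
 qed
 have "(- mua)*(ix h-ix e) = 1" using e1 \<open>m = 0\<close> by simp
 hence "- mua = 1" unfolding zmult_eq_1_iff using 3 by auto
 hence "det3 e f w = ix w" for w using D[of w] \<open>m = 0\<close> e0 by(simp add: M_def)
 thus ?thesis using T by simp
qed
qed

text \<open>By \<open>poly_growth\<close> the degree of p is less than k - S(b+1) - 1, so (a+1) +
  S(b+1) < k for the supporting line of each chart whose normal points to the right. On the axes the
  condition holds automatically for the shifted point.\<close>

lemma trace_support:
assumes P: "lattice_points P = A" and w: "W : HF chi"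
 and p: "!!s. s ~: bad ==> trace W b s = poly p s" and a: "Polynomial.coeff p a ~= 0"
shows "(a,b) : inn" unfolding inn_def
proof(intro CollectI ballI)
fix h assume th: "h : charts A"
let ?D = "det3 (fst h) (fst (snd h))"
consider "ALL w. ?D w = ix w" | "ALL w. ?D w = iy w" |
 mu m M where "0 < mu" "ALL w. ?D w = M-mu*ix w-m*iy w" using chart_edge[OF th] by blast
thus "0 < ?D (Suc (fst (a,b)),Suc (snd (a,b)))"
proof cases
 case 3
 define S k where "S = real_of_int m/real_of_int mu" and "k = real_of_int M/real_of_int mu"
 have K: "real (fst g)+S*real (snd g) <= k" if "g : A" for g
 proof -
  have "0 <= ?D g" using th that unfolding charts_def by(cases h) auto
  hence "mu*ix g+m*iy g <= M" using 3(2) by simp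
  hence "real_of_int (mu*ix g+m*iy g)/real_of_int mu <= k" unfolding k_def using 3(1)
   by(intro divide_right_mono) (simp_all only: of_int_le_iff of_int_0_le_iff less_imp_le)
  moreover have "real (fst g)+S*real (snd g) = real_of_int (mu*ix g+m*iy g)/real_of_int mu" using 3(1) by(simp add: S_def add_divide_distrib)
  ultimately show ?thesis by simp
 qed
 have "real (degree p) < k-S*(real b+1)-1"
 proof(rule poly_growth)
  fix ep :: real assume e: "ep > 0"
  have "eventually (%s. norm (trace W b s) <= ep*norm s powr (k-S*(real b+1)-1)) at_infinity" by(rule trace_growth[OF P w e]) (rule K)
  from this eventually_not_bad
  show "eventually (%s. norm (poly p s) <= ep*norm s powr (k-S*(real b+1)-1)) at_infinity" by eventually_elim (simp add: p)
 qed (use a in auto)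
 moreover have "real a <= real (degree p)" using le_degree[OF a] by simp
 ultimately have "real a+1 < k-S*(real b+1)" by linarith
 also have "... = real_of_int (M-m*(int b+1))/real_of_int mu" by(simp add: S_def k_def diff_divide_distrib)
 finally have "(real a+1)*real_of_int mu < real_of_int (M-m*(int b+1))" using 3(1) by(simp only: pos_less_divide_eq of_int_0_less_iff)
 hence "real_of_int (mu*(int a+1)) < real_of_int (M-m*(int b+1))" by(simp add: mult.commute)
 hence "mu*(int a+1) < M-m*(int b+1)" by(simp only: of_int_less_iff)
 moreover have "?D (Suc a,Suc b) = M-mu*(int a+1)-m*(int b+1)" using 3(2)[rule_format, of "(Suc a,Suc b)"] by(simp add: add.commute)
 ultimately show ?thesis by simp
qed auto
qed

text \<open>A vanishing combination of residue forms gives a polynomial of y-degree below n that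
  vanishes along a branch, hence zero. Conversely the traces of a form are polynomials with
  coefficients supported on \<open>inn\<close>, and \<open>trace_lagrange\<close> recovers the form
  from them.\<close>

theorem genus_inn:
assumes P: "lattice_points P = A" and fin: "finite inn" and ht: "!!g. g : inn ==> snd g < n"
shows "has_genus (RC chi) (card inn)" unfolding has_genus_def
proof(rule has_cdim_family[OF fin, where w = "%g. form_of (hres g)"])
note rf = residue_form
have comb: "eventually (%u. xcoef (%x. SUM g:inn. c g*form_of (hres g) x) (pt (sg h G u) (tg h G u))
  = (SUM g:inn. c g*(sg h G u^fst g*tg h G u ^ snd g))/pe (pderiv chi) (sg h G u) (tg h G u)) (at 0)"
 if th: "h : charts A" and par: "cpar h G r b" for c h G r b
proof -
 have "eventually (%u. ALL g:inn. xcoef (form_of (hres g)) (pt (sg h G u) (tg h G u))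
   = sg h G u^fst g*tg h G u ^ snd g/pe (pderiv chi) (sg h G u) (tg h G u)) (at 0)"
  using fin xcoef_residue[OF _ th par] by(simp add: eventually_ball_finite_distrib)
 with eventually_good[OF th par] show ?thesis
 proof eventually_elim
  case (elim u)
  hence g: "sg h G u ~: bad" "pe chi (sg h G u) (tg h G u) = 0" by blast+
  have "xcoef (%x. SUM g:inn. c g*form_of (hres g) x) (pt (sg h G u) (tg h G u))
    = (SUM g:inn. c g*xcoef (form_of (hres g)) (pt (sg h G u) (tg h G u)))" by(rule xcoef_sum[OF _ g]) (rule rf)
  thus ?case unfolding sum_divide_distrib by(simp only:) (intro sum.cong refl, simp add: elim(2))
 qed
qed
{
 fix c assume z: "!!x. (SUM g:inn. c g*form_of (hres g) x) = 0"
 obtain h G r b where t: "h : charts A" "cpar h G r b"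
 proof -
  obtain s t where st: "s ~: bad" "pe chi s t = 0"
  proof -
   obtain s where "s ~: bad" using finite_bad infinite_UNIV_char_0 ex_new_if_finite by blast
   moreover have "{t. pe chi s t = 0} ~= {}" using card_fiber[OF \<open>s ~: bad\<close>] n_pos by force
   ultimately show ?thesis using that by blast
  qed
  obtain b where "smooth_at th0 (tp th0 s t) b" using smooth_at_ex[OF th0 tp_cpts(1)[OF th0 good_point(1,2)[OF st] st(2)]] by blast
  then obtain G r where "cpar th0 G r b" by(rule smooth_par)
  thus ?thesis using that[OF th0] by blast
 qed
 have "eventually (%u. (SUM g:inn. c g*(sg h G u^fst g*tg h G u ^ snd g)) = 0) (at 0)" using comb[OF t, of c] eventually_good[OF t]
 proof eventually_elim
  case (elim u)
  have "xcoef (%_. 0) P = 0" for P by(simp add: xcoef_def)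
  thus ?case using elim good_point(3) z by auto
 qed
 thus "ALL g:inn. c g = 0" using monomials_independent[OF fin _ t, of c] ht by blast
}
show "HF chi = {%x. SUM g:inn. c g*form_of (hres g) x |c. True}"
proof(intro equalityI subsetI)
 fix W assume w: "W : HF chi"
 obtain p where p: "!!b s. s ~: bad ==> trace W b s = poly (p b) s" using trace_poly[OF P w] by metis
 define c where "c = (%g. Polynomial.coeff (p (snd g)) (fst g))"
 have key: "xcoef W (pt s t)*pe (pderiv chi) s t = (SUM g:inn. c g*(mn s t g))"
  if g: "s ~: bad" "pe chi s t = 0" for s t
 proof -
  define S where "S = (SIGMA b:{..<n}. {..degree (p b)})"
  have "xcoef W (pt s t)*pe (pderiv chi) s t = (SUM b<n. poly (p b) s*t^b)" using trace_lagrange[OF g(2), of W] p[OF g(1)] by simp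
  also have "... = (SUM (b,a):S. c (a,b)*(s^a*t^b))" unfolding S_def poly_altdef sum_distrib_right by(subst sum.Sigma) (auto simp: c_def mult_ac)
  also have "... = (SUM g:prod.swap ` S. c g*(mn s t g))" by(subst sum.reindex) (auto simp: inj_on_def intro!: sum.cong)
  also have "... = (SUM g:inn. c g*(mn s t g))"
  proof(rule sum.mono_neutral_cong)
   show "finite (prod.swap ` S)" by(simp add: S_def)
   fix g assume g: "g : inn-prod.swap ` S"
   have "(snd g,fst g) ~: S"
   proof
    assume "(snd g,fst g) : S"
    hence "prod.swap (snd g,fst g) : prod.swap ` S" by(rule imageI)
    thus False using g by simp
   qed
   hence "degree (p (snd g)) < fst g" using ht[of g] g by(simp add: S_def)
   thus "c g*(mn s t g) = 0" by(simp add: c_def coeff_eq_0)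
  next
   fix g assume g: "g : prod.swap ` S-inn"
   have "c g = 0" using trace_support[OF P w p, of "snd g" "fst g"] g by(auto simp: c_def)
   thus "c g*(mn s t g) = 0" by simp
  qed (use fin in auto)
  finally show ?thesis .
 qed
 have "W = (%x. SUM g:inn. c g*form_of (hres g) x)"
 proof(rule form_eq[OF w])
  show "(%x. SUM g:inn. c g*form_of (hres g) x) : HF chi" by(rule forms_sum) (rule rf)
 next
  fix h G r b assume t: "h : charts A" "cpar h G r b"
  show "eventually (%u. xcoef W (pt (sg h G u) (tg h G u)) = xcoef (%x. SUM g:inn. c g*form_of (hres g) x) (pt (sg h G u) (tg h G u))) (at 0)"
   using comb[OF t, of c] eventually_good[OF t]
  proof eventually_elim
   case (elim u)
   hence g: "sg h G u ~: bad" "pe chi (sg h G u) (tg h G u) = 0" by blast+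
   show ?case unfolding elim(1) key[OF g, symmetric] using good_point(3)[OF g] by simp
  qed
 qed
 thus "W : {%x. SUM g:inn. c g*form_of (hres g) x |c. True}" by blast
next
 fix W assume "W : {%x. SUM g:inn. c g*form_of (hres g) x |c. True}"
 then obtain c where "W = (%x. SUM g:inn. c g*form_of (hres g) x)" by blast
 moreover have "(%x. SUM g:inn. c g*form_of (hres g) x) : HF chi" by(rule forms_sum) (rule rf)
 ultimately show "W : HF chi" by simp
qed
qed

end

subsection \<open>Lattice polygons\<close>

text \<open>Convexity of a set of lattice points with integer weights in place of barycentric
  coordinates, so that the arguments about lattice polygons stay in integer arithmetic.\<close>

definition lattice_convex :: "mon set => bool" where
"lattice_convex A \<longleftrightarrow> (ALL e:A. ALL f:A. ALL g:A. ALL a b G::int. ALL x y::int. 0 <= a --> 0 <= b --> 0 <= G --> 0 < a+b+G -->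
  (a+b+G)*x = a*ix e+b*ix f+G*ix g -->
  (a+b+G)*y = a*iy e+b*iy f+G*iy g -->
  (EX h:A. ix h = x & iy h = y))"

lemma lattice_convexD:
assumes "lattice_convex A" "e : A" "f : A" "g : A" "0 <= a" "0 <= b" "0 <= G" "0 < a+b+G"
 "(a+b+G)*x = a*ix e+b*ix f+G*ix g"
 "(a+b+G)*y = a*iy e+b*iy f+G*iy g"
shows "EX h:A. ix h = x & iy h = y" using assms(1)[unfolded lattice_convex_def, rule_format, OF assms(2-10)] .

text \<open>Let d be the height of g over the primitive base. At height one the triangle contains d
  points whose positions, in units of the base vector, are consecutive multiples of 1/d; one of
  these is integral up to the common offset, hence a lattice point.\<close>

lemma level_one:
assumes A: "lattice_convex A" and efg: "e : A" "f : A" "g : A"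
 and cop: "gcd (ix f-ix e) (iy f-iy e) = 1" and D: "det3 e f g > 0"
shows "EX h:A. det3 e f h = 1"
proof -
define u1 u2 where "u1 = ix f-ix e" and "u2 = iy f-iy e"
define G1 G2 where "G1 = ix g-ix e" and "G2 = iy g-iy e"
obtain r s where rs: "r*u1 + s*u2 = 1" using bezout_int[of u1 u2] cop by(auto simp: u1_def u2_def)
define d where "d = u1*G2-u2*G1"
have d: "det3 e f g = d" by(simp add: det3_def d_def u1_def u2_def G1_def G2_def)
define p0 where "p0 = G1*r+G2 * s"
define p k where "p = p0 mod d" and "k = p0 div d"
have pk: "p0 = k*d+p" "0 <= p" "p < d" using D by(simp_all add: p_def k_def d)
have "p0*u1-d * s = G1*(r*u1 + s*u2)" "p0*u2+d*r = G2*(r*u1 + s*u2)" by(simp_all add: p0_def d_def alg)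
hence G: "G1 = p0*u1-d * s" "G2 = p0*u2+d*r" using rs by simp_all
\<comment> \<open>The weight b of f is the number in 0, ..., d-1 for which d divides p0 + b, and j +
  k is the quotient.\<close>
define j :: int where "j = (if p = 0 then 0 else 1)"
define x y where "x = ix e+(j + k)*u1 - s" and "y = iy e+(j + k)*u2+r"
define a b where "a = (if p = 0 then d-1 else p-1)" and "b = (if p = 0 then 0 else d-p)"
have s: "a+b+1 = d" by(simp add: a_def b_def)
have jd: "j*d = p+b" by(simp add: j_def b_def)
have x: "d*x = d*ix e+G1+b*u1"
proof -
 have "d*x = d*ix e+(j*d + k*d)*u1-d * s" by(simp add: x_def alg)
 also have "j*d + k*d = p0+b" using jd pk(1) by simp
 finally show ?thesis using G(1) by(simp add: alg)
qed
have y: "d*y = d*iy e+G2+b*u2"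
proof -
 have "d*y = d*iy e+(j*d + k*d)*u2+d*r" by(simp add: y_def alg)
 also have "j*d + k*d = p0+b" using jd pk(1) by simp
 finally show ?thesis using G(2) by(simp add: alg)
qed
have "EX h:A. ix h = x & iy h = y"
proof(rule lattice_convexD[OF A efg, of a b 1])
 show "0 <= a" "0 <= b" "(0::int) <= 1" "0 < a+b+1" using pk D s d by(auto simp: a_def b_def)
 have a: "a = d-b-1" using s by simp
 show "(a+b+1)*x = a*ix e+b*ix f+1*ix g" unfolding s x unfolding a by(simp add: u1_def G1_def alg)
 show "(a+b+1)*y = a*iy e+b*iy f+1*iy g" unfolding s y unfolding a by(simp add: u2_def G2_def alg)
qed
then obtain h where h: "h : A" "ix h = x" "iy h = y" by blast
have "det3 e f h = u1*(y-iy e)-u2*(x-ix e)" by(simp add: det3_def u1_def u2_def h)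
also have "... = r*u1 + s*u2" by(simp add: x_def y_def alg)
finally show ?thesis using h(1) rs by auto
qed

text \<open>On the supporting line take the first point e of A and its neighbour f one primitive
  step further, which lies in A by convexity; \<open>level_one\<close> provides h.\<close>

lemma line_chart:
assumes A: "lattice_convex A" "finite A" and ab: "a : A" "b : A" "a ~= b"
 and sup: "!!g. g : A ==> det3 a b g >= 0" and g0: "g0 : A" "det3 a b g0 > 0"
shows "EX q:charts A. det3 a b (fst q) = 0 & det3 a b (fst (snd q)) = 0 & det3 a b (snd (snd q)) > 0"
proof -
define b1 b2 where "b1 = ix b-ix a" and "b2 = iy b-iy a"
define d where "d = gcd b1 b2"
have "b1 ~= 0 | b2 ~= 0" using ab(3) by(auto simp: b1_def b2_def prod_eq_iff)
hence d: "d > 0" by(simp add: d_def)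
define u1 u2 where "u1 = b1 div d" and "u2 = b2 div d"
have u: "b1 = d*u1" "b2 = d*u2" unfolding u1_def u2_def d_def by(rule dvd_mult_div_cancel[symmetric], simp)+
have cop: "gcd u1 u2 = 1" unfolding u1_def u2_def d_def coprime_iff_gcd_eq_1[symmetric]
 by(rule div_gcd_coprime) (rule \<open>b1 ~= 0 | b2 ~= 0\<close>)
obtain r s where rs: "r*u1 + s*u2 = 1" using bezout_int[of u1 u2] cop by auto
\<comment> \<open>By Bezout this is an integral coordinate along the line.\<close>
define t where "t = (%g :: mon. r*(ix g-ix a) + s*(iy g-iy a))"
have det: "det3 a b g = d*(u1*(iy g-iy a)-u2*(ix g-ix a))" for g
proof -
 have "det3 a b g = b1*(iy g-iy a)-b2*(ix g-ix a)" by(simp add: det3_def b1_def b2_def)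
 thus ?thesis unfolding u by(simp add: alg)
qed
define S where "S = {g : A. det3 a b g = 0}"
have line: "ix g = ix a+t g*u1 & iy g = iy a+t g*u2" if "g : S" for g
proof -
 define x1 y1 where "x1 = ix g-ix a" and "y1 = iy g-iy a"
 have "u1*y1 = u2*x1" using that d det[of g] by(simp add: S_def x1_def y1_def)
 moreover have "t g = r*x1 + s*y1" by(simp add: t_def x1_def y1_def)
 ultimately have "t g*u1 = x1*(r*u1 + s*u2)" "t g*u2 = y1*(r*u1 + s*u2)" by(auto simp: alg)
 thus ?thesis using rs by(simp add: x1_def y1_def)
qed
have aS: "a : S" and bS: "b : S" using ab by(auto simp: S_def det3_def)
have "finite S" using A(2) by(simp add: S_def)
then obtain e where e: "e : S" "!!g. g : S ==> t e <= t g" using arg_min_if_finite[of S t] aS by(metis empty_iff not_less)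
have "t a = 0" by(simp add: t_def)
moreover have "t b = d" proof -
 have "t b = d*(r*u1 + s*u2)" using u by(simp add: t_def b1_def b2_def alg)
 thus ?thesis using rs by simp
qed
ultimately have te: "t e < t b" using e(2)[OF aS] d by simp
have "EX h:A. ix h = ix e+u1 & iy h = iy e+u2"
proof(rule lattice_convexD[OF A(1), of e b b "t b-t e-1" 1 0])
 show "e : A" "b : A" "b : A" using e(1) ab by(auto simp: S_def)
 show "0 <= t b-t e-1" using te by simp
 show "(t b-t e-1+1+0)*(ix e+u1) = (t b-t e-1)*ix e+1*ix b+0*ix b" using line[OF e(1)] line[OF bS] by(simp add: alg)
 show "(t b-t e-1+1+0)*(iy e+u2) = (t b-t e-1)*iy e+1*iy b+0*iy b" using line[OF e(1)] line[OF bS] by(simp add: alg)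
qed (use te in auto)
then obtain f where f: "f : A" "ix f = ix e+u1" "iy f = iy e+u2" by blast
have det': "det3 a b g = d*det3 e f g" for g
proof -
 have "det3 e f g = u1*(iy g-iy a)-u2*(ix g-ix a)" using line[OF e(1)] by(simp add: det3_def f alg)
 thus ?thesis by(simp only: det)
qed
have eA: "e : A" using e(1) by(simp add: S_def)
have "EX h:A. det3 e f h = 1" by(rule level_one[OF A(1) eA f(1) g0(1)]) (use f cop g0(2) d det' in \<open>auto simp: zero_less_mult_iff\<close>)
then obtain h where h: "h : A" "det3 e f h = 1" by blast
have "(e,f,h) : charts A" unfolding charts_def
proof(clarify, intro conjI ballI impI)
 show "e : A" "f : A" "h : A" "det3 e f h = 1" using eA f h by auto
 fix g assume g: "g : A"
 show "0 <= det3 e f g" using sup[OF g] d det'[of g] by(simp add: zero_le_mult_iff)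
 assume "det3 e f g = 0"
 hence gS: "g : S" using g det'[of g] by(simp add: S_def)
 have "det3 e g h = (t g-t e)*det3 e f h" unfolding det3_def f using line[OF gS] line[OF e(1)] by(simp add: alg)
 thus "0 <= det3 e g h" using e(2)[OF gS] h(2) by simp
qed
moreover have "det3 a b e = 0" "det3 a b f = 0" "det3 a b h > 0" using e(1) det'[of f] det'[of h] h(2) d by(auto simp: S_def det3_def)
ultimately show ?thesis by(intro bexI[of _ "(e,f,h)"]) auto
qed

text \<open>The pattern in which closedness is used: a and b and c are already in S and may have
  weights of any sign, while g' may lie outside S since its weight is nonnegative.\<close>

lemma closed_face_mem:
assumes S: "closed_face A S" "finite A" and p: "a : S" "b : S" "c : S" "g : A" "g' : A" and k: "0 < k" "0 <= k'"
 and rel: "k + k'+i+be+G = 0"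
  "k*ix g + k'*int (fst g')+i*ix a+be*ix b+G*ix c = 0"
  "k*iy g + k'*int (snd g')+i*iy a+be*iy b+G*iy c = 0"
shows "g : S"
proof(rule ccontr)
assume g: "g ~: S"
have SA: "S <= A" using S(1) by(simp add: closed_face_def)
\<comment> \<open>The weights are added up because the five points may coincide.\<close>
define w where "w = (%x. (if x = g then k else 0)+(if x = g' then k' else 0)+(if x = a then i else 0)
  + (if x = b then be else 0)+(if x = c then G else 0))"
have sum: "(SUM x:A. w x*h x) = k*h g + k'*h g'+i*h a+be*h b+G*h c" for h
proof -
 have 1: "(SUM x:A. (if x = y then l else 0)*h x) = l*h y" if "y : A" for y l
 proof -
  have "(SUM x:A. (if x = y then l else 0)*h x) = (SUM x:A. if x = y then l*h y else 0)" by(intro sum.cong) auto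
  thus ?thesis using S(2) that by simp
 qed
 show ?thesis unfolding w_def distrib_right sum.distrib using p SA by(simp add: 1 subsetD)
qed
have "(SUM x:A. w x) = 0" "(SUM x:A. w x*ix x) = 0" "(SUM x:A. w x*iy x) = 0"
 using sum[of "%_. 1"] sum[of "%x. ix x"] sum[of "%x. iy x"] rel by simp_all
moreover have "ALL x:A. w x < 0 --> x : S" using p(1-3) k by(auto simp: w_def)
moreover have "w g > 0" using g p(1-3) k by(auto simp: w_def)
ultimately show False using S(1) p(4) g unfolding closed_face_def by blast
qed

text \<open>Summing the relation against M minus the linear form gives 0, while every summand is
  nonnegative; so a point of positive weight attains M.\<close>

lemma supporting_face:
assumes "finite A" "!!g. g : A ==> p*ix g+q*iy g <= M"
shows "closed_face A {g:A. p*ix g+q*iy g = M}" unfolding closed_face_def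
proof(intro conjI allI impI ballI)
fix w :: "mon => int" and g
assume s: "(SUM g:A. w g) = 0" "(SUM g:A. w g*ix g) = 0" "(SUM g:A. w g*iy g) = 0"
 and neg: "ALL g:A. w g < 0 --> g : {g:A. p*ix g+q*iy g = M}" and g: "g : A" "0 < w g"
have "(SUM g:A. w g*(M-(p*ix g+q*iy g)))
  = (SUM g:A. w g)*M-p*(SUM g:A. w g*ix g)-q*(SUM g:A. w g*iy g)"
 by(simp add: sum_distrib_left sum_distrib_right sum_subtractf[symmetric] alg sum.distrib)
hence z: "(SUM g:A. w g*(M-(p*ix g+q*iy g))) = 0" using s by simp
have nn: "0 <= w x*(M-(p*ix x+q*iy x))" if "x : A" for x
proof(cases "w x < 0")
 case True thus ?thesis using neg that by auto
next
 case False thus ?thesis using assms(2)[OF that] by(intro mult_nonneg_nonneg) auto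
qed
have "ALL x:A. w x*(M-(p*ix x+q*iy x)) = 0" using sum_nonneg_eq_0_iff[OF assms(1), of "%x. w x*(M-(p*ix x+q*iy x))"] nn z by blast
thus "g : {g:A. p*ix g+q*iy g = M}" using g by auto
qed auto

text \<open>A closed face with three noncollinear points is all of A, by barycentric coordinates.
  Otherwise it lies on a line, and points of A on both sides of the line would be forced into the
  face; so the line supports A and \<open>line_chart\<close> applies in one of the two
  orientations.\<close>

lemma faces_chart:
assumes A: "lattice_convex A" "finite A" and n: "(0,0) : A" "(0,n) : A" "n > 0" and g0: "g0 : A" "fst g0 > 0"
 and S: "closed_face A S" and ab: "a : S" "b : S" "a ~= b"
shows "EX h:charts A. fst h : S & fst (snd h) : S & (snd (snd h) : S --> S = A)"
proof(cases "EX c:S. det3 a b c ~= 0")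
case True
then obtain c where c: "c : S" "det3 a b c ~= 0" by blast
have SA: "S <= A" using S by(simp add: closed_face_def)
have "g : S" if g: "g : A" for g
proof(rule closed_face_mem[OF S A(2) ab(1,2) c(1) g g, of "\<bar>det3 a b c\<bar>" 0 "- sgn (det3 a b c)*det3 b c g" "- sgn (det3 a b c)*det3 c a g"
   "- sgn (det3 a b c)*det3 a b g"])
 have s: "\<bar>x\<bar> = sgn x*x" for x :: int by(simp add: sgn_if)
 show "\<bar>det3 a b c\<bar>+0 + - sgn (det3 a b c)*det3 b c g + - sgn (det3 a b c)*det3 c a g + - sgn (det3 a b c)*det3 a b g = 0"
  unfolding s by(simp add: det3_def alg)
 show "\<bar>det3 a b c\<bar>*ix g+0*ix g + - sgn (det3 a b c)*det3 b c g*ix a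
   + - sgn (det3 a b c)*det3 c a g*ix b + - sgn (det3 a b c)*det3 a b g*ix c = 0"
  "\<bar>det3 a b c\<bar>*iy g+0*iy g + - sgn (det3 a b c)*det3 b c g*iy a
   + - sgn (det3 a b c)*det3 c a g*iy b + - sgn (det3 a b c)*det3 a b g*iy c = 0" unfolding s by(simp_all add: det3_def alg)
qed (use c in auto)
hence SA': "S = A" using SA by blast
have "EX h:charts A. det3 (0,n) (0,0) (fst h) = 0 & det3 (0,n) (0,0) (fst (snd h)) = 0 & det3 (0,n) (0,0) (snd (snd h)) > 0"
 by(rule line_chart[OF A n(2,1) _ _ g0(1)]) (use n(3) g0(2) in \<open>auto simp: det3_def\<close>)
then obtain h where "h : charts A" by blast
moreover have "fst h : A & fst (snd h) : A" using \<open>h : charts A\<close> chart_in by blast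
ultimately show ?thesis using SA' by blast
next
case False
hence col: "!!c. c : S ==> det3 a b c = 0" by blast
have SA: "S <= A" using S by(simp add: closed_face_def)
define b1 b2 where "b1 = ix b-ix a" and "b2 = iy b-iy a"
define N where "N = b1\<^sup>2+b2\<^sup>2"
have N: "N > 0" using ab(3) by(auto simp: N_def b1_def b2_def prod_eq_iff sum_power2_gt_zero_iff)
define dot where "dot = (%g :: mon. b1*(ix g-ix a)+b2*(iy g-iy a))"
have dec: "N*(ix g-ix a) = dot g*b1-det3 a b g*b2"
 "N*(iy g-iy a) = dot g*b2+det3 a b g*b1" for g by(simp_all add: N_def dot_def det3_def b1_def[symmetric] b2_def[symmetric] power2_eq_square alg)
\<comment> \<open>The weighted sum of x and y lies over the line through a and b, so it is a
  combination of a and b; the factor N clears the denominators of the orthogonal projection.\<close>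
have comb: "x : S" if x: "x : A" "y : A" "0 < k" "0 <= l" "k*det3 a b x+l*det3 a b y = 0" for x y k l
proof(rule closed_face_mem[OF S A(2) ab(1,2,1) x(1,2), of "N * k" "N*l" "k*dot x+l*dot y-N*(k+l)" "- (k*dot x+l*dot y)" 0])
 have e: "k*det3 a b x*z+l*det3 a b y*z = 0" for z using x(5) by(metis distrib_right mult_zero_left)
 have "k*(N*(ix x-ix a))+l*(N*(ix y-ix a))
   = (k*dot x+l*dot y)*b1-(k*det3 a b x*b2+l*det3 a b y*b2)" unfolding dec by(simp add: alg)
 hence "k*(N*(ix x-ix a))+l*(N*(ix y-ix a)) = (k*dot x+l*dot y)*b1" unfolding e by simp
 thus "N * k*ix x+N*l*ix y+(k*dot x+l*dot y-N*(k+l))*ix a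
   + - (k*dot x+l*dot y)*ix b+0*ix a = 0" by(simp add: b1_def alg)
 have "k*(N*(iy x-iy a))+l*(N*(iy y-iy a))
   = (k*dot x+l*dot y)*b2+(k*det3 a b x*b1+l*det3 a b y*b1)" unfolding dec by(simp add: alg)
 hence "k*(N*(iy x-iy a))+l*(N*(iy y-iy a)) = (k*dot x+l*dot y)*b2" unfolding e by simp
 thus "N * k*iy x+N*l*iy y+(k*dot x+l*dot y-N*(k+l))*iy a
   + - (k*dot x+l*dot y)*iy b+0*iy a = 0" by(simp add: b2_def alg)
qed (use N x in \<open>auto simp: alg\<close>)
have on: "g : S" if "g : A" "det3 a b g = 0" for g by(rule comb[OF that(1,1), of 1 0]) (use that in auto)
have side: "~ (det3 a b x > 0 & det3 a b y < 0)" if "x : A" "y : A" for x y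
proof
 assume "det3 a b x > 0 & det3 a b y < 0"
 hence "x : S" using comb[OF that, of "- det3 a b y" "det3 a b x"] by simp
 thus False using col \<open>det3 a b x > 0 & det3 a b y < 0\<close> by fastforce
qed
have off: "EX g:A. det3 a b g ~= 0"
proof(rule ccontr)
 assume "~ ?thesis"
 hence z: "det3 a b (0,0) = 0" "det3 a b (0,n) = 0" "det3 a b g0 = 0" using n(1,2) g0(1) by blast+
 have "b1*int n = 0" using z(1,2) by(simp add: det3_def b1_def alg)
 hence b1: "b1 = 0" using n(3) by simp
 have "b2*ix a = 0" using z(1) b1 by(simp add: det3_def b1_def[symmetric] b2_def[symmetric])
 moreover have "b2*(ix g0-ix a) = 0" using z(3) b1 by(simp add: det3_def b1_def[symmetric] b2_def[symmetric])
 moreover have "b2*ix g0 = b2*(ix g0-ix a)+b2*ix a" by(simp add: alg)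
 ultimately have "b2*ix g0 = 0" by(simp only: add_0)
 hence "b2 = 0" using g0(2) by simp
 thus False using N b1 by(simp add: N_def)
qed
have aA: "a : A" "b : A" using ab SA by auto
have swap: "det3 b a g = - det3 a b g" for g by(simp add: det3_def alg)
obtain g where g: "g : A" "det3 a b g ~= 0" using off by blast
have "EX h:charts A. det3 a b (fst h) = 0 & det3 a b (fst (snd h)) = 0 & det3 a b (snd (snd h)) ~= 0"
proof(cases "det3 a b g > 0")
 case True
 have pos: "!!x. x : A ==> det3 a b x >= 0" using side[OF g(1)] True by force
 have "EX h:charts A. det3 a b (fst h) = 0 & det3 a b (fst (snd h)) = 0 & det3 a b (snd (snd h)) > 0"
  by(rule line_chart[OF A aA ab(3) _ g(1) True]) (rule pos)
 thus ?thesis by fastforce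
next
 case False
 have pos: "!!x. x : A ==> det3 b a x >= 0" using side[OF _ g(1)] False g(2) by(force simp: swap)
 have "det3 b a g > 0" using False g(2) by(simp add: swap)
 hence "EX h:charts A. det3 b a (fst h) = 0 & det3 b a (fst (snd h)) = 0 & det3 b a (snd (snd h)) > 0"
  by(intro line_chart[OF A aA(2,1) ab(3)[symmetric] _ g(1)] pos)
 thus ?thesis unfolding swap by(auto intro!: bexI)
qed
then obtain h where t: "h : charts A" "det3 a b (fst h) = 0" "det3 a b (fst (snd h)) = 0" "det3 a b (snd (snd h)) ~= 0" by blast
have "fst h : S" "fst (snd h) : S" using on chart_in[OF t(1)] t(2,3) by blast+
moreover have "snd (snd h) ~: S" using col t(4) by blast
ultimately show ?thesis using t(1) by blast
qed

text \<open>The point (0,1) lies on the segment from (0,0) to (0,n), and \<open>level_one\<close>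
  over the base (0,1), (0,0) yields a point with first coordinate 1.\<close>

lemma unimodular_exists:
assumes A: "lattice_convex A" and n: "(0,0) : A" "(0,n) : A" "n > 0" and g0: "g0 : A" "fst g0 > 0"
shows "EX b. {(0,0),(0,1),(1,b)} <= A"
proof -
have "EX h:A. ix h = 0 & iy h = 1" by(rule lattice_convexD[OF A n(1,2,2), of "int n-1" 1 0]) (use n(3) in auto)
hence 1: "(0,1) : A" by(metis of_nat_0 of_nat_1 of_nat_eq_iff prod.collapse)
have "EX h:A. det3 (0,1) (0,0) h = 1" by(rule level_one[OF A 1 n(1) g0(1)]) (use g0(2) in \<open>auto simp: det3_def\<close>)
then obtain x y where "(x,y) : A" "x = 1" by(auto simp: det3_def)
thus ?thesis using n(1) 1 by blast
qed

subsection \<open>Sums of ceilings\<close>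

text \<open>As m is prime to mu, the residues of -mj run through 0, ..., mu-1 exactly once in each
  block of mu consecutive j.\<close>

lemma sum_residues:
fixes m mu :: int
assumes "mu > 0" "gcd m mu = 1"
shows "2*(SUM j:{1..int k*mu}. (- (m*j)) mod mu) = int k*(mu*(mu-1))"
proof(induction k)
case (Suc k)
define f where "f = (%j. (- (m*j)) mod mu)"
have inj: "inj_on f {int k*mu+1..int k*mu+mu}"
proof(rule inj_onI)
 fix x y assume xy: "x : {int k*mu+1..int k*mu+mu}" "y : {int k*mu+1..int k*mu+mu}" "f x = f y"
 have "mu dvd-(m*x) - - (m*y)" using xy(3) unfolding f_def by(rule mod_eq_dvd_iff[THEN iffD1])
 hence "mu dvd m*(y-x)" by(simp add: alg)
 moreover have "coprime mu m" using assms(2) by(simp add: coprime_iff_gcd_eq_1 gcd.commute)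
 ultimately have "mu dvd y-x" by(simp add: coprime_dvd_mult_right_iff)
 moreover have "\<bar>y-x\<bar> < mu" using xy(1,2) by auto
 ultimately show "x = y" using assms(1) dvd_imp_le_int[of "y-x" mu] by force
qed
have "f ` {int k*mu+1..int k*mu+mu} = {0..<mu}"
proof(rule card_subset_eq)
 show "f ` {int k*mu+1..int k*mu+mu} <= {0..<mu}" using assms(1) by(auto simp: f_def)
 show "card (f ` {int k*mu+1..int k*mu+mu}) = card {0..<mu}" using card_image[OF inj] by simp
qed simp
hence "sum f {int k*mu+1..int k*mu+mu} = \<Sum>{0..<mu}" using sum.reindex[OF inj, of "%x. x"] by simp
also have "... = (SUM x:{0..<nat mu}. int x)" by(rule sum.reindex_bij_witness[of _ int nat]) (use assms(1) in auto)
also have "2 * ... = mu*(mu-1)"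
proof -
 have "2*(SUM x:{0..<N}. int x) = int N*(int N-1)" for N by(induction N) (auto simp: alg)
 thus ?thesis using assms(1) by simp
qed
finally have B: "2 * sum f {int k*mu+1..int k*mu+mu} = mu*(mu-1)" by simp
have "{1..int (Suc k)*mu} = {1..int k*mu} \<union> {int k*mu+1..int k*mu+mu}"
proof -
 have "{1..N+mu} = {1..N} \<union> {N+1..N+mu}" if "0 <= N" for N using assms(1) that by auto
 moreover have "0 <= int k*mu" using assms(1) by simp
 moreover have "int (Suc k)*mu = int k*mu+mu" by(simp add: alg)
 ultimately show ?thesis by(simp only:)
qed
hence "sum f {1..int (Suc k)*mu} = sum f {1..int k*mu} + sum f {int k*mu+1..int k*mu+mu}" by(simp add: sum.union_disjoint)
hence "2 * sum f {1..int (Suc k)*mu} = int k*(mu*(mu-1))+mu*(mu-1)" using Suc.IH B by(simp add: f_def)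
thus ?case by(simp add: f_def alg)
qed simp

text \<open>Sum mu * ceiling(mj/mu) = mj + ((-mj) mod mu) over j and use
  \<open>sum_residues\<close>.\<close>

lemma sum_ceiling:
fixes m mu :: int
assumes "mu > 0" "gcd m mu = 1"
shows "2*(SUM j:{1..int k*mu}. \<lceil>real_of_int (m*j)/real_of_int mu\<rceil>) = int k*m*(int k*mu+1)+int k*(mu-1)"
proof -
have c: "mu*\<lceil>real_of_int (m*j)/real_of_int mu\<rceil> = m*j+(- (m*j)) mod mu" for j
 unfolding ceiling_divide_eq_div using minus_mult_div_eq_mod[of "- (m*j)" mu] by simp
have s: "2*(SUM j:{1..int K}. j) = int K*(int K+1)" for K
proof(induction K)
 case (Suc K)
 have "{1..int (Suc K)} = insert (int K+1) {1..int K}" by auto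
 thus ?case using Suc.IH by(simp add: alg)
qed simp
have K: "int (nat (int k*mu)) = int k*mu" using assms(1) by simp
have "mu*(2*(SUM j:{1..int k*mu}. \<lceil>real_of_int (m*j)/real_of_int mu\<rceil>))
  = 2*(SUM j:{1..int k*mu}. m*j+(- (m*j)) mod mu)" unfolding c[symmetric] by(simp add: sum_distrib_left mult_ac)
also have "... = m*(2*(SUM j:{1..int k*mu}. j))+2*(SUM j:{1..int k*mu}. (- (m*j)) mod mu)" by(simp add: sum.distrib sum_distrib_left alg)
also have "2*(SUM j:{1..int k*mu}. j) = int k*mu*(int k*mu+1)" using s[of "nat (int k*mu)"] unfolding K .
also have "m*(int k*mu*(int k*mu+1))+2*(SUM j:{1..int k*mu}. (- (m*j)) mod mu)
  = mu*(int k*m*(int k*mu+1)+int k*(mu-1))" unfolding sum_residues[OF assms] by(simp add: alg)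
finally show ?thesis using assms(1) by simp
qed

subsection \<open>The edges of the Newton polygon\<close>

locale polygon =
fixes S0 :: "mon set" and n :: nat and P :: "(real \<times> real) set"
assumes finS: "finite S0" and P: "P = convex hull (real_pt ` S0)" and S0: "(0,0) : S0" "(0,n) : S0" and n: "n > 0"
 and ht: "!!g. g : S0 ==> snd g <= n" "!!g. g : S0 ==> snd g = n ==> g = (0,n)" and dimP: "aff_dim P = 2"
begin

definition A where "A = lattice_points P"

lemma real_pt_simps [simp]: "fst (real_pt g) = real (fst g)" "snd (real_pt g) = real (snd g)"
by(simp_all add: real_pt_def split: prod.split)

lemma convexP: "convex P" by(simp add: P convex_convex_hull)
lemma compactP: "compact P" using finS by(simp add: P finite_imp_compact_convex_hull)

lemma S0_P: "g : S0 ==> real_pt g : P" unfolding P by(intro hull_inc imageI)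

lemma P_le:
assumes "!!g. g : S0 ==> a \<bullet> real_pt g <= r" "p : P" shows "a \<bullet> p <= r"
proof -
have "P <= {p. a \<bullet> p <= r}" unfolding P by(intro hull_minimal convex_halfspace_le) (use assms(1) in auto)
thus ?thesis using assms(2) by blast
qed

lemma P_quadrant: assumes "p : P" shows "0 <= fst p" "0 <= snd p" "snd p <= real n"
proof -
show "0 <= fst p" using P_le[of "(-1,0)" 0 p] assms by(cases p) (simp add: inner_Pair_0 inner_prod_def)
show "0 <= snd p" using P_le[of "(0, -1)" 0 p] assms by(cases p) (simp add: inner_prod_def)
show "snd p <= real n" using P_le[of "(0,1)" "real n" p] assms ht(1) by(cases p) (simp add: inner_prod_def)
qed

text \<open>A line through (0,n) bounds P on the right. The slope c is the largest x-coordinate,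
  which is enough because the other generating points lie at least one unit below height n.\<close>

lemma P_slope: "EX c. ALL p:P. fst p <= c*(real n - snd p)"
proof -
define c where "c = real (Max (fst ` S0))"
have "fst p+c * snd p <= c*real n" if "p : P" for p
proof -
 have "(1,c) \<bullet> p <= c*real n"
 proof(rule P_le[OF _ that])
  fix g assume g: "g : S0"
  show "(1,c) \<bullet> real_pt g <= c*real n"
  proof(cases "snd g = n")
   case True thus ?thesis using ht(2)[OF g True] by(simp add: inner_prod_def)
  next
   case False
   hence 1: "real n-real (snd g) >= 1" using ht(1)[OF g] by linarith
   have 2: "real (fst g) <= c" using g finS by(simp add: c_def)
   have "c*1 <= c*(real n-real (snd g))" using 1 by(intro mult_left_mono) (simp_all add: c_def)
   thus ?thesis using 2 by(simp add: inner_prod_def alg)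
  qed
 qed
 thus ?thesis by(simp add: inner_prod_def)
qed
hence "ALL p:P. fst p <= c*(real n - snd p)" by(simp add: alg)
thus ?thesis ..
qed

lemma A_P: "g : A \<longleftrightarrow> real_pt g : P" by(simp add: A_def lattice_points_def)

lemma S0_A: "S0 <= A" using S0_P A_P by blast

lemma A_top: "g : A ==> snd g <= n" "g : A ==> snd g = n ==> g = (0,n)"
proof -
show "g : A ==> snd g <= n" using P_quadrant(3)[of "real_pt g"] by(simp add: A_P)
obtain c where "ALL p:P. fst p <= c*(real n - snd p)" using P_slope by blast
thus "g : A ==> snd g = n ==> g = (0,n)" by(force simp: A_P prod_eq_iff)
qed

lemma finite_A: "finite A"
proof -
obtain B where B: "!!p. p : P ==> norm p <= B" using compact_imp_bounded[OF compactP] unfolding bounded_iff by blast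
have "A <= {..nat \<lceil>B\<rceil>} \<times> {..n}"
proof
 fix g assume g: "g : A"
 have "real (fst g) <= norm (real_pt g)" using norm_fst_le[of "real_pt g"] by(simp add: norm_prod_def)
 also have "... <= B" using B g by(simp add: A_P)
 finally have "fst g <= nat \<lceil>B\<rceil>" by linarith
 thus "g : {..nat \<lceil>B\<rceil>} \<times> {..n}" using A_top(1)[OF g] by(cases g) auto
qed
thus ?thesis by(rule finite_subset) auto
qed

lemma lattice_convex_A: "lattice_convex A"
unfolding lattice_convex_def
proof(intro ballI allI impI)
fix e f g and i be G x y :: int
assume efg: "e : A" "f : A" "g : A" and c: "0 <= i" "0 <= be" "0 <= G" "0 < i+be+G"
 and x: "(i+be+G)*x = i*ix e+be*ix f+G*ix g"
 and y: "(i+be+G)*y = i*iy e+be*iy f+G*iy g"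
have "0 <= (i+be+G)*x" "0 <= (i+be+G)*y" unfolding x y using c by simp_all
hence xy: "0 <= x" "0 <= y" using c(4) by(simp_all add: zero_le_mult_iff)
define s where "s = real_of_int (i+be+G)"
have s: "s > 0" using c(4) by(simp add: s_def)
define a b d where "a = real_of_int i / s" and "b = real_of_int be / s" and "d = real_of_int G / s"
have abd: "0 <= a" "0 <= b" "0 <= d" using s c by(simp_all add: a_def b_def d_def)
have "(real_of_int i+real_of_int be+real_of_int G) / s = 1" using s by(simp add: s_def)
hence sum: "a+b+d = 1" by(simp add: a_def b_def d_def add_divide_distrib)
have "a *\<^sub>R real_pt e+b *\<^sub>R real_pt f+d *\<^sub>R real_pt g : convex hull {real_pt e,real_pt f,real_pt g}"
 unfolding convex_hull_3 using abd sum by blast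
also have "... <= P" using efg by(intro hull_minimal convexP) (auto simp: A_P)
finally have "a *\<^sub>R real_pt e+b *\<^sub>R real_pt f+d *\<^sub>R real_pt g : P" .
moreover have "real_pt (nat x,nat y) = a *\<^sub>R real_pt e+b *\<^sub>R real_pt f+d *\<^sub>R real_pt g"
proof -
 have "s*real_of_int x = real_of_int i*real (fst e)+real_of_int be*real (fst f)+real_of_int G*real (fst g)"
  using arg_cong[OF x, of real_of_int] by(simp add: s_def)
 hence "real_of_int x = a*real (fst e)+b*real (fst f)+d*real (fst g)"
  using s by(simp add: a_def b_def d_def add_divide_distrib[symmetric] eq_divide_eq mult.commute)
 moreover have "s*real_of_int y = real_of_int i*real (snd e)+real_of_int be*real (snd f)+real_of_int G*real (snd g)"
  using arg_cong[OF y, of real_of_int] by(simp add: s_def)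
 hence "real_of_int y = a*real (snd e)+b*real (snd f)+d*real (snd g)"
  using s by(simp add: a_def b_def d_def add_divide_distrib[symmetric] eq_divide_eq mult.commute)
 ultimately show ?thesis using xy by(simp add: prod_eq_iff)
qed
ultimately show "EX h:A. ix h = x & iy h = y" using xy by(intro bexI[of _ "(nat x,nat y)"]) (auto simp: A_P)
qed

lemma right_point: "EX g:A. fst g > 0"
proof(rule ccontr)
assume c: "~ ?thesis"
have "P <= {p. (1,0) \<bullet> p = 0}" unfolding P
proof(rule hull_minimal)
 show "real_pt ` S0 <= {p. (1,0) \<bullet> p = 0}"
 proof
  fix p assume "p : real_pt ` S0"
  then obtain g where g: "g : S0" "p = real_pt g" by blast
  have "fst g = 0" using c subsetD[OF S0_A g(1)] by(metis gr0I)
  thus "p : {p. (1,0) \<bullet> p = 0}" by(simp add: g(2) inner_prod_def)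
 qed
 show "convex {p. (1,0) \<bullet> p = (0::real)}" by(rule convex_hyperplane)
qed
hence "aff_dim P <= aff_dim {p :: real \<times> real. (1,0) \<bullet> p = 0}" by(rule aff_dim_subset)
also have "... = int (DIM(real \<times> real)-1)" by(rule aff_dim_hyperplane) (simp add: prod_eq_iff)
finally show False using dimP by simp
qed

text \<open>Join a point of A off the y-axis to the origin or to (0,n), whichever lies on the other
  side of the height h.\<close>

lemma row_point:
assumes h: "0 < h" "h < real n" shows "EX p:P. snd p = h & 0 < fst p"
proof -
obtain g where g: "g : A" "fst g > 0" using right_point by blast
define y where "y = real (snd g)"
have "snd g ~= n" using A_top(2)[OF g(1)] g(2) by(metis fst_conv less_irrefl)
hence y: "0 <= y" "y < real n" using A_top(1)[OF g(1)] by(simp_all add: y_def)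
define q :: "real \<times> real" where "q = (if h <= y then (0,0) else (0,real n))"
define u where "u = (if h <= y then h/y else (real n-h)/(real n-y))"
have u: "0 < u" "u <= 1" using h y by(auto simp: u_def divide_simps)
have q: "q : P" using S0_P[OF S0(1)] S0_P[OF S0(2)] by(auto simp: q_def real_pt_def)
have "(1-u) *\<^sub>R q+u *\<^sub>R real_pt g : P" by(rule convexD_alt[OF convexP q]) (use g(1) u in \<open>auto simp: A_P\<close>)
moreover have "snd ((1-u) *\<^sub>R q+u *\<^sub>R real_pt g) = h"
proof(cases "h <= y")
 case True thus ?thesis using h by(simp add: q_def u_def y_def[symmetric])
next
 case False
 have "(1-u)*real n+u*y = real n-u*(real n-y)" by(simp add: alg)
 also have "u*(real n-y) = real n-h" using y False by(simp add: u_def)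
 finally show ?thesis using False by(simp add: q_def y_def[symmetric])
qed
moreover have "0 < fst ((1-u) *\<^sub>R q+u *\<^sub>R real_pt g)" using u g(2) by(simp add: q_def)
ultimately show ?thesis by blast
qed

end

locale polygon_edges = polygon +
fixes E :: "nat => (real \<times> real) set" and k :: "nat => nat" and m mu :: "nat => int" and ep :: nat
assumes E: "bij_betw E {1..ep} (first_quadrant_edges P)"
 and order: "!!i j p q. i : {1..ep} ==> j : {1..ep} ==> i < j ==> p : E i ==> q : E j ==> snd q <= snd p"
 and normal: "!!i p q. i : {1..ep} ==> p : E i ==> q : P ==>
     (1,of_int (m i) / of_int (mu i)) \<bullet> q <= (1,of_int (m i) / of_int (mu i)) \<bullet> p"
 and prim: "!!i. i : {1..ep} ==> mu i > 0 & gcd (m i) (mu i) = 1"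
 and card_E: "!!i. i : {1..ep} ==> card (lattice_points (E i)) = k i+1"
begin

text \<open>The linear form of the outer normal multiplied by the denominator mu, so that
  \<open>fi\<close> is integral on lattice points.\<close>

definition fn :: "nat => real \<times> real => real" where "fn i p = of_int (mu i)*fst p + of_int (m i) * snd p"
definition fi :: "nat => mon => int" where "fi i g = mu i*ix g+m i*iy g"

lemma fn_real_pt: "fn i (real_pt g) = of_int (fi i g)" by(simp add: fn_def fi_def)

lemma fn_inner: "fn i p = (of_int (mu i),of_int (m i)) \<bullet> p" by(simp add: fn_def inner_prod_def)

lemma edge: assumes "i : {1..ep}" shows "E i edge_of P" "~ E i <= {p. fst p = 0}" "~ E i <= {p. snd p = 0}"
using bij_betwE[OF E] assms unfolding first_quadrant_edges_def by blast+

lemma fn_max: assumes i: "i : {1..ep}" "p : E i" "q : P" shows "fn i q <= fn i p"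
proof -
have mu: "real_of_int (mu i) > 0" using prim[OF i(1)] by simp
have "fn i r = of_int (mu i)*((1,of_int (m i) / of_int (mu i)) \<bullet> r)" for r using mu by(simp add: fn_def inner_prod_def distrib_left)
thus ?thesis using normal[OF i] mu by simp
qed

lemma E_sub: "i : {1..ep} ==> E i <= P" using edge(1) edge_of_imp_subset by blast

lemma hyper_dim: "(a::real \<times> real) ~= 0 ==> aff_dim (P \<inter> {p. a \<bullet> p = r}) <= 1"
using aff_dim_subset[of "P \<inter> {p. a \<bullet> p = r}" "{p. a \<bullet> p = r}"] by simp

text \<open>The maximum face of the normal has dimension at most 1. The edge is a face of it of
  dimension 1, and a proper face would have smaller dimension.\<close>

lemma E_eq: assumes i: "i : {1..ep}" and p: "p : E i" shows "E i = {q:P. fn i q = fn i p}"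
proof -
let ?a = "(of_int (mu i),of_int (m i)) :: real \<times> real"
have a: "?a ~= 0" using prim[OF i] by(simp add: prod_eq_iff)
define F where "F = P \<inter> {q. ?a \<bullet> q = fn i p}"
have F: "F face_of P" unfolding F_def
 by(rule face_of_Int_supporting_hyperplane_le[OF convexP]) (use fn_max[OF i p] in \<open>simp add: fn_inner\<close>)
have EF: "E i <= F" using E_sub[OF i] fn_max[OF i p] fn_max[OF i _ subsetD[OF E_sub[OF i] p]] by(force simp: F_def fn_inner)
have "E i face_of F" using edge(1)[OF i] EF face_of_imp_subset[OF F] unfolding edge_of_def by(meson face_of_subset)
hence "E i = F" using face_of_aff_dim_lt[OF face_of_imp_convex[OF F], of "E i"] hyper_dim[OF a, of "fn i p"] edge(1)[OF i]
 unfolding edge_of_def F_def by fastforce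
thus ?thesis by(auto simp: F_def fn_inner)
qed

text \<open>A face of the hull of finitely many points is the hull of some of them, so highest and
  lowest points of the edge are found in S0. They differ in height, since on a line with mu > 0 the
  height determines the point.\<close>

lemma ends_exist:
assumes i: "i : {1..ep}"
shows "EX V W. V : S0 & W : S0 & real_pt V : E i & real_pt W : E i & snd W < snd V &
 (ALL p:E i. real (snd W) <= snd p & snd p <= real (snd V))"
proof -
have "E i face_of convex hull (real_pt ` S0)" using edge(1)[OF i] unfolding edge_of_def P by blast
then obtain T' where T': "T' <= real_pt ` S0" "E i = convex hull T'"
 using face_of_convex_hull_subset[of "real_pt ` S0" "E i"] finS finite_imp_compact by blast
then obtain T where T: "T <= S0" "T' = real_pt ` T" by(meson subset_imageE)
have ne: "E i ~= {}" using edge(1)[OF i] unfolding edge_of_def by auto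
have Tf: "finite T" "T ~= {}" using finite_subset[OF T(1) finS] T(2) T'(2) ne by auto
have "Max (snd ` T) : snd ` T" "Min (snd ` T) : snd ` T" using Tf by(intro Max_in Min_in; simp)+
then obtain V W where VW: "V : T" "W : T" "snd V = Max (snd ` T)" "snd W = Min (snd ` T)" by force
have sub: "convex hull T' <= {p. real (snd W) <= snd p & snd p <= real (snd V)}"
proof(rule hull_minimal)
 show "T' <= {p. real (snd W) <= snd p & snd p <= real (snd V)}"
 proof
  fix p assume "p : T'"
  then obtain g where g: "g : T" "p = real_pt g" unfolding T(2) by blast
  have "snd g <= snd V" "snd W <= snd g" unfolding VW(3,4) using g(1) Tf(1) by(auto intro: Max_ge Min_le)
  thus "p : {p. real (snd W) <= snd p & snd p <= real (snd V)}" by(simp add: g(2))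
 qed
 have "{p :: real \<times> real. real (snd W) <= snd p & snd p <= real (snd V)} = {p. (0,1) \<bullet> p >= real (snd W)} \<inter> {p. (0,1) \<bullet> p <= real (snd V)}"
  by(auto simp: inner_prod_def)
 thus "convex {p :: real \<times> real. real (snd W) <= snd p & snd p <= real (snd V)}"
  by(simp add: convex_Int convex_halfspace_ge convex_halfspace_le)
qed
have VE: "real_pt V : E i" "real_pt W : E i" using VW(1,2) unfolding T'(2) T(2) by(auto intro: hull_inc)
have "snd W < snd V"
proof(rule ccontr)
 assume "~ snd W < snd V"
 hence s: "snd p = real (snd V)" if "p : E i" for p using sub that VW(3,4) unfolding T'(2) by fastforce
 have "p = real_pt V" if p: "p : E i" for p
 proof -
  have "fn i p = fn i (real_pt V)" using E_eq[OF i VE(1)] p by blast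
  hence "fst p = real (fst V)" using s[OF p] prim[OF i] by(simp add: fn_def)
  thus ?thesis using s[OF p] by(simp add: prod_eq_iff)
 qed
 hence "E i = {real_pt V}" using VE(1) by blast
 thus False using edge(1)[OF i] unfolding edge_of_def by simp
qed
thus ?thesis using VE VW(1,2) T(1) sub unfolding T'(2) by blast
qed

definition ends :: "nat => mon \<times> (mon)" where
"ends i = (SOME (V,W). V : S0 & W : S0 & real_pt V : E i & real_pt W : E i & snd W < snd V &
 (ALL p:E i. real (snd W) <= snd p & snd p <= real (snd V)))"
abbreviation "hi i \<equiv> fst (ends i)"
abbreviation "lo i \<equiv> snd (ends i)"

lemma ends:
assumes "i : {1..ep}"
shows "hi i : A" "lo i : A" "real_pt (hi i) : E i" "real_pt (lo i) : E i" "snd (lo i) < snd (hi i)"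
 "p : E i ==> real (snd (lo i)) <= snd p" "p : E i ==> snd p <= real (snd (hi i))"
proof -
let ?Q = "%(V,W). V : S0 & W : S0 & real_pt V : E i & real_pt W : E i & snd W < snd V &
 (ALL p:E i. real (snd W) <= snd p & snd p <= real (snd V))"
obtain V W where "?Q (V,W)" using ends_exist[OF assms] by blast
from someI[of ?Q, OF this] have "?Q (hi i,lo i)" unfolding ends_def by simp
thus "hi i : A" "lo i : A" "real_pt (hi i) : E i" "real_pt (lo i) : E i" "snd (lo i) < snd (hi i)"
 "p : E i ==> real (snd (lo i)) <= snd p" "p : E i ==> snd p <= real (snd (hi i))" using S0_A by auto
qed

definition top :: "nat => int" where "top i = fi i (hi i)"

lemma E_fi: assumes i: "i : {1..ep}" shows "g : A ==> fi i g <= top i" "real_pt g : E i \<longleftrightarrow> g : A & fi i g = top i"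
"fi i (lo i) = top i" "p : P ==> fn i p <= of_int (top i)" "p : E i \<longleftrightarrow> p : P & fn i p = of_int (top i)"
proof -
show a: "p : E i \<longleftrightarrow> p : P & fn i p = of_int (top i)" for p using E_eq[OF i ends(3)[OF i]] by(auto simp: top_def fn_real_pt)
show b: "p : P ==> fn i p <= of_int (top i)" for p using fn_max[OF i ends(3)[OF i]] by(simp add: top_def fn_real_pt)
show "g : A ==> fi i g <= top i" using b[of "real_pt g"] by(simp add: A_P fn_real_pt)
show c: "real_pt g : E i \<longleftrightarrow> g : A & fi i g = top i" for g using a[of "real_pt g"] by(simp add: A_P fn_real_pt)
show "fi i (lo i) = top i" using c ends(4)[OF i] by blast
qed

text \<open>As mu and m are coprime, the lattice points on the edge differ by multiples of (-m,
  mu).\<close>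

lemma step:
assumes i: "i : {1..ep}" and g: "real_pt g : E i"
shows "EX s>=0. iy g = int (snd (lo i)) + s*mu i & ix g = int (fst (lo i)) - s*m i"
proof -
have mu: "mu i > 0" "coprime (mu i) (m i)" using prim[OF i] by(simp_all add: coprime_iff_gcd_eq_1 gcd.commute)
define dx dy where "dx = ix g-int (fst (lo i))" and "dy = iy g-int (snd (lo i))"
have e: "m i*dy = mu i*(- dx)" using E_fi(2,3)[OF i] g by(simp add: fi_def dx_def dy_def alg)
hence "mu i dvd m i*dy" by(rule dvdI)
hence "mu i dvd dy" using mu(2) by(simp add: coprime_dvd_mult_right_iff)
then obtain s where s: "dy = mu i * s" by(rule dvdE)
have "mu i*(- dx) = mu i*(s*m i)" using e unfolding s by(simp add: mult_ac)
hence "- dx = s*m i" by(rule mult_left_cancel[THEN iffD1, rotated]) (use mu(1) in simp)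
moreover have "0 <= dy" using ends(6)[OF i g] by(simp add: dy_def)
hence "s >= 0" using s mu(1) by(simp add: zero_le_mult_iff)
ultimately show ?thesis using s by(intro exI[of _ s]) (simp add: dx_def dy_def mult.commute)
qed

text \<open>If the upper end is t steps above the lower one, the edge carries t + 1 lattice points;
  comparison with the given count shows t = k i.\<close>

lemma ends_diff:
assumes i: "i : {1..ep}"
shows "int (snd (hi i)) = int (snd (lo i))+int (k i)*mu i" "int (fst (lo i)) = int (fst (hi i))+int (k i)*m i" "k i > 0"
proof -
obtain t where t: "t >= 0" "int (snd (hi i)) = int (snd (lo i))+t*mu i" "int (fst (hi i)) = int (fst (lo i))-t*m i"
 using step[OF i ends(3)[OF i]] by blast
have mu: "mu i > 0" using prim[OF i] by simp
have tp: "t > 0" using t(1,2) ends(5)[OF i] by(cases "t = 0") auto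
have inj: "inj_on (%g. iy g) (lattice_points (E i))"
proof(rule inj_onI)
 fix x y assume xy: "x : lattice_points (E i)" "y : lattice_points (E i)" "iy x = iy y"
 have "fi i x = fi i y" using xy(1,2) E_fi(2)[OF i] by(simp add: lattice_points_def)
 hence "fst x = fst y" using xy(3) mu by(simp add: fi_def)
 thus "x = y" using xy(3) by(simp add: prod_eq_iff)
qed
have "(%g. iy g) ` lattice_points (E i) = (%s. int (snd (lo i)) + s*mu i) ` {0..t}"
proof(intro equalityI subsetI)
 fix z assume "z : (%g. iy g) ` lattice_points (E i)"
 then obtain g where g: "real_pt g : E i" "z = iy g" by(auto simp: lattice_points_def)
 obtain s where s: "s >= 0" "z = int (snd (lo i)) + s*mu i" using step[OF i g(1)] g(2) by blast
 have "z <= int (snd (hi i))" using ends(7)[OF i g(1)] g(2) by simp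
 hence "s <= t" using s(2) t(2) mu by simp
 thus "z : (%s. int (snd (lo i)) + s*mu i) ` {0..t}" using s by auto
next
 fix z assume "z : (%s. int (snd (lo i)) + s*mu i) ` {0..t}"
 then obtain s where s: "0 <= s" "s <= t" "z = int (snd (lo i)) + s*mu i" by auto
 have "EX h:A. ix h = int (fst (lo i)) - s*m i & iy h = z" by(rule lattice_convexD[OF lattice_convex_A ends(2,1,1)[OF i], of "t - s" s 0])
   (use s(1,2) tp in \<open>auto simp: s(3) t(2,3) alg\<close>)
 then obtain h where h: "h : A" "ix h = int (fst (lo i)) - s*m i" "iy h = z" by blast
 have "fi i h = fi i (lo i)" unfolding fi_def h(2,3) s(3) by(simp add: alg)
 hence "real_pt h : E i" using E_fi(2,3)[OF i] h(1) by simp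
 thus "z : (%g. iy g) ` lattice_points (E i)" using h(3) by(auto simp: lattice_points_def)
qed
moreover have "inj_on (%s. int (snd (lo i)) + s*mu i) {0..t}" using mu by(auto simp: inj_on_def)
ultimately have "card (lattice_points (E i)) = card {0..t}" using card_image[OF inj] card_image by metis
hence kt: "int (k i) = t" using card_E[OF i] tp by simp
show "int (snd (hi i)) = int (snd (lo i))+int (k i)*mu i" "int (fst (lo i)) = int (fst (hi i))+int (k i)*m i" "k i > 0" using t tp kt by simp_all
qed

text \<open>The rightmost point of P at height y + 1/2 is a boundary point and so lies on a facet,
  which is a first quadrant edge because both coordinates of the point are positive. The
  half-integral height yields lo <= y and y < hi at once.\<close>

lemma cover:
assumes y: "y < n" shows "EX i:{1..ep}. snd (lo i) <= y & y < snd (hi i)"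
proof -
define h where "h = real y+1/2"
have h: "0 < h" "h < real n" using y by(auto simp: h_def)
define Q where "Q = P \<inter> {p. (0,1) \<bullet> p = h}"
have "compact Q" unfolding Q_def by(intro compact_Int_closed compactP closed_hyperplane)
moreover have "Q ~= {}" using row_point[OF h] by(auto simp: Q_def inner_prod_def)
ultimately obtain p where p: "p : Q" "!!q. q : Q ==> fst q <= fst p"
 using continuous_attains_sup[of Q fst] continuous_on_fst[OF continuous_on_id] by blast
have pP: "p : P" "snd p = h" using p(1) by(auto simp: Q_def inner_prod_def)
obtain p' where p': "p' : P" "snd p' = h" "0 < fst p'" using row_point[OF h] by blast
have fp: "fst p > 0" using p(2)[of p'] p' by(auto simp: Q_def inner_prod_def)
have "p ~: interior P"
proof
 assume "p : interior P"
 then obtain e where e: "e > 0" "ball p e <= P" by(auto simp: mem_interior)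
 have "dist p (fst p+e/2,snd p) < e" using e(1) by(simp add: dist_prod_def dist_real_def)
 hence "(fst p+e/2,snd p) : P" using e(2) by auto
 hence "(fst p+e/2,snd p) : Q" using pP(2) by(simp add: Q_def inner_prod_def)
 from p(2)[OF this] show False using e(1) by simp
qed
moreover have "rel_interior P = interior P" by(rule interior_rel_interior) (simp add: dimP)
moreover have "polyhedron P" unfolding P by(intro polytope_imp_polyhedron) (use finS in \<open>auto simp: polytope_def\<close>)
ultimately have "p : \<Union> {F. F facet_of P}" using rel_boundary_of_polyhedron[of P] pP(1) by blast
then obtain F where F: "F facet_of P" "p : F" by blast
have "F edge_of P" using F(1) dimP unfolding facet_of_def edge_of_def by simp
hence "F : first_quadrant_edges P" using F(2) fp pP(2) h(1) unfolding first_quadrant_edges_def by auto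
then obtain i where i: "i : {1..ep}" "F = E i" using bij_betw_imp_surj_on[OF E] by blast
have pe: "p : E i" using F(2) i(2) by simp
have "real (snd (lo i)) <= real y+1/2" "real y+1/2 <= real (snd (hi i))" using ends(6,7)[OF i(1) pe] pP(2) by(simp_all add: h_def)
hence "snd (lo i) <= y" "y < snd (hi i)" by linarith+
thus ?thesis using i(1) by blast
qed

lemma below: "i : {1..ep} ==> j : {1..ep} ==> i < j ==> snd (hi j) <= snd (lo i)"
using order[OF _ _ _ ends(4) ends(3)] by fastforce

abbreviation "blk i \<equiv> {snd (lo i)..<snd (hi i)}"

lemma blk_disj: "i : {1..ep} ==> j : {1..ep} ==> i ~= j ==> blk i \<inter> blk j = {}"
using below[of i j] below[of j i] by(cases "i < j") auto

lemma blk_union: "{..<n} = (UN i:{1..ep}. blk i)"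
proof(intro equalityI subsetI)
fix y assume "y : {..<n}" thus "y : (UN i:{1..ep}. blk i)" using cover[of y] by auto
next
fix y assume "y : (UN i:{1..ep}. blk i)"
then obtain i where "i : {1..ep}" "y : blk i" by blast
thus "y : {..<n}" using A_top(1)[OF ends(1)[of i]] by auto
qed

lemma card_blk: "i : {1..ep} ==> int (card (blk i)) = int (k i)*mu i"
using ends_diff(1)[of i] ends(5)[of i] by(simp add: of_nat_diff)

lemma hi_height:
assumes i: "i : {1..ep}" shows "int (snd (hi i)) = int n-(SUM j:{1..<i}. int (k j)*mu j)"
proof -
have "{snd (hi i)..<n} = (UN j:{1..<i}. blk j)"
proof(intro equalityI subsetI)
 fix y assume y: "y : {snd (hi i)..<n}"
 hence "y : {..<n}" by simp
 then obtain j where j: "j : {1..ep}" "y : blk j" unfolding blk_union by blast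
 have "j < i" using below[OF i j(1)] j(2) y ends(5)[OF i] by(cases "i = j"; cases "i < j") auto
 thus "y : (UN j:{1..<i}. blk j)" using j by auto
next
 fix y assume "y : (UN j:{1..<i}. blk j)"
 then obtain j where j: "1 <= j" "j < i" "y : blk j" by auto
 hence je: "j : {1..ep}" using i by auto
 have "y : {..<n}" unfolding blk_union using je j(3) by blast
 thus "y : {snd (hi i)..<n}" using below[OF i je] below[OF je i j(2)] j(3) by auto
qed
moreover have "card (UN j:{1..<i}. blk j) = (SUM j:{1..<i}. card (blk j))"
proof(rule card_UN_disjoint)
 have "{1..<i} <= {1..ep}" using i by auto
 thus "ALL j:{1..<i}. ALL j':{1..<i}. j ~= j' --> blk j \<inter> blk j' = {}" using blk_disj by blast
qed auto
moreover have "int (SUM j:{1..<i}. card (blk j)) = (SUM j:{1..<i}. int (k j)*mu j)"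
 unfolding of_nat_sum by(intro sum.cong refl card_blk) (use i in auto)
moreover have "int (card {snd (hi i)..<n}) = int n-int (snd (hi i))" using A_top(1)[OF ends(1)[OF i]] by(simp add: of_nat_diff)
ultimately show ?thesis by simp
qed

text \<open>Consecutive edges share an end point: the lower end of one and the upper end of the next
  have equal height, and each of the two normals is maximal at its own end, which gives both
  inequalities for the x-coordinates.\<close>

lemma hi_pos:
assumes i: "i : {1..ep}" shows "int (fst (hi i)) = (SUM j:{1..<i}. int (k j)*m j)" using i
proof(induction i)
case (Suc i)
show ?case
proof(cases "i = 0")
 case True
 have "snd (hi 1) = n" using hi_height[OF Suc.prems] True by simp
 thus ?thesis using A_top(2)[OF ends(1)[OF Suc.prems]] True by simp
next
 case False
 hence i: "i : {1..ep}" using Suc.prems by auto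
 have s: "{1..<Suc i} = insert i {1..<i}" using False by auto
 have h: "snd (hi (Suc i)) = snd (lo i)" using hi_height[OF Suc.prems] hi_height[OF i] ends_diff(1)[OF i] False by(simp add: s)
 have "mu i*int (fst (hi (Suc i))) <= mu i*int (fst (lo i))" using E_fi(1)[OF i ends(1)[OF Suc.prems]] E_fi(3)[OF i] h by(simp add: fi_def)
 moreover have "mu (Suc i)*int (fst (lo i)) <= mu (Suc i)*int (fst (hi (Suc i)))"
  using E_fi(1)[OF Suc.prems ends(2)[OF i]] h by(simp add: top_def fi_def)
 ultimately have "int (fst (hi (Suc i))) = int (fst (lo i))" using prim[OF i] prim[OF Suc.prems] by simp
 thus ?thesis using Suc.IH[OF i] ends_diff(2)[OF i] False by(simp add: s)
qed
qed simp

end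

context polygon_edges begin

definition II :: "mon set" where
"II = {g. ALL i:{1..ep}. fi i (Suc (fst g),Suc (snd g)) < top i}"

lemma edge_scale:
assumes i: "i : {1..ep}" and ef: "real_pt e : E i" "real_pt f : E i" and h: "h : A" "det3 e f h = 1"
shows "EX t>0. ALL w. det3 e f w = t*(top i-fi i w)"
proof -
obtain s where s: "iy e = int (snd (lo i)) + s*mu i" "ix e = int (fst (lo i)) - s*m i" using step[OF i ef(1)] by blast
obtain s' where s': "iy f = int (snd (lo i)) + s'*mu i" "ix f = int (fst (lo i)) - s'*m i" using step[OF i ef(2)] by blast
have te: "top i = fi i (lo i)" by(rule E_fi(3)[OF i, symmetric])
have d: "det3 e f w = (s' - s)*(top i-fi i w)" for w unfolding det3_def s s' te fi_def by(simp add: alg)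
have "(s' - s)*(top i-fi i h) = 1" using d[of h] h(2) by simp
moreover have "0 <= top i-fi i h" using E_fi(1)[OF i h(1)] by simp
ultimately have "s' - s > 0" by(metis less_le_not_le not_le mult_nonpos_nonneg zero_less_one)
thus ?thesis using d by blast
qed

text \<open>Every first quadrant edge carries a chart, by \<open>faces_chart\<close>. Conversely the
  line of a chart is an axis or carries a first quadrant edge, and there the determinant is a
  positive multiple of the slack of the edge. The trichotomy is a hypothesis here because it is
  proved for the curve, in \<open>chart_edge\<close>.\<close>

lemma charts_II:
assumes ce: "!!ch. ch : charts A ==> (ALL w. det3 (fst ch) (fst (snd ch)) w = ix w) |
 (ALL w. det3 (fst ch) (fst (snd ch)) w = iy w) |
 (EX mu m M. 0 < mu & (ALL w. det3 (fst ch) (fst (snd ch)) w = M-mu*ix w-m*iy w))"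
shows "{g. ALL ch:charts A. 0 < det3 (fst ch) (fst (snd ch)) (Suc (fst g),Suc (snd g))} = II"
proof(intro equalityI subsetI)
fix g assume "g : {g. ALL ch:charts A. 0 < det3 (fst ch) (fst (snd ch)) (Suc (fst g),Suc (snd g))}"
hence g: "!!ch. ch : charts A ==> 0 < det3 (fst ch) (fst (snd ch)) (Suc (fst g),Suc (snd g))" by blast
show "g : II" unfolding II_def
proof(intro CollectI ballI)
 fix i assume i: "i : {1..ep}"
 define S where "S = {g:A. mu i*ix g+m i*iy g = top i}"
 have cf: "closed_face A S" unfolding S_def by(rule supporting_face[OF finite_A]) (use E_fi(1)[OF i] in \<open>simp add: fi_def\<close>)
 have SE: "x : S ==> real_pt x : E i" for x using E_fi(2)[OF i] by(simp add: S_def fi_def)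
 have ends_S: "hi i : S" "lo i : S" "hi i ~= lo i" using E_fi(3)[OF i] ends[OF i] by(auto simp: S_def top_def fi_def)
 obtain r where r: "r : A" "fst r > 0" using right_point by blast
 have "EX ch:charts A. fst ch : S & fst (snd ch) : S & (snd (snd ch) : S --> S = A)"
  using S0 S0_A by(intro faces_chart[OF lattice_convex_A finite_A _ _ n r cf ends_S]) auto
 then obtain ch where t: "ch : charts A" "fst ch : S" "fst (snd ch) : S" by blast
 have "snd (snd ch) : A" "det3 (fst ch) (fst (snd ch)) (snd (snd ch)) = 1" using t(1) unfolding charts_def by auto
 then obtain t' where "t' > 0" "!!w. det3 (fst ch) (fst (snd ch)) w = t'*(top i-fi i w)" using edge_scale[OF i SE[OF t(2)] SE[OF t(3)]] by blast
 thus "fi i (Suc (fst g),Suc (snd g)) < top i" using g[OF t(1)] by(simp add: zero_less_mult_iff)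
qed
next
fix g assume g: "g : II"
show "g : {g. ALL ch:charts A. 0 < det3 (fst ch) (fst (snd ch)) (Suc (fst g),Suc (snd g))}"
proof(intro CollectI ballI)
 fix ch assume th: "ch : charts A"
 obtain e f h where T: "ch = (e,f,h)" by(cases ch)
 have c: "e : A" "f : A" "h : A" "det3 e f h = 1" "!!w. w : A ==> 0 <= det3 e f w" using th unfolding charts_def T by auto
 consider "ALL w. det3 e f w = ix w" | "ALL w. det3 e f w = iy w"
  | p q M where "0 < p" "ALL w. det3 e f w = M-p*ix w-q*iy w" using ce[OF th] unfolding T by auto
 thus "0 < det3 (fst ch) (fst (snd ch)) (Suc (fst g),Suc (snd g))"
 proof cases
  case 3
  have ef: "e ~= f" using c(4) by(auto simp: det3_def)
  have e0: "p*ix e+q*iy e = M" "p*ix f+q*iy f = M" using 3(2)[rule_format, of e] 3(2)[rule_format, of f] by(simp_all add: det3_def)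
  let ?a = "(of_int p,of_int q) :: real \<times> real"
  define F where "F = P \<inter> {x. ?a \<bullet> x = of_int M}"
  have ap: "?a \<bullet> real_pt w = of_int (p*ix w+q*iy w)" for w by(simp add: inner_prod_def)
  have le: "?a \<bullet> x <= of_int M" if "x : P" for x
  proof(rule P_le[OF _ that])
   fix w assume "w : S0"
   hence "0 <= det3 e f w" using c(5) S0_A by blast
   thus "?a \<bullet> real_pt w <= of_int M" unfolding ap of_int_le_iff using 3(2) by simp
  qed
  have F: "F face_of P" unfolding F_def by(rule face_of_Int_supporting_hyperplane_le[OF convexP le])
  have eF: "real_pt e : F" "real_pt f : F" using c(1,2) e0 unfolding F_def by(auto simp: ap A_P simp del: of_int_add of_int_mult)
  have "real_pt e ~= real_pt f" using ef by(auto simp: real_pt_def split: prod.splits)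
  hence "1 <= aff_dim F" using aff_dim_subset[of "{real_pt e,real_pt f}" F] eF by simp
  moreover have "aff_dim F <= 1" unfolding F_def by(rule hyper_dim) (use 3(1) in \<open>simp add: prod_eq_iff\<close>)
  ultimately have "F edge_of P" using F unfolding edge_of_def by simp
  moreover have "~ F <= {x. snd x = 0}"
  proof
   assume "F <= {x. snd x = 0}"
   hence s: "snd e = 0" "snd f = 0" using eF by auto
   hence "p*(ix e-ix f) = 0" using e0 by(simp add: alg)
   thus False using 3(1) s ef by(simp add: prod_eq_iff)
  qed
  moreover have "~ F <= {x. fst x = 0}"
  proof
   assume "F <= {x. fst x = 0}"
   hence s: "fst e = 0" "fst f = 0" using eF by auto
   hence "q*(iy e-iy f) = 0" using e0 by(simp add: alg)
   hence "q = 0" using s ef by(simp add: prod_eq_iff)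
   hence "det3 e f h = - p*ix h" using 3(2)[rule_format, of h] e0(1) s by simp
   moreover have "p*ix h >= 0" using 3(1) by simp
   ultimately show False using c(4) by simp
  qed
  ultimately have "F : first_quadrant_edges P" unfolding first_quadrant_edges_def by blast
  then obtain i where i: "i : {1..ep}" "F = E i" using bij_betw_imp_surj_on[OF E] by blast
  obtain t' where "t' > 0" "!!w. det3 e f w = t'*(top i-fi i w)" using edge_scale[OF i(1) _ _ c(3,4)] eF unfolding i(2) by blast
  thus ?thesis using g i(1) unfolding II_def T by(simp add: zero_less_mult_iff)
 qed (auto simp: T)
qed
qed

definition bk :: "nat => nat" where "bk y = (SOME i. i : {1..ep} & y : blk i)"

lemma bk_eq: assumes "i : {1..ep}" "y : blk i" shows "bk y = i"
unfolding bk_def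
proof(rule some_equality)
fix j assume "j : {1..ep} & y : blk j"
thus "j = i" using blk_disj[of i j] assms by blast
qed (use assms in simp)

lemma bk: assumes "y < n" shows "bk y : {1..ep}" "y : blk (bk y)"
proof -
have "y : {..<n}" using assms by simp
then obtain i where i: "i : {1..ep}" "y : blk i" unfolding blk_union by blast
show "bk y : {1..ep}" "y : blk (bk y)" using i bk_eq[OF i] by auto
qed

text \<open>The x-coordinate of the right boundary of P at height y.\<close>

definition bound :: "nat => real" where
"bound y = of_int (top (bk y)-m (bk y)*int y) / of_int (mu (bk y))"

lemma bound_less: "y < n ==> real_of_int x < bound y \<longleftrightarrow> mu (bk y)*x+m (bk y)*int y < top (bk y)"
proof -
assume y: "y < n"
have mu: "real_of_int (mu (bk y)) > 0" using prim bk(1)[OF y] by simp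
have "real_of_int x < bound y \<longleftrightarrow> real_of_int x*real_of_int (mu (bk y)) < of_int (top (bk y)-m (bk y)*int y)"
 unfolding bound_def by(rule pos_less_divide_eq[OF mu])
also have "... \<longleftrightarrow> x*mu (bk y) < top (bk y)-m (bk y)*int y" by(metis of_int_less_iff of_int_mult)
finally show ?thesis by(simp add: alg)
qed

text \<open>In a row only the edge crossing that row matters: its point at height y belongs to P, so
  it satisfies all other edge inequalities, and a point strictly to its left satisfies them
  strictly.\<close>

lemma row_iff:
assumes y: "y < n" and x: "mu (bk y)*x+m (bk y)*int y < top (bk y)" and j: "j : {1..ep}"
shows "mu j*x+m j*int y < top j"
proof -
define i where "i = bk y"
have i: "i : {1..ep}" "y : blk i" using bk[OF y] by(simp_all add: i_def)
have mu: "real_of_int (mu i) > 0" "real_of_int (mu j) > 0" using prim i(1) j by auto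
define L H where "L = real (snd (lo i))" and "H = real (snd (hi i))"
have LH: "L < H" "L <= real y" "real y <= H" using i(2) by(auto simp: L_def H_def)
define u where "u = (real y-L)/(H-L)"
have u: "0 <= u" "u <= 1" "u*(H-L) = real y-L" using LH by(simp_all add: u_def)
define p where "p = (1-u) *\<^sub>R real_pt (lo i)+u *\<^sub>R real_pt (hi i)"
have pP: "p : P" unfolding p_def by(rule convexD_alt[OF convexP]) (use ends(1,2)[OF i(1)] u in \<open>auto simp: A_P\<close>)
have "snd p = L+u*(H-L)" by(simp add: p_def L_def H_def alg)
hence sp: "snd p = real y" using u(3) by simp
have "fn i p = (1-u)*fn i (real_pt (lo i))+u*fn i (real_pt (hi i))" by(simp add: fn_def p_def alg)
hence "fn i p = of_int (top i)" using E_fi(3)[OF i(1)] by(simp add: fn_real_pt top_def alg)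
hence e: "of_int (mu i)*fst p + of_int (m i)*real y = of_int (top i)" using sp by(simp add: fn_def)
have "real_of_int (mu i*x+m i*int y) < of_int (top i)" using x unfolding i_def[symmetric] of_int_less_iff .
hence "of_int (mu i)*real_of_int x < of_int (mu i)*fst p" using e by simp
hence "real_of_int x < fst p" using mu(1) by(simp add: mult_less_cancel_left_pos)
hence "of_int (mu j)*real_of_int x < of_int (mu j)*fst p" using mu(2) by simp
moreover have "of_int (mu j)*fst p + of_int (m j)*real y <= of_int (top j)" using E_fi(4)[OF j pP] sp by(simp add: fn_def)
ultimately have "real_of_int (mu j*x+m j*int y) < of_int (top j)" by simp
thus ?thesis unfolding of_int_less_iff .
qed

text \<open>For 0 < y < n this is the number of interior lattice points in row y, that is, of
  positive integers below \<open>bound y\<close>.\<close>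

definition cw :: "nat => int" where "cw y = \<lceil>bound y\<rceil>-1"

lemma cw_less: "y < n ==> int a < cw y \<longleftrightarrow> mu (bk y)*(int a+1)+m (bk y)*int y < top (bk y)"
proof -
assume y: "y < n"
have "int a < cw y \<longleftrightarrow> int a+1 < \<lceil>bound y\<rceil>" by(auto simp: cw_def)
also have "... \<longleftrightarrow> real_of_int (int a+1) < bound y" by(rule less_ceiling_iff)
finally show ?thesis unfolding bound_less[OF y] .
qed

lemma cw_nonneg: assumes "0 < y" "y < n" shows "0 <= cw y"
proof -
have h: "0 < real y" "real y < real n" using assms by simp_all
obtain p where p: "p : P" "snd p = real y" "0 < fst p" using row_point[OF h] by blast
note i = bk(1)[OF assms(2)]
have mu: "real_of_int (mu (bk y)) > 0" using prim[OF i] by simp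
have "of_int (mu (bk y))*fst p + of_int (m (bk y))*real y <= of_int (top (bk y))" using E_fi(4)[OF i p(1)] p(2) by(simp add: fn_def)
moreover have "0 < of_int (mu (bk y))*fst p" using mu p(3) by simp
ultimately have "0 < bound y" unfolding bound_def using mu by(intro divide_pos_pos) simp_all
hence "0 < \<lceil>bound y\<rceil>" by simp
thus ?thesis by(simp add: cw_def)
qed

lemma first: "1 : {1..ep}" "hi 1 = (0,n)" "m 1 >= 0"
proof -
show 1: "1 : {1..ep}" using cover[OF n] by auto
show h: "hi 1 = (0,n)" using hi_height[OF 1] hi_pos[OF 1] by(simp add: prod_eq_iff)
have "0 <= int (k 1)*m 1" using ends_diff(2)[OF 1] h by(metis add_0 fst_conv of_nat_0 of_nat_0_le_iff)
thus "m 1 >= 0" using ends_diff(3)[OF 1] by(simp add: zero_le_mult_iff)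
qed

text \<open>The first edge starts at (0,n) with m 1 >= 0, so its strict inequality fails from height
  n upwards. This supplies the degree bound in y required by \<open>genus_inn\<close>.\<close>

lemma II_height: assumes "g : II" shows "Suc (snd g) < n"
proof(rule ccontr)
assume "~ ?thesis"
hence y: "int n <= int (Suc (snd g))" by simp
have "fi 1 (Suc (fst g),Suc (snd g)) < top 1" using assms first(1) unfolding II_def by blast
hence "mu 1*int (Suc (fst g))+m 1*int (Suc (snd g)) < m 1*int n" unfolding fi_def top_def first(2) by simp
moreover have "m 1*int n <= m 1*int (Suc (snd g))" using y first(3) by(rule mult_left_mono)
moreover have "0 <= mu 1*int (Suc (fst g))" using prim[OF first(1)] by simp
ultimately show False by linarith
qed

lemma II_rows: "II = (%(y,a). (a,y-1)) ` (SIGMA y:{1..<n}. {..<nat (cw y)})"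
proof(intro equalityI subsetI)
fix g assume g: "g : II"
obtain a b where ab: "g = (a,b)" by(cases g)
have y: "Suc b < n" using II_height[OF g] ab by simp
have "fi (bk (Suc b)) (Suc a,Suc b) < top (bk (Suc b))" using g bk(1)[OF y] unfolding II_def ab by auto
hence "int a < cw (Suc b)" unfolding cw_less[OF y] by(simp add: fi_def add.commute)
thus "g : (%(y,a). (a,y-1)) ` (SIGMA y:{1..<n}. {..<nat (cw y)})" using y by(intro image_eqI[of _ _ "(Suc b,a)"]) (auto simp: ab)
next
fix g assume "g : (%(y,a). (a,y-1)) ` (SIGMA y:{1..<n}. {..<nat (cw y)})"
then obtain y a where ya: "1 <= y" "y < n" "int a < cw y" "g = (a,y-1)" by auto
have "mu j*(int a+1)+m j*int y < top j" if "j : {1..ep}" for j by(rule row_iff[OF ya(2) _ that]) (use ya(3) cw_less[OF ya(2)] in blast)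
thus "g : II" using ya(1,4) unfolding II_def fi_def by(auto simp: add.commute)
qed

lemma finite_II: "finite II" unfolding II_rows by(intro finite_imageI finite_SigmaI) auto

text \<open>Number the rows of the block downwards from the upper end, j = 1, ..., k mu. The
  boundary then moves right by m/mu per row, starting from the x-coordinate of that end, and
  \<open>sum_ceiling\<close> applies.\<close>

lemma sum_block:
assumes i: "i : {1..ep}"
shows "2*(SUM y:blk i. cw y) = 2*(int (k i)*mu i*(int (fst (hi i))-1))
 + int (k i)*m i*(int (k i)*mu i+1)+int (k i)*(mu i-1)"
proof -
have mu: "mu i > 0" "gcd (m i) (mu i) = 1" using prim[OF i] by auto
have v: "int (snd (hi i)) = int (snd (lo i))+int (k i)*mu i" by(rule ends_diff(1)[OF i])
have cg: "\<lceil>of_int z+x\<rceil> = z+\<lceil>x\<rceil>" for z and x :: real by(metis add.commute ceiling_add_of_int)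
have "(SUM y:blk i. cw y) = (SUM j:{1..int (k i)*mu i}. int (fst (hi i))+\<lceil>real_of_int (m i*j)/real_of_int (mu i)\<rceil>-1)"
proof(rule sum.reindex_bij_witness[of _ "%j. nat (int (snd (hi i))-j)" "%y. int (snd (hi i))-int y"])
 fix y assume y: "y : blk i"
 define j where "j = int (snd (hi i))-int y"
 have "top i-m i*int y = mu i*int (fst (hi i))+m i*j" by(simp add: top_def fi_def j_def alg)
 hence "bound y = of_int (mu i*int (fst (hi i))+m i*j) / of_int (mu i)" unfolding bound_def bk_eq[OF i y] by simp
 also have "... = of_int (int (fst (hi i))) + of_int (m i*j) / of_int (mu i)" using mu(1) by(simp add: add_divide_distrib)
 finally have "\<lceil>bound y\<rceil> = int (fst (hi i))+\<lceil>real_of_int (m i*j)/real_of_int (mu i)\<rceil>" by(simp only: cg)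
 thus "int (fst (hi i))+\<lceil>real_of_int (m i*(int (snd (hi i))-int y))/real_of_int (mu i)\<rceil>-1 = cw y" by(simp add: cw_def j_def)
qed (use v in \<open>auto simp: nat_less_iff le_nat_iff\<close>)
also have "... = int (k i)*mu i*(int (fst (hi i))-1)+(SUM j:{1..int (k i)*mu i}. \<lceil>real_of_int (m i*j)/real_of_int (mu i)\<rceil>)"
 using mu(1) by(simp add: sum.distrib sum_subtractf alg)
finally show ?thesis using sum_ceiling[OF mu, of "k i"] by(simp add: alg)
qed

lemma card_II: "real (card II) = gamma_number ep k m mu"
proof -
let ?T = "SIGMA y:{1..<n}. {..<nat (cw y)}"
have "inj_on (%(y,a). (a,y-1)) ?T" by(auto simp: inj_on_def)
hence "card II = card ?T" unfolding II_rows by(rule card_image)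
also have "... = (SUM y:{1..<n}. nat (cw y))" by simp
finally have "int (card II) = (SUM y:{1..<n}. int (nat (cw y)))" by(simp only: of_nat_sum)
also have "... = (SUM y:{1..<n}. cw y)" by(intro sum.cong refl) (simp add: cw_nonneg)
finally have "int (card II) = (SUM y:{1..<n}. cw y)" .
moreover have "{..<n} = insert 0 {1..<n}" using n by auto
ultimately have c1: "int (card II) = (SUM y:{..<n}. cw y)-cw 0" by simp
have c2: "(SUM y:{..<n}. cw y) = (SUM i:{1..ep}. SUM y:blk i. cw y)" unfolding blk_union by(rule sum.UNION_disjoint) (use blk_disj in auto)
have e: "ep : {1..ep}" using first(1) by simp
have all: "(SUM j:{1..ep}. int (k j)*mu j) = int n"
proof -
 have "card (UN i:{1..ep}. blk i) = (SUM i:{1..ep}. card (blk i))" by(rule card_UN_disjoint) (use blk_disj in auto)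
 hence "int n = (SUM i:{1..ep}. int (card (blk i)))" unfolding blk_union[symmetric] by(simp flip: of_nat_sum)
 thus ?thesis using card_blk by simp
qed
have split: "{1..ep} = insert ep {1..<ep}" using e by auto
have "int (snd (hi ep)) = int (k ep)*mu ep" using hi_height[OF e] all unfolding split by simp
hence lo0: "snd (lo ep) = 0" using ends_diff(1)[OF e] by simp
hence b0: "bk 0 = ep" using ends(5)[OF e] by(intro bk_eq[OF e]) simp
have "top ep = mu ep*int (fst (lo ep))" using E_fi(3)[OF e] lo0 by(simp add: fi_def)
hence "bound 0 = of_int (int (fst (lo ep)))" unfolding bound_def b0 using prim[OF e] by simp
\<comment> \<open>The blocks include row 0, which has no interior points and has to be subtracted
  again. The last edge ends on the x-axis at the sum of all k m, which is where \<open>cw 0\<close>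
  comes from and, with it, the final + 1 of the genus formula.\<close>
hence c0: "cw 0 = int (fst (lo ep))-1" unfolding cw_def by(simp only: ceiling_of_int)
have lx: "int (fst (lo ep)) = (SUM j:{1..ep}. int (k j)*m j)" using ends_diff(2)[OF e] hi_pos[OF e] unfolding split by simp
have "2*int (card II) = (SUM i:{1..ep}. 2*(SUM y:blk i. cw y))-2*(SUM j:{1..ep}. int (k j)*m j)+2"
 unfolding c1 c2 c0 lx by(simp add: sum_distrib_left)
also have "(SUM i:{1..ep}. 2*(SUM y:blk i. cw y)) = (SUM i:{1..ep}. 2*(int (k i)*mu i*((SUM j:{1..<i}. int (k j)*m j)-1))
 + int (k i)*m i*(int (k i)*mu i+1)+int (k i)*(mu i-1))" by(intro sum.cong refl) (simp add: sum_block hi_pos)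
finally have I: "2*int (card II) = (SUM i:{1..ep}. (2*(int (k i)*mu i*((SUM j:{1..<i}. int (k j)*m j)-1))
 + int (k i)*m i*(int (k i)*mu i+1)+int (k i)*(mu i-1))-2*(int (k i)*m i))+2" by(simp add: sum_subtractf sum_distrib_left)
have "2*real (card II) = real_of_int (2*int (card II))" by simp
also have "... = (SUM i:{1..ep}. 2*(real (k i) * of_int (mu i) *
    ((SUM j = 1..<i. real (k j) * of_int (m j))+(real (k i) * of_int (m i)-1)/2))
  - 2*(real (k i)*(of_int (m i)+1)/2))+2" unfolding I of_int_add of_int_sum of_int_numeral
 by(intro arg_cong2[of _ _ _ _ "(+)"] refl sum.cong) (simp add: field_simps)
also have "... = 2*gamma_number ep k m mu" by(simp add: gamma_number_def sum_subtractf sum_distrib_left)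
finally show ?thesis by simp
qed

end

subsection \<open>Generic coefficients\<close>

text \<open>Extended by zero off the torus, so that exponents add under multiplication everywhere,
  also when they are negative.\<close>

definition lmon :: "'j set => ('j => int) => ('j => complex) => complex" where
"lmon J b z = (if ALL j:J. z j ~= 0 then PROD j:J. z j powi b j else 0)"

text \<open>Laurent polynomials with exponents bounded by C: a space spanned by (2C+1)^|J| elements,
  the count used in \<open>not_dominant\<close>.\<close>

definition lsp :: "'j set => nat => (('j => complex) => complex) set" where
"lsp J C = cfun.span (lmon J ` (PiE J (%_. {- int C..int C})))"

lemma lmon_in:
assumes "!!j. j : J ==> \<bar>b j\<bar> <= int C" shows "lmon J b : lsp J C"
proof -
have "lmon J b = lmon J (restrict b J)" by(rule ext) (simp add: lmon_def cong: prod.cong)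
moreover have "restrict b J : PiE J (%_. {- int C..int C})" using assms by(auto simp: abs_le_iff minus_le_iff)
ultimately show ?thesis unfolding lsp_def by(intro cfun.span_base) simp
qed

lemma lmon_mult: "lmon J b z*lmon J b' z = lmon J (%j. b j+b' j) z"
by(simp add: lmon_def power_int_add prod.distrib[symmetric] cong: prod.cong)

lemma lsp_add: "f : lsp J C ==> g : lsp J C ==> (%z. f z+g z) : lsp J C"
unfolding lsp_def using cfun.span_add by(fastforce simp: plus_fun_def)

lemma lsp_scale: "f : lsp J C ==> (%z. a*f z) : lsp J C"
unfolding lsp_def by(rule cfun.span_scale)

lemma lsp_zero: "(%z. 0) : lsp J C"
unfolding lsp_def using cfun.span_zero by(simp add: zero_fun_def)

lemma lsp_induct:
assumes f: "f : lsp J C" and b: "!!be. be : PiE J (%_. {- int C..int C}) ==> Q (lmon J be)"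
 and c: "Q (%z. 0)" "!!f g. Q f ==> Q g ==> Q (%z. f z+g z)" "!!a f. Q f ==> Q (%z. a*f z)"
shows "Q f"
proof(rule cfun.span_induct[OF f[unfolded lsp_def], where P = Q])
show "cfun.subspace (Collect Q)" unfolding cfun.subspace_def using c by(simp add: zero_fun_def plus_fun_def)
show "Q g" if "g : lmon J ` (PiE J (%_. {- int C..int C}))" for g using that b by blast
qed

lemma lsp_mono: assumes "f : lsp J C" "C <= C'" shows "f : lsp J C'"
proof(rule lsp_induct[OF assms(1), where Q = "%f. f : lsp J C'"])
fix b assume "b : PiE J (%_. {- int C..int C})"
hence "\<bar>b j\<bar> <= int C'" if "j : J" for j using that assms(2) by(force simp: PiE_def Pi_def abs_le_iff)
thus "lmon J b : lsp J C'" by(rule lmon_in)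
qed (auto intro: lsp_zero lsp_add lsp_scale)

lemma lsp_mult: assumes f: "f : lsp J C" and g: "g : lsp J C'" shows "(%z. f z*g z) : lsp J (C+C')"
proof(rule lsp_induct[OF f, where Q = "%f. (%z. f z*g z) : lsp J (C+C')"])
fix be assume b: "be : PiE J (%_. {- int C..int C})"
show "(%z. lmon J be z*g z) : lsp J (C+C')"
proof(rule lsp_induct[OF g, where Q = "%g. (%z. lmon J be z*g z) : lsp J (C+C')"])
 fix be' assume b': "be' : PiE J (%_. {- int C'..int C'})"
 have "\<bar>be j+be' j\<bar> <= int (C+C')" if j: "j : J" for j
 proof -
  have "be j : {- int C..int C}" "be' j : {- int C'..int C'}" using b b' j by(auto simp: PiE_def Pi_def)
  thus ?thesis by auto
 qed
 thus "(%z. lmon J be z*lmon J be' z) : lsp J (C+C')" unfolding lmon_mult by(rule lmon_in)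
next
 fix f h assume "(%z. lmon J be z*f z) : lsp J (C+C')" "(%z. lmon J be z*h z) : lsp J (C+C')"
 from lsp_add[OF this] show "(%z. lmon J be z*(f z+h z)) : lsp J (C+C')" by(simp add: distrib_left)
next
 fix a f assume "(%z. lmon J be z*f z) : lsp J (C+C')"
 from lsp_scale[OF this, of a] show "(%z. lmon J be z*(a*f z)) : lsp J (C+C')" by(simp add: mult.left_commute)
qed (simp add: lsp_zero)
next
fix f h assume "(%z. f z*g z) : lsp J (C+C')" "(%z. h z*g z) : lsp J (C+C')"
from lsp_add[OF this] show "(%z. (f z+h z)*g z) : lsp J (C+C')" by(simp add: distrib_right)
next
fix a f assume "(%z. f z*g z) : lsp J (C+C')"
from lsp_scale[OF this, of a] show "(%z. a*f z*g z) : lsp J (C+C')" by(simp add: mult.assoc)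
qed (simp add: lsp_zero)

definition cut :: "'j set => (('j => complex) => complex) => ('j => complex) => complex" where
"cut J f z = (if ALL j:J. z j ~= 0 then f z else 0)"

text \<open>Restrictions of Laurent polynomials in the variables \<open>J\<close> to the torus.\<close>

definition laurent :: "'j set => (('j => complex) => complex) => bool" where
"laurent J f \<longleftrightarrow> (EX C. cut J f : lsp J C)"

lemma laurent_common: assumes "cut J f : lsp J C" "cut J g : lsp J C'"
shows "cut J f : lsp J (C+C')" "cut J g : lsp J (C+C')" using lsp_mono[OF assms(1), of "C+C'"] lsp_mono[OF assms(2), of "C+C'"] by simp_all

lemma laurent_add: "laurent J f ==> laurent J g ==> laurent J (%z. f z+g z)"
unfolding laurent_def
proof(elim exE)
fix C C' assume "cut J f : lsp J C" "cut J g : lsp J C'"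
from lsp_add[OF laurent_common[OF this]] show "EX C. cut J (%z. f z+g z) : lsp J C"
 by(intro exI[of _ "C+C'"]) (simp add: cut_def[abs_def] if_distrib cong: if_cong)
qed

lemma laurent_mult: "laurent J f ==> laurent J g ==> laurent J (%z. f z*g z)"
unfolding laurent_def
proof(elim exE)
fix C C' assume "cut J f : lsp J C" "cut J g : lsp J C'"
moreover have "(%z. cut J f z*cut J g z) = cut J (%z. f z*g z)" by(rule ext) (simp add: cut_def)
ultimately show "EX C. cut J (%z. f z*g z) : lsp J C" using lsp_mult by metis
qed

lemma laurent_const: "laurent J (%z. a)"
proof -
have "(%z. a*lmon J (%_. 0) z) = cut J (%z. a)" by(rule ext) (simp add: lmon_def cut_def)
thus ?thesis unfolding laurent_def using lsp_scale[OF lmon_in[of J "%_. 0" 0], of a] by(intro exI[of _ 0]) simp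
qed

lemma laurent_powi: assumes "finite J" "j : J" shows "laurent J (%z. z j powi k)"
proof -
have "lmon J (%i. if i = j then k else 0) = cut J (%z. z j powi k)"
proof
 fix z :: "'a => complex"
 have "(PROD i:J. z i powi (if i = j then k else 0)) = (PROD i:J. if i = j then z j powi k else 1)" by(intro prod.cong) auto
 thus "lmon J (%i. if i = j then k else 0) z = cut J (%z. z j powi k) z" using assms by(simp add: lmon_def cut_def)
qed
thus ?thesis unfolding laurent_def using lmon_in[of J "%i. if i = j then k else 0" "nat \<bar>k\<bar>"] by(intro exI[of _ "nat \<bar>k\<bar>"]) simp
qed

lemma laurent_power: "finite J ==> j : J ==> laurent J (%z. z j ^ k)"
using laurent_powi[of J j "int k"] by simp

lemma laurent_var: "finite J ==> j : J ==> laurent J (%z. z j)"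
using laurent_power[of J j 1] by simp

lemma laurent_sum: "(!!i. i : S ==> laurent J (f i)) ==> laurent J (%z. SUM i:S. f i z)"
by(induction S rule: infinite_finite_induct) (auto intro: laurent_add laurent_const)

lemma laurent_minus: "laurent J f ==> laurent J (%z. - f z)"
using laurent_mult[OF laurent_const[of J "-1"]] by simp

lemma laurent_diff: "laurent J f ==> laurent J g ==> laurent J (%z. f z-g z)"
using laurent_add[OF _ laurent_minus] by simp

lemmas laurent_intros = laurent_add laurent_mult laurent_const laurent_powi laurent_power laurent_var laurent_sum
laurent_minus laurent_diff

text \<open>Fix all variables but one: a polynomial in one variable that vanishes everywhere has
  zero coefficients, and these are of the same shape with one variable less.\<close>

lemma monomials_indep:
assumes "finite I" "!!c. (SUM al:PiE I (%_. {..D}). a al*(PROD i:I. c i^al i)) = (0::complex)" "al : PiE I (%_. {..D})"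
shows "a al = 0" using assms
proof(induction I arbitrary: a al rule: finite_induct)
case empty thus ?case by simp
next
case (insert i I)
let ?N = "{..D :: nat}"
have fI: "finite (PiE I (%_. ?N))" using insert.hyps(1) by(intro finite_PiE) auto
have key: "(SUM al:PiE I (%_. ?N). a (al(i := k))*(PROD j:I. c j^al j)) = 0" if k: "k <= D" for c k
proof -
 define q where "q = (%k. SUM al:PiE I (%_. ?N). a (al(i := k))*(PROD j:I. c j^al j))"
 define p where "p = (SUM k<=D. monom (q k) k)"
 have "poly p t = 0" for t
 proof -
  have inj: "inj_on (%(y,g). g(i := y)) (?N \<times> PiE I (%_. ?N))" by(rule inj_combinator[OF insert.hyps(2)])
  have pr: "(PROD j:insert i I. (c(i := t)) j^(g(i := y)) j) = t^y*(PROD j:I. c j^g j)" for g y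
  proof -
   have "(PROD j:I. (c(i := t)) j^(g(i := y)) j) = (PROD j:I. c j^g j)" by(intro prod.cong refl) (use insert.hyps(2) in auto)
   thus ?thesis using insert.hyps by simp
  qed
  have "0 = (SUM al:PiE (insert i I) (%_. ?N). a al*(PROD j:insert i I. (c(i := t)) j^al j))" using insert.prems(1)[of "c(i := t)"] by simp
  also have "... = (SUM (y,g):?N \<times> PiE I (%_. ?N). a (g(i := y))*(t^y*(PROD j:I. c j^g j)))"
   unfolding PiE_insert_eq sum.reindex[OF inj] by(intro sum.cong refl) (simp only: o_def split_def pr)
  also have "... = (SUM y<=D. t^y*q y)" unfolding q_def sum_distrib_left by(subst sum.cartesian_product[symmetric]) (simp add: mult_ac)
  finally show ?thesis by(simp add: p_def poly_sum poly_monom mult.commute)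
 qed
 hence "p = 0" using poly_all_0_iff_0 by blast
 hence "0 = Polynomial.coeff p k" by simp
 also have "... = q k" using k by(simp add: p_def coeff_sum coeff_monom)
 finally show ?thesis by(simp add: q_def)
qed
obtain y g where yg: "y <= D" "g : PiE I (%_. ?N)" "al = g(i := y)" using insert.prems(2) unfolding PiE_insert_eq by auto
show ?case unfolding yg(3) by(rule insert.IH[OF key[OF yg(1)] yg(2)])
qed

lemma poly_fun_sum: "(!!i. i : S ==> poly_fun (f i)) ==> poly_fun (%z. SUM i:S. f i z)"
by(induction S rule: infinite_finite_induct) (auto intro: poly_fun.intros)

text \<open>There are fewer monomials of bounded degree in the torus coordinates than in the target coordinates.\<close>

lemma not_dominant:
fixes ph :: "'i => ('i => complex) => complex"
assumes I: "finite I" "j0 : I" and ph: "!!i. i : I ==> laurent (I-{j0}) (ph i)"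
shows "EX f. poly_fun f & (EX c. f c ~= 0) & (ALL c c'. (ALL i:I. c i = c' i) --> f c = f c') &
 (ALL z c. (ALL j:I-{j0}. z j ~= 0) --> (ALL i:I. c i = ph i z) --> f c = 0)"
proof -
define J where "J = I-{j0}"
have J: "finite J" "card I = Suc (card J)" using I card_Suc_Diff1[OF I] by(simp_all add: J_def)
obtain C0 where C0: "!!i. i : I ==> cut J (ph i) : lsp J (C0 i)" using ph unfolding laurent_def J_def by metis
define C where "C = (SUM i:I. C0 i)"
have C: "cut J (ph i) : lsp J C" if "i : I" for i
 by(rule lsp_mono[OF C0[OF that]]) (use I(1) that in \<open>auto simp: C_def intro: member_le_sum\<close>)
define d where "d = card I"
\<comment> \<open>With B = C d D the space of Laurent polynomials is spanned by (2B+1)^|J| <=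
  (K(D+1))^|J| = D (D+1)^|J| elements, fewer than the (D+1)^d monomials in the target coordinates,
  where d = |J| + 1.\<close>
define K where "K = 2*C*d+1"
define D where "D = K^card J"
define idx where "idx = PiE I (%_. {..D})"
\<comment> \<open>The factor \<open>lmon J (%_. 0)\<close> is the indicator of the torus; with it
  even the empty product lies in the span.\<close>
define T where "T = (%al z. lmon J (%_. 0) z*(PROD i:I. cut J (ph i) z^al i))"
have fidx: "finite idx" "card idx = (D+1)^d" unfolding idx_def d_def using I(1) by(auto simp: card_PiE intro: finite_PiE)
have pw: "(%z. h z*cut J (ph i) z ^ k) : lsp J (B+C * k)" if "h : lsp J B" "i : I" for h B i k
proof(induction k)
 case (Suc k)
 have "(%z. h z*cut J (ph i) z ^ k*cut J (ph i) z) : lsp J (B+C * k+C)" by(rule lsp_mult[OF Suc C[OF that(2)]])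
 thus ?case by(simp add: mult_ac add_ac)
qed (use that in simp)
have pr: "(%z. lmon J (%_. 0) z*(PROD i:S. cut J (ph i) z^al i)) : lsp J (C*(SUM i:S. al i))" if "finite S" "S <= I" for S al using that
proof(induction S rule: finite_induct)
 case empty show ?case using lmon_in[of J "%_. 0" 0] by simp
next
 case (insert i S)
 have "(%z. lmon J (%_. 0) z*(PROD i:S. cut J (ph i) z^al i)*cut J (ph i) z^al i) : lsp J (C*(SUM i:S. al i)+C*al i)" using insert by(intro pw) auto
 thus ?case using insert.hyps by(simp add: mult_ac distrib_left add.commute)
qed
define B where "B = C*(d*D)"
have Th: "T al : lsp J B" if a: "al : idx" for al
proof -
 have "(SUM i:I. al i) <= d*D" unfolding d_def by(rule sum_bounded_above[of I al D, simplified]) (use a in \<open>auto simp: idx_def\<close>)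
 hence "C*(SUM i:I. al i) <= B" by(simp add: B_def)
 thus ?thesis unfolding T_def by(rule lsp_mono[OF pr[OF I(1) order_refl]])
qed
have "EX a. (ALL z. (SUM al:idx. a al*T al z) = 0) & ~ (ALL al:idx. a al = 0)"
proof(rule ccontr)
 assume "~ ?thesis"
 hence ind: "!!a. (!!z. (SUM al:idx. a al*T al z) = 0) ==> ALL al:idx. a al = 0" by blast
 have "has_cdim {%z. SUM al:idx. a al*T al z | a. True} (card idx)" by(rule has_cdim_family[OF fidx(1) ind refl])
 then obtain Bs where Bs: "card Bs = card idx" "cfun.independent Bs" "cfun.span Bs = {%z. SUM al:idx. a al*T al z | a. True}"
  unfolding has_cdim_def by blast
 have "{%z. SUM al:idx. a al*T al z | a. True} <= lsp J B"
 proof clarify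
  fix a show "(%z. SUM al:idx. a al*T al z) : lsp J B" using fidx(1) Th
  proof(induction idx rule: finite_induct)
   case (insert x F) thus ?case using lsp_add[OF lsp_scale[of "T x"]] by simp
  qed (simp add: lsp_zero)
 qed
 hence sub: "Bs <= cfun.span (lmon J ` (PiE J (%_. {- int B..int B})))" using cfun.span_superset[of Bs] Bs(3) unfolding lsp_def by blast
 have fm: "finite (PiE J (%_. {- int B..int B}))" using J(1) by(intro finite_PiE) auto
 have "card Bs <= card (lmon J ` (PiE J (%_. {- int B..int B})))" using cfun.independent_span_bound[OF finite_imageI[OF fm] Bs(2) sub] by blast
 also have "... <= card (PiE J (%_. {- int B..int B}))" by(rule card_image_le[OF fm])
 also have "... = (2*B+1)^card J"
 proof -
  have "nat (1+int B - - int B) = 2*B+1" by linarith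
  thus ?thesis using J(1) by(simp add: card_PiE)
 qed
 also have "... <= (K*(D+1))^card J" by(intro power_mono) (auto simp: B_def K_def alg)
 also have "... = D*(D+1)^card J" unfolding power_mult_distrib D_def[symmetric] ..
 also have "... < (D+1)^d" unfolding d_def J(2) by simp
 finally show False using Bs(1) fidx(2) by simp
qed
then obtain a al0 where a: "!!z. (SUM al:idx. a al*T al z) = 0" "al0 : idx" "a al0 ~= 0" by blast
define f where "f = (%c. SUM al:idx. a al*(PROD i:I. c i^al i))"
have "poly_fun f" unfolding f_def by(intro poly_fun_sum poly_fun.mult poly_fun.const poly_fun_prod[OF I(1)] poly_fun_power poly_fun.coord)
moreover have "EX c. f c ~= 0"
proof(rule ccontr)
 assume "~ ?thesis"
 hence "(SUM al:PiE I (%_. {..D}). a al*(PROD i:I. c i^al i)) = 0" for c unfolding f_def idx_def by blast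
 from monomials_indep[OF I(1) this] show False using a(2,3) unfolding idx_def by blast
qed
moreover have "f c = f c'" if "ALL i:I. c i = c' i" for c c' unfolding f_def using that by simp
moreover have "f c = 0" if z: "ALL j:J. z j ~= 0" "ALL i:I. c i = ph i z" for z c
proof -
 have "T al z = (PROD i:I. c i^al i)" for al using z by(simp add: T_def lmon_def cut_def)
 thus ?thesis using a(1)[of z] by(simp add: f_def)
qed
ultimately show ?thesis unfolding J_def by blast
qed

lemma poly_fun_line: "poly_fun f ==> EX p. ALL t. f (%i. a i+t*b i) = poly p t"
proof(induction rule: poly_fun.induct)
case (const c) show ?case by(intro exI[of _ "[:c:]"]) simp
next
case (coord i) show ?case by(intro exI[of _ "[:a i,b i:]"]) simp
next
case (add f g) thus ?case by(metis poly_add)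
next
case (mult f g) thus ?case by(metis poly_mult)
qed

definition coef_space :: "'i set => 'i => ('i => complex) set" where
"coef_space A e0 = {c. c e0 = 1 & (ALL e. e ~: A --> c e = 0)}"

text \<open>On the line joining two points of the affine space each of the functions is a nonzero
  polynomial in one variable, so all but finitely many points of the line serve.\<close>

lemma common_nonzero:
assumes "finite F" "!!f. f : F ==> poly_fun f & (EX c:coef_space A e0. f c ~= 0)" "e0 : A"
shows "EX c:coef_space A e0. ALL f:F. f c ~= 0" using assms
proof(induction F rule: finite_induct)
case empty
have "(%e. if e = e0 then 1 else 0) : coef_space A e0" using empty.prems by(auto simp: coef_space_def)
thus ?case by auto
next
case (insert g F)
obtain a where a: "a : coef_space A e0" "ALL f:F. f a ~= 0" using insert.IH insert.prems by auto
obtain b where b: "b : coef_space A e0" "g b ~= 0" using insert.prems(1)[of g] by auto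
define l where "l = (%t i. a i+t*(b i-a i))"
have l: "l t : coef_space A e0" for t using a(1) b(1) by(auto simp: coef_space_def l_def)
have fin: "finite {t. f (l t) = 0}" if f: "f : insert g F" for f
proof -
 have pf: "poly_fun f" using insert.prems(1)[OF f] by blast
 obtain p where p: "ALL t. f (%i. a i+t*(b i-a i)) = poly p t" using poly_fun_line[OF pf, of a "%i. b i-a i"] by blast
 have "f (l 0) = f a" "f (l 1) = f b" by(simp_all add: l_def)
 hence "poly p 0 ~= 0 | poly p 1 ~= 0" using f a(2) b(2) p[rule_format, of 0] p[rule_format, of 1] by(auto simp: l_def)
 hence "p ~= 0" by auto
 thus ?thesis using poly_roots_finite[of p] p by(simp add: l_def)
qed
have "finite (UN f:insert g F. {t. f (l t) = 0})" using fin insert.hyps(1) by blast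
then obtain t where "t ~: (UN f:insert g F. {t. f (l t) = 0})" using ex_new_if_finite[OF infinite_UNIV_char_0] by blast
thus ?case using l by(intro bexI[of _ "l t"]) auto
qed

text \<open>\<open>not_dominant\<close> in the coordinates other than e0; since f depends on these
  alone, a nonzero of f can be moved into the affine space by setting the coordinate e0 to
  1.\<close>

lemma avoid_image:
fixes F :: "'i => ('i => complex) => complex"
assumes A: "finite A" "e0 : A" and j0: "j0 : A-{e0}" and F: "!!i. i : A-{e0} ==> laurent (A-{e0}-{j0}) (F i)"
shows "EX f. poly_fun f & (EX c:coef_space A e0. f c ~= 0) &
 (ALL z c. (ALL j:A-{e0}-{j0}. z j ~= 0) --> (ALL i:A-{e0}. c i = F i z) --> f c = 0)"
proof -
have fin: "finite (A-{e0})" using A(1) by simp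
have "EX f. poly_fun f & (EX c. f c ~= 0) & (ALL c c'. (ALL i:A-{e0}. c i = c' i) --> f c = f c') &
 (ALL z c. (ALL j:A-{e0}-{j0}. z j ~= 0) --> (ALL i:A-{e0}. c i = F i z) --> f c = 0)" by(rule not_dominant[OF fin j0]) (rule F)
then obtain f where f: "poly_fun f" "EX c. f c ~= 0" "ALL c c'. (ALL i:A-{e0}. c i = c' i) --> f c = f c'"
 "ALL z c. (ALL j:A-{e0}-{j0}. z j ~= 0) --> (ALL i:A-{e0}. c i = F i z) --> f c = 0"
 by(elim exE conjE) (rule that; (assumption | (rule exI, assumption)))
obtain c where c: "f c ~= 0" using f(2) by blast
define c' where "c' = (%e. if e = e0 then 1 else if e : A then c e else 0)"
have "f c' = f c" using f(3) by(auto simp: c'_def)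
moreover have "c' : coef_space A e0" using A(2) by(simp add: coef_space_def c'_def)
ultimately have "EX c:coef_space A e0. f c ~= 0" using c by(intro bexI[of _ c']) simp_all
thus ?thesis using f(1,4) by(intro exI[of _ f] conjI)
qed

text \<open>A multiple root v of an edge polynomial gives two linear equations, solvable for the
  coefficients at g1 and g2. Storing v in the slot of g1 parametrizes the bad vectors by one
  variable less than there are free coefficients. If the edge has only one free coefficient, its
  polynomial is a binomial and has no multiple nonzero root.\<close>

lemma edge_generic:
fixes j :: "'i => int"
assumes A: "finite A" "e0 : A" and D: "D <= A" "inj_on j D" "p : D" "q : D" "p ~= q"
shows "EX f. poly_fun f & (EX c:coef_space A e0. f c ~= 0) & (ALL c:coef_space A e0. (ALL e:A. c e ~= 0) -->
 (ALL v. v ~= 0 --> (SUM g:D. c g * v powi j g) = 0 --> (SUM g:D. c g*(of_int (j g) * v powi j g)) = 0 --> f c = 0))"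
proof(cases "EX g1:D-{e0}. EX g2:D-{e0}. g1 ~= g2")
case False
have "D <= {e0} \<union> (D-{e0})" by blast
obtain g where g: "g : D" "g ~= e0" using D(3-5) by metis
have De: "D = {e0,g}" using False g D(3-5) by auto
have jn: "j g ~= j e0" using D(2) g De by(auto simp: inj_on_def)
have "(%e. if e = e0 then 1 else 0) : coef_space A e0" using A(2) by(auto simp: coef_space_def)
moreover have "~ ((SUM g:D. c g * v powi j g) = 0 & (SUM g:D. c g*(of_int (j g) * v powi j g)) = 0)"
 if c: "ALL e:A. c e ~= 0" and v: "v ~= 0" for c and v :: complex
proof
 assume z: "(SUM g:D. c g * v powi j g) = 0 & (SUM g:D. c g*(of_int (j g) * v powi j g)) = 0"
 have "(SUM g:D. c g*(of_int (j g) * v powi j g)) - of_int (j e0)*(SUM g:D. c g * v powi j g)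
   = of_int (j g-j e0)*(c g * v powi j g)" using g(2) by(simp add: De alg)
 hence "of_int (j g-j e0)*(c g * v powi j g) = 0" using z by simp
 thus False using jn c D(1) g(1) v by auto
qed
ultimately show ?thesis by(intro exI[of _ "%_. 1"]) (auto intro: poly_fun.const)
next
case True
then obtain g1 g2 where g: "g1 : D-{e0}" "g2 : D-{e0}" "g1 ~= g2" by blast
have jn: "j g1 ~= j g2" using D(2) g by(auto simp: inj_on_def)
define J where "J = A-{e0}-{g2}"
have J: "finite J" "g1 : J" using A(1) g D(1) by(auto simp: J_def)
define R where "R = D-{g1,g2}"
have RJ: "g : R ==> g ~= e0 ==> g : J" for g using D(1) by(auto simp: R_def J_def)
define cr where "cr = (%z :: 'i => complex. %g. if g = e0 then 1 else z g)"
define s0 where "s0 = (%z. SUM g:R. cr z g*z g1 powi j g)"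
define s1 where "s1 = (%z. SUM g:R. cr z g*(of_int (j g)*z g1 powi j g))"
define w2 where "w2 = (%z. inverse (of_int (j g2-j g1))*(of_int (j g1) * s0 z - s1 z))"
define F where "F = (%i z. if i = g2 then w2 z*z g1 powi-j g2 else if i = g1 then (- s0 z-w2 z)*z g1 powi-j g1 else z i)"
have lcr: "laurent J (%z. cr z g)" if "g : R" for g
proof(cases "g = e0")
 case True thus ?thesis by(simp add: cr_def laurent_const)
next
 case False thus ?thesis using laurent_var[OF J(1) RJ[OF that False]] by(simp add: cr_def)
qed
have ls: "laurent J s0" "laurent J s1" unfolding s0_def s1_def by(intro laurent_intros J lcr; assumption)+
have lw: "laurent J w2" unfolding w2_def by(intro laurent_intros ls)
have "EX f. poly_fun f & (EX c:coef_space A e0. f c ~= 0) &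
 (ALL z c. (ALL j:A-{e0}-{g2}. z j ~= 0) --> (ALL i:A-{e0}. c i = F i z) --> f c = 0)"
proof(rule avoid_image[OF A])
 show "g2 : A-{e0}" using g D(1) by blast
 fix i assume i: "i : A-{e0}"
 have "laurent J (F i)"
 proof -
  consider "i = g2" | "i = g1" "i ~= g2" | "i ~= g1" "i ~= g2" by blast
  thus ?thesis
  proof cases
   case 1 thus ?thesis unfolding F_def by(simp) (intro laurent_intros lw J)
  next
   case 2 thus ?thesis unfolding F_def by(simp) (intro laurent_intros lw ls J)
  next
   case 3 thus ?thesis unfolding F_def using i by(simp) (intro laurent_var J, simp add: J_def)
  qed
 qed
 thus "laurent (A-{e0}-{g2}) (F i)" by(simp add: J_def)
qed
then obtain f where f: "poly_fun f" "EX c:coef_space A e0. f c ~= 0"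
 "!!z c. (ALL j:A-{e0}-{g2}. z j ~= 0) ==> (ALL i:A-{e0}. c i = F i z) ==> f c = 0" by blast
have "f c = 0" if c: "c : coef_space A e0" "ALL e:A. c e ~= 0" and v: "v ~= 0"
  and z0: "(SUM g:D. c g * v powi j g) = 0" and z1: "(SUM g:D. c g*(of_int (j g) * v powi j g)) = 0" for c v
proof(rule f(3)[of "c(g1 := v)"])
 let ?z = "c(g1 := v)"
 show "ALL j:A-{e0}-{g2}. ?z j ~= 0" using c(2) v by auto
 have ce: "c e0 = 1" using c(1) by(simp add: coef_space_def)
 have cr: "cr ?z g = c g" if "g : R" for g using that ce by(auto simp: cr_def R_def)
 have fin: "finite R" using finite_subset[OF D(1) A(1)] by(simp add: R_def)
 have Dd: "D = insert g1 (insert g2 R)" using g by(auto simp: R_def)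
 have sp: "sum h D = h g1+(h g2 + sum h R)" for h :: "'i => complex" unfolding Dd using fin g by(simp add: R_def)
 have s0: "s0 ?z = (SUM g:R. c g * v powi j g)" "s1 ?z = (SUM g:R. c g*(of_int (j g) * v powi j g))"
  unfolding s0_def s1_def by(intro sum.cong refl; simp add: cr)+
 define W1 W2 where "W1 = c g1 * v powi j g1" and "W2 = c g2 * v powi j g2"
 have e0: "W1+(W2 + s0 ?z) = 0" using z0 unfolding sp s0 W1_def W2_def .
 have e1: "of_int (j g1)*W1+(of_int (j g2)*W2 + s1 ?z) = 0" using z1 unfolding sp s0 W1_def W2_def by(simp add: mult_ac)
 have "of_int (j g2-j g1)*W2 = (of_int (j g1)*W1+(of_int (j g2)*W2 + s1 ?z)) - of_int (j g1)*(W1+(W2 + s0 ?z))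
   + (of_int (j g1) * s0 ?z - s1 ?z)" by(simp add: alg)
 also have "... = of_int (j g1) * s0 ?z - s1 ?z" unfolding e0 e1 by simp
 finally have W2: "W2 = w2 ?z" unfolding w2_def using jn by(simp add: field_simps)
 have W1: "W1 = - s0 ?z-w2 ?z" using e0 unfolding W2 by(simp add: alg eq_neg_iff_add_eq_0)
 have zv: "?z g1 = v" by simp
 have h2: "c g2 = w2 ?z * v powi-j g2" unfolding W2[symmetric] W2_def using v by(simp add: power_int_minus)
 have h1: "c g1 = (- s0 ?z-w2 ?z) * v powi-j g1" unfolding W1[symmetric] W1_def using v by(simp add: power_int_minus)
 show "ALL i:A-{e0}. c i = F i ?z"
 proof
  fix i assume "i : A-{e0}"
  consider "i = g2" | "i = g1" "i ~= g2" | "i ~= g1" "i ~= g2" by blast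
  thus "c i = F i ?z"
  proof cases
   case 1 thus ?thesis unfolding F_def zv using h2 by simp
  next
   case 2 thus ?thesis unfolding F_def zv using h1 by simp
  qed (simp add: F_def)
 qed
qed
thus ?thesis using f(1,2) by blast
qed

text \<open>A singular point (s,t) in the torus gives three equations, solvable for the coefficients
  at (0,0), (0,1) and (1,b). The slots of the first two store s and t, so one variable is saved. For
  n >= 2 none of the three points is the normalized one.\<close>

lemma singular_generic:
assumes A: "finite A" and n: "n >= 2" "(0,n) : A" "{(0,0),(0,1),(1,b)} <= A"
shows "EX f. poly_fun f & (EX c:coef_space A (0,n). f c ~= 0) & (ALL c:coef_space A (0,n). (ALL e:A. c e ~= 0) -->
 (ALL s t. s ~= 0 --> t ~= 0 --> (SUM g:A. c g*(mn s t g)) = 0 -->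
  (SUM g:A. c g*(of_nat (fst g)*(mn s t g))) = 0 -->
  (SUM g:A. c g*(of_nat (snd g)*(mn s t g))) = 0 --> f c = 0))"
proof -
define e0 g1 g2 g3 where "e0 = (0 :: nat,n)" and "g1 = (0 :: nat,0 :: nat)" and "g2 = (0 :: nat,1 :: nat)" and "g3 = (1 :: nat,b)"
have dist: "g1 ~= g2" "g1 ~= g3" "g2 ~= g3" "e0 ~= g1" "e0 ~= g2" "e0 ~= g3" using n(1) by(auto simp: e0_def g1_def g2_def g3_def)
have inA: "e0 : A" "g1 : A" "g2 : A" "g3 : A" using n by(auto simp: e0_def g1_def g2_def g3_def)
define J where "J = A-{e0}-{g3}"
have J: "finite J" "g1 : J" "g2 : J" using A inA dist by(auto simp: J_def)
define R where "R = A-{g1,g2,g3}"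
have RJ: "g : R ==> g ~= e0 ==> g : J" for g by(auto simp: R_def J_def)
define cr where "cr = (%z :: mon => complex. %g. if g = e0 then 1 else z g)"
define s0 where "s0 = (%z. SUM g:R. cr z g*(z g1^fst g*z g2 ^ snd g))"
define sx where "sx = (%z. SUM g:R. cr z g*(of_nat (fst g)*(z g1^fst g*z g2 ^ snd g)))"
define sy where "sy = (%z. SUM g:R. cr z g*(of_nat (snd g)*(z g1^fst g*z g2 ^ snd g)))"
define F where "F = (%i z. if i = g3 then - sx z*(z g1 powi -1*z g2 powi-int b)
 else if i = g2 then (of_nat b * sx z - sy z)*z g2 powi -1 else if i = g1 then sy z + sx z - of_nat b * sx z - s0 z else z i)"
have lcr: "laurent J (%z. cr z g)" if "g : R" for g
proof(cases "g = e0")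
 case True thus ?thesis by(simp add: cr_def laurent_const)
next
 case False thus ?thesis using laurent_var[OF J(1) RJ[OF that False]] by(simp add: cr_def)
qed
have ls: "laurent J s0" "laurent J sx" "laurent J sy" unfolding s0_def sx_def sy_def by(intro laurent_intros J lcr; assumption)+
have "EX f. poly_fun f & (EX c:coef_space A e0. f c ~= 0) &
 (ALL z c. (ALL j:A-{e0}-{g3}. z j ~= 0) --> (ALL i:A-{e0}. c i = F i z) --> f c = 0)"
proof(rule avoid_image[OF A inA(1)])
 show "g3 : A-{e0}" using inA dist by blast
 fix i assume i: "i : A-{e0}"
 have "laurent J (F i)"
 proof -
  consider "i = g3" | "i = g2" | "i = g1" | "i ~= g1" "i ~= g2" "i ~= g3" by blast
  thus ?thesis
  proof cases
   case 1 
   have "laurent J (%z. - sx z*(z g1 powi -1*z g2 powi-int b))" by(intro laurent_intros ls J)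
   thus ?thesis using 1 by(simp add: F_def)
  next
   case 2
   have "laurent J (%z. (of_nat b * sx z - sy z)*z g2 powi -1)" by(intro laurent_intros ls J)
   thus ?thesis using 2 dist by(simp add: F_def)
  next
   case 3
   have "laurent J (%z. sy z + sx z - of_nat b * sx z - s0 z)" by(intro laurent_intros ls J)
   thus ?thesis using 3 dist by(simp add: F_def)
  next
   case 4
   have "i : J" using i 4 by(simp add: J_def)
   thus ?thesis using 4 laurent_var[OF J(1)] by(simp add: F_def)
  qed
 qed
 thus "laurent (A-{e0}-{g3}) (F i)" by(simp add: J_def)
qed
then obtain f where f: "poly_fun f" "EX c:coef_space A e0. f c ~= 0"
 "!!z c. (ALL j:A-{e0}-{g3}. z j ~= 0) ==> (ALL i:A-{e0}. c i = F i z) ==> f c = 0" by blast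
have "f c = 0" if c: "c : coef_space A e0" "ALL e:A. c e ~= 0" and st: "s ~= 0" "t ~= 0"
  and z: "(SUM g:A. c g*(mn s t g)) = 0" "(SUM g:A. c g*(of_nat (fst g)*(mn s t g))) = 0"
   "(SUM g:A. c g*(of_nat (snd g)*(mn s t g))) = 0" for c s t
proof(rule f(3)[of "c(g1 := s,g2 := t)"])
 let ?z = "c(g1 := s,g2 := t)"
 have zz: "?z g1 = s" "?z g2 = t" using dist by auto
 show "ALL j:A-{e0}-{g3}. ?z j ~= 0" using c(2) st by auto
 have ce: "c e0 = 1" using c(1) by(simp add: coef_space_def)
 have cr: "cr ?z g = c g" if "g : R" for g using that ce by(auto simp: cr_def R_def)
 have fin: "finite R" using A by(simp add: R_def)
 have Ad: "A = insert g1 (insert g2 (insert g3 R))" using inA by(auto simp: R_def)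
 have sp: "sum h A = h g1+(h g2+(h g3 + sum h R))" for h :: "mon => complex"
 proof -
  have "sum h (insert g1 (insert g2 (insert g3 R))) = h g1+(h g2+(h g3 + sum h R))" using fin dist by(simp add: R_def)
  thus ?thesis using Ad by simp
 qed
 have s: "s0 ?z = (SUM g:R. c g*(mn s t g))"
  "sx ?z = (SUM g:R. c g*(of_nat (fst g)*(mn s t g)))"
  "sy ?z = (SUM g:R. c g*(of_nat (snd g)*(mn s t g)))" unfolding s0_def sx_def sy_def zz by(intro sum.cong refl; simp only: cr)+
 define w where "w = c g3*(s*t^b)"
 have e0: "c g1+(c g2*t+(w + s0 ?z)) = 0" using z(1) unfolding sp s(1) by(simp add: g1_def g2_def g3_def w_def)
 have e1: "w + sx ?z = 0" using z(2) unfolding sp s(2) by(simp add: g1_def g2_def g3_def w_def)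
 have e2: "c g2*t+(of_nat b*w + sy ?z) = 0" using z(3) unfolding sp s(3) by(simp add: g1_def g2_def g3_def w_def mult_ac)
 have w: "w = - sx ?z" using e1 by(simp add: eq_neg_iff_add_eq_0)
 have c2: "c g2*t = of_nat b * sx ?z - sy ?z" using e2 unfolding w by(simp add: alg add_eq_0_iff)
 have c1: "c g1 = sy ?z + sx ?z - of_nat b * sx ?z - s0 ?z" using e0 unfolding w c2 by(simp add: alg add_eq_0_iff eq_neg_iff_add_eq_0)
 have c3: "c g3 = - sx ?z*(s powi -1*t powi-int b)" unfolding w[symmetric] w_def using st by(simp add: power_int_minus divide_simps)
 have c2': "c g2 = (of_nat b * sx ?z - sy ?z)*t powi -1" unfolding c2[symmetric] using st by(simp add: power_int_minus)
 show "ALL i:A-{e0}. c i = F i ?z"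
 proof
  fix i assume "i : A-{e0}"
  consider "i = g3" | "i = g2" | "i = g1" | "i ~= g1" "i ~= g2" "i ~= g3" by blast
  thus "c i = F i ?z"
  proof cases
   case 1 thus ?thesis unfolding F_def zz using c3 by simp
  next
   case 2 thus ?thesis unfolding F_def zz using c2' dist by simp
  next
   case 3 thus ?thesis unfolding F_def zz using c1 dist by simp
  qed (simp add: F_def)
 qed
qed
thus ?thesis using f(1,2) unfolding e0_def by blast
qed

text \<open>At u = 0 only the edge terms survive, and the vanishing of gth and gV means a multiple
  root of the edge polynomial. For u nonzero the point corresponds to a singular point of chi in the
  torus.\<close>

lemma smooth_from_generic:
assumes A: "finite A" and th: "q : charts A" and p: "p : cpts c A q"
 and edge: "!!v. v ~= 0 ==> (SUM g:{g:A. dd q g = 0}. c g * v powi jj q g) = 0 ==>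
  (SUM g:{g:A. dd q g = 0}. c g*(of_int (jj q g) * v powi jj q g)) ~= 0"
 and sing: "!!s t. s ~= 0 ==> t ~= 0 ==> (SUM g:A. c g*(mn s t g)) = 0 ==>
  (SUM g:A. c g*(of_nat (fst g)*(mn s t g))) = 0 ==>
  (SUM g:A. c g*(of_nat (snd g)*(mn s t g))) ~= 0"
shows "gV c A q p ~= 0 | fst p ~= 0 & gU c A q p ~= 0"
proof(rule ccontr)
assume nz: "~ ?thesis"
define u v where "u = fst p" and "v = snd p"
have v: "v ~= 0" and g0: "gth c A q p = 0" using p by(auto simp: cpts_def v_def)
have V0: "gV c A q p = 0" using nz by blast
have vV: "(SUM g:A. c g*(u^dd q g*(of_int (jj q g) * v powi jj q g))) = v * gV c A q p" unfolding gV_def sum_distrib_left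
 by(intro sum.cong refl) (use v in \<open>simp add: u_def[symmetric] v_def[symmetric] power_int_diff\<close>)
hence vV0: "(SUM g:A. c g*(u^dd q g*(of_int (jj q g) * v powi jj q g))) = 0" using V0 by simp
have g0': "(SUM g:A. c g*(u^dd q g * v powi jj q g)) = 0" using g0 by(simp add: gth_def u_def v_def)
show False
proof(cases "u = 0")
 case True
 have red: "(SUM g:A. c g*(u^dd q g*h g)) = (SUM g:{g:A. dd q g = 0}. c g*h g)" for h :: "mon => complex"
 proof -
  have "(SUM g:{g:A. dd q g = 0}. c g*h g) = (SUM g:{g:A. dd q g = 0}. c g*(u^dd q g*h g))" by(intro sum.cong) auto
  also have "... = (SUM g:A. c g*(u^dd q g*h g))" by(rule sum.mono_neutral_left) (use A True in auto)
  finally show ?thesis by simp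
 qed
 show False using edge[OF v] g0' vV0 unfolding red by blast
next
 case False
 have U0: "gU c A q p = 0" using nz False by(simp add: u_def)
 have "(SUM g:A. c g*(of_nat (dd q g)*(u^dd q g * v powi jj q g))) = u*gU c A q p" unfolding gU_def sum_distrib_left
 proof(intro sum.cong refl)
  fix g
  have e: "of_nat (dd q g)*u^dd q g = u*(of_nat (dd q g)*u^(dd q g-1))" by(cases "dd q g") simp_all
  have "c g*(of_nat (dd q g)*(u^dd q g * v powi jj q g)) = c g*(of_nat (dd q g)*u^dd q g) * v powi jj q g" by(simp only: mult.assoc)
  also have "... = u*(c g*(of_nat (dd q g)*u^(dd q g-1) * v powi jj q g))" unfolding e by(simp only: mult_ac)
  finally show "c g*(of_nat (dd q g)*(u^dd q g * v powi jj q g)) = u*(c g*(of_nat (dd q g)*fst p^(dd q g-1) * snd p powi jj q g))"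
   unfolding u_def v_def .
 qed
 hence uU0: "(SUM g:A. c g*(of_nat (dd q g)*(u^dd q g * v powi jj q g))) = 0" using U0 by simp
 have vV0': "(SUM g:A. c g*(of_int (jj q g)*(u^dd q g * v powi jj q g))) = 0" using vV0 by(simp add: mult_ac)
 define s t where "s = backS q u v" and "t = backT q u v"
 have st: "s ~= 0" "t ~= 0" "lm s t (wU q) = u" "lm s t (wV q) = v" using back_nonzero[OF False v] lm_back[OF th False v] by(auto simp: s_def t_def)
 define L where "L = lm s t (ipt (bas q))"
 have mon: "s^fst g*t ^ snd g = L*(u^dd q g * v powi jj q g)" if "g : A" for g
 proof -
  have "s^fst g*t ^ snd g = lm s t (ipt g)" by(simp add: lm_def ipt_def power_int_def)
  also have "... = L*lm s t (ipt g-ipt (bas q))" using lm_add[OF st(1,2), of "ipt (bas q)" "ipt g-ipt (bas q)"] by(simp add: L_def)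
  finally show ?thesis using lm_chart[OF th that st(1,2)] st(3,4) by simp
 qed
 obtain e f h where T: "q = (e,f,h)" by(cases q)
 have d: "det3 e f h = 1" "!!g. g : A ==> 0 <= det3 e f g" using th unfolding charts_def T by auto
 \<comment> \<open>The exponents of x and y are affine functions of \<open>dd\<close> and
   \<open>jj\<close>, so the sums for x chi_x and y chi_y are combinations of the three sums that
   vanish in the chart.\<close>
 have aff: "EX a x y. ALL g:A. (of_nat (k g) :: complex) = a + of_nat (dd q g)*x + of_int (jj q g)*y" if "k = fst | k = snd" for k :: "mon => nat"
 proof -
  define a x y where "a = int (k e)" and "x = int (k h)-int (k e)" and "y = int (k f)-int (k e)"
  have "of_nat (k g) = (of_int (a+int (dd q g)*x+jj q g*y) :: complex)" if g: "g : A" for g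
  proof -
   have "int (k g) = a+int (dd q g)*x+jj q g*y" using det_expand[OF d(1), of g] d(2)[OF g] \<open>k = fst | k = snd\<close>
    by(auto simp: T dd_def jj_def ipt_def a_def x_def y_def prod_eq_iff)
   from arg_cong[OF this, of "of_int :: int => complex"] show ?thesis by simp
  qed
  thus ?thesis by(intro exI[of _ "of_int a"] exI[of _ "of_int x"] exI[of _ "of_int y"]) simp
 qed
 have zero: "(SUM g:A. c g*(of_nat (k g)*(mn s t g))) = 0" if k: "k = fst | k = snd" for k :: "mon => nat"
 proof -
  obtain a x y where axy: "!!g. g : A ==> (of_nat (k g) :: complex) = a + of_nat (dd q g)*x + of_int (jj q g)*y" using aff[OF k] by blast
  have "(SUM g:A. c g*(of_nat (k g)*(mn s t g)))
   = (SUM g:A. L*a*(c g*(u^dd q g * v powi jj q g))+L*x*(c g*(of_nat (dd q g)*(u^dd q g * v powi jj q g)))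
     + L*y*(c g*(of_int (jj q g)*(u^dd q g * v powi jj q g))))" by(intro sum.cong refl) (simp add: mon axy alg)
  also have "... = L*a*(SUM g:A. c g*(u^dd q g * v powi jj q g))+L*x*(SUM g:A. c g*(of_nat (dd q g)*(u^dd q g * v powi jj q g)))
     + L*y*(SUM g:A. c g*(of_int (jj q g)*(u^dd q g * v powi jj q g)))" by(simp only: sum.distrib sum_distrib_left)
  finally show ?thesis unfolding g0' uU0 vV0' by simp
 qed
 have "(SUM g:A. c g*(mn s t g)) = L*(SUM g:A. c g*(u^dd q g * v powi jj q g))" unfolding sum_distrib_left by(intro sum.cong refl) (simp add: mon)
 hence "(SUM g:A. c g*(mn s t g)) = 0" unfolding g0' by simp
 thus False using sing[OF st(1,2)] zero[of fst] zero[of snd] by blast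
qed
qed

text \<open>Finitely many conditions are imposed: one for each chart, one for the torus, and one for
  the nonvanishing of all coefficients. A product of nonzero polynomials expresses them
  together.\<close>

theorem generic_smooth:
assumes A: "finite A" and n: "n > 0" "(0,n) : A" "{(0,0),(0,1),(1,b)} <= A"
 and top: "!!g. g : A ==> snd g <= n" "!!g. g : A ==> snd g = n ==> g = (0,n)"
shows "EX f. poly_fun f & (EX c:coef_space A (0,n). f c ~= 0) & (ALL c:coef_space A (0,n). f c ~= 0 -->
 (ALL e:A. c e ~= 0) & (ALL q:charts A. ALL p:cpts c A q. gV c A q p ~= 0 | fst p ~= 0 & gU c A q p ~= 0))"
proof -
let ?V = "coef_space A (0,n)"
define Q where "Q = (%q f. poly_fun f & (EX c:?V. f c ~= 0) & (ALL c:?V. (ALL e:A. c e ~= 0) -->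
 (ALL v. v ~= 0 --> (SUM g:{g:A. dd q g = 0}. c g * v powi jj q g) = 0 -->
   (SUM g:{g:A. dd q g = 0}. c g*(of_int (jj q g) * v powi jj q g)) = 0 --> f c = 0)))"
have "EX f. Q q f" if th: "q : charts A" for q unfolding Q_def
proof(rule edge_generic[OF A n(2), of _ "jj q" "fst q" "fst (snd q)"])
 show "fst q : {g:A. dd q g = 0}" "fst (snd q) : {g:A. dd q g = 0}" using chart_vertices[OF th] chart_in[OF th] by auto
 show "fst q ~= fst (snd q)" using chart_vertices(2,4)[OF th] by auto
 obtain e f h where T: "q = (e,f,h)" by(cases q)
 have d: "det3 e f h = 1" "!!g. g : A ==> 0 <= det3 e f g" using th unfolding charts_def T by auto
 show "inj_on (jj q) {g:A. dd q g = 0}"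
 proof(rule inj_onI)
  fix x y assume x: "x : {g:A. dd q g = 0}" and y: "y : {g:A. dd q g = 0}" and xy: "jj q x = jj q y"
  have "det3 e f x = 0" "det3 e f y = 0" using x y d(2)[of x] d(2)[of y] by(auto simp: dd_def T)
  moreover have "det3 e x h = det3 e y h" using xy by(simp add: jj_def T)
  ultimately have "ipt x-ipt e = ipt y-ipt e" unfolding det_expand[OF d(1), of x] det_expand[OF d(1), of y] by(simp only:)
  thus "x = y" by(simp add: ipt_def prod_eq_iff)
 qed
qed auto
hence "ALL q:charts A. EX f. Q q f" by blast
from bchoice[OF this] obtain F where F: "ALL q:charts A. Q q (F q)" by blast
have one: "(%e. if e : A then 1 else 0) : ?V" using n(2) by(auto simp: coef_space_def)
obtain f3 where f3: "poly_fun f3" "EX c:?V. f3 c ~= 0" "!!c s t. c : ?V ==> (ALL e:A. c e ~= 0) ==> s ~= 0 ==> t ~= 0 ==>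
  (SUM g:A. c g*(mn s t g)) = 0 ==> (SUM g:A. c g*(of_nat (fst g)*(mn s t g))) = 0 ==>
  (SUM g:A. c g*(of_nat (snd g)*(mn s t g))) = 0 ==> f3 c = 0"
proof(cases "n >= 2")
 case True
 from singular_generic[OF A True n(2,3)] show ?thesis using that by blast
next
 \<comment> \<open>For n = 1 the slot (0,1) is the normalized one, but then y chi_y = y has no zero
   on the torus.\<close>
 case False
 hence n1: "n = 1" using n(1) by simp
 have "(SUM g:A. c g*(of_nat (snd g)*(mn s t g))) ~= 0" if c: "c : ?V" and t: "t ~= 0" for c s t
 proof -
  have "(SUM g:A. c g*(of_nat (snd g)*(mn s t g))) = (SUM g:{(0,n)}. c g*(of_nat (snd g)*(mn s t g)))"
  proof(rule sum.mono_neutral_right[OF A])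
   show "ALL g:A-{(0,n)}. c g*(of_nat (snd g)*(mn s t g)) = 0"
   proof
    fix g assume "g : A-{(0,n)}"
    hence "snd g = 0" using top[of g] n1 by(cases "snd g") auto
    thus "c g*(of_nat (snd g)*(mn s t g)) = 0" by simp
   qed
  qed (use n(2) in auto)
  also have "... = t" using c n1 by(simp add: coef_space_def)
  finally show ?thesis using t by simp
 qed
 thus ?thesis using that[of "%_. 1"] one by(auto intro: poly_fun.const)
qed
define f1 where "f1 = (%c :: mon => complex. PROD e:A. c e)"
have f1: "poly_fun f1" "EX c:?V. f1 c ~= 0"
 unfolding f1_def using one by(auto intro!: poly_fun_prod[OF A] poly_fun.coord bexI[of _ "%e. if e : A then 1 else 0"])
have "charts A <= A \<times> A \<times> A" by(auto simp: charts_def)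
hence fc: "finite (charts A)" using A by(meson finite_SigmaI finite_subset)
define FS where "FS = insert f1 (insert f3 (F ` charts A))"
have fFS: "finite FS" using fc by(simp add: FS_def)
have FS: "poly_fun f & (EX c:?V. f c ~= 0)" if "f : FS" for f using that f1 f3(1,2) F unfolding FS_def Q_def by blast
obtain c0 where c0: "c0 : ?V" "ALL f:FS. f c0 ~= 0" using common_nonzero[OF fFS FS n(2)] by blast
define f where "f = (%c. PROD g:FS. g c)"
have "poly_fun f" unfolding f_def by(rule poly_fun_prod[OF fFS]) (use FS in blast)
moreover have "f c0 ~= 0" using c0(2) fFS by(simp add: f_def)
moreover have "(ALL e:A. c e ~= 0) & (ALL q:charts A. ALL p:cpts c A q. gV c A q p ~= 0 | fst p ~= 0 & gU c A q p ~= 0)"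
 if c: "c : ?V" "f c ~= 0" for c
proof -
 have nz: "g c ~= 0" if "g : FS" for g using c(2) fFS that by(auto simp: f_def)
 have "f1 c ~= 0" by(rule nz) (simp add: FS_def)
 hence e: "ALL e:A. c e ~= 0" using A by(auto simp: f1_def)
 have n3: "f3 c ~= 0" by(rule nz) (simp add: FS_def)
 have "gV c A q p ~= 0 | fst p ~= 0 & gU c A q p ~= 0" if th: "q : charts A" and p: "p : cpts c A q" for q p
 proof(rule smooth_from_generic[OF A th p])
  have "F q c ~= 0" by(rule nz) (use th in \<open>simp add: FS_def\<close>)
  thus "(SUM g:{g:A. dd q g = 0}. c g*(of_int (jj q g) * v powi jj q g)) ~= 0"
   if "v ~= 0" "(SUM g:{g:A. dd q g = 0}. c g * v powi jj q g) = 0" for v using F th c(1) e that unfolding Q_def by blast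
  show "(SUM g:A. c g*(of_nat (snd g)*(mn s t g))) ~= 0" if "s ~= 0" "t ~= 0"
   "(SUM g:A. c g*(mn s t g)) = 0" "(SUM g:A. c g*(of_nat (fst g)*(mn s t g))) = 0" for s t using f3(3)[OF c(1) e that] n3 by blast
 qed
 thus ?thesis using e by blast
qed
ultimately show ?thesis using c0(1) by blast
qed

section \<open>From coefficient vectors to polynomials, and the conclusion\<close>

lemma coeff_vec_sum_mono2:
assumes "finite A" "!!e. e ~: A ==> c e = 0"
shows "coeff_vec (SUM g:A. mono2 (c g) g) = c"
proof
fix e
have "coeff_vec (SUM g:A. mono2 (c g) g) e = (SUM g:A. if g = e then c g else 0)"
 by(cases e, simp add: coeff_vec_def coeff_sum, intro sum.cong) (auto simp: mono2_monom coeff_monom)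
also have "... = c e" using assms by(auto simp: sum.delta')
finally show "coeff_vec (SUM g:A. mono2 (c g) g) e = c e" .
qed

lemma coeff_vec_monic: "monic_in_y n chi ==> coeff_vec chi (a,n) = (if a = 0 then 1 else 0)"
by(auto simp: monic_in_y_def coeff_vec_def)

lemma monic_from_coeffs:
assumes top: "!!g. coeff_vec chi g ~= 0 ==> snd g <= n" "!!g. coeff_vec chi g ~= 0 ==> snd g = n ==> g = (0,n)"
 and one: "coeff_vec chi (0,n) = 1"
shows "monic_in_y n chi"
proof -
have hi: "Polynomial.coeff chi m = 0" if "m > n" for m
proof(rule poly_eqI)
 fix a show "Polynomial.coeff (Polynomial.coeff chi m) a = Polynomial.coeff 0 a" using top(1)[of "(a,m)"] that by(auto simp: coeff_vec_def)
qed
have nn: "Polynomial.coeff chi n = 1"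
proof(rule poly_eqI)
 fix a show "Polynomial.coeff (Polynomial.coeff chi n) a = Polynomial.coeff 1 a"
  using top(2)[of "(a,n)"] one by(cases "a = 0") (auto simp: coeff_vec_def)
qed
have "degree chi <= n" using hi by(intro degree_le) simp
moreover have "n <= degree chi" using nn by(intro le_degree) simp
ultimately have "degree chi = n" by simp
thus ?thesis using nn by(simp add: monic_in_y_def)
qed

theorem theorem5p8:
fixes chi0 :: "complex poly poly" and n \<epsilon> :: nat
 and P :: "(real \<times> real) set" and E :: "nat \<Rightarrow> (real \<times> real) set"
 and k :: "nat \<Rightarrow> nat" and m \<mu> :: "nat \<Rightarrow> int"
assumes "irreducible chi0" and "monic_in_y n chi0" and "coeff_vec chi0 (0, 0) \<noteq> 0"
 and "P = newton_polygon chi0" and "aff_dim P = 2"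
 and "bij_betw E {1..\<epsilon>} (first_quadrant_edges P)"
 and "\<And>i j p q. i \<in> {1..\<epsilon>} \<Longrightarrow> j \<in> {1..\<epsilon>} \<Longrightarrow> i < j \<Longrightarrow> p \<in> E i \<Longrightarrow> q \<in> E j \<Longrightarrow> snd q \<le> snd p"
 and "\<And>i p q. i \<in> {1..\<epsilon>} \<Longrightarrow> p \<in> E i \<Longrightarrow> q \<in> P \<Longrightarrow>
     (1, of_int (m i) / of_int (\<mu> i)) \<bullet> q \<le> (1, of_int (m i) / of_int (\<mu> i)) \<bullet> p"
 and "\<And>i. i \<in> {1..\<epsilon>} \<Longrightarrow> \<mu> i > 0 \<and> gcd (m i) (\<mu> i) = 1"
 and "\<And>i. i \<in> {1..\<epsilon>} \<Longrightarrow> card (lattice_points (E i)) = k i + 1"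
shows "\<exists>U. zariski_open_in (monic_polys_in n P) U \<and> U \<noteq> {} \<and>
     (\<forall>chi\<in>U. irreducible chi \<longrightarrow> newton_polygon chi = P \<longrightarrow> coeff_vec chi (0, 0) \<noteq> 0 \<longrightarrow>
      (\<exists>g. has_genus (rs_charts chi) g \<and> real g = gamma_number \<epsilon> k m \<mu>) \<and>
      smooth_toric_curve P chi \<and>
      (\<exists>\<Phi>. identifies_with_curve P chi \<Phi>))"
proof -
define S0 where "S0 = {e. coeff_vec chi0 e \<noteq> 0}"
interpret c0: ff_context chi0 n by unfold_locales (rule assms)+
have n: "n > 0" by (rule c0.n_pos)
interpret pg: polygon_edges S0 n P E k m \<mu> \<epsilon>
proof
 have "S0 \<subseteq> (\<lambda>(m, a). (a, m)) ` (SIGMA m:{..degree chi0}. {..degree (Polynomial.coeff chi0 m)})"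
 proof
  fix e assume "e \<in> S0"
  hence nz: "Polynomial.coeff (Polynomial.coeff chi0 (snd e)) (fst e) \<noteq> 0" by (simp add: S0_def coeff_vec_def split: prod.splits)
  have "(snd e, fst e) \<in> (SIGMA m:{..degree chi0}. {..degree (Polynomial.coeff chi0 m)})"
   using le_degree[OF nz] le_degree[of chi0 "snd e"] nz by fastforce
  thus "e \<in> (\<lambda>(m, a). (a, m)) ` (SIGMA m:{..degree chi0}. {..degree (Polynomial.coeff chi0 m)})"
   by (intro image_eqI[of _ _ "(snd e, fst e)"]) auto
 qed
 thus "finite S0" by (rule finite_subset) auto
 show "P = convex hull real_pt ` S0" using assms(4) by (simp add: newton_polygon_def S0_def)
 show "(0, 0) \<in> S0" "(0, n) \<in> S0" using assms(3) coeff_vec_monic[OF assms(2)] by (simp_all add: S0_def)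
 fix g assume g: "g \<in> S0"
 show "snd g \<le> n"
 proof (rule ccontr)
  assume "\<not> snd g \<le> n"
  hence "Polynomial.coeff chi0 (snd g) = 0" using assms(2) by (simp add: monic_in_y_def coeff_eq_0)
  thus False using g by (simp add: S0_def coeff_vec_def split: prod.splits)
 qed
 show "g = (0, n)" if "snd g = n" using g that coeff_vec_monic[OF assms(2), of "fst g"] by (cases g) (auto simp: S0_def split: if_splits)
qed (rule n assms(5-10); assumption?)+
define A where "A = pg.A"
have AP: "A = lattice_points P" by (simp add: A_def pg.A_def)
have A: "finite A" "lattice_convex A" "(0, 0) \<in> A" "(0, n) \<in> A" "\<And>g. g \<in> A \<Longrightarrow> snd g \<le> n" "\<And>g. g \<in> A \<Longrightarrow> snd g = n \<Longrightarrow> g = (0, n)"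
 using pg.finite_A pg.lattice_convex_A pg.S0 pg.S0_A pg.A_top unfolding A_def by blast+
obtain r where r: "r \<in> A" "fst r > 0" using pg.right_point unfolding A_def by blast
obtain b where b: "{(0, 0), (0, 1), (1, b)} \<subseteq> A" using unimodular_exists[OF A(2,3,4) n r] by blast
obtain f where f: "poly_fun f" "\<exists>c\<in>coef_space A (0, n). f c \<noteq> 0"
 "\<And>c. c \<in> coef_space A (0, n) \<Longrightarrow> f c \<noteq> 0 \<Longrightarrow> (\<forall>e\<in>A. c e \<noteq> 0) \<and> (\<forall>\<theta>\<in>charts A. \<forall>p\<in>cpts c A \<theta>. gV c A \<theta> p \<noteq> 0 \<or> fst p \<noteq> 0 \<and> gU c A \<theta> p \<noteq> 0)"
 using generic_smooth[OF A(1) n A(4) b A(5,6)] by blast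
\<comment> \<open>A principal open set is enough. On it all coefficients indexed by A are nonzero,
  so the support of chi is the full set of lattice points.\<close>
define U where "U = {chi\<in>monic_polys_in n P. \<exists>f'\<in>{f}. f' (coeff_vec chi) \<noteq> 0}"
have "zariski_open_in (monic_polys_in n P) U" unfolding zariski_open_in_def U_def using f(1) by (intro exI[of _ "{f}"]) auto
moreover have "U \<noteq> {}"
proof -
 obtain c where c: "c \<in> coef_space A (0, n)" "f c \<noteq> 0" using f(2) by blast
 \<comment> \<open>A coefficient vector with f nonzero is turned into a polynomial; it is monic
   because (0,n) is the only point of A at height n.\<close>
 define chi where "chi = (\<Sum>g\<in>A. mono2 (c g) g)"
 have cA: "c e \<noteq> 0 \<Longrightarrow> e \<in> A" for e using c(1) by (cases e) (auto simp: coef_space_def)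
 have cv: "coeff_vec chi = c" unfolding chi_def using cA by (intro coeff_vec_sum_mono2 A(1)) blast
 have "monic_in_y n chi" by (rule monic_from_coeffs; unfold cv) (use cA A(5,6) c(1) in \<open>auto simp: coef_space_def\<close>)
 hence "chi \<in> U" using c(2) cA by (simp add: U_def monic_polys_in_def cv AP)
 thus ?thesis by blast
qed
moreover have "(\<exists>g. has_genus (rs_charts chi) g \<and> real g = gamma_number \<epsilon> k m \<mu>) \<and> smooth_toric_curve P chi \<and>
  (\<exists>\<Phi>. identifies_with_curve P chi \<Phi>)"
 if chi: "chi \<in> U" "irreducible chi" "coeff_vec chi (0, 0) \<noteq> 0" for chi
proof -
 have mc: "monic_in_y n chi" "\<And>e. coeff_vec chi e \<noteq> 0 \<Longrightarrow> e \<in> A" "f (coeff_vec chi) \<noteq> 0"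
  using chi(1) by (auto simp: U_def monic_polys_in_def AP)
 have cs: "coeff_vec chi \<in> coef_space A (0, n)" using mc(2) coeff_vec_monic[OF mc(1)] by (auto simp: coef_space_def)
 note G = f(3)[OF cs mc(3)]
 interpret ff: ff_context chi n by unfold_locales (rule chi mc(1))+
 interpret nd: nondeg chi n ff.ev0 ff.theta A
 proof (rule nondeg.intro[OF ff.curve_model], unfold_locales)
  show "finite A" by (rule A(1))
  show "coeff_vec chi g \<noteq> 0 \<longleftrightarrow> g \<in> A" for g using G mc(2) by blast
  show "gV (coeff_vec chi) A \<theta> p \<noteq> 0 \<or> fst p \<noteq> 0 \<and> gU (coeff_vec chi) A \<theta> p \<noteq> 0"
   if "\<theta> \<in> charts A" "p \<in> cpts (coeff_vec chi) A \<theta>" for \<theta> p using G that by blast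
  show "\<exists>\<theta>\<in>charts A. fst \<theta> \<in> S \<and> fst (snd \<theta>) \<in> S \<and> (snd (snd \<theta>) \<in> S \<longrightarrow> S = A)"
   if "closed_face A S" "a \<in> S" "b \<in> S" "a \<noteq> b" for S a b by (rule faces_chart[OF A(2,1,3,4) n r that])
  show "\<exists>b. {(0, 0), (0, 1), (1, b)} \<subseteq> A" using b by blast
 qed
 have inn: "nd.inn = pg.II" unfolding nd.inn_def by (rule pg.charts_II[folded A_def]) (rule nd.chart_edge)
 have "has_genus (rs_charts chi) (card nd.inn)"
  by (rule nd.genus_inn[OF AP[symmetric]]) (use pg.finite_II pg.II_height in \<open>auto simp: inn dest: Suc_lessD\<close>)
 thus ?thesis using pg.card_II nd.smooth_toric[OF AP[symmetric]] nd.Phi_identifies[OF AP[symmetric]] unfolding inn by blast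
qed
ultimately show ?thesis by blast
qed

end
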